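(* Let $\lambda$ be sampled from the Jack measure $M_V(\varepsilon_2,\varepsilon_1)$ with analytic symbol $v$. In the limit $\varepsilon_2\to0\leftarrow\varepsilon_1$ taken so that $\frac{\beta}{2}=\frac{-\varepsilon_2}{\varepsilon_1}>0$ is fixed, the joint moments of the linear statistics $\mathrm{ch}_l[f]$ of the random profile $f_\lambda(c\,|\,\varepsilon_2,\varepsilon_1)$ converge to those of a deterministic limit shape $f_{\star|v}$, a continuous profile independent of $\beta$: for all $n\ge1$ and $l_1,\dots,l_n\in\mathbb{N}$, $$\mathbb{E}\Big[\prod_{i=1}^n\mathrm{ch}_{l_i}[f_\lambda(\cdot\,|\,\varepsilon_2,\varepsilon_1)]\Big]\to\prod_{i=1}^n\mathrm{ch}_{l_i}[f_{\star|v}],$$ where $f_{\star|v}$ is characterized by $$2\pi\cdot\frac{1+f'_{\star|v}(c)}{2}=(v_*d\theta)\big((-\infty,c)\big)=\mathrm{Leb}\{\theta\in[0,2\pi):v(e^{\mathbf{i}\theta})<c\},$$ i.e. $\frac{1+f'_{\star|v}}{2}$ is the distribution function of the push-forward along $v:\mathbb{T}\to\mathbb{R}$ of the normalized uniform measure on the circle (and $f_{\star|v}(c)=|c|$ for $|c|$ large).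
   Context: Fix real $\varepsilon_2<0<\varepsilon_1$, $\beta=-2\varepsilon_2/\varepsilon_1$. $\mathcal{F}=\mathbb{C}[V_1,V_2,\dots]$ has the inner product ($\langle1,1\rangle=1$) in which multiplication by $V_k$ has adjoint $(-\varepsilon_1\varepsilon_2)k\,\partial/\partial V_k$; $P_\lambda(V|\varepsilon_2,\varepsilon_1)$ is the Jack symmetric function $P_\lambda$ with parameter $\alpha=\varepsilon_1/(-\varepsilon_2)$ in power sums $p_k=V_k/(-\varepsilon_2)$. Given fixed complex numbers $V_k$, $k\ge1$ (independent of $\varepsilon_1,\varepsilon_2$), the symbol $v(w)=\sum_{k\ge1}(\overline{V_k}w^{-k}+V_kw^k)$ is real on $\mathbb{T}=\{|w|=1\}$ and is assumed analytic in an open neighborhood of $\mathbb{T}$. The Jack measure $M_V(\varepsilon_2,\varepsilon_1)$ is $\mathrm{Prob}(\lambda)=\Pi^{-1}|P_\lambda(V)|^2/\langle P_\lambda,P_\lambda\rangle$, $\Pi=\exp\big(\sum_k\frac{|V_k|^2}{-\varepsilon_1\varepsilon_2k}\big)$. Profile: the box in row $i$, column $j$ of $\lambda$ is $\{(i-1+s)(\varepsilon_2,-\varepsilon_2)+(j-1+t)(\varepsilon_1,\varepsilon_1):s,t\in[0,1]\}\subset\mathbb{R}^2$, and $f_\lambda(c|\varepsilon_2,\varepsilon_1)$ is the piecewise-linear function whose graph is the upper boundary of the union of $\{y\ge|c|\}$ with these boxes. A continuous profile is a $1$-Lipschitz $f:\mathbb{R}\to\mathbb{R}_{\ge0}$ with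 $\int(f(c)-|c|)dc<\infty$. Linear statistics: $\mathrm{ch}_l[f]=\frac12\int_{-\infty}^\infty c^lf''(c)\,dc$ with $f''$ the distributional second derivative. *)

theory Defs
  imports "HOL-Analysis.Analysis"
begin

definition is_partition :: "nat list \<Rightarrow> bool" where
  "is_partition lam \<longleftrightarrow> sorted_wrt (\<ge>) lam \<and> 0 \<notin> set lam"

definition parts :: "nat \<Rightarrow> nat list set" where
  "parts n = {lam. is_partition lam \<and> sum_list lam = n}"

definition dominates :: "nat list \<Rightarrow> nat list \<Rightarrow> bool" where
  "dominates lam mu \<longleftrightarrow>
     (\<forall>k. (\<Sum>i<k. nth_default 0 mu i) \<le> (\<Sum>i<k. nth_default 0 lam i))"

text \<open>A homogeneous symmetric function of degree n is a coefficient vector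
  c :: partition => real, meaning sum over mu of c mu * p_mu.
  Its coefficient on the monomial symmetric function m_lam is the coefficient
  of x_1^lam_1 ... x_n^lam_n in the evaluation at n variables; the coefficient of
  that monomial in p_mu(x_1..x_n) counts maps g from parts of mu to variables
  with sum of mu_j over g j = i equal to lam_i.\<close>
definition mono_coeff :: "nat \<Rightarrow> (nat list \<Rightarrow> real) \<Rightarrow> nat list \<Rightarrow> real" where
  "mono_coeff n c lam =
     (\<Sum>mu\<in>parts n. c mu * real (card
        {g \<in> {..<length mu} \<rightarrow>\<^sub>E {..<n}.
           \<forall>i<n. (\<Sum>j\<in>{j. j < length mu \<and> g j = i}. mu ! j) = nth_default 0 lam i}))"

definition zee :: "nat list \<Rightarrow> real" where
  "zee mu = (\<Prod>i\<in>set mu. real i ^ count (mset mu) i * fact (count (mset mu) i))"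

definition jack_ip :: "real \<Rightarrow> nat \<Rightarrow> (nat list \<Rightarrow> real) \<Rightarrow> (nat list \<Rightarrow> real) \<Rightarrow> real" where
  "jack_ip \<alpha> n c d = (\<Sum>mu\<in>parts n. c mu * d mu * zee mu * \<alpha> ^ length mu)"

definition jack_family :: "real \<Rightarrow> nat \<Rightarrow> (nat list \<Rightarrow> nat list \<Rightarrow> real) \<Rightarrow> bool" where
  "jack_family \<alpha> n P \<longleftrightarrow>
     (\<forall>lam. lam \<notin> parts n \<longrightarrow> P lam = (\<lambda>_. 0)) \<and>
     (\<forall>lam\<in>parts n. \<forall>mu. mu \<notin> parts n \<longrightarrow> P lam mu = 0) \<and>
     (\<forall>lam\<in>parts n. mono_coeff n (P lam) lam = 1 \<and>
        (\<forall>mu\<in>parts n. mono_coeff n (P lam) mu \<noteq> 0 \<longrightarrow> dominates lam mu)) \<and>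
     (\<forall>lam\<in>parts n. \<forall>mu\<in>parts n. lam \<noteq> mu \<longrightarrow> jack_ip \<alpha> n (P lam) (P mu) = 0)"

definition jackP :: "real \<Rightarrow> nat list \<Rightarrow> nat list \<Rightarrow> real" where
  "jackP \<alpha> lam = (THE P. jack_family \<alpha> (sum_list lam) P) lam"

definition jack_eval :: "real \<Rightarrow> real \<Rightarrow> (nat \<Rightarrow> complex) \<Rightarrow> nat list \<Rightarrow> complex" where
  "jack_eval e2 e1 V lam =
     (\<Sum>mu\<in>parts (sum_list lam). of_real (jackP (e1 / (- e2)) lam mu) *
        (\<Prod>i<length mu. V (mu ! i) / of_real (- e2)))"

definition jack_norm2 :: "real \<Rightarrow> real \<Rightarrow> nat list \<Rightarrow> real" where
  "jack_norm2 e2 e1 lam =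
     jack_ip (e1 / (- e2)) (sum_list lam) (jackP (e1 / (- e2)) lam) (jackP (e1 / (- e2)) lam)"

definition jack_Pi :: "real \<Rightarrow> real \<Rightarrow> (nat \<Rightarrow> complex) \<Rightarrow> real" where
  "jack_Pi e2 e1 V = exp (\<Sum>k. (norm (V (Suc k)))\<^sup>2 / (- e1 * e2 * real (Suc k)))"

definition jack_prob :: "real \<Rightarrow> real \<Rightarrow> (nat \<Rightarrow> complex) \<Rightarrow> nat list \<Rightarrow> real" where
  "jack_prob e2 e1 V lam =
     (norm (jack_eval e2 e1 V lam))\<^sup>2 / jack_norm2 e2 e1 lam / jack_Pi e2 e1 V"

text \<open>Box in row i+1, column j+1 (0-indexed i, j) is
  {(i+s)(e2,-e2) + (j+t)(e1,e1) : s,t in [0,1]}; the profile is the upper boundary of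
  the region below the graph of |c| together with the boxes.\<close>
definition profile :: "real \<Rightarrow> real \<Rightarrow> nat list \<Rightarrow> real \<Rightarrow> real" where
  "profile e2 e1 lam c = Sup (insert \<bar>c\<bar>
     {y. \<exists>i<length lam. \<exists>j<lam ! i. \<exists>s\<in>{0..1}. \<exists>t\<in>{0..1}.
          c = (real i + s) * e2 + (real j + t) * e1 \<and>
          y = - (real i + s) * e2 + (real j + t) * e1})"

definition cont_profile :: "(real \<Rightarrow> real) \<Rightarrow> bool" where
  "cont_profile f \<longleftrightarrow> (\<forall>x y. \<bar>f x - f y\<bar> \<le> \<bar>x - y\<bar>) \<and> (\<forall>c. 0 \<le> f c) \<and>
     integrable lborel (\<lambda>c. f c - \<bar>c\<bar>)"

text \<open>ch_l[f] = 1/2 * int c^l f''(c) dc (distributional), written out by pairing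
  f'' = (f - |c|)'' + 2 delta_0 against c^l (integration by parts twice).\<close>
definition ch :: "nat \<Rightarrow> (real \<Rightarrow> real) \<Rightarrow> real" where
  "ch l f = real (l * (l - 1)) / 2 * (\<integral>c. (f c - \<bar>c\<bar>) * c ^ (l - 2) \<partial>lborel)
            + (if l = 0 then 1 else 0)"

definition symbol :: "(nat \<Rightarrow> complex) \<Rightarrow> complex \<Rightarrow> complex" where
  "symbol V w = (\<Sum>k. cnj (V (Suc k)) * inverse w ^ Suc k + V (Suc k) * w ^ Suc k)"

text \<open>Analytic in a neighbourhood of the unit circle: the Laurent series converges
  absolutely on an annulus r^-1 < |w| < r with r > 1.\<close>
definition analytic_symbol :: "(nat \<Rightarrow> complex) \<Rightarrow> bool" where
  "analytic_symbol V \<longleftrightarrow> (\<exists>r>1. summable (\<lambda>k. norm (V (Suc k)) * r ^ Suc k))"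

definition pushF :: "(nat \<Rightarrow> complex) \<Rightarrow> real \<Rightarrow> real" where
  "pushF V c = measure lborel {\<theta>\<in>{0..<2*pi}. Re (symbol V (cis \<theta>)) < c} / (2 * pi)"

definition limit_shape :: "(nat \<Rightarrow> complex) \<Rightarrow> (real \<Rightarrow> real) \<Rightarrow> bool" where
  "limit_shape V f \<longleftrightarrow> cont_profile f \<and> (\<exists>R. \<forall>c. R \<le> \<bar>c\<bar> \<longrightarrow> f c = \<bar>c\<bar>) \<and>
     (AE c in lborel. (f has_real_derivative (2 * pushF V c - 1)) (at c))"

end

theory Submission
  imports Defs "HOL-Computational_Algebra.Formal_Power_Series"
begin

text \<open>Let \<open>L\<close> be the Nazarov--Sklyanin Lax operator on \<open>\<F>[w]\<close>. Its vacuum elements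
  \<open>T\<^sub>k = \<langle>1, L\<^sup>k 1\<rangle>\<close> are self-adjoint operators on symmetric functions. Realising \<open>L\<close> as a Dunkl operator
  on symmetric polynomials times powers of one more variable shows that they are triangular for dominance
  order, so the Jack functions are joint eigenvectors. The eigenvalues \<open>t\<^sub>k(\<lambda>)\<close> are
  related to the linear statistics \<open>s\<^sub>k = ch\<^sub>k\<close> of the profile by Newton's relations
  \<open>k t\<^sub>k = \<Sum> t\<^sub>k\<^sub>-\<^sub>j s\<^sub>j\<close>, so each \<open>s\<^sub>l\<close> is a fixed polynomial in the \<open>t\<^sub>k\<close>.

  Expanding in Jack functions, the expectation of \<open>t\<^sub>k\<^sub>1 \<cdots> t\<^sub>k\<^sub>m\<close> under the Jack measure is the expectation
  of \<open>T\<^sub>k\<^sub>1 \<cdots> T\<^sub>k\<^sub>m\<close> in the coherent state with parameters \<open>V\<close>. Conjugation by the coherent state adds the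
  constants \<open>cnj V\<^sub>j\<close> to the annihilation operators, and all remaining quantum terms carry factors
  \<open>-\<epsilon>\<^sub>1\<epsilon>\<^sub>2\<close> or \<open>\<epsilon>\<^sub>1 + \<epsilon>\<^sub>2\<close>. By dominated convergence, using analyticity of the symbol,
  the limit is the product of \<open>\<tau>\<^sub>k = \<langle>e\<^sub>0, T(v)\<^sup>k e\<^sub>0\<rangle>\<close> for the Toeplitz operator \<open>T(v)\<close>. A Szego-type
  identity shows that the \<open>\<tau>\<^sub>k\<close> satisfy Newton's relations with the moments of \<open>v\<close> on the circle,
  and these moments are the linear statistics of the limit shape.\<close>

section \<open>The Lax operator and its realisation on exponents\<close>

text \<open>In degree \<open>n\<close> the letter \<open>w\<close> is realised as one more variable
  \<open>x_n\<close> beside \<open>x_0, ..., x_(n-1)\<close>: \<open>n\<close> variables already see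
  every symmetric function of degree \<open>n\<close>, and coefficients with exponent 0 of
  \<open>x_n\<close> see only the vacuum component. The Euler coefficient \<alpha> - 1 is forced by
  this picture, because the power sums then include \<open>x_n\<close> itself. Jack functions are
  treated in the normalisation \<open>e2 = -1\<close>, \<open>e1 = \<alpha>\<close>; scaling the
  power sums by \<open>b = -e2\<close> restores the true parameters. Two obstacles shape the proof.
  \<open>jackP\<close> is a definite description over a partial order, so existence, and
  orthogonality for incomparable partitions, have to be proved; this comes from distinct partitions
  having distinct eigenvalue sequences. And the Lax operator is unbounded: its multiplicities grow
  with the degree, so every application trades a little of the analyticity radius for summability.
  Moreover the identities under the Jack measure are obtained degree by degree; the passage to sums
  over all partitions rests on convergence of second moments.\<close>

definition pos_mset :: "nat multiset set" where
  "pos_mset = {\<mu>. 0 \<notin># \<mu>}"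

definition deg_msets :: "nat \<Rightarrow> nat multiset set" where
  "deg_msets n = {\<mu>\<in>pos_mset. sum_mset \<mu> = n}"

definition deg_pairs :: "nat \<Rightarrow> (nat \<times> nat multiset) set" where
  "deg_pairs n = {(k, \<mu>). \<mu> \<in> pos_mset \<and> k + sum_mset \<mu> = n}"

text \<open>A function of a multiset \<open>\<mu>\<close> lists the coefficients of the power-sum products \<open>p\<^sub>\<mu>\<close>;
  \<open>G k \<mu>\<close> is the coefficient of \<open>w\<^sup>k p\<^sub>\<mu>\<close>. On such elements \<open>lax\<close> is the Nazarov--Sklyanin Lax
  operator: a Toeplitz operator in \<open>w\<close> whose entries are multiplications by \<open>p\<^sub>j\<close> and their adjoints
  \<open>h j \<partial>/\<partial>p\<^sub>j\<close>, plus \<open>\<kappa>\<close> times the Euler operator in \<open>w\<close>. The sequence \<open>c\<close> shifts the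
  annihilation part by constants, as conjugation by a coherent state does.\<close>
definition lax :: "'a::comm_ring_1 \<Rightarrow> 'a \<Rightarrow> (nat \<Rightarrow> 'a) \<Rightarrow> (nat \<Rightarrow> nat multiset \<Rightarrow> 'a) \<Rightarrow> nat \<Rightarrow> nat multiset \<Rightarrow> 'a" where
  "lax h \<kappa> c G k \<mu> =
     (\<Sum>j=1..k. h * of_nat (j * Suc (count \<mu> j)) * G (k - j) (add_mset j \<mu>)) +
     (\<Sum>j=1..k. c j * G (k - j) \<mu>) +
     (\<Sum>j\<in>set_mset \<mu> - {0}. G (k + j) (\<mu> - {#j#})) + \<kappa> * of_nat k * G k \<mu>"

definition lift0 :: "(nat multiset \<Rightarrow> 'a::zero) \<Rightarrow> nat \<Rightarrow> nat multiset \<Rightarrow> 'a" where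
  "lift0 f k \<mu> = (if k = 0 then f \<mu> else 0)"

lemma finite_deg_msets: "finite (deg_msets n)"
proof -
  have "deg_msets n \<subseteq> mset ` {xs. set xs \<subseteq> {..n} \<and> length xs \<le> n}"
  proof
    fix \<mu> assume m: "\<mu> \<in> deg_msets n"
    obtain xs where xs: "\<mu> = mset xs" by (metis ex_mset)
    have "x \<le> n" if "x \<in> set xs" for x
      using m that member_le_sum_list[of x xs] by (auto simp: deg_msets_def xs sum_mset_sum_list)
    moreover have "length ys \<le> sum_list ys" if "0 \<notin> set ys" for ys :: "nat list"
      using that by (induction ys) auto
    then have "length xs \<le> n" using m by (auto simp: deg_msets_def pos_mset_def xs sum_mset_sum_list)
    ultimately show "\<mu> \<in> mset ` {xs. set xs \<subseteq> {..n} \<and> length xs \<le> n}"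
      using xs by auto
  qed
  then show ?thesis
    by (rule finite_subset) (auto intro: finite_lists_length_le)
qed

lemma finite_deg_pairs: "finite (deg_pairs n)"
proof -
  have "deg_pairs n \<subseteq> {..n} \<times> (\<Union>m\<le>n. deg_msets m)"
    by (auto simp: deg_pairs_def deg_msets_def)
  then show ?thesis
    by (rule finite_subset) (auto simp: finite_deg_msets)
qed

text \<open>A part \<open>j\<close> moves from the exponent of \<open>w\<close> into the multiset,
  keeping the total degree. This exchanges annihilation and creation terms, and so drives the
  intertwining relation, self-adjointness and the weighted bounds. \<open>P\<close> fixes the degree
  in the finite sums and is trivially true in the infinite ones.\<close>

lemma move_part_bij:
  "bij_betw (\<lambda>((k, \<mu>), j). ((k - j, add_mset j \<mu>), j))
     {((k, \<mu>), j). \<mu> \<in> pos_mset \<and> 1 \<le> j \<and> j \<le> k \<and> P (k + sum_mset \<mu>)}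
     {((k, \<mu>), j). \<mu> \<in> pos_mset \<and> j \<in># \<mu> \<and> P (k + sum_mset \<mu>)}"
proof (rule bij_betw_byWitness[where f' = "\<lambda>((k, \<mu>), j). ((k + j, \<mu> - {#j#}), j)"], goal_cases)
  case 4
  have "sum_mset (\<mu> - {#j#}) + j = sum_mset \<mu>" if "j \<in># \<mu>" for \<mu> :: "nat multiset" and j
    using that by (auto dest!: multi_member_split)
  then show ?case
    by (auto simp: pos_mset_def add.assoc dest: in_diffD) (metis add.commute not_gr_zero One_nat_def Suc_leI)+
qed (auto simp: pos_mset_def)

lemma deg_pairs_move_up:
  fixes F :: "nat \<Rightarrow> nat multiset \<Rightarrow> nat \<Rightarrow> 'a::comm_monoid_add"
  shows "(\<Sum>(k, \<mu>)\<in>deg_pairs n. \<Sum>j=1..k. F (k - j) (add_mset j \<mu>) j) =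
         (\<Sum>(k, \<mu>)\<in>deg_pairs n. \<Sum>j\<in>set_mset \<mu>. F k \<mu> j)"
proof -
  let ?S = "{((k, \<mu>), j). \<mu> \<in> pos_mset \<and> 1 \<le> j \<and> j \<le> k \<and> k + sum_mset \<mu> = n}"
  let ?T = "{((k, \<mu>), j). \<mu> \<in> pos_mset \<and> j \<in># \<mu> \<and> k + sum_mset \<mu> = n}"
  have S: "?S = Sigma (deg_pairs n) (\<lambda>(k, \<mu>). {1..k})"
    by (auto simp: deg_pairs_def)
  have T: "?T = Sigma (deg_pairs n) (\<lambda>(k, \<mu>). set_mset \<mu>)"
    by (auto simp: deg_pairs_def)
  have "(\<Sum>(k, \<mu>)\<in>deg_pairs n. \<Sum>j=1..k. F (k - j) (add_mset j \<mu>) j) =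
      (\<Sum>((k, \<mu>), j)\<in>?S. F (k - j) (add_mset j \<mu>) j)"
    unfolding S by (subst sum.Sigma[symmetric]) (auto simp: finite_deg_pairs intro!: sum.cong)
  also have "\<dots> = (\<Sum>((k, \<mu>), j)\<in>?T. F k \<mu> j)"
    using sum.reindex_bij_betw[OF move_part_bij[where P = "\<lambda>m. m = n"],
        where g = "\<lambda>((k, \<mu>), j). F k \<mu> j"]
    by (simp add: case_prod_unfold)
  also have "\<dots> = (\<Sum>(k, \<mu>)\<in>deg_pairs n. \<Sum>j\<in>set_mset \<mu>. F k \<mu> j)"
    unfolding T by (subst sum.Sigma[symmetric]) (auto simp: finite_deg_pairs intro!: sum.cong)
  finally show ?thesis .
qed

lemma deg_pairs_move_down:
  fixes F :: "nat \<Rightarrow> nat multiset \<Rightarrow> nat \<Rightarrow> 'a::comm_monoid_add"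
  shows "(\<Sum>(k, \<mu>)\<in>deg_pairs n. \<Sum>j\<in>set_mset \<mu>. F (k + j) (\<mu> - {#j#}) j) =
         (\<Sum>(k, \<mu>)\<in>deg_pairs n. \<Sum>j=1..k. F k \<mu> j)"
proof -
  have "(\<Sum>(k, \<mu>)\<in>deg_pairs n. \<Sum>j=1..k. F k \<mu> j) =
     (\<Sum>(k, \<mu>)\<in>deg_pairs n. \<Sum>j=1..k. F (k - j + j) (add_mset j \<mu> - {#j#}) j)"
    by (intro sum.cong) auto
  also have "\<dots> = (\<Sum>(k, \<mu>)\<in>deg_pairs n. \<Sum>j\<in>set_mset \<mu>. F (k + j) (\<mu> - {#j#}) j)"
    by (rule deg_pairs_move_up[of "\<lambda>k \<mu> j. F (k + j) (\<mu> - {#j#}) j"])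
  finally show ?thesis by simp
qed

text \<open>Polynomials in \<open>x\<^sub>0, x\<^sub>1, \<dots>\<close> are represented by their coefficient functions on exponents;
  \<open>shiftX i j\<close> is multiplication by \<open>x\<^sub>i\<close> to the power \<open>j\<close>, and \<open>dunkl \<alpha> n\<close> is the Heckman--Cherednik
  operator attached to the variable \<open>x\<^sub>n\<close>.\<close>
definition shiftX :: "nat \<Rightarrow> nat \<Rightarrow> ((nat \<Rightarrow> nat) \<Rightarrow> real) \<Rightarrow> (nat \<Rightarrow> nat) \<Rightarrow> real" where
  "shiftX i j h a = (if j \<le> a i then h (a(i := a i - j)) else 0)"

definition mulp :: "nat set \<Rightarrow> nat \<Rightarrow> ((nat \<Rightarrow> nat) \<Rightarrow> real) \<Rightarrow> (nat \<Rightarrow> nat) \<Rightarrow> real" where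
  "mulp I j h a = (\<Sum>i\<in>I. shiftX i j h a)"

definition pmon :: "nat set \<Rightarrow> nat multiset \<Rightarrow> (nat \<Rightarrow> nat) \<Rightarrow> real" where
  "pmon I \<mu> = fold_mset (mulp I) (\<lambda>a. if a = (\<lambda>_. 0) then 1 else 0) \<mu>"

text \<open>On polynomials this is the divided difference \<open>x_i / (x_n - x_i) (1 - s)\<close>,
  where \<open>s\<close> exchanges \<open>x_i\<close> and \<open>x_n\<close>, read off on
  coefficients. The range of \<open>t\<close> does not depend on which exponent is larger; the
  surplus terms cancel by antisymmetry.\<close>

definition dunkl1 :: "nat \<Rightarrow> nat \<Rightarrow> ((nat \<Rightarrow> nat) \<Rightarrow> real) \<Rightarrow> (nat \<Rightarrow> nat) \<Rightarrow> real" where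
  "dunkl1 n i h a = (\<Sum>t=1..a i. h (a(n := a n + t, i := a i - t)) - h (a(n := a i - t, i := a n + t)))"

definition dunkl :: "real \<Rightarrow> nat \<Rightarrow> ((nat \<Rightarrow> nat) \<Rightarrow> real) \<Rightarrow> (nat \<Rightarrow> nat) \<Rightarrow> real" where
  "dunkl \<alpha> n h a = \<alpha> * a n * h a + (\<Sum>i<n. dunkl1 n i h a)"

section \<open>Dunkl operators and multiplication by power sums\<close>

lemma shiftX_commute: "shiftX i j (shiftX i' k h) = shiftX i' k (shiftX i j h)"
proof
  fix a
  show "shiftX i j (shiftX i' k h) a = shiftX i' k (shiftX i j h) a"
  proof (cases "i = i'")
    case True
    have "a i - j - k = a i - k - j" by simp
    then show ?thesis using True by (simp add: shiftX_def) linarith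
  next
    case False
    then show ?thesis by (simp add: shiftX_def fun_upd_twist)
  qed
qed

lemma shiftX_0 [simp]: "shiftX i 0 h = h"
  by (rule ext) (auto simp: shiftX_def)

lemma shiftX_add: "shiftX i j (shiftX i k h) = shiftX i (j + k) h"
  by (rule ext) (auto simp: shiftX_def)

lemma shiftX_sum: "shiftX i j (\<lambda>a. \<Sum>x\<in>S. f x a) = (\<lambda>a. \<Sum>x\<in>S. shiftX i j (f x) a)"
  by (rule ext) (auto simp: shiftX_def)

lemma shiftX_mulp: "shiftX i j (mulp I k h) = mulp I k (shiftX i j h)"
  unfolding mulp_def by (subst shiftX_sum) (simp add: shiftX_commute)

lemma mulp_commute: "mulp I j (mulp I k h) = mulp I k (mulp I j h)"
proof
  fix a
  have "mulp I j (mulp I k h) a = (\<Sum>i\<in>I. \<Sum>i'\<in>I. shiftX i' k (shiftX i j h) a)"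
    by (simp add: mulp_def[of I j] shiftX_mulp) (simp add: mulp_def)
  also have "\<dots> = (\<Sum>i'\<in>I. \<Sum>i\<in>I. shiftX i' k (shiftX i j h) a)"
    by (rule sum.swap)
  also have "\<dots> = mulp I k (mulp I j h) a"
    by (simp add: mulp_def[of I k] shiftX_mulp) (simp add: mulp_def shiftX_commute)
  finally show "mulp I j (mulp I k h) a = mulp I k (mulp I j h) a" .
qed

lemma sum_antisym_zero:
  fixes e :: "nat \<Rightarrow> nat \<Rightarrow> real"
  assumes "\<And>p q. e p q = - e q p"
  shows "(\<Sum>p\<le>m. e p (m - p)) = 0"
proof -
  have "(\<Sum>p\<le>m. e p (m - p)) = (\<Sum>p\<le>m. e (m - p) (m - (m - p)))"
    by (rule sum.reindex_bij_witness[of _ "\<lambda>p. m - p" "\<lambda>p. m - p"]) auto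
  also have "\<dots> = (\<Sum>p\<le>m. - e p (m - p))"
    by (rule sum.cong) (auto simp: assms[symmetric])
  finally show ?thesis by (simp add: sum_negf)
qed

text \<open>Here \<open>e\<close> is an antisymmetrised coefficient
  \<open>h(p, q) - h(q, p)\<close>. Multiplying by \<open>x_n^j + x_i^j\<close> shifts the range of
  summation; the terms by which the two sides can differ fill a whole antidiagonal
  \<open>p + q = m\<close> and cancel by antisymmetry.\<close>

lemma dunkl_sym_sum:
  fixes e :: "nat \<Rightarrow> nat \<Rightarrow> real"
  assumes anti: "\<And>p q. e p q = - e q p"
  shows "(\<Sum>t=1..B. (if j \<le> A + t then e (A + t - j) (B - t) else 0) + (if j \<le> B - t then e (A + t) (B - t - j) else 0)) =
    (if j \<le> A then \<Sum>t=1..B. e (A - j + t) (B - t) else 0) + (if j \<le> B then \<Sum>t=1..B-j. e (A + t) (B - j - t) else 0)"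
proof -
  have 1: "(\<Sum>t=1..B. if j \<le> A + t then e (A + t - j) (B - t) else 0) = (if j \<le> A then \<Sum>t=1..B. e (A - j + t) (B - t) else 0)"
  proof (cases "j \<le> A")
    case True
    then show ?thesis by (auto intro!: sum.cong)
  next
    case False
    have "(\<Sum>t=1..B. if j \<le> A + t then e (A + t - j) (B - t) else 0) = (\<Sum>t\<in>{j-A..B}. e (A + t - j) (B - t))"
      using False by (intro sum.mono_neutral_cong_right) auto
    also have "\<dots> = 0"
    proof (cases "j - A \<le> B")
      case True
      define m where "m = B - (j - A)"
      have "(\<Sum>t\<in>{j-A..B}. e (A + t - j) (B - t)) = (\<Sum>p\<le>m. e p (m - p))"
        using True False by (intro sum.reindex_bij_witness[of _ "\<lambda>p. p + (j - A)" "\<lambda>t. t - (j - A)"])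
          (auto simp: m_def algebra_simps)
      then show ?thesis using sum_antisym_zero[where e = e and m = m, OF anti] by simp
    qed auto
    finally show ?thesis using False by simp
  qed
  have 2: "(\<Sum>t=1..B. if j \<le> B - t then e (A + t) (B - t - j) else 0) = (if j \<le> B then \<Sum>t=1..B-j. e (A + t) (B - j - t) else 0)"
  proof (cases "j \<le> B")
    case True
    then show ?thesis
    proof -
      have "(\<Sum>t=1..B. if j \<le> B - t then e (A + t) (B - t - j) else 0) = (\<Sum>t=1..B-j. e (A + t) (B - t - j))"
      proof (cases "j = 0")
        case True then show ?thesis by (auto intro!: sum.cong)
      next
        case False
        then show ?thesis using True by (intro sum.mono_neutral_cong_right) auto
      qed
      then show ?thesis using True by (simp add: add.commute)
    qed
  next
    case False
    then have "\<And>t. \<not> j \<le> B - t" by auto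
    with False show ?thesis by simp
  qed
  show ?thesis by (simp only: sum.distrib 1 2)
qed

lemma dunkl1_shift_sym:
  assumes ne: "i \<noteq> n"
  shows "dunkl1 n i (\<lambda>a. shiftX n j h a + shiftX i j h a) a = shiftX n j (dunkl1 n i h) a + shiftX i j (dunkl1 n i h) a"
proof -
  define g where "g p q = h (a(n := p, i := q))" for p q
  define e where "e p q = g p q - g q p" for p q
  have "dunkl1 n i (\<lambda>a. shiftX n j h a + shiftX i j h a) a =
    (\<Sum>t=1..a i. (if j \<le> a n + t then e (a n + t - j) (a i - t) else 0) + (if j \<le> a i - t then e (a n + t) (a i - t - j) else 0))"
    unfolding dunkl1_def using ne
    by (intro sum.cong) (auto simp: shiftX_def g_def e_def fun_upd_twist)
  also have "\<dots> = (if j \<le> a n then \<Sum>t=1..a i. e (a n - j + t) (a i - t) else 0) + (if j \<le> a i then \<Sum>t=1..a i-j. e (a n + t) (a i - j - t) else 0)"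
    by (rule dunkl_sym_sum) (simp add: e_def)
  also have "\<dots> = shiftX n j (dunkl1 n i h) a + shiftX i j (dunkl1 n i h) a"
    using ne by (auto simp: shiftX_def dunkl1_def g_def e_def fun_upd_twist intro!: sum.cong)
  finally show ?thesis .
qed

lemma dunkl1_shift_other:
  assumes "i \<noteq> n" "l \<noteq> n" "l \<noteq> i"
  shows "dunkl1 n i (shiftX l j h) a = shiftX l j (dunkl1 n i h) a"
  using assms by (auto simp: dunkl1_def shiftX_def fun_upd_twist intro!: sum.cong)

lemma dunkl1_add: "dunkl1 n i (\<lambda>a. f a + g a) a = dunkl1 n i f a + dunkl1 n i g a"
  by (simp add: dunkl1_def sum.distrib[symmetric] algebra_simps)

lemma dunkl1_sum: "dunkl1 n i (\<lambda>a. \<Sum>x\<in>S. f x a) a = (\<Sum>x\<in>S. dunkl1 n i (f x) a)"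
  unfolding dunkl1_def by (simp add: sum_subtractf[symmetric] sum.swap[of _ S])

lemma dunkl1_cmult: "dunkl1 n i (\<lambda>a. c * f a) a = c * dunkl1 n i f a"
  by (simp add: dunkl1_def sum_distrib_left algebra_simps)

lemma dunkl1_mulp:
  assumes "i < n"
  shows "dunkl1 n i (mulp {..n} j h) a = mulp {..n} j (dunkl1 n i h) a"
proof -
  have ins: "{..n} = insert n (insert i ({..n} - {n, i}))" using assms by auto
  have split: "mulp {..n} j f a = (shiftX n j f a + shiftX i j f a) + (\<Sum>l\<in>{..n} - {n, i}. shiftX l j f a)" for f a
    unfolding mulp_def by (subst ins) (use assms in \<open>simp add: add.assoc\<close>)
  have "dunkl1 n i (mulp {..n} j h) a = dunkl1 n i (\<lambda>a. (shiftX n j h a + shiftX i j h a) + (\<Sum>l\<in>{..n} - {n, i}. shiftX l j h a)) a"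
    by (rule arg_cong[where f = "\<lambda>u. dunkl1 n i u a"]) (rule ext, rule split)
  also have "\<dots> = dunkl1 n i (\<lambda>a. shiftX n j h a + shiftX i j h a) a + (\<Sum>l\<in>{..n} - {n, i}. dunkl1 n i (shiftX l j h) a)"
    by (subst dunkl1_add) (simp add: dunkl1_sum)
  also have "\<dots> = mulp {..n} j (dunkl1 n i h) a"
    unfolding split using assms by (simp add: dunkl1_shift_sym dunkl1_shift_other)
  finally show ?thesis .
qed

text \<open>The divided differences commute with multiplication by anything symmetric in
  \<open>x_n\<close> and \<open>x_i\<close>, hence with the power sum; only the Euler term obeys a
  Leibniz rule and leaves \<open>\<alpha> j x_n^j\<close>.\<close>

lemma dunkl_mulp:
  fixes \<alpha> :: real
  shows "dunkl \<alpha> n (mulp {..n} j h) a = mulp {..n} j (dunkl \<alpha> n h) a + \<alpha> * j * shiftX n j h a"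
proof -
  have 1: "real (a n) * shiftX i j h a = shiftX i j (\<lambda>a. real (a n) * h a) a + (if i = n then real j * shiftX n j h a else 0)" for i
    by (auto simp: shiftX_def of_nat_diff algebra_simps)
  have add: "mulp {..n} j (\<lambda>a. f a + g a) a = mulp {..n} j f a + mulp {..n} j g a" for f g a
    by (simp add: mulp_def shiftX_def sum.distrib[symmetric] if_distrib cong: if_cong)
  have cm: "mulp {..n} j (\<lambda>a. c * f a) a = c * mulp {..n} j f a" for c f a
    by (simp add: mulp_def shiftX_def sum_distrib_left if_distrib cong: if_cong)
  have sm: "mulp {..n} j (\<lambda>a. \<Sum>i<n. f i a) a = (\<Sum>i<n. mulp {..n} j (f i) a)" for f a
    unfolding mulp_def by (simp add: shiftX_sum sum.swap[of _ "{..<n}"])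
  have "real (a n) * mulp {..n} j h a = (\<Sum>i\<le>n. real (a n) * shiftX i j h a)"
    by (simp add: mulp_def sum_distrib_left)
  also have "\<dots> = mulp {..n} j (\<lambda>a. real (a n) * h a) a + real j * shiftX n j h a"
    by (simp add: 1 mulp_def sum.distrib)
  finally have 2: "real (a n) * mulp {..n} j h a = mulp {..n} j (\<lambda>a. real (a n) * h a) a + real j * shiftX n j h a" .
  have "dunkl \<alpha> n (mulp {..n} j h) a = \<alpha> * (real (a n) * mulp {..n} j h a) + (\<Sum>i<n. mulp {..n} j (dunkl1 n i h) a)"
    by (simp add: dunkl_def dunkl1_mulp mult.assoc)
  also have "\<dots> = mulp {..n} j (\<lambda>a. \<alpha> * (real (a n) * h a) + (\<Sum>i<n. dunkl1 n i h a)) a + \<alpha> * j * shiftX n j h a"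
    unfolding 2 by (simp add: add cm sm algebra_simps)
  finally show ?thesis by (simp add: dunkl_def[abs_def] mult.assoc)
qed

lemma dunkl_cmult: "dunkl \<alpha> n (\<lambda>a. c * f a) a = c * dunkl \<alpha> n f a"
  by (simp add: dunkl_def dunkl1_cmult sum_distrib_left algebra_simps)

lemma dunkl_sum: "dunkl \<alpha> n (\<lambda>a. \<Sum>x\<in>S. f x a) a = (\<Sum>x\<in>S. dunkl \<alpha> n (f x) a)"
  by (simp add: dunkl_def dunkl1_sum sum.distrib sum_distrib_left sum.swap[of _ S])

lemma pmon_empty: "pmon I {#} = (\<lambda>a. if a = (\<lambda>_. 0) then 1 else 0)"
  by (simp add: pmon_def)

lemma pmon_add: "pmon I (add_mset j \<mu>) = mulp I j (pmon I \<mu>)"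
proof -
  interpret comp_fun_commute "mulp I"
    by unfold_locales (auto simp: fun_eq_iff mulp_commute)
  show ?thesis by (simp add: pmon_def)
qed

text \<open>Since \<open>x_i (x_n^k - x_i^k) / (x_n - x_i)\<close> is the sum of
  \<open>x_n^(k-j) x_i^j\<close> over \<open>1 \<le> j \<le> k\<close>, summing over
  \<open>i < n\<close> gives power sums in all variables, except that the terms with
  \<open>i = n\<close> are missing. Their total \<open>k x_n^k\<close> turns \<alpha> into \<alpha>
  - 1.\<close>

lemma dunkl_shift_one:
  fixes n k :: nat and \<alpha> :: real
  defines "\<delta> \<equiv> pmon {..n} {#}"
  shows "dunkl \<alpha> n (shiftX n k \<delta>) a =
     (\<Sum>j=1..k. shiftX n (k - j) (mulp {..n} j \<delta>) a) + (\<alpha> - 1) * k * shiftX n k \<delta> a"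
proof -
  have sh: "shiftX n k \<delta> a = (if a = (\<lambda>_. 0)(n := k) then 1 else 0)" for k a
  proof -
    have "(k \<le> a n \<and> a(n := a n - k) = (\<lambda>_. 0)) \<longleftrightarrow> a = (\<lambda>_. 0)(n := k)"
      by (auto simp: fun_eq_iff split: if_splits)
    then show ?thesis by (auto simp: shiftX_def \<delta>_def pmon_empty)
  qed
  have sh2: "shiftX n k (shiftX i j \<delta>) a = (if a = ((\<lambda>_. 0)(n := k, i := j)) then 1 else 0)" if "i \<noteq> n" for k i j a
  proof -
    have "(k \<le> a n \<and> j \<le> a i \<and> a(n := a n - k, i := a i - j) = (\<lambda>_. 0)) \<longleftrightarrow> a = (\<lambda>_. 0)(n := k, i := j)"
      using that by (auto simp: fun_eq_iff split: if_splits)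
    then show ?thesis using that by (auto simp: shiftX_def \<delta>_def pmon_empty)
  qed
  have D: "dunkl1 n i (shiftX n k \<delta>) a = (\<Sum>j=1..k. shiftX n (k - j) (shiftX i j \<delta>) a)" if "i < n" for i
  proof -
    have ne: "i \<noteq> n" using that by simp
    define Q where "Q \<longleftrightarrow> a = (\<lambda>_. 0)(n := k - a i, i := a i)"
    have z: "a(n := a i - t, i := a n + t) \<noteq> (\<lambda>_. 0)(n := k)" if "1 \<le> t" for t
      using that ne by (metis add_is_0 fun_upd_same fun_upd_other not_one_le_zero)
    have e: "a(n := a n + t, i := a i - t) = (\<lambda>_. 0)(n := k) \<longleftrightarrow> t = a i \<and> a = (\<lambda>_. 0)(n := k - a i, i := a i) \<and> a i \<le> k"
      if "1 \<le> t" "t \<le> a i" for t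
    proof
      assume "a(n := a n + t, i := a i - t) = (\<lambda>_. 0)(n := k)"
      then have v: "(a(n := a n + t, i := a i - t)) x = ((\<lambda>_. 0)(n := k)) x" for x by simp
      have "a n + t = k" "a i = t" using v[of n] v[of i] ne that by auto
      moreover have "a x = 0" if "x \<noteq> n" "x \<noteq> i" for x using v[of x] that by simp
      ultimately show "t = a i \<and> a = (\<lambda>_. 0)(n := k - a i, i := a i) \<and> a i \<le> k"
        using ne by (auto simp: fun_eq_iff)
    next
      assume *: "t = a i \<and> a = (\<lambda>_. 0)(n := k - a i, i := a i) \<and> a i \<le> k"
      then have "a n = k - t" using ne by (metis fun_upd_other fun_upd_same)
      moreover have "a x = 0" if "x \<noteq> n" "x \<noteq> i" for x using * that by (metis fun_upd_other)
      ultimately show "a(n := a n + t, i := a i - t) = (\<lambda>_. 0)(n := k)"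
        using conjunct1[OF *] conjunct2[OF conjunct2[OF *]] ne by (auto simp: fun_eq_iff)
    qed
    have "dunkl1 n i (shiftX n k \<delta>) a = (\<Sum>t=1..a i. if t = a i \<and> a = (\<lambda>_. 0)(n := k - a i, i := a i) \<and> a i \<le> k then 1 else 0)"
      unfolding dunkl1_def unfolding Q_def[symmetric] by (intro sum.cong refl) (simp add: sh z e[folded Q_def])
    also have "\<dots> = (if 1 \<le> a i \<and> a = (\<lambda>_. 0)(n := k - a i, i := a i) \<and> a i \<le> k then 1 else 0)"
      unfolding Q_def[symmetric] by (cases "Q \<and> a i \<le> k") (auto simp: sum.delta)
    also have "\<dots> = (\<Sum>j=1..k. if j = a i \<and> a = (\<lambda>_. 0)(n := k - a i, i := a i) then 1 else 0)"
      unfolding Q_def[symmetric] by (cases Q) (auto simp: sum.delta')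
    also have "\<dots> = (\<Sum>j=1..k. shiftX n (k - j) (shiftX i j \<delta>) a)"
    proof (intro sum.cong refl)
      fix j
      have "a = (\<lambda>_. 0)(n := k - j, i := j) \<longleftrightarrow> j = a i \<and> a = (\<lambda>_. 0)(n := k - a i, i := a i)"
        by (metis fun_upd_same)
      then show "(if j = a i \<and> a = (\<lambda>_. 0)(n := k - a i, i := a i) then 1 else 0) = shiftX n (k - j) (shiftX i j \<delta>) a"
        unfolding sh2[OF ne] Q_def[symmetric] by (simp only:)
    qed
    finally show ?thesis .
  qed
  have "(\<Sum>j=1..k. shiftX n (k - j) (mulp {..n} j \<delta>) a) = (\<Sum>j=1..k. \<Sum>i\<le>n. shiftX n (k - j) (shiftX i j \<delta>) a)"
    unfolding shiftX_mulp by (simp add: mulp_def shiftX_commute)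
  also have "\<dots> = (\<Sum>j=1..k. \<Sum>i<n. shiftX n (k - j) (shiftX i j \<delta>) a) + (\<Sum>j=1..k. shiftX n (k - j) (shiftX n j \<delta>) a)"
    by (simp add: lessThan_Suc_atMost[symmetric] sum.distrib)
  also have "(\<Sum>j=1..k. shiftX n (k - j) (shiftX n j \<delta>) a) = k * shiftX n k \<delta> a"
    by (simp add: shiftX_add)
  also have "(\<Sum>j=1..k. \<Sum>i<n. shiftX n (k - j) (shiftX i j \<delta>) a) = (\<Sum>i<n. dunkl1 n i (shiftX n k \<delta>) a)"
    by (subst sum.swap) (simp add: D)
  finally have eq: "(\<Sum>j=1..k. shiftX n (k - j) (mulp {..n} j \<delta>) a) = (\<Sum>i<n. dunkl1 n i (shiftX n k \<delta>) a) + k * shiftX n k \<delta> a" .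
  have "real (a n) * shiftX n k \<delta> a = k * shiftX n k \<delta> a"
    unfolding sh by auto
  with eq show ?thesis by (simp add: dunkl_def mult.assoc) (simp add: algebra_simps)
qed

text \<open>The action on basis elements, by induction on \<open>\<mu>\<close> through
  \<open>dunkl_mulp\<close>. \<open>lax\<close> describes the same operator on coefficients, so
  there the transfers of a part run in the opposite direction.\<close>

lemma dunkl_pmon:
  fixes \<alpha> :: real
  shows "dunkl \<alpha> n (shiftX n k (pmon {..n} \<mu>)) a =
     (\<Sum>j\<in>#\<mu>. \<alpha> * j * shiftX n (k + j) (pmon {..n} (\<mu> - {#j#})) a) +
     (\<Sum>j=1..k. shiftX n (k - j) (pmon {..n} (add_mset j \<mu>)) a) +
     (\<alpha> - 1) * k * shiftX n k (pmon {..n} \<mu>) a"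
proof (induction \<mu> arbitrary: a)
  case empty
  then show ?case by (simp add: dunkl_shift_one pmon_add)
next
  case (add i \<mu>)
  let ?p = "pmon {..n}" and ?M = "mulp {..n} i"
  have madd: "?M (\<lambda>a. f a + g a) a = ?M f a + ?M g a" for f g a
    by (simp add: mulp_def shiftX_def sum.distrib[symmetric] if_distrib cong: if_cong)
  have mcm: "?M (\<lambda>a. c * f a) a = c * ?M f a" for c f a
    by (simp add: mulp_def shiftX_def sum_distrib_left if_distrib cong: if_cong)
  have msum: "?M (\<lambda>a. \<Sum>x\<in>S. f x a) a = (\<Sum>x\<in>S. ?M (f x) a)" for f a and S :: "nat set"
    unfolding mulp_def by (simp add: shiftX_sum sum.swap[of _ S])
  have mms: "?M (\<lambda>a. \<Sum>j\<in>#\<nu>. f j a) a = (\<Sum>j\<in>#\<nu>. ?M (f j) a)" for f a and \<nu> :: "nat multiset"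
    by (induction \<nu>) (simp_all add: madd, simp add: mulp_def shiftX_def)
  have "dunkl \<alpha> n (shiftX n k (?p (add_mset i \<mu>))) a = dunkl \<alpha> n (?M (shiftX n k (?p \<mu>))) a"
    by (simp add: pmon_add shiftX_mulp)
  also have "\<dots> = ?M (dunkl \<alpha> n (shiftX n k (?p \<mu>))) a + \<alpha> * i * shiftX n (k + i) (?p \<mu>) a"
    by (simp add: dunkl_mulp shiftX_add add.commute)
  also have "?M (dunkl \<alpha> n (shiftX n k (?p \<mu>))) a =
      (\<Sum>j\<in>#\<mu>. \<alpha> * j * shiftX n (k + j) (?M (?p (\<mu> - {#j#}))) a) +
      (\<Sum>j=1..k. shiftX n (k - j) (?M (?p (add_mset j \<mu>))) a) + (\<alpha> - 1) * k * shiftX n k (?M (?p \<mu>)) a"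
    by (subst add.IH[THEN ext]) (simp add: madd mcm msum mms shiftX_mulp del: of_nat_sum_mset)
  also have "(\<Sum>j\<in>#\<mu>. \<alpha> * j * shiftX n (k + j) (?M (?p (\<mu> - {#j#}))) a) =
      (\<Sum>j\<in>#\<mu>. \<alpha> * j * shiftX n (k + j) (?p (add_mset i \<mu> - {#j#})) a)"
    by (rule arg_cong[where f = sum_mset], rule image_mset_cong)
       (auto simp: pmon_add[symmetric] dest!: multi_member_split)
  finally show ?case
    by (simp add: pmon_add[symmetric] add_mset_commute)
qed

lemma sum_mset_eq_sum_count:
  "(\<Sum>j\<in>#\<mu>. f j) = (\<Sum>j\<in>set_mset \<mu>. of_nat (count \<mu> j) * (f j :: 'a::comm_semiring_1))"
proof (induction \<mu>)
  case (add x \<mu>)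
  have "(\<Sum>j\<in>set_mset (add_mset x \<mu>). of_nat (count (add_mset x \<mu>) j) * f j) =
     (\<Sum>j\<in>insert x (set_mset \<mu>). (if j = x then f x else 0) + of_nat (count \<mu> j) * f j)"
    by (intro sum.cong) (auto simp: algebra_simps)
  also have "\<dots> = f x + (\<Sum>j\<in>insert x (set_mset \<mu>). of_nat (count \<mu> j) * f j)"
    by (simp add: sum.distrib)
  also have "(\<Sum>j\<in>insert x (set_mset \<mu>). of_nat (count \<mu> j) * f j) = (\<Sum>j\<in>set_mset \<mu>. of_nat (count \<mu> j) * f j)"
    by (intro sum.mono_neutral_right) (auto simp: not_in_iff)
  finally show ?case using add by simp
qed simp

text \<open>The substitution \<open>w = x_n\<close>, \<open>p_j = x_0^j + ... + x_n^j\<close> on the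
  part of total degree \<open>n\<close>: the letter \<open>w\<close> becomes one of the variables
  over which the power sums run.\<close>

definition hat :: "nat \<Rightarrow> (nat \<Rightarrow> nat multiset \<Rightarrow> real) \<Rightarrow> (nat \<Rightarrow> nat) \<Rightarrow> real" where
  "hat n G a = (\<Sum>(k, \<mu>)\<in>deg_pairs n. G k \<mu> * shiftX n k (pmon {..n} \<mu>) a)"

lemma hat_lax:
  fixes \<alpha> :: real
  shows "hat n (lax \<alpha> (\<alpha> - 1) (\<lambda>_. 0) G) = dunkl \<alpha> n (hat n G)"
proof
  fix a
  let ?X = "\<lambda>k \<mu>. shiftX n k (pmon {..n} \<mu>) a"
  have pos: "set_mset \<mu> - {0} = set_mset \<mu>" if "(k, \<mu>) \<in> deg_pairs n" for k \<mu>
    using that by (auto simp: deg_pairs_def pos_mset_def)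
  have "hat n (lax \<alpha> (\<alpha> - 1) (\<lambda>_. 0) G) a =
     (\<Sum>(k, \<mu>)\<in>deg_pairs n. (\<Sum>j=1..k. \<alpha> * real (j * count (add_mset j \<mu>) j) * G (k - j) (add_mset j \<mu>) * ?X (k - j + j) (add_mset j \<mu> - {#j#}))) +
     (\<Sum>(k, \<mu>)\<in>deg_pairs n. (\<Sum>j\<in>set_mset \<mu>. G (k + j) (\<mu> - {#j#}) * ?X (k + j - j) (add_mset j (\<mu> - {#j#})))) +
     (\<Sum>(k, \<mu>)\<in>deg_pairs n. (\<alpha> - 1) * k * G k \<mu> * ?X k \<mu>)"
    unfolding hat_def sum.distrib[symmetric]
    by (intro sum.cong refl) (auto simp: lax_def pos algebra_simps sum_distrib_left sum_distrib_right intro!: sum.cong arg_cong2[where f = "(+)"])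
  also have "\<dots> =
     (\<Sum>(k, \<mu>)\<in>deg_pairs n. (\<Sum>j\<in>set_mset \<mu>. \<alpha> * real (j * count \<mu> j) * G k \<mu> * ?X (k + j) (\<mu> - {#j#}))) +
     (\<Sum>(k, \<mu>)\<in>deg_pairs n. (\<Sum>j=1..k. G k \<mu> * ?X (k - j) (add_mset j \<mu>))) +
     (\<Sum>(k, \<mu>)\<in>deg_pairs n. (\<alpha> - 1) * k * G k \<mu> * ?X k \<mu>)"
    unfolding deg_pairs_move_up[of "\<lambda>k \<mu> j. \<alpha> * real (j * count \<mu> j) * G k \<mu> * ?X (k + j) (\<mu> - {#j#})"]
      deg_pairs_move_down[of "\<lambda>k \<mu> j. G k \<mu> * ?X (k - j) (add_mset j \<mu>)"] ..
  also have "\<dots> = (\<Sum>(k, \<mu>)\<in>deg_pairs n. G k \<mu> * dunkl \<alpha> n (shiftX n k (pmon {..n} \<mu>)) a)"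
    unfolding sum.distrib[symmetric]
    by (intro sum.cong refl)
       (auto simp: dunkl_pmon sum_mset_eq_sum_count sum_distrib_left algebra_simps)
  also have "\<dots> = dunkl \<alpha> n (hat n G) a"
    unfolding hat_def[abs_def] by (simp add: dunkl_sum case_prod_unfold dunkl_cmult)
  finally show "hat n (lax \<alpha> (\<alpha> - 1) (\<lambda>_. 0) G) a = dunkl \<alpha> n (hat n G) a" .
qed

lemma hat_lax_pow: "hat n ((lax \<alpha> (\<alpha> - 1) (\<lambda>_. 0) ^^ m) G) = (dunkl \<alpha> n ^^ m) (hat n G)"
  by (induction m) (simp_all add: hat_lax)

section \<open>Dunkl operators respect dominance\<close>

definition psum :: "nat list \<Rightarrow> nat \<Rightarrow> nat" where
  "psum lam k = (\<Sum>i<k. nth_default 0 lam i)"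

text \<open>Dominance by \<open>lam\<close>, phrased for unsorted exponents.\<close>
definition dom_exp :: "nat \<Rightarrow> nat list \<Rightarrow> (nat \<Rightarrow> nat) \<Rightarrow> bool" where
  "dom_exp n lam a \<longleftrightarrow> (\<forall>K\<subseteq>{..n}. sum a K \<le> psum lam (card K))"

text \<open>Terms with \<open>a n + t < a i\<close> cancel under the reflection
  \<open>t \<mapsto> a i - a n - t\<close>, which exchanges the two exponents. What remains reads
  \<open>h\<close> only at exponents spread at least as far apart as those of \<open>a\<close>, the
  form needed for dominance.\<close>

lemma dunkl1_spread:
  assumes "i \<noteq> n"
  shows "dunkl1 n i h a = (\<Sum>t\<in>{t\<in>{1..a i}. a i \<le> a n + t}. h (a(n := a n + t, i := a i - t)) - h (a(n := a i - t, i := a n + t)))"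
proof -
  define e where "e p q = h (a(n := p, i := q)) - h (a(n := q, i := p))" for p q
  have anti: "e p q = - e q p" for p q by (simp add: e_def)
  have "dunkl1 n i h a = (\<Sum>t\<in>{1..a i}. e (a n + t) (a i - t))"
    by (simp add: dunkl1_def e_def)
  also have "\<dots> = (\<Sum>t\<in>{t\<in>{1..a i}. a i \<le> a n + t}. e (a n + t) (a i - t)) + (\<Sum>t\<in>{t\<in>{1..a i}. \<not> a i \<le> a n + t}. e (a n + t) (a i - t))"
    by (subst sum.union_disjoint[symmetric]) (auto intro!: sum.cong)
  also have "(\<Sum>t\<in>{t\<in>{1..a i}. \<not> a i \<le> a n + t}. e (a n + t) (a i - t)) = 0"
  proof -
    let ?T = "{t\<in>{1..a i}. \<not> a i \<le> a n + t}"
    have "(\<Sum>t\<in>?T. e (a n + t) (a i - t)) = (\<Sum>t\<in>?T. e (a i - t) (a n + t))"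
      by (rule sum.reindex_bij_witness[of _ "\<lambda>t. a i - a n - t" "\<lambda>t. a i - a n - t"]) auto
    also have "\<dots> = - (\<Sum>t\<in>?T. e (a n + t) (a i - t))"
      by (subst sum_negf[symmetric]) (rule sum.cong, rule refl, rule anti)
    finally show ?thesis by simp
  qed
  finally show ?thesis by (simp add: e_def)
qed

lemma dom_expD: "dom_exp n lam a \<Longrightarrow> K \<subseteq> {..n} \<Longrightarrow> sum a K \<le> psum lam (card K)"
  by (simp add: dom_exp_def)

text \<open>Spreading two exponents with fixed sum can only increase maximal partial sums. A set
  containing one of the two indices is compared with the set where this index is replaced by the one
  carrying the larger value \<open>p\<close>; sets containing both or neither have the same sum
  before and after.\<close>

lemma dom_exp_spread:
  assumes "dom_exp n lam (a(n := p, i := q)) \<or> dom_exp n lam (a(n := q, i := p))" "i < n"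
    and "p + q = a n + a i" "a n \<le> p" "a i \<le> p"
  shows "dom_exp n lam a"
  unfolding dom_exp_def
proof (intro allI impI)
  fix K assume K: "K \<subseteq> {..n}"
  have fK: "finite K" using K finite_subset by blast
  define R where "R = K - {n, i}"
  have R: "finite R" "n \<notin> R" "i \<notin> R" "R \<subseteq> {..n}" using fK K by (auto simp: R_def)
  have sR: "sum (a(n := x, i := y)) R = sum a R" for x y
    using R by (intro sum.cong) auto
  define K' where "K' j = insert j R" for j
  have key: "sum a R + p \<le> psum lam (Suc (card R))"
    using assms(1)
  proof
    assume d: "dom_exp n lam (a(n := p, i := q))"
    have "sum (a(n := p, i := q)) (insert n R) \<le> psum lam (card (insert n R))"
      using R by (intro dom_expD[OF d]) auto
    moreover have "sum (a(n := p, i := q)) (insert n R) = p + sum a R"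
      using R assms(2) sR by (simp add: sum.insert)
    ultimately show ?thesis using R by (simp add: add.commute)
  next
    assume d: "dom_exp n lam (a(n := q, i := p))"
    have "sum (a(n := q, i := p)) (insert i R) \<le> psum lam (card (insert i R))"
      using R assms(2) by (intro dom_expD[OF d]) auto
    moreover have "sum (a(n := q, i := p)) (insert i R) = p + sum a R"
      using R sR by (simp add: sum.insert)
    ultimately show ?thesis using R by (simp add: add.commute)
  qed
  have both: "sum a R + (a n + a i) \<le> psum lam (Suc (Suc (card R)))"
    using assms(1)
  proof
    assume d: "dom_exp n lam (a(n := p, i := q))"
    have "sum (a(n := p, i := q)) (insert n (insert i R)) \<le> psum lam (card (insert n (insert i R)))"
      using R assms(2) by (intro dom_expD[OF d]) auto
    then show ?thesis using R assms(2,3) sR by (simp add: sum.insert)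
  next
    assume d: "dom_exp n lam (a(n := q, i := p))"
    have "sum (a(n := q, i := p)) (insert n (insert i R)) \<le> psum lam (card (insert n (insert i R)))"
      using R assms(2) by (intro dom_expD[OF d]) auto
    then show ?thesis using R assms(2,3) sR by (simp add: sum.insert)
  qed
  have none: "sum a R \<le> psum lam (card R)"
    using assms(1) R sR unfolding dom_exp_def by metis
  consider "n \<in> K" "i \<in> K" | "n \<in> K" "i \<notin> K" | "n \<notin> K" "i \<in> K" | "n \<notin> K" "i \<notin> K" by blast
  then show "sum a K \<le> psum lam (card K)"
  proof cases
    case 1
    then have "K = insert n (insert i R)" by (auto simp: R_def)
    then show ?thesis using both R assms(2) by (simp add: add.commute add.left_commute)
  next
    case 2
    then have "K = insert n R" by (auto simp: R_def)
    then show ?thesis using key R assms(4) by simp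
  next
    case 3
    then have "K = insert i R" by (auto simp: R_def)
    then show ?thesis using key R assms(5) by simp
  next
    case 4
    then have "K = R" by (auto simp: R_def)
    then show ?thesis using none by simp
  qed
qed

lemma dunkl_dom:
  assumes "\<And>a. h a \<noteq> 0 \<Longrightarrow> dom_exp n lam a" and "dunkl \<alpha> n h a \<noteq> 0"
  shows "dom_exp n lam a"
proof (rule ccontr)
  assume nd: "\<not> dom_exp n lam a"
  then have "h a = 0" using assms(1) by blast
  moreover have "dunkl1 n i h a = 0" if "i < n" for i
  proof -
    have "h (a(n := a n + t, i := a i - t)) = 0 \<and> h (a(n := a i - t, i := a n + t)) = 0"
      if "t \<in> {1..a i}" "a i \<le> a n + t" for t
      using dom_exp_spread[of n lam a "a n + t" i "a i - t"] that \<open>i < n\<close> nd assms(1) by auto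
    then show ?thesis using that by (subst dunkl1_spread) (auto intro!: sum.neutral)
  qed
  ultimately have "dunkl \<alpha> n h a = 0" by (simp add: dunkl_def)
  with assms(2) show False by simp
qed

lemma sum_le_top:
  fixes f :: "'b \<Rightarrow> nat"
  assumes "finite J" "finite J'" "card J = card J'"
    and "\<And>x. x \<in> J - J' \<Longrightarrow> M \<le> f x" "\<And>x. x \<in> J' - J \<Longrightarrow> f x \<le> M"
  shows "sum f J' \<le> sum f J"
proof -
  have c: "card (J - J') = card (J' - J)"
    using assms(1-3) by (simp add: card_Diff_subset_Int Int_commute)
  have "sum f (J' - J) \<le> card (J' - J) * M"
    using sum_bounded_above[of "J' - J" f M] assms(5) by simp
  also have "\<dots> = card (J - J') * M" using c by simp
  also have "\<dots> \<le> sum f (J - J')"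
    using sum_bounded_below[of "J - J'" M f] assms(4) by simp
  finally have "sum f (J' - J) \<le> sum f (J - J')" .
  moreover have "sum f J = sum f (J \<inter> J') + sum f (J - J')" using assms(1) by (rule sum.Int_Diff)
  moreover have "sum f J' = sum f (J' \<inter> J) + sum f (J' - J)" using assms(2) by (rule sum.Int_Diff)
  ultimately show ?thesis by (simp add: Int_commute)
qed

section \<open>Eigenvalues on dominance-maximal exponents\<close>

definition in_block :: "nat \<Rightarrow> nat list \<Rightarrow> (nat \<Rightarrow> nat) \<Rightarrow> bool" where
  "in_block n lam a \<longleftrightarrow> (\<exists>\<sigma>. \<sigma> permutes {..n} \<and> a = nth_default 0 lam \<circ> \<sigma>)"

lemma in_block_swap:
  assumes "in_block n lam a" "i \<le> n"
  shows "in_block n lam (a(n := a i, i := a n))"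
proof -
  obtain \<sigma> where s: "\<sigma> permutes {..n}" "a = nth_default 0 lam \<circ> \<sigma>"
    using assms by (auto simp: in_block_def)
  have "a(n := a i, i := a n) = nth_default 0 lam \<circ> (\<sigma> \<circ> Transposition.transpose n i)"
    unfolding s(2) by (auto simp: fun_eq_iff Transposition.transpose_def)
  moreover have "\<sigma> \<circ> Transposition.transpose n i permutes {..n}"
    using s(1) assms(2) by (intro permutes_compose permutes_swap_id) auto
  ultimately show ?thesis unfolding in_block_def by blast
qed

text \<open>Rearrangements of \<open>lam\<close> are extremal. With \<open>M\<close> the larger of
  the two exponents and \<open>R\<close> the other positions with entries at least \<open>M\<close>,
  the entries at \<open>R\<close> together with \<open>M\<close> already reach the maximal sum
  \<open>psum lam (card R + 1)\<close>; a strictly larger \<open>p\<close> in place of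
  \<open>M\<close> violates dominance.\<close>

lemma in_block_not_spread:
  assumes "in_block n lam a" "i < n" "p > a n" "p > a i"
  shows "\<not> dom_exp n lam (a(n := p, i := q))" "\<not> dom_exp n lam (a(n := q, i := p))"
proof -
  obtain \<sigma> where s: "\<sigma> permutes {..n}" "a = nth_default 0 lam \<circ> \<sigma>"
    using assms by (auto simp: in_block_def)
  define M where "M = max (a n) (a i)"
  define R where "R = {l\<in>{..n} - {n, i}. M \<le> a l}"
  have R: "finite R" "n \<notin> R" "i \<notin> R" "R \<subseteq> {..n}" by (auto simp: R_def)
  define m where "m = (if a i \<le> a n then n else i)"
  have m: "a m = M" "m \<le> n" "m \<notin> R" using assms(2) R by (auto simp: m_def M_def)
  define J where "J = \<sigma> ` insert m R"
  have inj: "inj_on \<sigma> S" for S using s(1) by (meson permutes_inj inj_on_subset subset_UNIV)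
  have cJ: "card J = Suc (card R)" unfolding J_def using inj R m by (subst card_image) auto
  have Jsub: "J \<subseteq> {..n}" unfolding J_def using R m permutes_image[OF s(1)] by (auto simp: permutes_in_image[OF s(1)])
  have leN: "Suc (card R) \<le> Suc n" using card_mono[OF _ Jsub] cJ by simp
  have "psum lam (Suc (card R)) \<le> sum (nth_default 0 lam) J"
    unfolding psum_def
  proof (rule sum_le_top[where M = M])
    show "finite J" using R by (simp add: J_def)
    show "card J = card {..<Suc (card R)}" using cJ by simp
    fix x assume "x \<in> J - {..<Suc (card R)}"
    then obtain y where "y \<in> insert m R" "x = \<sigma> y" by (auto simp: J_def)
    then show "M \<le> nth_default 0 lam x" using m s(2) by (auto simp: R_def)
  next
    fix x assume x: "x \<in> {..<Suc (card R)} - J"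
    then have "x \<in> {..n}" using leN by auto
    then obtain y where y: "y \<in> {..n}" "x = \<sigma> y" using permutes_image[OF s(1)] by blast
    then have "y \<notin> insert m R" using x by (auto simp: J_def)
    then have "a y \<le> M" using y by (cases "y \<in> {n, i}") (auto simp: R_def M_def)
    then show "nth_default 0 lam x \<le> M" using y s(2) by simp
  qed simp
  also have "sum (nth_default 0 lam) J = sum a (insert m R)"
    unfolding J_def s(2) by (subst sum.reindex[OF inj]) simp
  also have "\<dots> = M + sum a R" using R m by simp
  also have "\<dots> < p + sum a R" using assms by (simp add: M_def)
  finally have key: "psum lam (Suc (card R)) < p + sum a R" .
  have sR: "sum (a(n := x, i := y)) R = sum a R" for x y
    using R by (intro sum.cong) auto
  show "\<not> dom_exp n lam (a(n := p, i := q))"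
  proof
    assume d: "dom_exp n lam (a(n := p, i := q))"
    have "sum (a(n := p, i := q)) (insert n R) \<le> psum lam (card (insert n R))"
      using R by (intro dom_expD[OF d]) auto
    then show False using key R sR assms(2) by (simp add: sum.insert)
  qed
  show "\<not> dom_exp n lam (a(n := q, i := p))"
  proof
    assume d: "dom_exp n lam (a(n := q, i := p))"
    have "sum (a(n := q, i := p)) (insert i R) \<le> psum lam (card (insert i R))"
      using R assms(2) by (intro dom_expD[OF d]) auto
    then show False using key R sR assms(2) by (simp add: sum.insert)
  qed
qed

text \<open>Strictly spread exponents lie outside the support of \<open>h\<close>, so in the divided
  difference only \<open>t = a i - a n\<close> survives, and this term merely exchanges the two
  exponents.\<close>

lemma dunkl_block:
  assumes dom: "\<And>a. h a \<noteq> 0 \<Longrightarrow> dom_exp n lam a" and blk: "in_block n lam a"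
  shows "dunkl \<alpha> n h a = \<alpha> * a n * h a + (\<Sum>i\<in>{i. i \<le> n \<and> a n < a i}. h (a(n := a i, i := a n)) - h a)"
proof -
  have 1: "dunkl1 n i h a = (if a n < a i then h (a(n := a i, i := a n)) - h a else 0)" if i: "i < n" for i
  proof -
    have z: "h (a(n := a n + t, i := a i - t)) = 0 \<and> h (a(n := a i - t, i := a n + t)) = 0"
      if "t \<in> {1..a i}" "a i < a n + t" for t
      using in_block_not_spread[OF blk i, of "a n + t"] that dom by auto
    have "dunkl1 n i h a = (\<Sum>t\<in>{t\<in>{1..a i}. a i = a n + t}. h (a(n := a n + t, i := a i - t)) - h (a(n := a i - t, i := a n + t)))"
      unfolding dunkl1_spread[OF less_imp_neq[OF i]]
    proof (intro sum.mono_neutral_right ballI)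
      fix t assume "t \<in> {t\<in>{1..a i}. a i \<le> a n + t} - {t\<in>{1..a i}. a i = a n + t}"
      then have "t \<in> {1..a i}" "a i < a n + t" by auto
      then show "h (a(n := a n + t, i := a i - t)) - h (a(n := a i - t, i := a n + t)) = 0"
        using z by simp
    qed auto
    also have "{t\<in>{1..a i}. a i = a n + t} = (if a n < a i then {a i - a n} else {})" by auto
    also have "(\<Sum>t\<in>(if a n < a i then {a i - a n} else {}). h (a(n := a n + t, i := a i - t)) - h (a(n := a i - t, i := a n + t))) =
       (if a n < a i then h (a(n := a i, i := a n)) - h a else 0)"
      using i by (auto simp: fun_upd_idem)
    finally show ?thesis .
  qed
  have "(\<Sum>i<n. dunkl1 n i h a) = (\<Sum>i<n. if a n < a i then h (a(n := a i, i := a n)) - h a else 0)"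
    by (intro sum.cong) (auto simp: 1)
  also have "\<dots> = (\<Sum>i\<in>{i. i \<le> n \<and> a n < a i}. h (a(n := a i, i := a n)) - h a)"
    by (subst sum.inter_filter[symmetric]) (auto intro!: sum.cong simp: le_less)
  finally show ?thesis by (simp add: dunkl_def)
qed

text \<open>For a function constant on the rearrangements of \<open>lam\<close> and supported on exponents dominated by \<open>lam\<close>, this is
  the factor by which the \<open>k\<close>-th power of the Dunkl operator multiplies its value at a rearrangement whose last
  entry is \<open>v\<close>.\<close>
fun walk :: "real \<Rightarrow> nat list \<Rightarrow> nat \<Rightarrow> nat \<Rightarrow> real" where
  "walk \<alpha> lam 0 v = 1"
| "walk \<alpha> lam (Suc k) v = \<alpha> * v * walk \<alpha> lam k v +
     (\<Sum>r\<in>{r. r < length lam \<and> v < lam ! r}. walk \<alpha> lam k (lam ! r) - walk \<alpha> lam k v)"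

lemma dunkl_pow_dom:
  assumes "\<And>a. h a \<noteq> 0 \<Longrightarrow> dom_exp n lam a" and "(dunkl \<alpha> n ^^ m) h a \<noteq> 0"
  shows "dom_exp n lam a"
  using assms(2)
proof (induction m arbitrary: a)
  case (Suc m)
  then show ?case using dunkl_dom[of "(dunkl \<alpha> n ^^ m) h" n lam \<alpha> a] by auto
qed (use assms in auto)

text \<open>Exchanging \<open>a n\<close> with \<open>a i\<close> stays among the rearrangements of
  \<open>lam\<close> and replaces the last entry by a larger one, so the powers act as a walk on the
  value of the last entry alone. Zero entries are never targets of a step, so padding
  \<open>lam\<close> by zeros is harmless.\<close>

lemma dunkl_pow_block:
  assumes dom: "\<And>a. h a \<noteq> 0 \<Longrightarrow> dom_exp n lam a" and c: "\<And>a. in_block n lam a \<Longrightarrow> h a = c"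
    and len: "length lam \<le> n" and blk: "in_block n lam a"
  shows "(dunkl \<alpha> n ^^ m) h a = c * walk \<alpha> lam m (a n)"
  using blk
proof (induction m arbitrary: a)
  case (Suc m)
  obtain \<sigma> where s: "\<sigma> permutes {..n}" "a = nth_default 0 lam \<circ> \<sigma>"
    using Suc.prems by (auto simp: in_block_def)
  have ai: "a i = nth_default 0 lam (\<sigma> i)" for i using s(2) by simp
  let ?w = "walk \<alpha> lam m"
  have "(dunkl \<alpha> n ^^ Suc m) h a = \<alpha> * a n * (c * ?w (a n)) +
     (\<Sum>i\<in>{i. i \<le> n \<and> a n < a i}. (dunkl \<alpha> n ^^ m) h (a(n := a i, i := a n)) - c * ?w (a n))"
    using dunkl_block[of "(dunkl \<alpha> n ^^ m) h" n lam a \<alpha>, OF _ Suc.prems] dunkl_pow_dom[OF dom] Suc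
    by auto
  also have "(\<Sum>i\<in>{i. i \<le> n \<and> a n < a i}. (dunkl \<alpha> n ^^ m) h (a(n := a i, i := a n)) - c * ?w (a n)) =
     (\<Sum>i\<in>{i. i \<le> n \<and> a n < a i}. c * ?w (a i) - c * ?w (a n))"
  proof (intro sum.cong refl)
    fix i assume i: "i \<in> {i. i \<le> n \<and> a n < a i}"
    then have e: "(a(n := a i, i := a n)) n = a i" by auto
    have "i \<le> n" using i by simp
    from Suc.IH[OF in_block_swap[OF Suc.prems this]]
    show "(dunkl \<alpha> n ^^ m) h (a(n := a i, i := a n)) - c * ?w (a n) = c * ?w (a i) - c * ?w (a n)"
      unfolding e by (simp only:)
  qed
  also have "\<dots> = (\<Sum>i\<in>{..n}. if a n < a i then c * ?w (a i) - c * ?w (a n) else 0)"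
    by (subst sum.inter_filter[symmetric]) (auto intro!: sum.cong)
  also have "\<dots> = (\<Sum>i\<in>{..n}. if a n < nth_default 0 lam i then c * ?w (nth_default 0 lam i) - c * ?w (a n) else 0)"
    using sum.permute[OF s(1), of "\<lambda>i. if a n < nth_default 0 lam i then c * ?w (nth_default 0 lam i) - c * ?w (a n) else 0"]
    unfolding ai comp_def by (rule sym)
  also have "\<dots> = (\<Sum>r\<in>{r. r < length lam \<and> a n < lam ! r}. c * ?w (lam ! r) - c * ?w (a n))"
    by (subst sum.inter_filter[symmetric], simp, rule sum.cong)
       (use len in \<open>auto simp: nth_default_def split: if_splits\<close>)
  finally show ?case by (simp add: sum_distrib_left algebra_simps)
qed (use c in auto)

section \<open>Power-sum products as polynomials in finitely many variables\<close>

lemma pmon_nonneg: "0 \<le> pmon I \<mu> a"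
proof (induction \<mu> arbitrary: a)
  case (add j \<mu>)
  then show ?case by (auto simp: pmon_add mulp_def shiftX_def intro!: sum_nonneg)
qed (simp add: pmon_empty)

lemma pmon_supp:
  assumes "finite I" "pmon I \<mu> a \<noteq> 0"
  shows "(\<forall>i. i \<notin> I \<longrightarrow> a i = 0) \<and> sum a I = sum_mset \<mu>"
  using assms(2)
proof (induction \<mu> arbitrary: a)
  case empty
  then show ?case by (auto simp: pmon_empty split: if_splits)
next
  case (add j \<mu>)
  then have "(\<Sum>i\<in>I. shiftX i j (pmon I \<mu>) a) \<noteq> 0" by (simp add: pmon_add mulp_def)
  then obtain i where i: "i \<in> I" "shiftX i j (pmon I \<mu>) a \<noteq> 0"
    by (rule sum.not_neutral_contains_not_neutral)
  then have j: "j \<le> a i" and "pmon I \<mu> (a(i := a i - j)) \<noteq> 0"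
    by (auto simp: shiftX_def split: if_splits)
  from add.IH[OF this(2)] have IH: "\<forall>k. k \<notin> I \<longrightarrow> (a(i := a i - j)) k = 0" "sum (a(i := a i - j)) I = sum_mset \<mu>"
    by auto
  have "sum (a(i := a i - j)) I = (a(i := a i - j)) i + sum (a(i := a i - j)) (I - {i})"
    by (rule sum.remove[OF assms(1) i(1)])
  also have "sum (a(i := a i - j)) (I - {i}) = sum a (I - {i})" by (rule sum.cong) auto
  finally have "sum (a(i := a i - j)) I = (a i - j) + sum a (I - {i})" by simp
  moreover have "sum a I = a i + sum a (I - {i})" by (rule sum.remove[OF assms(1) i(1)])
  ultimately have "sum a I = j + sum_mset \<mu>" using IH(2) j by simp
  moreover have "\<forall>k. k \<notin> I \<longrightarrow> a k = 0" using IH(1) i by (metis fun_upd_other)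
  ultimately show ?case by simp
qed

lemma pmon_permute:
  assumes "\<sigma> permutes I"
  shows "pmon I \<mu> (a \<circ> \<sigma>) = pmon I \<mu> a"
proof (induction \<mu> arbitrary: a)
  case empty
  have "a \<circ> \<sigma> = (\<lambda>_. 0) \<longleftrightarrow> a = (\<lambda>_. 0)"
    using permutes_surj[OF assms] by (auto simp: fun_eq_iff) (metis surjD)
  then show ?case by (simp only: pmon_empty)
next
  case (add j \<mu>)
  have "shiftX i j (pmon I \<mu>) (a \<circ> \<sigma>) = shiftX (\<sigma> i) j (pmon I \<mu>) a" for i
  proof -
    have "(a \<circ> \<sigma>)(i := a (\<sigma> i) - j) = a(\<sigma> i := a (\<sigma> i) - j) \<circ> \<sigma>"
      using permutes_inj[OF assms] by (auto simp: fun_eq_iff inj_eq)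
    then show ?thesis by (simp only: shiftX_def comp_apply add.IH)
  qed
  then show ?case
    using sum.permute[OF assms, of "\<lambda>i. shiftX i j (pmon I \<mu>) a"]
    by (simp add: pmon_add mulp_def comp_def)
qed

lemma pmon_drop_var:
  assumes "\<mu> \<in> pos_mset" "a n = 0"
  shows "pmon {..n} \<mu> a = pmon {..<n} \<mu> a"
  using assms
proof (induction \<mu> arbitrary: a)
  case empty
  then show ?case by (simp add: pmon_empty)
next
  case (add j \<mu>)
  have j: "j > 0" and m: "\<mu> \<in> pos_mset" using add.prems by (auto simp: pos_mset_def)
  have "shiftX n j (pmon {..n} \<mu>) a = 0" using add.prems j by (simp add: shiftX_def)
  moreover have "shiftX i j (pmon {..n} \<mu>) a = shiftX i j (pmon {..<n} \<mu>) a" if "i < n" for i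
    using that add m by (simp add: shiftX_def)
  ultimately show ?case by (simp add: pmon_add mulp_def lessThan_Suc_atMost[symmetric])
qed

text \<open>Expanding a product of power sums chooses a variable for every part; \<open>g\<close>
  records the choices. Peeling off the last part matches the recursion of \<open>pmon\<close> with
  the count that \<open>mono_coeff\<close> uses.\<close>

lemma pmon_card:
  assumes "finite I" "\<And>i. i \<notin> I \<Longrightarrow> a i = 0"
  shows "pmon I (mset mu) a = real (card {g \<in> {..<length mu} \<rightarrow>\<^sub>E I.
           \<forall>i\<in>I. (\<Sum>j\<in>{j. j < length mu \<and> g j = i}. mu ! j) = a i})"
  using assms(2)
proof (induction mu arbitrary: a rule: rev_induct)
  case Nil
  have "a = (\<lambda>_. 0) \<longleftrightarrow> (\<forall>i\<in>I. a i = 0)" using Nil by (auto simp: fun_eq_iff)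
  then show ?case by (auto simp: pmon_empty)
next
  case (snoc x mu)
  let ?m = "length mu"
  define S where "S = {g \<in> {..<Suc ?m} \<rightarrow>\<^sub>E I. \<forall>i\<in>I. (\<Sum>j\<in>{j. j < Suc ?m \<and> g j = i}. (mu @ [x]) ! j) = a i}"
  define T where "T i = {g \<in> {..<?m} \<rightarrow>\<^sub>E I. \<forall>l\<in>I. (\<Sum>j\<in>{j. j < ?m \<and> g j = l}. mu ! j) = (a(i := a i - x)) l}" for i
  have fT: "finite (T i)" for i unfolding T_def using assms(1) by (auto intro!: finite_PiE)
  have fS: "finite S" unfolding S_def using assms(1) by (auto intro!: finite_PiE)
  have sp: "(\<Sum>j\<in>{j. j < Suc ?m \<and> g j = i}. (mu @ [x]) ! j) =
      (\<Sum>j\<in>{j. j < ?m \<and> g j = i}. mu ! j) + (if g ?m = i then x else 0)" for g :: "nat \<Rightarrow> nat" and i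
  proof -
    have "{j. j < Suc ?m \<and> g j = i} = {j. j < ?m \<and> g j = i} \<union> (if g ?m = i then {?m} else {})"
      by (auto simp: less_Suc_eq)
    then show ?thesis by (auto simp: nth_append intro!: sum.cong)
  qed
  have "bij_betw (\<lambda>(i, g). g(?m := i)) (Sigma {i\<in>I. x \<le> a i} T) S"
  proof (rule bij_betw_byWitness[where f' = "\<lambda>g. (g ?m, restrict g {..<?m})"])
    show "\<forall>p\<in>Sigma {i\<in>I. x \<le> a i} T. (case case p of (i, g) \<Rightarrow> g(?m := i) of g \<Rightarrow> (g ?m, restrict g {..<?m})) = p"
      by (auto simp: T_def fun_eq_iff restrict_def PiE_def extensional_def)
    show "\<forall>g\<in>S. (case (g ?m, restrict g {..<?m}) of (i, g) \<Rightarrow> g(?m := i)) = g"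
      by (auto simp: S_def fun_eq_iff restrict_def PiE_def extensional_def)
    show "(\<lambda>(i, g). g(?m := i)) ` Sigma {i\<in>I. x \<le> a i} T \<subseteq> S"
    proof safe
      fix i g assume i: "i \<in> I" "x \<le> a i" and g: "g \<in> T i"
      have "(\<Sum>j\<in>{j. j < ?m \<and> (g(?m := i)) j = l}. mu ! j) = (\<Sum>j\<in>{j. j < ?m \<and> g j = l}. mu ! j)" for l
        by (rule sum.cong) auto
      then show "g(?m := i) \<in> S" using i g unfolding S_def sp T_def
        by (auto simp: PiE_def extensional_def Pi_def less_Suc_eq)
    qed
    show "(\<lambda>g. (g ?m, restrict g {..<?m})) ` S \<subseteq> Sigma {i\<in>I. x \<le> a i} T"
    proof safe
      fix g assume g: "g \<in> S"
      have gm: "g ?m \<in> I" using g by (auto simp: S_def PiE_def)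
      have e: "(\<Sum>j\<in>{j. j < ?m \<and> g j = l}. mu ! j) + (if g ?m = l then x else 0) = a l" if "l \<in> I" for l
        using g that unfolding S_def sp by auto
      have r: "(\<Sum>j\<in>{j. j < ?m \<and> restrict g {..<?m} j = l}. mu ! j) = (\<Sum>j\<in>{j. j < ?m \<and> g j = l}. mu ! j)" for l
        by (rule sum.cong) auto
      show "g ?m \<in> I" by fact
      show "x \<le> a (g ?m)" using e[OF gm] by simp
      show "restrict g {..<?m} \<in> T (g ?m)"
        unfolding T_def mem_Collect_eq r
      proof (intro conjI ballI)
        show "restrict g {..<?m} \<in> {..<?m} \<rightarrow>\<^sub>E I" using g by (auto simp: S_def PiE_def Pi_def)
        fix l assume "l \<in> I"
        from e[OF this] show "(\<Sum>j\<in>{j. j < ?m \<and> g j = l}. mu ! j) = (a(g ?m := a (g ?m) - x)) l"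
          by (auto split: if_splits)
      qed
    qed
  qed
  then have "card S = card (Sigma {i\<in>I. x \<le> a i} T)" by (simp add: bij_betw_same_card)
  also have "\<dots> = (\<Sum>i\<in>{i\<in>I. x \<le> a i}. card (T i))"
    using assms(1) fT by (subst card_SigmaI) auto
  finally have cS: "real (card S) = (\<Sum>i\<in>{i\<in>I. x \<le> a i}. real (card (T i)))" by simp
  have "pmon I (mset (mu @ [x])) a = (\<Sum>i\<in>I. if x \<le> a i then pmon I (mset mu) (a(i := a i - x)) else 0)"
    by (simp add: pmon_add mulp_def shiftX_def)
  also have "\<dots> = (\<Sum>i\<in>I. if x \<le> a i then real (card (T i)) else 0)"
  proof (intro sum.cong refl)
    fix i assume "i \<in> I"
    then show "(if x \<le> a i then pmon I (mset mu) (a(i := a i - x)) else 0) = (if x \<le> a i then real (card (T i)) else 0)"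
      unfolding T_def using snoc.prems by (subst snoc.IH) auto
  qed
  also have "\<dots> = real (card S)"
    unfolding cS using assms(1) by (subst sum.inter_filter) auto
  finally show ?case unfolding S_def by simp
qed

text \<open>The nonzero exponents of a monomial in a power-sum product are sums of parts, so there
  are as many of them as parts only if nothing is merged. This is the triangularity between power
  sums and monomial symmetric functions.\<close>

lemma pmon_coarser:
  assumes "finite I" "\<mu> \<in> pos_mset" "pmon I \<mu> a \<noteq> 0"
  shows "card {i\<in>I. a i \<noteq> 0} \<le> size \<mu> \<and> (card {i\<in>I. a i \<noteq> 0} = size \<mu> \<longrightarrow> image_mset a (mset_set {i\<in>I. a i \<noteq> 0}) = \<mu>)"
  using assms(2,3)
proof (induction \<mu> arbitrary: a)
  case empty
  then show ?case by (auto simp: pmon_empty split: if_splits)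
next
  case (add j \<mu>)
  have j: "j > 0" and m: "\<mu> \<in> pos_mset" using add.prems by (auto simp: pos_mset_def)
  have "(\<Sum>i\<in>I. shiftX i j (pmon I \<mu>) a) \<noteq> 0" using add.prems by (simp add: pmon_add mulp_def)
  then obtain i where i: "i \<in> I" "shiftX i j (pmon I \<mu>) a \<noteq> 0"
    by (rule sum.not_neutral_contains_not_neutral)
  then have ji: "j \<le> a i" and nz: "pmon I \<mu> (a(i := a i - j)) \<noteq> 0"
    by (auto simp: shiftX_def split: if_splits)
  define b where "b = a(i := a i - j)"
  have IH: "card {l\<in>I. b l \<noteq> 0} \<le> size \<mu>" "card {l\<in>I. b l \<noteq> 0} = size \<mu> \<Longrightarrow> image_mset b (mset_set {l\<in>I. b l \<noteq> 0}) = \<mu>"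
    using add.IH[OF m nz] unfolding b_def by blast+
  show ?case
  proof (cases "a i = j")
    case True
    have A: "{l\<in>I. a l \<noteq> 0} = insert i {l\<in>I. b l \<noteq> 0}" and ni: "i \<notin> {l\<in>I. b l \<noteq> 0}"
      using True j i by (auto simp: b_def)
    have "image_mset a (mset_set {l\<in>I. b l \<noteq> 0}) = image_mset b (mset_set {l\<in>I. b l \<noteq> 0})"
      using assms(1) by (intro image_mset_cong) (auto simp: b_def True)
    then show ?thesis unfolding A using IH ni assms(1) True by auto
  next
    case False
    have "{l\<in>I. a l \<noteq> 0} = {l\<in>I. b l \<noteq> 0}"
      using False ji j by (auto simp: b_def)
    then show ?thesis using IH(1) by auto
  qed
qed

lemma pmon_self_pos:
  assumes "finite I" "\<mu> \<in> pos_mset" "image_mset a (mset_set {i\<in>I. a i \<noteq> 0}) = \<mu>" "\<And>i. i \<notin> I \<Longrightarrow> a i = 0"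
  shows "pmon I \<mu> a > 0"
  using assms(2-)
proof (induction \<mu> arbitrary: a)
  case empty
  then have "{i\<in>I. a i \<noteq> 0} = {}" using assms(1) by (simp add: mset_set_empty_iff)
  then have "a = (\<lambda>_. 0)" using empty by (auto simp: fun_eq_iff)
  then show ?case by (simp add: pmon_empty)
next
  case (add j \<mu>)
  have j: "j > 0" and m: "\<mu> \<in> pos_mset" using add.prems by (auto simp: pos_mset_def)
  have "j \<in># image_mset a (mset_set {i\<in>I. a i \<noteq> 0})" using add.prems(2) by simp
  then obtain i where i: "i \<in> I" "a i = j" using assms(1) by auto
  define b where "b = a(i := a i - j)"
  have A: "{l\<in>I. a l \<noteq> 0} = insert i {l\<in>I. b l \<noteq> 0}" and ni: "i \<notin> {l\<in>I. b l \<noteq> 0}"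
    using j i by (auto simp: b_def)
  have "image_mset a (mset_set {l\<in>I. b l \<noteq> 0}) = image_mset b (mset_set {l\<in>I. b l \<noteq> 0})"
    using assms(1) i by (intro image_mset_cong) (auto simp: b_def)
  then have "image_mset b (mset_set {l\<in>I. b l \<noteq> 0}) = \<mu>"
    using add.prems(2) ni assms(1) i unfolding A by auto
  moreover have "b l = 0" if "l \<notin> I" for l using add.prems(3) that i by (auto simp: b_def)
  ultimately have "pmon I \<mu> b > 0"
    by (rule add.IH[OF m])
  then have "0 < shiftX i j (pmon I \<mu>) a" using i by (simp add: shiftX_def b_def)
  also have "\<dots> \<le> mulp I j (pmon I \<mu>) a"
    unfolding mulp_def using i assms(1) by (intro member_le_sum) (auto simp: shiftX_def pmon_nonneg)
  finally show ?case by (simp add: pmon_add)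
qed

section \<open>Partitions and monomial coefficients\<close>

definition plist :: "nat multiset \<Rightarrow> nat list" where
  "plist \<mu> = rev (sorted_list_of_multiset \<mu>)"

lemma mset_plist [simp]: "mset (plist \<mu>) = \<mu>"
  by (simp add: plist_def)

lemma plist_in_parts: "\<mu> \<in> deg_msets n \<Longrightarrow> plist \<mu> \<in> parts n"
  by (auto simp: plist_def parts_def is_partition_def deg_msets_def pos_mset_def sorted_wrt_rev
      simp flip: sum_mset_sum_list)

lemma mset_in_deg: "mu \<in> parts n \<Longrightarrow> mset mu \<in> deg_msets n"
  by (auto simp: parts_def is_partition_def deg_msets_def pos_mset_def sum_mset_sum_list)

lemma plist_mset: "is_partition mu \<Longrightarrow> plist (mset mu) = mu"
proof -
  assume "is_partition mu"
  then have "sorted (rev mu)" by (simp add: is_partition_def sorted_wrt_rev)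
  then have "sort mu = rev mu" by (intro properties_for_sort) auto
  then show ?thesis by (simp add: plist_def)
qed

lemma parts_partition: "mu \<in> parts n \<Longrightarrow> is_partition mu"
  by (simp add: parts_def)

lemma bij_parts: "bij_betw mset (parts n) (deg_msets n)"
  by (rule bij_betw_byWitness[where f' = plist])
     (auto simp: plist_mset parts_partition plist_in_parts mset_in_deg)

lemma finite_parts: "finite (parts n)"
  using bij_betw_finite[OF bij_parts] finite_deg_msets by blast

lemma length_parts: "mu \<in> parts n \<Longrightarrow> length mu \<le> n"
proof -
  assume "mu \<in> parts n"
  moreover have "length ys \<le> sum_list ys" if "0 \<notin> set ys" for ys :: "nat list"
    using that by (induction ys) auto
  ultimately show ?thesis by (auto simp: parts_def is_partition_def)
qed

lemma parts_nth_pos: "mu \<in> parts n \<Longrightarrow> i < length mu \<Longrightarrow> mu ! i > 0"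
  by (auto simp: parts_def is_partition_def) (metis nth_mem gr0I)

lemma psum_ge:
  assumes "length mu \<le> k"
  shows "psum mu k = sum_list mu"
proof -
  have "psum mu k = (\<Sum>i<length mu. nth_default 0 mu i)"
    unfolding psum_def using assms by (intro sum.mono_neutral_right) (auto simp: nth_default_def)
  also have "\<dots> = sum_list mu"
    by (simp add: sum_list_sum_nth nth_default_def atLeast0LessThan)
  finally show ?thesis .
qed

text \<open>For a sorted exponent the leading entries maximise the sum over any index set of given
  cardinality.\<close>

lemma dominates_dom_exp:
  assumes "mu \<in> parts n" "dominates lam mu"
  shows "dom_exp n lam (nth_default 0 mu)"
  unfolding dom_exp_def
proof (intro allI impI)
  fix K assume K: "K \<subseteq> {..n}"
  have fK: "finite K" using K finite_subset by blast
  have mono: "nth_default 0 mu j \<le> nth_default 0 mu i" if "i \<le> j" for i j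
    using assms(1) that by (auto simp: nth_default_def parts_def is_partition_def sorted_wrt_iff_nth_less le_less)
  have "sum (nth_default 0 mu) K \<le> sum (nth_default 0 mu) {..<card K}"
    by (rule sum_le_top[where M = "nth_default 0 mu (card K)"]) (use fK in \<open>auto intro: mono\<close>)
  also have "\<dots> \<le> psum lam (card K)"
    using assms(2) by (auto simp: dominates_def psum_def)
  finally show "sum (nth_default 0 mu) K \<le> psum lam (card K)" .
qed

lemma dom_exp_dominates:
  assumes "mu \<in> parts n" "lam \<in> parts n" "dom_exp n lam (nth_default 0 mu)"
  shows "dominates lam mu"
  unfolding dominates_def
proof
  fix k
  show "(\<Sum>i<k. nth_default 0 mu i) \<le> (\<Sum>i<k. nth_default 0 lam i)"
  proof (cases "k \<le> n")
    case True
    then have "{..<k} \<subseteq> {..n}" by auto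
    then show ?thesis using dom_expD[OF assms(3), of "{..<k}"] by (auto simp: psum_def)
  next
    case False
    then have "psum mu k = psum lam k"
      using length_parts[OF assms(1)] length_parts[OF assms(2)] assms(1,2)
      by (simp add: psum_ge) (simp add: parts_def)
    then show ?thesis by (simp add: psum_def)
  qed
qed

lemma dominates_refl: "dominates lam lam"
  by (simp add: dominates_def)

lemma dominates_trans: "dominates a b \<Longrightarrow> dominates b c \<Longrightarrow> dominates a c"
  unfolding dominates_def using order_trans by blast

lemma dominates_antisym:
  assumes "a \<in> parts n" "b \<in> parts n" "dominates a b" "dominates b a"
  shows "a = b"
proof -
  have e: "(\<Sum>i<k. nth_default 0 a i) = (\<Sum>i<k. nth_default 0 b i)" for k
    using assms(3,4) by (auto simp: dominates_def intro: antisym)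
  have "nth_default 0 a k = nth_default 0 b k" for k
    using e[of "Suc k"] e[of k] by simp
  moreover have "no_trailing ((=) 0) a" "no_trailing ((=) 0) b"
    using assms(1,2) by (auto simp: parts_def is_partition_def no_trailing_unfold) (metis last_in_set gr0I)+
  ultimately show ?thesis
    by (metis ext nth_default_eq_iff strip_while_idem_iff)
qed

lemma dom_exp_permute:
  assumes "dom_exp n lam a" "\<sigma> permutes {..n}"
  shows "dom_exp n lam (a \<circ> \<sigma>)"
  unfolding dom_exp_def
proof (intro allI impI)
  fix K assume K: "K \<subseteq> {..n}"
  have inj: "inj_on \<sigma> K" using assms(2) by (meson permutes_inj inj_on_subset subset_UNIV)
  have "sum (a \<circ> \<sigma>) K = sum a (\<sigma> ` K)" by (simp add: sum.reindex[OF inj])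
  also have "\<dots> \<le> psum lam (card (\<sigma> ` K))"
    using K permutes_image[OF assms(2)] by (intro dom_expD[OF assms(1)]) blast
  finally show "sum (a \<circ> \<sigma>) K \<le> psum lam (card K)" by (simp add: card_image[OF inj])
qed

lemma exponent_sort:
  assumes "\<And>i. i \<notin> {..n} \<Longrightarrow> a i = 0" "sum a {..n} = n"
  shows "\<exists>mu\<in>parts n. in_block n mu a"
proof -
  define xs where "xs = map a [0..<Suc n]"
  define \<mu> where "\<mu> = filter_mset (\<lambda>x. x \<noteq> 0) (mset xs)"
  define mu where "mu = plist \<mu>"
  have "sum_mset \<mu> = sum_mset (mset xs)"
    unfolding \<mu>_def by (induction xs) auto
  also have "\<dots> = n" using assms(2) by (simp add: xs_def sum_mset_sum_list interv_sum_list_conv_sum_set_nat atLeast0LessThan lessThan_Suc_atMost sum_unfold_sum_mset del: upt_Suc)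
  finally have mu: "mu \<in> parts n"
    unfolding mu_def by (intro plist_in_parts) (auto simp: deg_msets_def pos_mset_def \<mu>_def)
  define ys where "ys = mu @ replicate (Suc n - length mu) 0"
  have "mset xs = \<mu> + filter_mset (\<lambda>x. x = 0) (mset xs)"
    unfolding \<mu>_def by (simp add: multiset_partition[of "mset xs" "\<lambda>x. x \<noteq> 0", simplified])
  moreover have "filter_mset (\<lambda>x. x = 0) (mset xs) = replicate_mset (count (mset xs) 0) 0"
    by (simp add: filter_eq_replicate_mset)
  ultimately have ms: "mset xs = \<mu> + replicate_mset (count (mset xs) 0) 0" by simp
  have "size (mset xs) = Suc n" by (simp add: xs_def)
  then have "count (mset xs) 0 = Suc n - length mu"
    using arg_cong[OF ms, of size] by (simp add: mu_def flip: size_mset)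
  then have "mset xs = mset ys" using ms by (simp add: ys_def mu_def)
  then obtain p where p: "p permutes {..<length ys}" "permute_list p ys = xs"
    using mset_eq_permutation by blast
  have len: "length ys = Suc n" using length_parts[OF mu] by (simp add: ys_def)
  have "a i = (nth_default 0 mu \<circ> p) i" for i
  proof (cases "i \<le> n")
    case True
    then have "p i < Suc n" using p(1) len permutes_in_image[OF p(1), of i] by simp
    moreover have "a i = xs ! i" using True unfolding xs_def by (simp del: upt_Suc)
    moreover have "xs ! i = ys ! p i" using p True len by (metis permute_list_nth less_Suc_eq_le)
    ultimately show ?thesis using len by (auto simp: ys_def nth_append nth_default_def)
  next
    case False
    then have "p i = i" using p(1) len by (auto simp: permutes_def)
    then show ?thesis using False assms(1)[of i] length_parts[OF mu] by (simp add: nth_default_def)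
  qed
  then have "a = nth_default 0 mu \<circ> p" by (simp add: fun_eq_iff)
  moreover have "p permutes {..n}" using p(1) len by (simp add: lessThan_Suc_atMost)
  ultimately show ?thesis using mu unfolding in_block_def by blast
qed

lemma expo_support:
  assumes "mu \<in> parts n"
  shows "{i\<in>{..n}. nth_default 0 mu i \<noteq> 0} = {..<length mu}"
    and "image_mset (nth_default 0 mu) (mset_set {..<length mu}) = mset mu"
proof -
  show "{i\<in>{..n}. nth_default 0 mu i \<noteq> 0} = {..<length mu}"
    using length_parts[OF assms] parts_nth_pos[OF assms] by (auto simp: nth_default_def)
  have "image_mset (nth_default 0 mu) (mset_set {..<length mu}) = mset (map (nth_default 0 mu) [0..<length mu])"
    by (simp add: mset_set_upto_eq_mset_upto)
  also have "map (nth_default 0 mu) [0..<length mu] = mu"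
    by (rule nth_equalityI) (auto simp: nth_default_def)
  finally show "image_mset (nth_default 0 mu) (mset_set {..<length mu}) = mset mu" .
qed

text \<open>The coefficient of a monomial symmetric function, read off in \<open>n + 1\<close>
  variables, one more than in \<open>mono_coeff\<close>, so that the same variables serve the Dunkl
  operator. A partition of \<open>n\<close> leaves the last exponent 0, hence both agree
  (\<open>mono_coeff_mon\<close>).\<close>

definition mon :: "nat \<Rightarrow> (nat multiset \<Rightarrow> real) \<Rightarrow> nat list \<Rightarrow> real" where
  "mon n f mu = (\<Sum>\<nu>\<in>deg_msets n. f \<nu> * pmon {..n} \<nu> (nth_default 0 mu))"

text \<open>A positive power of \<open>x_n\<close> cannot contribute to an exponent with
  \<open>a n = 0\<close>: this is how the vacuum component is extracted on the polynomial
  side.\<close>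

lemma hat_zero_exp:
  assumes "a n = 0"
  shows "hat n G a = (\<Sum>\<mu>\<in>deg_msets n. G 0 \<mu> * pmon {..n} \<mu> a)"
proof -
  have "hat n G a = (\<Sum>(k, \<mu>)\<in>Pair 0 ` deg_msets n. G k \<mu> * shiftX n k (pmon {..n} \<mu>) a)"
    unfolding hat_def
    by (rule sum.mono_neutral_right)
       (use assms finite_deg_pairs[of n] in \<open>auto simp: deg_pairs_def deg_msets_def shiftX_def image_iff\<close>)
  also have "\<dots> = (\<Sum>\<mu>\<in>deg_msets n. G 0 \<mu> * pmon {..n} \<mu> a)"
    by (subst sum.reindex) (auto simp: inj_on_def)
  finally show ?thesis .
qed

lemma hat_lift0: "hat n (lift0 f) a = (\<Sum>\<mu>\<in>deg_msets n. f \<mu> * pmon {..n} \<mu> a)"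
proof -
  have "hat n (lift0 f) a = (\<Sum>(k, \<mu>)\<in>Pair 0 ` deg_msets n. lift0 f k \<mu> * shiftX n k (pmon {..n} \<mu>) a)"
    unfolding hat_def
    by (rule sum.mono_neutral_right)
       (use finite_deg_pairs[of n] in \<open>auto simp: deg_pairs_def deg_msets_def lift0_def image_iff\<close>)
  also have "\<dots> = (\<Sum>\<mu>\<in>deg_msets n. f \<mu> * pmon {..n} \<mu> a)"
    by (subst sum.reindex) (auto simp: inj_on_def lift0_def)
  finally show ?thesis .
qed

lemma mono_coeff_mon:
  assumes "lam \<in> parts n"
  shows "mono_coeff n (\<lambda>mu. f (mset mu)) lam = mon n f lam"
proof -
  have "mono_coeff n (\<lambda>mu. f (mset mu)) lam = (\<Sum>mu\<in>parts n. f (mset mu) * pmon {..n} (mset mu) (nth_default 0 lam))"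
    unfolding mono_coeff_def
  proof (intro sum.cong refl)
    fix mu assume mu: "mu \<in> parts n"
    have ln: "nth_default 0 lam i = 0" if "i \<ge> n" for i
      using length_parts[OF assms] that by (simp add: nth_default_def)
    have "pmon {..n} (mset mu) (nth_default 0 lam) = pmon {..<n} (mset mu) (nth_default 0 lam)"
      using mset_in_deg[OF mu] ln by (intro pmon_drop_var) (auto simp: deg_msets_def)
    also have "\<dots> = real (card {g \<in> {..<length mu} \<rightarrow>\<^sub>E {..<n}.
           \<forall>i\<in>{..<n}. (\<Sum>j\<in>{j. j < length mu \<and> g j = i}. mu ! j) = nth_default 0 lam i})"
      by (rule pmon_card) (use ln in auto)
    finally show "f (mset mu) * real (card {g \<in> {..<length mu} \<rightarrow>\<^sub>E {..<n}.
           \<forall>i<n. (\<Sum>j\<in>{j. j < length mu \<and> g j = i}. mu ! j) = nth_default 0 lam i}) =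
        f (mset mu) * pmon {..n} (mset mu) (nth_default 0 lam)"
      by (simp add: Ball_def)
  qed
  also have "\<dots> = mon n f lam"
    unfolding mon_def using sum.reindex_bij_betw[OF bij_parts, of "\<lambda>\<mu>. f \<mu> * pmon {..n} \<mu> (nth_default 0 lam)"]
    by simp
  finally show ?thesis .
qed

section \<open>Self-adjointness\<close>

definition zz :: "nat multiset \<Rightarrow> real" where
  "zz \<mu> = (\<Prod>i\<in>set_mset \<mu>. real i ^ count \<mu> i * fact (count \<mu> i))"

lemma zz_empty [simp]: "zz {#} = 1"
  by (simp add: zz_def)

lemma zz_add: "zz (add_mset j \<mu>) = zz \<mu> * real (j * Suc (count \<mu> j))"
proof -
  let ?f = "\<lambda>i. real i ^ count \<mu> i * fact (count \<mu> i)"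
  let ?g = "\<lambda>i. real i ^ count (add_mset j \<mu>) i * fact (count (add_mset j \<mu>) i)"
  have "zz (add_mset j \<mu>) = ?g j * prod ?g (set_mset \<mu> - {j})"
    unfolding zz_def by (subst prod.remove[of _ j]) (auto intro!: prod.cong)
  also have "prod ?g (set_mset \<mu> - {j}) = prod ?f (set_mset \<mu> - {j})"
    by (rule prod.cong) auto
  also have "?g j = ?f j * real (j * Suc (count \<mu> j))"
    by (simp add: algebra_simps)
  also have "?f j * real (j * Suc (count \<mu> j)) * prod ?f (set_mset \<mu> - {j}) = ?f j * prod ?f (set_mset \<mu> - {j}) * real (j * Suc (count \<mu> j))"
    by simp
  also have "?f j * prod ?f (set_mset \<mu> - {j}) = zz \<mu>"
  proof (cases "j \<in># \<mu>")
    case True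
    then show ?thesis unfolding zz_def by (subst (2) prod.remove[of _ j]) auto
  next
    case False
    then show ?thesis by (simp add: zz_def not_in_iff[of j])
  qed
  finally show ?thesis by (simp add: algebra_simps)
qed

lemma zz_pos: "\<mu> \<in> pos_mset \<Longrightarrow> zz \<mu> > 0"
  unfolding zz_def by (rule prod_pos) (auto simp: pos_mset_def intro!: mult_pos_pos zero_less_power gr0I)

definition fip :: "real \<Rightarrow> nat \<Rightarrow> (nat multiset \<Rightarrow> real) \<Rightarrow> (nat multiset \<Rightarrow> real) \<Rightarrow> real" where
  "fip \<alpha> n f g = (\<Sum>\<mu>\<in>deg_msets n. f \<mu> * g \<mu> * zz \<mu> * \<alpha> ^ size \<mu>)"

definition pip :: "real \<Rightarrow> nat \<Rightarrow> (nat \<Rightarrow> nat multiset \<Rightarrow> real) \<Rightarrow> (nat \<Rightarrow> nat multiset \<Rightarrow> real) \<Rightarrow> real" where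
  "pip \<alpha> n F G = (\<Sum>(k, \<mu>)\<in>deg_pairs n. F k \<mu> * G k \<mu> * zz \<mu> * \<alpha> ^ size \<mu>)"

lemma pip_commute: "pip \<alpha> n F G = pip \<alpha> n G F"
  unfolding pip_def by (rule sum.cong) auto

lemma pip_lift0: "pip \<alpha> n (lift0 f) G = fip \<alpha> n f (G 0)"
proof -
  have "pip \<alpha> n (lift0 f) G = (\<Sum>(k, \<mu>)\<in>Pair 0 ` deg_msets n. lift0 f k \<mu> * G k \<mu> * zz \<mu> * \<alpha> ^ size \<mu>)"
    unfolding pip_def
    by (rule sum.mono_neutral_right)
       (use finite_deg_pairs[of n] in \<open>auto simp: deg_pairs_def deg_msets_def lift0_def image_iff\<close>)
  also have "\<dots> = fip \<alpha> n f (G 0)"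
    unfolding fip_def by (subst sum.reindex) (auto simp: inj_on_def lift0_def)
  finally show ?thesis .
qed

text \<open>By \<open>zz_add\<close>, adding a part \<open>j\<close> multiplies the weight
  \<open>zz \<mu> * \<alpha> ^ size \<mu>\<close> by exactly the coefficient of the annihilation
  term. Moving the part therefore turns annihilation on \<open>G\<close> into creation on
  \<open>F\<close>, so the two off-diagonal sums are exchanged when \<open>F\<close> and
  \<open>G\<close> are.\<close>

lemma lax_selfadjoint:
  "pip \<alpha> n F (lax \<alpha> \<kappa> (\<lambda>_. 0) G) = pip \<alpha> n (lax \<alpha> \<kappa> (\<lambda>_. 0) F) G"
proof -
  define u where "u F G = (\<Sum>(k, \<mu>)\<in>deg_pairs n. \<Sum>j\<in>set_mset \<mu>. F (k + j) (\<mu> - {#j#}) * G k \<mu> * zz \<mu> * \<alpha> ^ size \<mu>)"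
    for F G :: "nat \<Rightarrow> nat multiset \<Rightarrow> real"
  define d where "d F G = (\<Sum>(k, \<mu>)\<in>deg_pairs n. \<kappa> * k * F k \<mu> * G k \<mu> * zz \<mu> * \<alpha> ^ size \<mu>)"
    for F G :: "nat \<Rightarrow> nat multiset \<Rightarrow> real"
  have pos: "set_mset \<mu> - {0} = set_mset \<mu>" if "(k, \<mu>) \<in> deg_pairs n" for k \<mu>
    using that by (auto simp: deg_pairs_def pos_mset_def)
  have main: "pip \<alpha> n F (lax \<alpha> \<kappa> (\<lambda>_. 0) G) = u F G + u G F + d F G" for F G
  proof -
    have "pip \<alpha> n F (lax \<alpha> \<kappa> (\<lambda>_. 0) G) =
      (\<Sum>(k, \<mu>)\<in>deg_pairs n. \<Sum>j=1..k. F (k - j + j) (add_mset j \<mu> - {#j#}) * G (k - j) (add_mset j \<mu>) * zz (add_mset j \<mu>) * \<alpha> ^ size (add_mset j \<mu>)) +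
      u G F + d F G"
      unfolding pip_def u_def d_def sum.distrib[symmetric]
    proof (intro sum.cong refl, clarify)
      fix k \<mu> assume km: "(k, \<mu>) \<in> deg_pairs n"
      have "F k \<mu> * lax \<alpha> \<kappa> (\<lambda>_. 0) G k \<mu> * zz \<mu> * \<alpha> ^ size \<mu> =
        (\<Sum>j = 1..k. \<alpha> * real (j * Suc (count \<mu> j)) * G (k - j) (add_mset j \<mu>)) * (F k \<mu> * zz \<mu> * \<alpha> ^ size \<mu>) +
        (\<Sum>j\<in>set_mset \<mu>. G (k + j) (\<mu> - {#j#})) * (F k \<mu> * zz \<mu> * \<alpha> ^ size \<mu>) + \<kappa> * k * F k \<mu> * G k \<mu> * zz \<mu> * \<alpha> ^ size \<mu>"
        by (simp add: lax_def pos[OF km] algebra_simps)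
      also have "(\<Sum>j = 1..k. \<alpha> * real (j * Suc (count \<mu> j)) * G (k - j) (add_mset j \<mu>)) * (F k \<mu> * zz \<mu> * \<alpha> ^ size \<mu>) =
        (\<Sum>j=1..k. F (k - j + j) (add_mset j \<mu> - {#j#}) * G (k - j) (add_mset j \<mu>) * zz (add_mset j \<mu>) * \<alpha> ^ size (add_mset j \<mu>))"
        unfolding sum_distrib_right by (intro sum.cong refl) (simp add: zz_add)
      also have "(\<Sum>j\<in>set_mset \<mu>. G (k + j) (\<mu> - {#j#})) * (F k \<mu> * zz \<mu> * \<alpha> ^ size \<mu>) =
        (\<Sum>j\<in>set_mset \<mu>. G (k + j) (\<mu> - {#j#}) * F k \<mu> * zz \<mu> * \<alpha> ^ size \<mu>)"
        unfolding sum_distrib_right by (intro sum.cong refl) simp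
      finally show "F k \<mu> * lax \<alpha> \<kappa> (\<lambda>_. 0) G k \<mu> * zz \<mu> * \<alpha> ^ size \<mu> =
        (\<Sum>j=1..k. F (k - j + j) (add_mset j \<mu> - {#j#}) * G (k - j) (add_mset j \<mu>) * zz (add_mset j \<mu>) * \<alpha> ^ size (add_mset j \<mu>)) +
        (\<Sum>j\<in>set_mset \<mu>. G (k + j) (\<mu> - {#j#}) * F k \<mu> * zz \<mu> * \<alpha> ^ size \<mu>) +
        \<kappa> * k * F k \<mu> * G k \<mu> * zz \<mu> * \<alpha> ^ size \<mu>" .
    qed
    also have "(\<Sum>(k, \<mu>)\<in>deg_pairs n. \<Sum>j=1..k. F (k - j + j) (add_mset j \<mu> - {#j#}) * G (k - j) (add_mset j \<mu>) * zz (add_mset j \<mu>) * \<alpha> ^ size (add_mset j \<mu>)) = u F G"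
      unfolding u_def
      by (rule deg_pairs_move_up[of "\<lambda>k \<mu> j. F (k + j) (\<mu> - {#j#}) * G k \<mu> * zz \<mu> * \<alpha> ^ size \<mu>"])
    finally show ?thesis .
  qed
  have "d F G = d G F" unfolding d_def by (rule sum.cong) auto
  then have "pip \<alpha> n F (lax \<alpha> \<kappa> (\<lambda>_. 0) G) = pip \<alpha> n G (lax \<alpha> \<kappa> (\<lambda>_. 0) F)"
    unfolding main by simp
  then show ?thesis by (simp add: pip_commute)
qed

definition vac :: "'a::comm_ring_1 \<Rightarrow> 'a \<Rightarrow> (nat \<Rightarrow> 'a) \<Rightarrow> nat \<Rightarrow> (nat multiset \<Rightarrow> 'a) \<Rightarrow> nat multiset \<Rightarrow> 'a" where
  "vac h \<kappa> c k f = (lax h \<kappa> c ^^ k) (lift0 f) 0"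

lemma vac_selfadjoint:
  "fip \<alpha> n f (vac \<alpha> \<kappa> (\<lambda>_. 0) k g) = fip \<alpha> n (vac \<alpha> \<kappa> (\<lambda>_. 0) k f) g"
proof -
  have "pip \<alpha> n F ((lax \<alpha> \<kappa> (\<lambda>_. 0) ^^ k) G) = pip \<alpha> n ((lax \<alpha> \<kappa> (\<lambda>_. 0) ^^ k) F) G" for F G
    by (induction k arbitrary: F G) (simp_all add: lax_selfadjoint funpow_swap1)
  then have "pip \<alpha> n (lift0 f) ((lax \<alpha> \<kappa> (\<lambda>_. 0) ^^ k) (lift0 g)) = pip \<alpha> n (lift0 g) ((lax \<alpha> \<kappa> (\<lambda>_. 0) ^^ k) (lift0 f))"
    by (simp add: pip_commute)
  then have "fip \<alpha> n f (vac \<alpha> \<kappa> (\<lambda>_. 0) k g) = fip \<alpha> n g (vac \<alpha> \<kappa> (\<lambda>_. 0) k f)"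
    by (simp add: pip_lift0 vac_def)
  then show ?thesis by (simp add: fip_def mult_ac)
qed

definition supp_deg :: "nat \<Rightarrow> (nat multiset \<Rightarrow> 'a::zero) \<Rightarrow> bool" where
  "supp_deg n f \<longleftrightarrow> (\<forall>\<mu>. \<mu> \<notin> deg_msets n \<longrightarrow> f \<mu> = 0)"

lemma lax_degree:
  assumes G: "\<And>k \<mu>. (k, \<mu>) \<notin> deg_pairs n \<Longrightarrow> G k \<mu> = 0" and "(k, \<mu>) \<notin> deg_pairs n"
  shows "lax h \<kappa> (\<lambda>_. 0) G k \<mu> = 0"
proof -
  have "G (k - j) (add_mset j \<mu>) = 0" if "j \<in> {1..k}" for j
    by (rule G) (use assms(2) that in \<open>auto simp: deg_pairs_def pos_mset_def\<close>)
  moreover have "G (k + j) (\<mu> - {#j#}) = 0" if "j \<in> set_mset \<mu> - {0}" for j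
    by (rule G) (use assms(2) that in \<open>auto simp: deg_pairs_def pos_mset_def dest!: multi_member_split\<close>)
  moreover have "G k \<mu> = 0" by (rule G) fact
  ultimately show ?thesis by (simp add: lax_def)
qed

lemma vac_supp:
  assumes "supp_deg n f"
  shows "supp_deg n (vac h \<kappa> (\<lambda>_. 0) k f)"
proof -
  have "(lax h \<kappa> (\<lambda>_. 0) ^^ k) (lift0 f) l \<mu> = 0" if "(l, \<mu>) \<notin> deg_pairs n" for l \<mu>
    using that
  proof (induction k arbitrary: l \<mu>)
    case 0
    then show ?case using assms by (auto simp: lift0_def supp_deg_def deg_pairs_def deg_msets_def)
  next
    case (Suc k)
    show ?case using lax_degree[of n "(lax h \<kappa> (\<lambda>_. 0) ^^ k) (lift0 f)", OF Suc.IH Suc.prems] by simp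
  qed
  then show ?thesis by (auto simp: supp_deg_def vac_def deg_pairs_def deg_msets_def)
qed

text \<open>The span of the monomial symmetric functions of degree \<open>n\<close> dominated by
  \<open>lam\<close>, written in power-sum coefficients.\<close>

definition lower :: "nat \<Rightarrow> nat list \<Rightarrow> (nat multiset \<Rightarrow> real) \<Rightarrow> bool" where
  "lower n lam f \<longleftrightarrow> supp_deg n f \<and> (\<forall>mu\<in>parts n. mon n f mu \<noteq> 0 \<longrightarrow> dominates lam mu)"

lemma hat_block:
  assumes "in_block n mu a"
  shows "hat n (lift0 f) a = mon n f mu"
proof -
  obtain \<sigma> where s: "\<sigma> permutes {..n}" "a = nth_default 0 mu \<circ> \<sigma>"
    using assms by (auto simp: in_block_def)
  show ?thesis unfolding hat_lift0 mon_def s(2) pmon_permute[OF s(1)] ..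
qed

lemma lower_dom:
  assumes "lower n lam f" "hat n (lift0 f) a \<noteq> 0"
  shows "dom_exp n lam a"
proof -
  have "(\<Sum>\<mu>\<in>deg_msets n. f \<mu> * pmon {..n} \<mu> a) \<noteq> 0" using assms(2) by (simp add: hat_lift0)
  then obtain \<mu> where "\<mu> \<in> deg_msets n" "f \<mu> * pmon {..n} \<mu> a \<noteq> 0"
    by (rule sum.not_neutral_contains_not_neutral)
  then have "(\<forall>i. i \<notin> {..n} \<longrightarrow> a i = 0) \<and> sum a {..n} = n"
    using pmon_supp[of "{..n}" \<mu> a] by (auto simp: deg_msets_def)
  then obtain mu where mu: "mu \<in> parts n" "in_block n mu a" using exponent_sort by blast
  then have "dominates lam mu" using assms hat_block by (auto simp: lower_def)
  from dominates_dom_exp[OF mu(1) this] show ?thesis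
    using mu(2) dom_exp_permute by (auto simp: in_block_def)
qed

lemma mon_vac:
  assumes "mu \<in> parts n"
  shows "mon n (vac \<alpha> (\<alpha> - 1) (\<lambda>_. 0) k f) mu = (dunkl \<alpha> n ^^ k) (hat n (lift0 f)) (nth_default 0 mu)"
proof -
  have "nth_default 0 mu n = 0" using length_parts[OF assms] by (simp add: nth_default_def)
  then have "mon n (vac \<alpha> (\<alpha> - 1) (\<lambda>_. 0) k f) mu = hat n ((lax \<alpha> (\<alpha> - 1) (\<lambda>_. 0) ^^ k) (lift0 f)) (nth_default 0 mu)"
    by (simp add: hat_zero_exp mon_def vac_def)
  then show ?thesis by (simp add: hat_lax_pow)
qed

lemma lower_vac:
  assumes "lam \<in> parts n" "lower n lam f"
  shows "lower n lam (vac \<alpha> (\<alpha> - 1) (\<lambda>_. 0) k f)"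
    and "mon n (vac \<alpha> (\<alpha> - 1) (\<lambda>_. 0) k f) lam = walk \<alpha> lam k 0 * mon n f lam"
proof -
  show "lower n lam (vac \<alpha> (\<alpha> - 1) (\<lambda>_. 0) k f)"
    unfolding lower_def
  proof (intro conjI ballI impI)
    show "supp_deg n (vac \<alpha> (\<alpha> - 1) (\<lambda>_. 0) k f)" using assms(2) by (auto simp: lower_def intro: vac_supp)
    fix mu assume mu: "mu \<in> parts n" "mon n (vac \<alpha> (\<alpha> - 1) (\<lambda>_. 0) k f) mu \<noteq> 0"
    then have "dom_exp n lam (nth_default 0 mu)"
      using dunkl_pow_dom[of "hat n (lift0 f)", OF lower_dom[OF assms(2)]] mon_vac by metis
    then show "dominates lam mu" using dom_exp_dominates mu assms by blast
  qed
  have blk: "in_block n lam (nth_default 0 lam)"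
    unfolding in_block_def by (rule exI[of _ id]) (simp add: permutes_id)
  have "nth_default 0 lam n = 0" using length_parts[OF assms(1)] by (simp add: nth_default_def)
  then show "mon n (vac \<alpha> (\<alpha> - 1) (\<lambda>_. 0) k f) lam = walk \<alpha> lam k 0 * mon n f lam"
    unfolding mon_vac[OF assms(1)]
    using dunkl_pow_block[of "hat n (lift0 f)" n lam "mon n f lam", OF lower_dom[OF assms(2)] hat_block length_parts[OF assms(1)] blk]
    by simp
qed

section \<open>Newton relations for the eigenvalues\<close>

text \<open>The alternating power sum of the anisotropic contents at the corners of \<open>lam\<close>, telescoped over
  rows.\<close>
definition csum :: "real \<Rightarrow> nat list \<Rightarrow> nat \<Rightarrow> real" where
  "csum \<alpha> lam l = (- real (length lam)) ^ l +
     (\<Sum>r<length lam. (\<alpha> * lam ! r - r) ^ l - (\<alpha> * lam ! r - r - 1) ^ l)"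

text \<open>The series \<open>x X / (1 - x X)\<close>, that is, \<open>X\<close> times the
  logarithmic derivative of \<open>1 / (1 - x X)\<close>.\<close>

definition fps_pw :: "real \<Rightarrow> real fps" where
  "fps_pw x = Abs_fps (\<lambda>l. if l = 0 then 0 else x ^ l)"

lemma fps_pw_mult: "(1 - fps_const x * fps_X) * fps_pw x = fps_const x * fps_X"
proof (rule fps_ext)
  fix n
  show "fps_nth ((1 - fps_const x * fps_X) * fps_pw x) n = fps_nth (fps_const x * fps_X) n"
    by (cases n) (auto simp: fps_pw_def left_diff_distrib mult.assoc fps_X_nth)
qed

text \<open>Multiplication by \<open>(1 - y X) / (1 - x X)\<close> adds
  \<open>fps_pw x - fps_pw y\<close> to the logarithmic derivative; the form avoids division of
  series.\<close>

lemma fps_logderiv_step: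
  fixes F H S :: "real fps"
  assumes e: "(1 - fps_const x * fps_X) * F = (1 - fps_const y * fps_X) * H" and S: "fps_X * fps_deriv H = H * S"
  shows "fps_X * fps_deriv F = F * (S + fps_pw x - fps_pw y)"
proof -
  let ?x = "fps_const x" and ?y = "fps_const y" and ?X = "fps_X :: real fps"
  have "fps_deriv ((1 - ?x * ?X) * F) = fps_deriv ((1 - ?y * ?X) * H)" using e by simp
  then have d: "(1 - ?x * ?X) * fps_deriv F - ?x * F = (1 - ?y * ?X) * fps_deriv H - ?y * H"
    by (simp add: algebra_simps)
  have "(1 - ?x * ?X) * (?X * fps_deriv F) = ?X * ((1 - ?x * ?X) * fps_deriv F - ?x * F) + ?x * ?X * F"
    by (simp add: algebra_simps)
  also have "\<dots> = ?X * ((1 - ?y * ?X) * fps_deriv H - ?y * H) + ?x * ?X * F" by (simp only: d)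
  also have "\<dots> = (1 - ?y * ?X) * (?X * fps_deriv H) - (?y * ?X) * H + (?x * ?X) * F"
    by (simp add: algebra_simps)
  also have "\<dots> = (1 - ?y * ?X) * H * S - (?y * ?X) * H + (?x * ?X) * F"
    unfolding S by (simp add: algebra_simps)
  also have "(?y * ?X) * H = ((1 - ?y * ?X) * fps_pw y) * H" by (simp only: fps_pw_mult)
  also have "\<dots> = fps_pw y * ((1 - ?y * ?X) * H)" by (simp only: mult_ac)
  also have "(?x * ?X) * F = ((1 - ?x * ?X) * fps_pw x) * F" by (simp only: fps_pw_mult)
  also have "(1 - ?y * ?X) * H * S - fps_pw y * ((1 - ?y * ?X) * H) + ((1 - ?x * ?X) * fps_pw x) * F =
      (1 - ?x * ?X) * F * S - fps_pw y * ((1 - ?x * ?X) * F) + ((1 - ?x * ?X) * fps_pw x) * F"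
    by (simp only: e)
  also have "\<dots> = (1 - ?x * ?X) * (F * (S + fps_pw x - fps_pw y))"
    by (simp add: algebra_simps)
  finally have "(1 - ?x * ?X) * (?X * fps_deriv F) = (1 - ?x * ?X) * (F * (S + fps_pw x - fps_pw y))" .
  moreover have "1 - ?x * ?X \<noteq> 0"
  proof
    assume "1 - ?x * ?X = 0"
    then have "fps_nth (1 - ?x * ?X) 0 = 0" by simp
    then show False by simp
  qed
  ultimately show ?thesis by simp
qed

text \<open>The recursion for \<open>walk\<close> makes its generating functions rational. With
  \<open>A r\<close> as in the proof, passing row \<open>r\<close> multiplies by
  \<open>(1 - (x - 1) X) / (1 - x X)\<close>, where \<open>x = \<alpha> * lam ! r - r\<close>, and
  \<open>g 0\<close> is \<open>A (length lam)\<close> divided by \<open>1 + length lam X\<close>. So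
  \<open>g 0\<close> is an explicit product over the rows, and Newton's relations are its
  logarithmic derivative.\<close>

lemma walk_newton_fps:
  fixes \<alpha> :: real and lam :: "nat list"
  assumes sorted: "sorted_wrt (\<ge>) lam" and pos: "0 \<notin> set lam"
  defines "g \<equiv> \<lambda>v. Abs_fps (\<lambda>k. walk \<alpha> lam k v)"
  shows "fps_X * fps_deriv (g 0) = g 0 * (fps_pw (- real (length lam)) +
     (\<Sum>r<length lam. fps_pw (\<alpha> * lam ! r - r) - fps_pw (\<alpha> * lam ! r - r - 1)))"
proof -
  let ?X = "fps_X :: real fps"
  have g_rec: "g v = 1 + ?X * (fps_const (\<alpha> * v) * g v + (\<Sum>r\<in>{r. r < length lam \<and> v < lam ! r}. g (lam ! r) - g v))" for v
  proof (rule fps_ext)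
    fix k
    show "fps_nth (g v) k = fps_nth (1 + ?X * (fps_const (\<alpha> * v) * g v + (\<Sum>r\<in>{r. r < length lam \<and> v < lam ! r}. g (lam ! r) - g v))) k"
      by (cases k) (simp_all add: g_def fps_sum_nth)
  qed
  have g_rec': "g v = 1 + ?X * (fps_const (\<alpha> * v) * g v + (\<Sum>q<r. g (lam ! q) - g v))"
    if "{q. q < length lam \<and> v < lam ! q} \<subseteq> {..<r}" "\<And>q. q < r \<Longrightarrow> v \<le> lam ! q" "r \<le> length lam" for v r
  proof -
    \<comment> \<open>Rows with \<open>lam ! q = v\<close> contribute 0, so the cut \<open>r\<close>
      may fall anywhere inside the block of rows equal to \<open>v\<close>.\<close>
    have "(\<Sum>q<r. g (lam ! q) - g v) = (\<Sum>q\<in>{q. q < length lam \<and> v < lam ! q}. g (lam ! q) - g v)"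
      using that by (intro sum.mono_neutral_right) (auto simp: order_le_less)
    then show ?thesis using g_rec[of v] by simp
  qed
  define A where "A r = 1 + ?X * (\<Sum>q<r. g (lam ! q))" for r
  have anti: "lam ! j \<le> lam ! i" if "i \<le> j" "j < length lam" for i j
    using sorted that by (auto simp: sorted_wrt_iff_nth_less le_less)
  have gA: "(1 - fps_const (\<alpha> * v - r) * ?X) * g v = A r"
    if "{q. q < length lam \<and> v < lam ! q} \<subseteq> {..<r}" "\<And>q. q < r \<Longrightarrow> v \<le> lam ! q" "r \<le> length lam" for v r
  proof -
    have "g v = A r + fps_const (\<alpha> * v) * ?X * g v - of_nat r * ?X * g v"
      using g_rec'[OF that] by (simp add: A_def sum_subtractf algebra_simps)
    then have "g v - (fps_const (\<alpha> * v) - of_nat r) * ?X * g v = A r" by (simp add: algebra_simps)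
    moreover have "fps_const (\<alpha> * v - r) = fps_const (\<alpha> * v) - of_nat r"
      by (simp add: fps_of_nat[symmetric])
    ultimately show ?thesis by (simp only: left_diff_distrib mult_1_left)
  qed
  have "fps_X * fps_deriv (A r) = A r * (\<Sum>q<r. fps_pw (\<alpha> * lam ! q - q) - fps_pw (\<alpha> * lam ! q - q - 1))"
    if "r \<le> length lam" for r
    using that
  proof (induction r)
    case 0
    then show ?case by (simp add: A_def)
  next
    case (Suc r)
    let ?x = "\<alpha> * lam ! r - r"
    have gr: "(1 - fps_const ?x * ?X) * g (lam ! r) = A r"
      using Suc.prems anti by (intro gA) (auto simp: not_less[symmetric])
    have "(1 - fps_const ?x * ?X) * A (Suc r) = (1 - fps_const ?x * ?X) * A r + ?X * ((1 - fps_const ?x * ?X) * g (lam ! r))"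
      by (simp add: A_def algebra_simps)
    also have "\<dots> = (1 - fps_const ?x * ?X) * A r + ?X * A r" by (simp only: gr)
    also have "\<dots> = (1 - fps_const (?x - 1) * ?X) * A r"
    proof -
      have "fps_const (?x - 1) = fps_const ?x - 1" by (metis fps_const_sub fps_const_1_eq_1)
      then show ?thesis by (simp only:) (simp add: left_diff_distrib)
    qed
    finally have "(1 - fps_const ?x * ?X) * A (Suc r) = (1 - fps_const (?x - 1) * ?X) * A r" .
    from fps_logderiv_step[OF this Suc.IH[OF Suc_leD[OF Suc.prems]]] show ?case
      by (simp add: add_diff_eq)
  qed
  note 1 = this[of "length lam", OF order_refl]
  have "(1 - fps_const (\<alpha> * real 0 - length lam) * ?X) * g 0 = A (length lam)"
    by (rule gA) auto
  then have "(1 - fps_const (- real (length lam)) * ?X) * g 0 = (1 - fps_const 0 * ?X) * A (length lam)"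
    by simp
  from fps_logderiv_step[OF this 1] have
    "?X * fps_deriv (g 0) = g 0 * ((\<Sum>q<length lam. fps_pw (\<alpha> * lam ! q - q) - fps_pw (\<alpha> * lam ! q - q - 1)) + fps_pw (- real (length lam)) - fps_pw 0)" .
  moreover have "fps_pw 0 = 0" by (rule fps_ext) (simp add: fps_pw_def)
  ultimately show ?thesis by (simp add: add.commute)
qed

lemma walk_newton:
  assumes "is_partition lam"
  shows "real k * walk \<alpha> lam k 0 = (\<Sum>j=1..k. walk \<alpha> lam (k - j) 0 * csum \<alpha> lam j)"
proof -
  have s: "sorted_wrt (\<ge>) lam" "0 \<notin> set lam" using assms by (auto simp: is_partition_def)
  let ?S = "fps_pw (- real (length lam)) + (\<Sum>r<length lam. fps_pw (\<alpha> * lam ! r - r) - fps_pw (\<alpha> * lam ! r - r - 1))"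
  have S: "fps_nth ?S j = (if j = 0 then 0 else csum \<alpha> lam j)" for j
    by (simp add: fps_sum_nth fps_pw_def csum_def)
  have "real k * walk \<alpha> lam k 0 = fps_nth (fps_X * fps_deriv (Abs_fps (\<lambda>k. walk \<alpha> lam k 0))) k"
    by (cases k) auto
  also have "\<dots> = fps_nth (?S * Abs_fps (\<lambda>k. walk \<alpha> lam k 0)) k"
    by (subst walk_newton_fps[OF s]) (simp only: mult.commute)
  also have "\<dots> = (\<Sum>j=0..k. fps_nth ?S j * walk \<alpha> lam (k - j) 0)"
    by (simp only: fps_mult_nth fps_nth_Abs_fps)
  also have "\<dots> = (\<Sum>j=1..k. walk \<alpha> lam (k - j) 0 * csum \<alpha> lam j)"
    unfolding S by (rule sum.mono_neutral_cong_right) auto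
  finally show ?thesis .
qed

lemma csum_pad:
  assumes "length lam \<le> n"
  shows "csum \<alpha> lam l = (- real n) ^ l +
     (\<Sum>r<n. (\<alpha> * nth_default 0 lam r - r) ^ l - (\<alpha> * nth_default 0 lam r - r - 1) ^ l)"
  using assms
proof (induction n rule: dec_induct)
  case base
  then show ?case by (simp add: csum_def nth_default_def)
next
  case (step n)
  then show ?case by (simp add: nth_default_beyond algebra_simps)
qed

text \<open>Rows before \<open>r0\<close> cancel, and the longer row \<open>r0\<close> of
  \<open>lam\<close> gives a point \<open>z\<close> larger than every other point coming from the
  rows from \<open>r0\<close> on. Equality of all power sums would extend to all polynomials, and a
  polynomial vanishing at every other point but not at \<open>z\<close> separates the two
  sides.\<close>

lemma csum_separate:
  assumes lam: "lam \<in> parts n" and mu: "mu \<in> parts n" and \<alpha>: "\<alpha> > 0"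
    and eq: "\<And>r. r < r0 \<Longrightarrow> nth_default 0 lam r = nth_default 0 mu r"
    and less: "nth_default 0 mu r0 < nth_default 0 lam r0"
  shows "\<exists>l. csum \<alpha> lam l \<noteq> csum \<alpha> mu l"
proof (rule ccontr)
  assume "\<not> ?thesis"
  then have ceq: "csum \<alpha> lam l = csum \<alpha> mu l" for l by blast
  define x where "x nu r = \<alpha> * nth_default 0 nu r - real r" for nu :: "nat list" and r
  have pw: "(\<Sum>r<n. x lam r ^ l - (x lam r - 1) ^ l) = (\<Sum>r<n. x mu r ^ l - (x mu r - 1) ^ l)" for l
    using ceq[of l] csum_pad[OF length_parts[OF lam], of \<alpha> l] csum_pad[OF length_parts[OF mu], of \<alpha> l]
    by (simp add: x_def)
  have pol: "(\<Sum>r<n. poly q (x lam r) - poly q (x lam r - 1)) = (\<Sum>r<n. poly q (x mu r) - poly q (x mu r - 1))" for q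
  proof -
    have "(\<Sum>r<n. poly q (x nu r) - poly q (x nu r - 1)) = (\<Sum>i\<le>degree q. coeff q i * (\<Sum>r<n. x nu r ^ i - (x nu r - 1) ^ i))" for nu
      by (simp add: poly_altdef sum_distrib_left sum_subtractf[symmetric] right_diff_distrib) (rule sum.swap)
    then show ?thesis by (simp add: pw)
  qed
  have mono: "nth_default 0 nu j \<le> nth_default 0 nu i" if "i \<le> j" "nu \<in> parts n" for i j nu
    using that by (auto simp: nth_default_def parts_def is_partition_def sorted_wrt_iff_nth_less le_less)
  have r0: "r0 < n" using less length_parts[OF lam] by (auto simp: nth_default_def split: if_splits)
  define z where "z = x lam r0"
  have xanti: "x nu j \<le> x nu i - (real j - real i)" if "i \<le> j" "nu \<in> parts n" for i j nu
    using mono[OF that] \<alpha> by (simp add: x_def)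
  have xl: "x lam r < z" if "r > r0" for r
    using xanti[of r0 r lam] that lam by (simp add: z_def)
  have xm: "x mu r < z" if "r \<ge> r0" for r
  proof -
    have "x mu r \<le> x mu r0" using xanti[of r0 r mu] that mu by simp
    also have "\<dots> < z" using less \<alpha> by (simp add: x_def z_def)
    finally show ?thesis .
  qed
  define W where "W = (x lam ` {..<n} \<union> (\<lambda>r. x lam r - 1) ` {..<n} \<union> x mu ` {..<n} \<union> (\<lambda>r. x mu r - 1) ` {..<n}) - {z}"
  define q where "q = (\<Prod>w\<in>W. [:- w, 1:])"
  have fW: "finite W" by (simp add: W_def)
  have q0: "poly q w = 0" if "w \<in> W" for w using that fW by (auto simp: q_def poly_prod)
  have qz: "poly q z \<noteq> 0" using fW by (auto simp: q_def poly_prod W_def)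
  have inW: "poly q w = 0" if "w \<noteq> z" "w \<in> x lam ` {..<n} \<union> (\<lambda>r. x lam r - 1) ` {..<n} \<union> x mu ` {..<n} \<union> (\<lambda>r. x mu r - 1) ` {..<n}" for w
    using q0 that by (auto simp: W_def)
  define d where "d nu r = poly q (x nu r) - poly q (x nu r - 1)" for nu r
  have "d lam r = d mu r" if "r < r0" for r using eq[OF that] by (simp add: d_def x_def)
  moreover have "d lam r = d mu r" if "r > r0" "r < n" for r
    using xl[of r] xm[of r] that inW[of "x lam r"] inW[of "x lam r - 1"] inW[of "x mu r"] inW[of "x mu r - 1"]
    by (simp add: d_def)
  moreover have "d mu r0 = 0" using xm[of r0] r0 inW[of "x mu r0"] inW[of "x mu r0 - 1"] by (simp add: d_def)
  moreover have "d lam r0 = poly q z" using r0 inW[of "x lam r0 - 1"] by (simp add: d_def z_def)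
  ultimately have "(\<Sum>r<n. d lam r - d mu r) = (\<Sum>r<n. if r = r0 then poly q z else 0)"
    by (intro sum.cong refl) (metis diff_self diff_zero lessThan_iff linorder_neqE_nat)
  also have "\<dots> = poly q z" using r0 by simp
  finally show False using pol[of q] qz by (simp add: d_def sum_subtractf)
qed

lemma walk_separate:
  assumes lam: "lam \<in> parts n" and mu: "mu \<in> parts n" and \<alpha>: "\<alpha> > 0" and ne: "lam \<noteq> mu"
  shows "\<exists>k. walk \<alpha> lam k 0 \<noteq> walk \<alpha> mu k 0"
proof (rule ccontr)
  assume "\<not> ?thesis"
  then have w: "walk \<alpha> lam k 0 = walk \<alpha> mu k 0" for k by blast
  have c: "csum \<alpha> lam k = csum \<alpha> mu k" for k
  proof (induction k rule: less_induct)
    case (less k)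
    show ?case
    proof (cases "k = 0")
      case True
      then show ?thesis by (simp add: csum_def)
    next
      case False
      have "(\<Sum>j=1..k. walk \<alpha> lam (k - j) 0 * csum \<alpha> lam j) = (\<Sum>j=1..k. walk \<alpha> lam (k - j) 0 * csum \<alpha> mu j)"
        using walk_newton[OF parts_partition[OF lam], of k \<alpha>] walk_newton[OF parts_partition[OF mu], of k \<alpha>] by (simp add: w)
      moreover have "{1..k} = insert k {1..<k}" using False by auto
      moreover have "(\<Sum>j\<in>{1..<k}. walk \<alpha> lam (k - j) 0 * csum \<alpha> lam j) = (\<Sum>j\<in>{1..<k}. walk \<alpha> lam (k - j) 0 * csum \<alpha> mu j)"
        by (rule sum.cong) (auto simp: less)
      ultimately show ?thesis by simp
    qed
  qed
  have "\<exists>r. nth_default 0 lam r \<noteq> nth_default 0 mu r"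
  proof (rule ccontr)
    assume "\<not> ?thesis"
    then have "nth_default 0 lam = nth_default 0 mu" by (simp add: fun_eq_iff)
    then show False using dominates_antisym[OF lam mu] ne by (simp add: dominates_def)
  qed
  then obtain r0 where r0: "nth_default 0 lam r0 \<noteq> nth_default 0 mu r0" "\<And>r. r < r0 \<Longrightarrow> nth_default 0 lam r = nth_default 0 mu r"
    using exists_least_iff[of "\<lambda>r. nth_default 0 lam r \<noteq> nth_default 0 mu r"] by blast
  show False
  proof (cases "nth_default 0 mu r0 < nth_default 0 lam r0")
    case True
    then show False using csum_separate[OF lam mu \<alpha> r0(2)] c by blast
  next
    case False
    then show False using csum_separate[OF mu lam \<alpha> r0(2)[symmetric], of r0] c r0(1) by (metis linorder_neqE_nat)
  qed
qed

section \<open>Jack symmetric functions as eigenvectors\<close>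

lemma mon_diff: "mon n (\<lambda>\<mu>. f \<mu> - g \<mu>) mu = mon n f mu - mon n g mu"
  by (simp add: mon_def algebra_simps sum_subtractf)

lemma mon_cmult: "mon n (\<lambda>\<mu>. c * f \<mu>) mu = c * mon n f mu"
  by (simp add: mon_def sum_distrib_left mult.assoc)

lemma mon_sum: "mon n (\<lambda>\<mu>. \<Sum>x\<in>S. f x \<mu>) mu = (\<Sum>x\<in>S. mon n (f x) mu)"
  unfolding mon_def sum_distrib_right by (rule sum.swap)

lemma pmon_expo_cases:
  assumes "lam \<in> parts n" "mu \<in> parts n" "pmon {..n} (mset lam) (nth_default 0 mu) \<noteq> 0"
  shows "length mu < length lam \<or> mu = lam"
proof -
  have "length mu \<le> length lam \<and> (length mu = length lam \<longrightarrow> mset mu = mset lam)"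
    using pmon_coarser[OF _ _ assms(3)] mset_in_deg[OF assms(1)]
    unfolding expo_support[OF assms(2)] by (simp add: deg_msets_def)
  moreover have "mu = lam" if "mset mu = mset lam"
    using that plist_mset assms(1,2) parts_partition by metis
  ultimately show ?thesis by auto
qed

lemma pmon_expo_self:
  assumes "lam \<in> parts n"
  shows "pmon {..n} (mset lam) (nth_default 0 lam) > 0"
proof (rule pmon_self_pos)
  show "image_mset (nth_default 0 lam) (mset_set {i\<in>{..n}. nth_default 0 lam i \<noteq> 0}) = mset lam"
    unfolding expo_support(1)[OF assms] by (rule expo_support(2)[OF assms])
qed (use mset_in_deg[OF assms] length_parts[OF assms] in \<open>auto simp: deg_msets_def nth_default_def\<close>)

text \<open>Inverts the triangularity of power sums: the product for \<open>lam\<close> is a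
  positive multiple of the monomial function of \<open>lam\<close> plus monomial functions of
  strictly shorter partitions, which are removed by induction on the length.\<close>

lemma mon_basis_exists:
  assumes "lam \<in> parts n"
  shows "\<exists>f. supp_deg n f \<and> (\<forall>mu\<in>parts n. mon n f mu = (if mu = lam then 1 else 0))"
  using assms
proof (induction "length lam" arbitrary: lam rule: less_induct)
  case less
  let ?S = "{nu\<in>parts n. length nu < length lam}"
  let ?p = "\<lambda>mu. pmon {..n} (mset lam) (nth_default 0 mu)"
  have "\<forall>nu\<in>?S. \<exists>f. supp_deg n f \<and> (\<forall>mu\<in>parts n. mon n f mu = (if mu = nu then 1 else 0))"
    using less by auto
  then obtain F where F: "\<And>nu. nu \<in> ?S \<Longrightarrow> supp_deg n (F nu) \<and> (\<forall>mu\<in>parts n. mon n (F nu) mu = (if mu = nu then 1 else 0))"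
    by metis
  define e where "e \<mu> = (if \<mu> = mset lam then 1 else 0 :: real)" for \<mu>
  have me: "mon n e mu = ?p mu" for mu
    using mset_in_deg[OF less.prems] by (simp add: mon_def e_def if_distrib[of "\<lambda>x. x * _"] finite_deg_msets cong: if_cong)
  define f where "f \<mu> = (1 / ?p lam) * (e \<mu> - (\<Sum>nu\<in>?S. ?p nu * F nu \<mu>))" for \<mu>
  have fS: "finite ?S" using finite_parts by simp
  have "supp_deg n f"
    using F mset_in_deg[OF less.prems] by (auto simp: supp_deg_def f_def e_def)
  moreover have "mon n f mu = (if mu = lam then 1 else 0)" if mu: "mu \<in> parts n" for mu
  proof -
    have "mon n f mu = (1 / ?p lam) * (?p mu - (\<Sum>nu\<in>?S. ?p nu * mon n (F nu) mu))"
      unfolding f_def mon_cmult mon_diff mon_sum me ..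
    also have "(\<Sum>nu\<in>?S. ?p nu * mon n (F nu) mu) = (\<Sum>nu\<in>?S. if nu = mu then ?p mu else 0)"
      using F mu by (intro sum.cong) auto
    also have "\<dots> = (if mu \<in> ?S then ?p mu else 0)" using fS by simp
    also have "(1 / ?p lam) * (?p mu - (if mu \<in> ?S then ?p mu else 0)) = (if mu = lam then 1 else 0)"
      using pmon_expo_cases[OF less.prems mu] pmon_expo_self[OF less.prems] mu by auto
    finally show ?thesis .
  qed
  ultimately show ?case by blast
qed

text \<open>Take \<open>\<nu>\<close> of maximal size in the support. Any other product containing
  the monomial of \<open>\<nu>\<close> would need more parts, so this coefficient is
  \<open>f \<nu>\<close> times a positive number.\<close>

lemma mon_inj:
  assumes "supp_deg n f" "\<And>mu. mu \<in> parts n \<Longrightarrow> mon n f mu = 0"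
  shows "f \<mu> = 0"
proof (rule ccontr)
  assume nz: "f \<mu> \<noteq> 0"
  define S where "S = {\<nu>\<in>deg_msets n. f \<nu> \<noteq> 0}"
  have S: "finite S" "\<mu> \<in> S" using nz assms(1) finite_deg_msets by (auto simp: S_def supp_deg_def)
  then have "Max (size ` S) \<in> size ` S" by (intro Max_in) auto
  then obtain \<nu> where "\<nu> \<in> S" "size \<nu> = Max (size ` S)" by auto
  then have \<nu>: "\<nu> \<in> S" "\<And>\<rho>. \<rho> \<in> S \<Longrightarrow> size \<rho> \<le> size \<nu>" using S by auto
  define lam where "lam = plist \<nu>"
  have lam: "lam \<in> parts n" "mset lam = \<nu>" using \<nu> by (auto simp: lam_def S_def plist_in_parts)
  have "f \<rho> * pmon {..n} \<rho> (nth_default 0 lam) = (if \<rho> = \<nu> then f \<nu> * pmon {..n} \<nu> (nth_default 0 lam) else 0)"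
    if "\<rho> \<in> deg_msets n" for \<rho>
  proof (cases "f \<rho> = 0 \<or> pmon {..n} \<rho> (nth_default 0 lam) = 0")
    case False
    then have "length lam < length (plist \<rho>) \<or> lam = plist \<rho>"
      using pmon_expo_cases[OF plist_in_parts[OF that] lam(1)] by simp
    moreover have "size \<rho> \<le> size \<nu>" using \<nu>(2) that False by (simp add: S_def)
    moreover have "length lam = size \<nu>" "length (plist \<rho>) = size \<rho>" using lam(2) by (auto simp flip: size_mset)
    ultimately have "\<rho> = \<nu>" using lam(2) by auto
    then show ?thesis by simp
  qed auto
  then have "mon n f lam = (\<Sum>\<rho>\<in>deg_msets n. if \<rho> = \<nu> then f \<nu> * pmon {..n} \<nu> (nth_default 0 lam) else 0)"
    unfolding mon_def by (rule sum.cong[OF refl])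
  also have "\<dots> = f \<nu> * pmon {..n} \<nu> (nth_default 0 lam)"
    using \<nu>(1) by (simp add: S_def finite_deg_msets)
  finally have "f \<nu> * pmon {..n} \<nu> (nth_default 0 lam) = 0" using assms(2)[OF lam(1)] by simp
  then show False using pmon_expo_self[OF lam(1)] \<nu>(1) lam(2) by (auto simp: S_def)
qed

text \<open>The monomial symmetric function of \<open>lam\<close>, expressed in power sums.\<close>

definition mbasis :: "nat \<Rightarrow> nat list \<Rightarrow> nat multiset \<Rightarrow> real" where
  "mbasis n lam = (SOME f. supp_deg n f \<and> (\<forall>mu\<in>parts n. mon n f mu = (if mu = lam then 1 else 0)))"

lemma mbasis:
  assumes "lam \<in> parts n"
  shows "supp_deg n (mbasis n lam)" "\<And>mu. mu \<in> parts n \<Longrightarrow> mon n (mbasis n lam) mu = (if mu = lam then 1 else 0)"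
  using someI_ex[OF mon_basis_exists[OF assms]] unfolding mbasis_def by auto

lemma mbasis_expand:
  assumes "supp_deg n f"
  shows "f \<mu> = (\<Sum>lam\<in>parts n. mon n f lam * mbasis n lam \<mu>)"
proof -
  define g where "g \<mu> = f \<mu> - (\<Sum>lam\<in>parts n. mon n f lam * mbasis n lam \<mu>)" for \<mu>
  have "g \<mu> = 0"
  proof (rule mon_inj)
    show "supp_deg n g" using assms mbasis(1) by (auto simp: supp_deg_def g_def)
    fix mu assume mu: "mu \<in> parts n"
    have "mon n g mu = mon n f mu - (\<Sum>lam\<in>parts n. mon n f lam * mon n (mbasis n lam) mu)"
      unfolding g_def mon_diff mon_sum mon_cmult ..
    also have "(\<Sum>lam\<in>parts n. mon n f lam * mon n (mbasis n lam) mu) = (\<Sum>lam\<in>parts n. if lam = mu then mon n f mu else 0)"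
      using mbasis(2) mu by (intro sum.cong) auto
    finally show "mon n g mu = 0" using mu by (simp add: finite_parts)
  qed
  then show ?thesis by (simp add: g_def)
qed

lemma fip_sum_right: "fip \<alpha> n f (\<lambda>\<mu>. \<Sum>x\<in>S. c x * g x \<mu>) = (\<Sum>x\<in>S. c x * fip \<alpha> n f (g x))"
  unfolding fip_def sum_distrib_left sum_distrib_right
  by (subst sum.swap) (intro sum.cong refl, simp add: mult_ac)

lemma fip_cong: "(\<And>\<mu>. \<mu> \<in> deg_msets n \<Longrightarrow> g \<mu> = g' \<mu>) \<Longrightarrow> fip \<alpha> n f g = fip \<alpha> n f g'"
  unfolding fip_def by (intro sum.cong) auto

lemma fip_diff_right: "fip \<alpha> n f (\<lambda>\<mu>. g \<mu> - h \<mu>) = fip \<alpha> n f g - fip \<alpha> n f h"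
  by (simp add: fip_def algebra_simps sum_subtractf)

lemma fip_cmult_right: "fip \<alpha> n f (\<lambda>\<mu>. c * g \<mu>) = c * fip \<alpha> n f g"
  by (simp add: fip_def algebra_simps sum_distrib_left)

lemma fip_commute: "fip \<alpha> n f g = fip \<alpha> n g f"
  by (simp add: fip_def mult_ac)

lemma fip_self_pos:
  assumes "\<alpha> > 0" "supp_deg n f" "f \<noteq> (\<lambda>_. 0)"
  shows "fip \<alpha> n f f > 0"
proof -
  obtain \<mu> where \<mu>: "f \<mu> \<noteq> 0" using assms(3) by auto
  have "\<mu> \<in> deg_msets n" using \<mu> assms(2) by (auto simp: supp_deg_def)
  moreover have w: "0 < zz \<nu> * \<alpha> ^ size \<nu>" if "\<nu> \<in> deg_msets n" for \<nu>
    using that assms(1) zz_pos by (auto simp: deg_msets_def)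
  moreover have "fip \<alpha> n f f = (\<Sum>\<nu>\<in>deg_msets n. (f \<nu>)\<^sup>2 * (zz \<nu> * \<alpha> ^ size \<nu>))"
    by (simp add: fip_def power2_eq_square mult.assoc)
  ultimately show ?thesis
  proof (simp only:, intro sum_pos2[of _ \<mu>] finite_deg_msets)
    show "0 < (f \<mu>)\<^sup>2 * (zz \<mu> * \<alpha> ^ size \<mu>)"
      using \<mu> by (intro mult_pos_pos[OF _ w[OF \<open>\<mu> \<in> deg_msets n\<close>]]) auto
    show "0 \<le> (f \<nu>)\<^sup>2 * (zz \<nu> * \<alpha> ^ size \<nu>)" if "\<nu> \<in> deg_msets n" for \<nu>
      by (intro mult_nonneg_nonneg[OF _ less_imp_le[OF w[OF that]]]) auto
  qed
qed

lemma mon_zero [simp]: "mon n (\<lambda>_. 0) mu = 0"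
  by (simp add: mon_def)

definition below :: "nat \<Rightarrow> nat list \<Rightarrow> nat list set" where
  "below n lam = {mu\<in>parts n. dominates lam mu \<and> mu \<noteq> lam}"

text \<open>Characterises a single Jack function without reference to the others, as orthogonal to
  the whole space strictly below its leading term. This permits induction along dominance before the
  family is known to exist.\<close>

definition is_jack :: "real \<Rightarrow> nat \<Rightarrow> nat list \<Rightarrow> (nat multiset \<Rightarrow> real) \<Rightarrow> bool" where
  "is_jack \<alpha> n lam f \<longleftrightarrow> lower n lam f \<and> mon n f lam = 1 \<and>
     (\<forall>g. lower n lam g \<and> mon n g lam = 0 \<longrightarrow> fip \<alpha> n f g = 0)"

lemma is_jack_unique:
  assumes "\<alpha> > 0" "is_jack \<alpha> n lam f" "is_jack \<alpha> n lam g" "lam \<in> parts n"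
  shows "f = g"
proof (rule ccontr)
  assume ne: "f \<noteq> g"
  define h where "h \<mu> = f \<mu> - g \<mu>" for \<mu>
  have "h \<noteq> (\<lambda>_. 0)" using ne by (auto simp: h_def fun_eq_iff)
  moreover have s: "supp_deg n h" using assms by (auto simp: h_def is_jack_def lower_def supp_deg_def)
  moreover have mh: "mon n h mu = mon n f mu - mon n g mu" for mu unfolding h_def by (rule mon_diff)
  have "lower n lam h" using assms(2,3) s unfolding lower_def is_jack_def mh by auto
  moreover have "mon n h lam = 0" using assms by (simp add: mh is_jack_def)
  ultimately have "fip \<alpha> n f h = 0" "fip \<alpha> n g h = 0" using assms by (auto simp: is_jack_def)
  then have "fip \<alpha> n h f - fip \<alpha> n h g = 0" by (simp add: fip_commute)
  then have "fip \<alpha> n h h = 0" using fip_diff_right[of \<alpha> n h f g] by (simp add: h_def[symmetric])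
  then show False using fip_self_pos[OF assms(1) s \<open>h \<noteq> (\<lambda>_. 0)\<close>] by simp
qed

text \<open>By triangularity the defect \<open>h\<close> has no \<open>lam\<close> coefficient, and
  neither has its image under the operator. Self-adjointness then moves the operator from
  \<open>f\<close> to \<open>h\<close>, where orthogonality of \<open>f\<close> to strictly lower
  functions applies, so \<open>h\<close> is orthogonal to itself.\<close>

lemma is_jack_eigen:
  assumes "\<alpha> > 0" "is_jack \<alpha> n lam f" "lam \<in> parts n"
  shows "vac \<alpha> (\<alpha> - 1) (\<lambda>_. 0) k f = (\<lambda>\<mu>. walk \<alpha> lam k 0 * f \<mu>)"
proof -
  let ?A = "vac \<alpha> (\<alpha> - 1) (\<lambda>_. 0) k" and ?t = "walk \<alpha> lam k 0"
  define h where "h \<mu> = ?A f \<mu> - ?t * f \<mu>" for \<mu>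
  have lf: "lower n lam f" and m1: "mon n f lam = 1" and orth: "\<And>g. lower n lam g \<Longrightarrow> mon n g lam = 0 \<Longrightarrow> fip \<alpha> n f g = 0"
    using assms(2) by (auto simp: is_jack_def)
  have mh: "mon n h mu = mon n (?A f) mu - ?t * mon n f mu" for mu
    unfolding h_def mon_diff mon_cmult ..
  have lh: "lower n lam h"
    using lf lower_vac(1)[OF assms(3) lf, of \<alpha> k] unfolding lower_def mh by (auto simp: supp_deg_def h_def)
  have h0: "mon n h lam = 0" using lower_vac(2)[OF assms(3) lf, of \<alpha> k] by (simp add: mh)
  have "fip \<alpha> n h h = fip \<alpha> n h (?A f) - ?t * fip \<alpha> n h f"
    using fip_diff_right[of \<alpha> n h "?A f" "\<lambda>\<mu>. ?t * f \<mu>"] by (simp add: h_def[symmetric] fip_cmult_right)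
  also have "fip \<alpha> n h f = 0" using orth[OF lh h0] by (simp add: fip_commute)
  also have "fip \<alpha> n h (?A f) = fip \<alpha> n f (?A h)" using vac_selfadjoint[of \<alpha> n h] by (simp add: fip_commute)
  also have "\<dots> = 0"
    using lower_vac[OF assms(3) lh, of \<alpha> k] h0 by (intro orth) auto
  finally have "fip \<alpha> n h h = 0" by simp
  then have "h = (\<lambda>_. 0)" using fip_self_pos[OF assms(1), of n h] lh by (force simp: lower_def)
  then show ?thesis by (auto simp: h_def fun_eq_iff)
qed

lemma is_jack_orth:
  assumes "\<alpha> > 0" "is_jack \<alpha> n lam f" "is_jack \<alpha> n mu g" "lam \<in> parts n" "mu \<in> parts n" "lam \<noteq> mu"
  shows "fip \<alpha> n f g = 0"
proof -
  obtain k where k: "walk \<alpha> lam k 0 \<noteq> walk \<alpha> mu k 0"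
    using walk_separate[OF assms(4,5,1,6)] by blast
  have "walk \<alpha> mu k 0 * fip \<alpha> n f g = fip \<alpha> n f (vac \<alpha> (\<alpha> - 1) (\<lambda>_. 0) k g)"
    by (simp add: is_jack_eigen[OF assms(1,3,5)] fip_cmult_right)
  also have "\<dots> = fip \<alpha> n g (vac \<alpha> (\<alpha> - 1) (\<lambda>_. 0) k f)"
    by (subst vac_selfadjoint) (rule fip_commute)
  also have "\<dots> = walk \<alpha> lam k 0 * fip \<alpha> n f g"
    by (simp add: is_jack_eigen[OF assms(1,2,4)] fip_cmult_right fip_commute)
  finally show ?thesis using k by simp
qed

text \<open>The functions \<open>P mu\<close> with \<open>mu\<close> strictly below
  \<open>lam\<close> span the strictly lower space. The leading coefficient is removed with
  \<open>P mu\<close>, the rest is expanded in \<open>mbasis\<close>, and the number of partitions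
  below decreases.\<close>

lemma lower_orth:
  assumes P: "\<And>mu. mu \<in> below n lam \<Longrightarrow> lower n mu (P mu) \<and> mon n (P mu) mu = 1 \<and> fip \<alpha> n f (P mu) = 0"
    and g: "lower n lam g" "mon n g lam = 0"
  shows "fip \<alpha> n f g = 0"
proof -
  have sub: "fip \<alpha> n f g = 0" if "lower n mu g" "mu \<in> below n lam" for mu g
    using that
  proof (induction "card (below n mu)" arbitrary: mu g rule: less_induct)
    case less
    have mu: "mu \<in> parts n" "dominates lam mu" "mu \<noteq> lam" using less.prems by (auto simp: below_def)
    define h where "h \<mu> = g \<mu> - mon n g mu * P mu \<mu>" for \<mu>
    have mh: "mon n h nu = mon n g nu - mon n g mu * mon n (P mu) nu" for nu
      unfolding h_def mon_diff mon_cmult ..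
    have Pm: "lower n mu (P mu)" "mon n (P mu) mu = 1" "fip \<alpha> n f (P mu) = 0" using P less.prems by auto
    have lh: "lower n mu h"
      using less.prems(1) Pm(1) unfolding lower_def mh by (auto simp: supp_deg_def h_def)
    have h0: "mon n h mu = 0" using Pm by (simp add: mh)
    have "fip \<alpha> n f h = fip \<alpha> n f (\<lambda>\<mu>. \<Sum>nu\<in>parts n. mon n h nu * mbasis n nu \<mu>)"
      using lh by (intro fip_cong mbasis_expand) (simp add: lower_def)
    also have "\<dots> = (\<Sum>nu\<in>parts n. mon n h nu * fip \<alpha> n f (mbasis n nu))" by (rule fip_sum_right)
    also have "\<dots> = 0"
    proof (rule sum.neutral, rule ballI)
      fix nu assume nu: "nu \<in> parts n"
      show "mon n h nu * fip \<alpha> n f (mbasis n nu) = 0"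
      proof (cases "mon n h nu = 0")
        case False
        then have d: "dominates mu nu" "nu \<noteq> mu" using lh nu h0 by (auto simp: lower_def)
        have "nu \<in> below n lam"
          using nu d mu dominates_trans dominates_antisym unfolding below_def by blast
        moreover have "below n nu \<subset> below n mu"
          using nu d mu dominates_trans dominates_antisym unfolding below_def by blast
        then have "card (below n nu) < card (below n mu)"
          by (intro psubset_card_mono) (auto simp: below_def finite_parts)
        moreover have "lower n nu (mbasis n nu)"
          using mbasis[OF nu] by (auto simp: lower_def dominates_refl split: if_splits)
        ultimately show ?thesis using less.hyps by simp
      qed simp
    qed
    finally have "fip \<alpha> n f h = 0" .
    moreover have "fip \<alpha> n f h = fip \<alpha> n f g - mon n g mu * fip \<alpha> n f (P mu)"
      unfolding h_def fip_diff_right fip_cmult_right ..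
    ultimately show ?case using Pm by simp
  qed
  have "fip \<alpha> n f g = fip \<alpha> n f (\<lambda>\<mu>. \<Sum>nu\<in>parts n. mon n g nu * mbasis n nu \<mu>)"
    using g by (intro fip_cong mbasis_expand) (simp add: lower_def)
  also have "\<dots> = (\<Sum>nu\<in>parts n. mon n g nu * fip \<alpha> n f (mbasis n nu))" by (rule fip_sum_right)
  also have "\<dots> = 0"
  proof (rule sum.neutral, rule ballI)
    fix nu assume nu: "nu \<in> parts n"
    show "mon n g nu * fip \<alpha> n f (mbasis n nu) = 0"
    proof (cases "mon n g nu = 0")
      case False
      then have "nu \<in> below n lam" using g nu by (auto simp: lower_def below_def)
      moreover have "lower n nu (mbasis n nu)"
        using mbasis[OF nu] by (auto simp: lower_def dominates_refl split: if_splits)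
      ultimately show ?thesis using sub by simp
    qed simp
  qed
  finally show ?thesis .
qed

text \<open>Gram-Schmidt along a partial order. The partitions below \<open>lam\<close> include
  incomparable ones, for which triangularity gives no orthogonality; it comes from their distinct
  eigenvalues through \<open>is_jack_orth\<close>.\<close>

lemma is_jack_exists:
  assumes \<alpha>: "\<alpha> > 0" and "lam \<in> parts n"
  shows "\<exists>f. is_jack \<alpha> n lam f"
  using assms(2)
proof (induction "card (below n lam)" arbitrary: lam rule: less_induct)
  case less
  have "\<exists>f. is_jack \<alpha> n mu f" if mu: "mu \<in> below n lam" for mu
  proof -
    have "below n mu \<subset> below n lam"
      using mu less.prems dominates_trans dominates_antisym unfolding below_def by blast
    then have "card (below n mu) < card (below n lam)"
      by (intro psubset_card_mono) (auto simp: below_def finite_parts)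
    then show ?thesis using less.hyps mu by (auto simp: below_def)
  qed
  then obtain P where P: "\<And>mu. mu \<in> below n lam \<Longrightarrow> is_jack \<alpha> n mu (P mu)" by metis
  have bp: "mu \<in> parts n" if "mu \<in> below n lam" for mu using that by (simp add: below_def)
  have fb: "finite (below n lam)" by (simp add: below_def finite_parts)
  define c where "c mu = fip \<alpha> n (mbasis n lam) (P mu) / fip \<alpha> n (P mu) (P mu)" for mu
  define f where "f \<mu> = mbasis n lam \<mu> - (\<Sum>mu\<in>below n lam. c mu * P mu \<mu>)" for \<mu>
  have Pn: "fip \<alpha> n (P mu) (P mu) \<noteq> 0" if "mu \<in> below n lam" for mu
  proof -
    have "P mu \<noteq> (\<lambda>_. 0)" using P[OF that] by (auto simp: is_jack_def)
    then show ?thesis using fip_self_pos[OF \<alpha>, of n "P mu"] P[OF that] by (auto simp: is_jack_def lower_def)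
  qed
  have forth: "fip \<alpha> n f (P mu) = 0" if mu: "mu \<in> below n lam" for mu
  proof -
    have "fip \<alpha> n (P mu) f = fip \<alpha> n (P mu) (mbasis n lam) - (\<Sum>nu\<in>below n lam. c nu * fip \<alpha> n (P mu) (P nu))"
      unfolding f_def fip_diff_right fip_sum_right ..
    also have "(\<Sum>nu\<in>below n lam. c nu * fip \<alpha> n (P mu) (P nu)) = (\<Sum>nu\<in>below n lam. if nu = mu then c mu * fip \<alpha> n (P mu) (P mu) else 0)"
      using is_jack_orth[OF \<alpha> P P bp bp] mu by (intro sum.cong) auto
    also have "\<dots> = c mu * fip \<alpha> n (P mu) (P mu)" using mu fb by simp
    also have "\<dots> = fip \<alpha> n (mbasis n lam) (P mu)" using Pn[OF mu] by (simp add: c_def)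
    finally show ?thesis by (simp add: fip_commute)
  qed
  have mf: "mon n f nu = mon n (mbasis n lam) nu - (\<Sum>mu\<in>below n lam. c mu * mon n (P mu) nu)" for nu
    unfolding f_def mon_diff mon_sum mon_cmult ..
  have Pz: "mon n (P mu) nu = 0" if "mu \<in> below n lam" "nu \<in> parts n" "\<not> dominates lam nu \<or> nu = lam" for mu nu
  proof (rule ccontr)
    assume "mon n (P mu) nu \<noteq> 0"
    then have "dominates mu nu" using P[OF that(1)] that(2) by (auto simp: is_jack_def lower_def)
    then show False using that less.prems dominates_trans dominates_antisym unfolding below_def by blast
  qed
  have sf: "supp_deg n f"
    using mbasis(1)[OF less.prems] P by (auto simp: supp_deg_def f_def is_jack_def lower_def)
  have "lower n lam f"
    unfolding lower_def
  proof (intro conjI ballI impI sf)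
    fix nu assume nu: "nu \<in> parts n" "mon n f nu \<noteq> 0"
    show "dominates lam nu"
    proof (rule ccontr)
      assume nd: "\<not> dominates lam nu"
      then have "nu \<noteq> lam" using dominates_refl by auto
      then show False using nu Pz nd mbasis(2)[OF less.prems nu(1)] by (simp add: mf)
    qed
  qed
  moreover have "mon n f lam = 1"
    using Pz less.prems mbasis(2)[OF less.prems less.prems] by (simp add: mf)
  moreover have "fip \<alpha> n f g = 0" if "lower n lam g" "mon n g lam = 0" for g
    by (rule lower_orth[of n lam P \<alpha> f g]) (use P forth that in \<open>auto simp: is_jack_def\<close>)
  ultimately show ?case unfolding is_jack_def by blast
qed

definition jackF :: "real \<Rightarrow> nat \<Rightarrow> nat list \<Rightarrow> nat multiset \<Rightarrow> real" where
  "jackF \<alpha> n lam = (SOME f. is_jack \<alpha> n lam f)"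

lemma jackF: "\<alpha> > 0 \<Longrightarrow> lam \<in> parts n \<Longrightarrow> is_jack \<alpha> n lam (jackF \<alpha> n lam)"
  unfolding jackF_def using is_jack_exists by (rule someI_ex)

lemma jackF_supp: "\<alpha> > 0 \<Longrightarrow> lam \<in> parts n \<Longrightarrow> supp_deg n (jackF \<alpha> n lam)"
  using jackF by (auto simp: is_jack_def lower_def)

section \<open>Identification with the Jack functions of the statement\<close>

lemma zee_zz: "zee mu = zz (mset mu)"
  by (simp add: zee_def zz_def)

lemma jack_ip_fip:
  "jack_ip \<alpha> n (\<lambda>mu. f (mset mu)) (\<lambda>mu. g (mset mu)) = fip \<alpha> n f g"
proof -
  have "jack_ip \<alpha> n (\<lambda>mu. f (mset mu)) (\<lambda>mu. g (mset mu)) =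
    (\<Sum>mu\<in>parts n. f (mset mu) * g (mset mu) * zz (mset mu) * \<alpha> ^ size (mset mu))"
    by (simp add: jack_ip_def zee_zz)
  also have "\<dots> = fip \<alpha> n f g"
    unfolding fip_def by (rule sum.reindex_bij_betw[OF bij_parts])
  finally show ?thesis .
qed

lemma jack_ip_cong:
  "(\<And>mu. mu \<in> parts n \<Longrightarrow> c mu = c' mu) \<Longrightarrow> (\<And>mu. mu \<in> parts n \<Longrightarrow> d mu = d' mu) \<Longrightarrow> jack_ip \<alpha> n c d = jack_ip \<alpha> n c' d'"
  unfolding jack_ip_def by (intro sum.cong) auto

lemma mono_coeff_cong:
  "(\<And>mu. mu \<in> parts n \<Longrightarrow> c mu = c' mu) \<Longrightarrow> mono_coeff n c lam = mono_coeff n c' lam"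
  unfolding mono_coeff_def by (intro sum.cong) auto

lemma jack_family_jackF:
  assumes \<alpha>: "\<alpha> > 0"
  shows "jack_family \<alpha> n (\<lambda>lam mu. if lam \<in> parts n \<and> mu \<in> parts n then jackF \<alpha> n lam (mset mu) else 0)"
proof -
  define P where "P lam mu = (if lam \<in> parts n \<and> mu \<in> parts n then jackF \<alpha> n lam (mset mu) else 0)" for lam mu
  have mc: "mono_coeff n (P lam) mu = mon n (jackF \<alpha> n lam) mu" if "lam \<in> parts n" "mu \<in> parts n" for lam mu
    using that by (subst mono_coeff_mon[symmetric], simp) (auto intro!: mono_coeff_cong simp: P_def)
  have ip: "jack_ip \<alpha> n (P lam) (P mu) = fip \<alpha> n (jackF \<alpha> n lam) (jackF \<alpha> n mu)" if "lam \<in> parts n" "mu \<in> parts n" for lam mu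
    unfolding jack_ip_fip[symmetric] using that by (intro jack_ip_cong) (auto simp: P_def)
  have "jack_family \<alpha> n P" unfolding jack_family_def
    using jackF[OF \<alpha>, of _ n] is_jack_orth[OF \<alpha> jackF[OF \<alpha>] jackF[OF \<alpha>], of _ n]
    by (auto simp: mc ip is_jack_def lower_def) (auto simp: P_def)
  then show ?thesis by (simp add: P_def[abs_def])
qed

text \<open>Orthogonality inside the family extends to the whole strictly lower space by
  \<open>lower_orth\<close>, so every member satisfies \<open>is_jack\<close>, which determines
  it.\<close>

lemma jack_family_unique:
  assumes \<alpha>: "\<alpha> > 0" and P: "jack_family \<alpha> n P"
  shows "P = (\<lambda>lam mu. if lam \<in> parts n \<and> mu \<in> parts n then jackF \<alpha> n lam (mset mu) else 0)"
proof -
  define f where "f lam \<mu> = (if \<mu> \<in> deg_msets n then P lam (plist \<mu>) else 0)" for lam \<mu>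
  have fP: "P lam mu = f lam (mset mu)" if "mu \<in> parts n" for lam mu
    using that by (simp add: f_def mset_in_deg plist_mset parts_partition)
  have mc: "mono_coeff n (P lam) mu = mon n (f lam) mu" if "lam \<in> parts n" "mu \<in> parts n" for lam mu
    using that by (subst mono_coeff_mon[symmetric], simp) (auto intro!: mono_coeff_cong simp: fP)
  have ip: "jack_ip \<alpha> n (P lam) (P mu) = fip \<alpha> n (f lam) (f mu)" for lam mu
    unfolding jack_ip_fip[symmetric] by (intro jack_ip_cong) (auto simp: fP)
  have lo: "lower n lam (f lam) \<and> mon n (f lam) lam = 1" if "lam \<in> parts n" for lam
    using P that mc unfolding jack_family_def lower_def by (auto simp: supp_deg_def f_def)
  have orth: "fip \<alpha> n (f lam) (f mu) = 0" if "lam \<in> parts n" "mu \<in> parts n" "lam \<noteq> mu" for lam mu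
    using P that unfolding jack_family_def ip by blast
  have "is_jack \<alpha> n lam (f lam)" if lam: "lam \<in> parts n" for lam
    unfolding is_jack_def
  proof (intro conjI allI impI)
    fix g assume g: "lower n lam g \<and> mon n g lam = 0"
    show "fip \<alpha> n (f lam) g = 0"
    proof (rule lower_orth[of n lam f])
      fix mu assume "mu \<in> below n lam"
      then have "mu \<in> parts n" "mu \<noteq> lam" by (auto simp: below_def)
      then show "lower n mu (f mu) \<and> mon n (f mu) mu = 1 \<and> fip \<alpha> n (f lam) (f mu) = 0"
        using lo orth lam by auto
    qed (use g in auto)
  qed (use lo lam in auto)
  then have eq: "f lam = jackF \<alpha> n lam" if "lam \<in> parts n" for lam
    using is_jack_unique[OF \<alpha> _ jackF[OF \<alpha> that] that] that by blast
  show ?thesis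
  proof (intro ext)
    fix lam mu
    show "P lam mu = (if lam \<in> parts n \<and> mu \<in> parts n then jackF \<alpha> n lam (mset mu) else 0)"
      using P eq[of lam] fP[of mu lam] by (auto simp: jack_family_def)
  qed
qed

lemma jackP_eq:
  assumes "\<alpha> > 0" "lam \<in> parts n" "mu \<in> parts n"
  shows "jackP \<alpha> lam mu = jackF \<alpha> n lam (mset mu)"
proof -
  have "sum_list lam = n" using assms(2) by (simp add: parts_def)
  moreover have "The (jack_family \<alpha> n) = (\<lambda>lam mu. if lam \<in> parts n \<and> mu \<in> parts n then jackF \<alpha> n lam (mset mu) else 0)"
    by (rule the_equality) (use jack_family_jackF[OF assms(1)] jack_family_unique[OF assms(1)] in auto)
  ultimately have "jackP \<alpha> lam = (\<lambda>mu. if lam \<in> parts n \<and> mu \<in> parts n then jackF \<alpha> n lam (mset mu) else 0)"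
    unfolding jackP_def by simp
  then show ?thesis using assms by simp
qed

lemma jackF_norm_pos:
  assumes "\<alpha> > 0" "lam \<in> parts n"
  shows "fip \<alpha> n (jackF \<alpha> n lam) (jackF \<alpha> n lam) > 0"
proof -
  have "jackF \<alpha> n lam \<noteq> (\<lambda>_. 0)" using jackF[OF assms] by (auto simp: is_jack_def)
  then show ?thesis using fip_self_pos assms jackF_supp by blast
qed

lemma jackF_expand:
  assumes \<alpha>: "\<alpha> > 0" and f: "supp_deg n f"
  shows "f \<mu> = (\<Sum>lam\<in>parts n. fip \<alpha> n (jackF \<alpha> n lam) f / fip \<alpha> n (jackF \<alpha> n lam) (jackF \<alpha> n lam) * jackF \<alpha> n lam \<mu>)"
proof -
  let ?J = "jackF \<alpha> n"
  define c where "c lam = fip \<alpha> n (?J lam) f / fip \<alpha> n (?J lam) (?J lam)" for lam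
  define h where "h \<mu> = f \<mu> - (\<Sum>lam\<in>parts n. c lam * ?J lam \<mu>)" for \<mu>
  have sh: "supp_deg n h" using f jackF_supp[OF \<alpha>] by (auto simp: supp_deg_def h_def)
  have hJ: "fip \<alpha> n h (?J mu) = 0" if mu: "mu \<in> parts n" for mu
  proof -
    have "fip \<alpha> n (?J mu) h = fip \<alpha> n (?J mu) f - (\<Sum>lam\<in>parts n. c lam * fip \<alpha> n (?J mu) (?J lam))"
      unfolding h_def fip_diff_right fip_sum_right ..
    also have "(\<Sum>lam\<in>parts n. c lam * fip \<alpha> n (?J mu) (?J lam)) = (\<Sum>lam\<in>parts n. if lam = mu then c mu * fip \<alpha> n (?J mu) (?J mu) else 0)"
      using is_jack_orth[OF \<alpha> jackF[OF \<alpha>] jackF[OF \<alpha>]] mu by (intro sum.cong) auto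
    also have "\<dots> = fip \<alpha> n (?J mu) f"
      using mu jackF_norm_pos[OF \<alpha> mu] by (simp add: finite_parts c_def)
    finally show ?thesis by (simp add: fip_commute)
  qed
  have hm: "fip \<alpha> n h (mbasis n lam) = 0" if lam: "lam \<in> parts n" for lam
  proof -
    let ?g = "\<lambda>\<mu>. mbasis n lam \<mu> - ?J lam \<mu>"
    have J: "is_jack \<alpha> n mu (?J mu)" if "mu \<in> parts n" for mu using jackF[OF \<alpha> that] .
    have mg: "mon n ?g mu = mon n (mbasis n lam) mu - mon n (?J lam) mu" for mu by (rule mon_diff)
    have "lower n lam ?g"
      unfolding lower_def mg using mbasis[OF lam] J[OF lam]
      by (auto simp: supp_deg_def is_jack_def lower_def dominates_refl split: if_splits)
    moreover have "mon n ?g lam = 0" using mbasis(2)[OF lam lam] J[OF lam] by (simp add: mg is_jack_def)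
    ultimately have "fip \<alpha> n h ?g = 0"
      by (intro lower_orth[of n lam ?J]) (use J hJ in \<open>auto simp: below_def is_jack_def\<close>)
    then show ?thesis using hJ[OF lam] by (simp add: fip_diff_right)
  qed
  have "fip \<alpha> n h h = fip \<alpha> n h (\<lambda>\<mu>. \<Sum>lam\<in>parts n. mon n h lam * mbasis n lam \<mu>)"
    using sh by (intro fip_cong mbasis_expand)
  also have "\<dots> = 0" by (simp add: fip_sum_right hm)
  finally have "h = (\<lambda>_. 0)" using fip_self_pos[OF \<alpha> sh] by force
  then have "h \<mu> = 0" by simp
  then show ?thesis by (simp add: h_def c_def)
qed

section \<open>Vacuum operators in the Jack basis\<close>

lemma lax_sum:
  "lax h \<kappa> c (\<lambda>k \<mu>. \<Sum>x\<in>S. d x * G x k \<mu>) k \<mu> = (\<Sum>x\<in>S. d x * lax h \<kappa> c (G x) k \<mu>)"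
proof -
  have 1: "(\<Sum>j=1..k. h * of_nat (j * Suc (count \<mu> j)) * (\<Sum>x\<in>S. d x * G x (k - j) (add_mset j \<mu>))) =
    (\<Sum>x\<in>S. d x * (\<Sum>j=1..k. h * of_nat (j * Suc (count \<mu> j)) * G x (k - j) (add_mset j \<mu>)))"
    unfolding sum_distrib_left by (subst sum.swap) (intro sum.cong refl, simp add: mult_ac)
  have 2: "(\<Sum>j=1..k. c j * (\<Sum>x\<in>S. d x * G x (k - j) \<mu>)) = (\<Sum>x\<in>S. d x * (\<Sum>j=1..k. c j * G x (k - j) \<mu>))"
    unfolding sum_distrib_left by (subst sum.swap) (intro sum.cong refl, simp add: mult_ac)
  have 3: "(\<Sum>j\<in>set_mset \<mu> - {0}. (\<Sum>x\<in>S. d x * G x (k + j) (\<mu> - {#j#}))) = (\<Sum>x\<in>S. d x * (\<Sum>j\<in>set_mset \<mu> - {0}. G x (k + j) (\<mu> - {#j#})))"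
    unfolding sum_distrib_left by (rule sum.swap)
  have 4: "\<kappa> * of_nat k * (\<Sum>x\<in>S. d x * G x k \<mu>) = (\<Sum>x\<in>S. d x * (\<kappa> * of_nat k * G x k \<mu>))"
    unfolding sum_distrib_left by (intro sum.cong refl, simp add: mult_ac)
  show ?thesis unfolding lax_def 1 2 3 4 by (simp add: distrib_left sum.distrib)
qed

lemma lax_pow_sum:
  "(lax h \<kappa> c ^^ m) (\<lambda>k \<mu>. \<Sum>x\<in>S. d x * G x k \<mu>) = (\<lambda>k \<mu>. \<Sum>x\<in>S. d x * (lax h \<kappa> c ^^ m) (G x) k \<mu>)"
proof (induction m)
  case (Suc m)
  show ?case by (simp add: Suc) (simp add: lax_sum fun_eq_iff)
qed simp

lemma vac_sum:
  "vac h \<kappa> c m (\<lambda>\<mu>. \<Sum>x\<in>S. d x * f x \<mu>) = (\<lambda>\<mu>. \<Sum>x\<in>S. d x * vac h \<kappa> c m (f x) \<mu>)"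
proof -
  have "lift0 (\<lambda>\<mu>. \<Sum>x\<in>S. d x * f x \<mu>) = (\<lambda>k \<mu>. \<Sum>x\<in>S. d x * lift0 (f x) k \<mu>)"
    by (auto simp: lift0_def fun_eq_iff)
  then show ?thesis unfolding vac_def by (simp add: lax_pow_sum)
qed

lemma lax_of_real:
  "lax (of_real h) (of_real \<kappa>) (\<lambda>_. 0) (\<lambda>k \<mu>. of_real (G k \<mu>)) = (\<lambda>k \<mu>. (of_real (lax h \<kappa> (\<lambda>_. 0) G k \<mu>) :: complex))"
  by (simp add: lax_def fun_eq_iff)

lemma vac_of_real:
  "vac (of_real h) (of_real \<kappa>) (\<lambda>_. 0) m (\<lambda>\<mu>. of_real (f \<mu>)) = (\<lambda>\<mu>. (of_real (vac h \<kappa> (\<lambda>_. 0) m f \<mu>) :: complex))"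
proof -
  have "(lax (of_real h) (of_real \<kappa>) (\<lambda>_. 0) ^^ m) (\<lambda>k \<mu>. of_real (G k \<mu>)) = (\<lambda>k \<mu>. (of_real ((lax h \<kappa> (\<lambda>_. 0) ^^ m) G k \<mu>) :: complex))" for G
    by (induction m) (simp_all add: lax_of_real)
  moreover have "lift0 (\<lambda>\<mu>. complex_of_real (f \<mu>)) = (\<lambda>k \<mu>. of_real (lift0 f k \<mu>))"
    by (auto simp: lift0_def fun_eq_iff)
  ultimately show ?thesis by (simp add: vac_def)
qed

lemma lax_cong_degree:
  assumes G: "\<And>k \<mu>. (k, \<mu>) \<in> deg_pairs n \<Longrightarrow> G k \<mu> = G' k \<mu>" and km: "(k, \<mu>) \<in> deg_pairs n"
  shows "lax h \<kappa> (\<lambda>_. 0) G k \<mu> = lax h \<kappa> (\<lambda>_. 0) G' k \<mu>"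
proof -
  have "G (k - j) (add_mset j \<mu>) = G' (k - j) (add_mset j \<mu>)" if "j \<in> {1..k}" for j
    by (rule G) (use km that in \<open>auto simp: deg_pairs_def pos_mset_def\<close>)
  moreover have "G (k + j) (\<mu> - {#j#}) = G' (k + j) (\<mu> - {#j#})" if "j \<in> set_mset \<mu> - {0}" for j
    by (rule G) (use km that in \<open>auto simp: deg_pairs_def pos_mset_def dest: in_diffD dest!: multi_member_split\<close>)
  moreover have "G k \<mu> = G' k \<mu>" by (rule G) fact
  ultimately show ?thesis by (simp add: lax_def)
qed

lemma vac_cong_degree:
  assumes f: "\<And>\<mu>. \<mu> \<in> deg_msets n \<Longrightarrow> f \<mu> = f' \<mu>" and "\<mu> \<in> deg_msets n"
  shows "vac h \<kappa> (\<lambda>_. 0) m f \<mu> = vac h \<kappa> (\<lambda>_. 0) m f' \<mu>"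
proof -
  have "(lax h \<kappa> (\<lambda>_. 0) ^^ m) (lift0 f) k \<mu> = (lax h \<kappa> (\<lambda>_. 0) ^^ m) (lift0 f') k \<mu>" if "(k, \<mu>) \<in> deg_pairs n" for k \<mu>
    using that
  proof (induction m arbitrary: k \<mu>)
    case 0
    then show ?case using f by (auto simp: lift0_def deg_pairs_def deg_msets_def)
  next
    case (Suc m)
    show ?case using lax_cong_degree[of n, OF Suc.IH Suc.prems] by simp
  qed
  then show ?thesis using assms(2) by (simp add: vac_def deg_pairs_def deg_msets_def)
qed

text \<open>\<open>\<Psi>\<close> is the degree \<open>n\<close> part of a reproducing kernel:
  pairing it with a real coefficient vector gives the conjugate of the evaluation at
  \<open>v\<close>. Hence its Jack coefficients are \<open>cnj (ev lam)\<close> over the squared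
  norm. Each vacuum operator multiplies them by \<open>walk\<close>, and the final pairing with
  \<open>v\<close> completes the squared modulus.\<close>

lemma jack_expect_degree:
  fixes v :: "nat multiset \<Rightarrow> complex" and n :: nat and \<alpha> :: real
  assumes \<alpha>: "\<alpha> > 0"
  defines "\<Psi> \<equiv> \<lambda>\<mu>. cnj (v \<mu>) / of_real (zz \<mu> * \<alpha> ^ size \<mu>)"
    and "ev \<equiv> \<lambda>lam. \<Sum>\<mu>\<in>deg_msets n. of_real (jackF \<alpha> n lam \<mu>) * v \<mu>"
  shows "(\<Sum>\<mu>\<in>deg_msets n. v \<mu> * foldr (vac (of_real \<alpha>) (of_real (\<alpha> - 1)) (\<lambda>_. 0)) ks \<Psi> \<mu>) =
     of_real (\<Sum>lam\<in>parts n. (norm (ev lam))\<^sup>2 / fip \<alpha> n (jackF \<alpha> n lam) (jackF \<alpha> n lam) * (\<Prod>k\<leftarrow>ks. walk \<alpha> lam k 0))"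
proof -
  let ?J = "jackF \<alpha> n"
  define N where "N lam = fip \<alpha> n (?J lam) (?J lam)" for lam
  have N: "N lam > 0" if "lam \<in> parts n" for lam using jackF_norm_pos[OF \<alpha> that] by (simp add: N_def)
  have w: "zz \<mu> * \<alpha> ^ size \<mu> > 0" if "\<mu> \<in> deg_msets n" for \<mu>
    using that \<alpha> zz_pos by (auto simp: deg_msets_def)
  have exp0: "\<Psi> \<mu> = (\<Sum>lam\<in>parts n. (cnj (ev lam) / of_real (N lam)) * of_real (?J lam \<mu>))" if \<mu>: "\<mu> \<in> deg_msets n" for \<mu>
  proof -
    \<comment> \<open>Completeness of the Jack functions, obtained by expanding the indicator of
      \<open>\<nu>\<close>.\<close>
    have "of_real (if \<mu> = \<nu> then 1 else 0) = (\<Sum>lam\<in>parts n. of_real (?J lam \<nu> * zz \<nu> * \<alpha> ^ size \<nu>) / of_real (N lam) * complex_of_real (?J lam \<mu>))"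
      if \<nu>: "\<nu> \<in> deg_msets n" for \<nu>
    proof -
      let ?e = "\<lambda>\<mu>. if \<mu> = \<nu> then 1 else 0 :: real"
      have "supp_deg n ?e" using \<nu> by (auto simp: supp_deg_def)
      moreover have "fip \<alpha> n (?J lam) ?e = ?J lam \<nu> * zz \<nu> * \<alpha> ^ size \<nu>" for lam
        using \<nu> by (simp add: fip_def if_distrib[of "\<lambda>x. _ * x"] if_distrib[of "\<lambda>x. x * _"] finite_deg_msets cong: if_cong)
      ultimately show ?thesis using jackF_expand[OF \<alpha>, of n ?e \<mu>] by (simp add: N_def)
    qed
    then have "(\<Sum>\<nu>\<in>deg_msets n. \<Psi> \<nu> * of_real (if \<mu> = \<nu> then 1 else 0)) =
      (\<Sum>\<nu>\<in>deg_msets n. \<Psi> \<nu> * (\<Sum>lam\<in>parts n. of_real (?J lam \<nu> * zz \<nu> * \<alpha> ^ size \<nu>) / of_real (N lam) * complex_of_real (?J lam \<mu>)))"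
      by (intro sum.cong) auto
    also have "\<dots> = (\<Sum>lam\<in>parts n. \<Sum>\<nu>\<in>deg_msets n. \<Psi> \<nu> * (of_real (?J lam \<nu> * zz \<nu> * \<alpha> ^ size \<nu>) / of_real (N lam) * complex_of_real (?J lam \<mu>)))"
      unfolding sum_distrib_left by (rule sum.swap)
    also have "\<dots> = (\<Sum>lam\<in>parts n. (cnj (ev lam) / of_real (N lam)) * of_real (?J lam \<mu>))"
    proof (intro sum.cong refl)
      fix lam
      have "(\<Sum>\<nu>\<in>deg_msets n. \<Psi> \<nu> * (of_real (?J lam \<nu> * zz \<nu> * \<alpha> ^ size \<nu>) / of_real (N lam) * complex_of_real (?J lam \<mu>))) =
        (\<Sum>\<nu>\<in>deg_msets n. cnj (of_real (?J lam \<nu>) * v \<nu>) * (complex_of_real (?J lam \<mu>) / of_real (N lam)))"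
      proof (intro sum.cong refl)
        fix \<nu> assume "\<nu> \<in> deg_msets n"
        then have "\<Psi> \<nu> * of_real (zz \<nu> * \<alpha> ^ size \<nu>) = cnj (v \<nu>)"
          using w[of \<nu>] \<alpha> by (auto simp: \<Psi>_def)
        moreover have "\<Psi> \<nu> * (of_real (?J lam \<nu> * zz \<nu> * \<alpha> ^ size \<nu>) / of_real (N lam) * complex_of_real (?J lam \<mu>)) =
          (\<Psi> \<nu> * of_real (zz \<nu> * \<alpha> ^ size \<nu>)) * (of_real (?J lam \<nu>) * (complex_of_real (?J lam \<mu>) / of_real (N lam)))"
          by (simp add: mult_ac)
        ultimately show "\<Psi> \<nu> * (of_real (?J lam \<nu> * zz \<nu> * \<alpha> ^ size \<nu>) / of_real (N lam) * complex_of_real (?J lam \<mu>)) =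
          cnj (of_real (?J lam \<nu>) * v \<nu>) * (complex_of_real (?J lam \<mu>) / of_real (N lam))"
          by (simp add: mult_ac)
      qed
      also have "\<dots> = (cnj (ev lam) / of_real (N lam)) * of_real (?J lam \<mu>)"
        unfolding ev_def by (simp add: sum_distrib_right sum_divide_distrib)
      finally show "(\<Sum>\<nu>\<in>deg_msets n. \<Psi> \<nu> * (of_real (?J lam \<nu> * zz \<nu> * \<alpha> ^ size \<nu>) / of_real (N lam) * complex_of_real (?J lam \<mu>))) =
        (cnj (ev lam) / of_real (N lam)) * of_real (?J lam \<mu>)" .
    qed
    finally show ?thesis using \<mu>
      by (simp add: if_distrib[of of_real] if_distrib[of "\<lambda>x. _ * x"] finite_deg_msets cong: if_cong)
  qed
  have exps: "foldr (vac (of_real \<alpha>) (of_real (\<alpha> - 1)) (\<lambda>_. 0)) ks \<Psi> \<mu> =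
     (\<Sum>lam\<in>parts n. (cnj (ev lam) / of_real (N lam) * of_real (\<Prod>k\<leftarrow>ks. walk \<alpha> lam k 0)) * of_real (?J lam \<mu>))" if "\<mu> \<in> deg_msets n" for \<mu>
    using that
  proof (induction ks arbitrary: \<mu>)
    case Nil
    then show ?case by (simp add: exp0)
  next
    case (Cons k ks)
    let ?A = "vac (complex_of_real \<alpha>) (of_real (\<alpha> - 1)) (\<lambda>_. 0)"
    let ?c = "\<lambda>lam. cnj (ev lam) / of_real (N lam) * of_real (\<Prod>k\<leftarrow>ks. walk \<alpha> lam k 0)"
    \<comment> \<open>The expansion is known in degree \<open>n\<close> only; this suffices because
      the operator preserves the degree.\<close>
    have "foldr ?A (k # ks) \<Psi> \<mu> = ?A k (\<lambda>\<mu>. \<Sum>lam\<in>parts n. ?c lam * of_real (?J lam \<mu>)) \<mu>"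
      unfolding foldr_Cons comp_apply by (rule vac_cong_degree[of n]) (use Cons in auto)
    also have "\<dots> = (\<Sum>lam\<in>parts n. ?c lam * of_real (vac \<alpha> (\<alpha> - 1) (\<lambda>_. 0) k (?J lam) \<mu>))"
      by (simp only: vac_sum vac_of_real)
    also have "\<dots> = (\<Sum>lam\<in>parts n. ?c lam * of_real (walk \<alpha> lam k 0 * ?J lam \<mu>))"
      by (intro sum.cong refl) (simp add: is_jack_eigen[OF \<alpha> jackF[OF \<alpha>]])
    finally show ?case by (simp add: mult_ac)
  qed
  have "(\<Sum>\<mu>\<in>deg_msets n. v \<mu> * foldr (vac (of_real \<alpha>) (of_real (\<alpha> - 1)) (\<lambda>_. 0)) ks \<Psi> \<mu>) =
    (\<Sum>\<mu>\<in>deg_msets n. \<Sum>lam\<in>parts n. v \<mu> * ((cnj (ev lam) / of_real (N lam) * of_real (\<Prod>k\<leftarrow>ks. walk \<alpha> lam k 0)) * of_real (?J lam \<mu>)))"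
    by (intro sum.cong refl) (simp only: exps sum_distrib_left)
  also have "\<dots> = (\<Sum>lam\<in>parts n. \<Sum>\<mu>\<in>deg_msets n. v \<mu> * ((cnj (ev lam) / of_real (N lam) * of_real (\<Prod>k\<leftarrow>ks. walk \<alpha> lam k 0)) * of_real (?J lam \<mu>)))"
    by (rule sum.swap)
  also have "\<dots> = (\<Sum>lam\<in>parts n. of_real ((norm (ev lam))\<^sup>2 / N lam * (\<Prod>k\<leftarrow>ks. walk \<alpha> lam k 0)))"
  proof (intro sum.cong refl)
    fix lam
    have "(\<Sum>\<mu>\<in>deg_msets n. v \<mu> * ((cnj (ev lam) / of_real (N lam) * of_real (\<Prod>k\<leftarrow>ks. walk \<alpha> lam k 0)) * of_real (?J lam \<mu>))) =
      ev lam * (cnj (ev lam) / of_real (N lam) * of_real (\<Prod>k\<leftarrow>ks. walk \<alpha> lam k 0))"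
      unfolding ev_def sum_distrib_right by (intro sum.cong refl) (simp add: mult_ac)
    also have "\<dots> = of_real ((norm (ev lam))\<^sup>2 / N lam * (\<Prod>k\<leftarrow>ks. walk \<alpha> lam k 0))"
      by (simp add: complex_norm_square[symmetric] mult.assoc[symmetric])
    finally show "(\<Sum>\<mu>\<in>deg_msets n. v \<mu> * ((cnj (ev lam) / of_real (N lam) * of_real (\<Prod>k\<leftarrow>ks. walk \<alpha> lam k 0)) * of_real (?J lam \<mu>))) =
      of_real ((norm (ev lam))\<^sup>2 / N lam * (\<Prod>k\<leftarrow>ks. walk \<alpha> lam k 0))" .
  qed
  finally show ?thesis by (simp add: N_def)
qed

section \<open>Linear statistics of profiles\<close>

text \<open>Boundary terms at \<open>\<plusminus>R\<close> in the \<open>l\<close>-th moment of \<open>c \<mapsto> \<bar>c - a\<bar>\<close>; being affine in \<open>a\<close>, they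
  agree with those of \<open>\<bar>c\<bar>\<close> for every combination of kinks of total mass one and mean zero.\<close>
definition absC :: "nat \<Rightarrow> real \<Rightarrow> real" where
  "absC l R = real (l - 1) / 2 * (R ^ l + (- R) ^ l)"

definition absD :: "nat \<Rightarrow> real \<Rightarrow> real" where
  "absD l R = - real l / 2 * (R ^ (l - 1) + (- R) ^ (l - 1))"

lemma abs_moment:
  fixes a R :: real
  assumes "\<bar>a\<bar> \<le> R" "l \<ge> 2"
  shows "((\<lambda>c. \<bar>c - a\<bar> * c ^ (l - 2)) has_integral (a ^ l + absC l R + absD l R * a) / (real (l * (l - 1)) / 2)) {-R..R}"
proof -
  \<comment> \<open>An antiderivative of \<open>(c - a) * c ^ (l - 2)\<close>; the integral is split
    at the kink \<open>a\<close>.\<close>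
  define G where "G c = (real (l - 1) * c ^ l - real l * a * c ^ (l - 1)) / real (l * (l - 1))" for c :: real
  obtain m where l: "l = Suc (Suc m)" using assms(2) by (metis add_2_eq_Suc le_Suc_ex)
  have G: "(G has_vector_derivative (c - a) * c ^ (l - 2)) (at c within S)" for c S
  proof -
    have "(G has_real_derivative (real (l - 1) * (real l * c ^ (l - 1)) - real l * a * (real (l - 1) * c ^ (l - 1 - 1))) / real (l * (l - 1))) (at c within S)"
      unfolding G_def by (intro DERIV_cdivide DERIV_diff DERIV_cmult DERIV_pow[unfolded One_nat_def[symmetric]])
    also have "(real (l - 1) * (real l * c ^ (l - 1)) - real l * a * (real (l - 1) * c ^ (l - 1 - 1))) / real (l * (l - 1)) = (c - a) * c ^ (l - 2)"
    proof -
      define p q where "p = real l" and "q = real (l - 1)"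
      have "p \<noteq> 0" "q \<noteq> 0" "real (l * (l - 1)) = p * q" "c ^ (l - 1) = c * c ^ (l - 2)" "l - 1 - 1 = l - 2"
        using assms(2) by (auto simp: p_def q_def l algebra_simps)
      then show ?thesis unfolding p_def[symmetric] q_def[symmetric] by (simp add: field_simps)
    qed
    finally show ?thesis by (simp add: has_real_derivative_iff_has_vector_derivative)
  qed
  have 1: "((\<lambda>c. (c - a) * c ^ (l - 2)) has_integral (G R - G a)) {a..R}"
    by (rule fundamental_theorem_of_calculus) (use assms G in auto)
  have 2: "((\<lambda>c. (c - a) * c ^ (l - 2)) has_integral (G a - G (-R))) {-R..a}"
    by (rule fundamental_theorem_of_calculus) (use assms G in auto)
  have p1: "((\<lambda>c. \<bar>c - a\<bar> * c ^ (l - 2)) has_integral (G R - G a)) {a..R}"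
    by (rule has_integral_eq[OF _ 1]) auto
  have p2: "((\<lambda>c. \<bar>c - a\<bar> * c ^ (l - 2)) has_integral - (G a - G (-R))) {-R..a}"
    by (rule has_integral_eq[OF _ has_integral_neg[OF 2]]) (auto simp: algebra_simps)
  have "((\<lambda>c. \<bar>c - a\<bar> * c ^ (l - 2)) has_integral (- (G a - G (-R)) + (G R - G a))) {-R..R}"
    by (rule has_integral_combine[OF _ _ p2 p1]) (use assms in auto)
  moreover have "- (G a - G (-R)) + (G R - G a) = (a ^ l + absC l R + absD l R * a) / (real (l * (l - 1)) / 2)"
  proof -
    define K where "K = real (l * (l - 1))"
    have K: "K \<noteq> 0" using assms(2) by (simp add: K_def)
    have GK: "G x * K = real (l - 1) * x ^ l - real l * a * x ^ (l - 1)" for x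
      unfolding G_def K_def[symmetric] using K by simp
    have "real (l - 1) = real l - 1" "a * a ^ (l - 1) = a ^ l" using assms(2) by (auto simp: l)
    then have Ga: "G a * K = - (a ^ l)" unfolding GK by (simp add: left_diff_distrib mult.assoc)
    have "(- (G a - G (-R)) + (G R - G a)) * K = G (-R) * K + G R * K - 2 * (G a * K)"
      by (simp add: algebra_simps)
    also have "\<dots> = 2 * (a ^ l + absC l R + absD l R * a)"
      unfolding Ga unfolding GK absC_def absD_def by (simp add: algebra_simps add_divide_distrib)
    finally have "(- (G a - G (-R)) + (G R - G a)) * K = 2 * (a ^ l + absC l R + absD l R * a)" .
    then show ?thesis using K unfolding K_def[symmetric] by (simp add: field_simps)
  qed
  ultimately show ?thesis by simp
qed

text \<open>The moment of \<open>\<bar>c\<bar>\<close> is the case \<open>a = 0\<close> of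
  \<open>abs_moment\<close>, so only the boundary constant \<open>absC\<close> has to be
  subtracted.\<close>

lemma ch_compact:
  assumes f: "continuous_on UNIV f" "\<And>c. R \<le> \<bar>c\<bar> \<Longrightarrow> f c = \<bar>c\<bar>" and R: "R > 0" and l: "l \<ge> 2"
    and I: "((\<lambda>c. f c * c ^ (l - 2)) has_integral J) {-R..R}"
  shows "ch l f = real (l * (l - 1)) / 2 * J - absC l R"
proof -
  let ?g = "\<lambda>c. (f c - \<bar>c\<bar>) * c ^ (l - 2)"
  have "continuous_on {-R..R} ?g" using f(1) by (auto intro!: continuous_intros intro: continuous_on_subset)
  then have si: "set_integrable lborel {-R..R} ?g" by (rule borel_integrable_atLeastAtMost')
  have "(\<integral>c. ?g c \<partial>lborel) = (LINT c:{-R..R}|lborel. ?g c)"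
    unfolding set_lebesgue_integral_def
  proof (rule Bochner_Integration.integral_cong)
    fix c show "?g c = indicat_real {-R..R} c *\<^sub>R ?g c"
      using f(2)[of c] by (cases "R \<le> \<bar>c\<bar>") (auto simp: indicator_def abs_le_iff not_le abs_less_iff)
  qed simp
  also have "\<dots> = integral {-R..R} ?g" by (rule set_borel_integral_eq_integral(2)[OF si])
  also have "\<dots> = J - absC l R / (real (l * (l - 1)) / 2)"
  proof (rule integral_unique)
    have "((\<lambda>c. f c * c ^ (l - 2) - \<bar>c - 0\<bar> * c ^ (l - 2)) has_integral J - (0 ^ l + absC l R + absD l R * 0) / (real (l * (l - 1)) / 2)) {-R..R}"
      by (intro has_integral_diff I abs_moment) (use R l in auto)
    then show "(?g has_integral J - absC l R / (real (l * (l - 1)) / 2)) {-R..R}"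
      using l by (simp add: left_diff_distrib power_0_left)
  qed
  finally show ?thesis using l by (simp add: ch_def right_diff_distrib)
qed

text \<open>Half the height that row \<open>i\<close> of \<open>lam\<close> adds to the profile above \<open>c\<close>.\<close>
definition strip :: "real \<Rightarrow> real \<Rightarrow> nat list \<Rightarrow> real \<Rightarrow> nat \<Rightarrow> real" where
  "strip b e lam c i = max 0 (min (b * (real i + 1)) (e * lam ! i - c) - max (b * i) (- c))"

text \<open>On the vertical line over \<open>c\<close> a point is
  \<open>y = c + 2 * \<sigma>\<close> with \<open>\<sigma> = b * (i + s)\<close>. The boxes of row
  \<open>i\<close> fill an interval of values \<open>\<sigma>\<close> whose length, above
  \<open>m\<close>, is \<open>strip\<close>. Since rows shrink, all rows before the last one met are
  met fully, so these intervals stack without gaps above \<open>m\<close>, the value of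
  \<open>\<sigma>\<close> at height \<open>\<bar>c\<bar>\<close>.\<close>

lemma profile_eq_strip:
  assumes b: "b > 0" and e: "e > 0" and lam: "is_partition lam"
  shows "profile (- b) e lam c = \<bar>c\<bar> + 2 * (\<Sum>i<length lam. strip b e lam c i)"
proof -
  let ?S = "\<Sum>i<length lam. strip b e lam c i"
  let ?Y = "{y. \<exists>i<length lam. \<exists>j<lam ! i. \<exists>s\<in>{0..1}. \<exists>t\<in>{0..1}.
          c = (real i + s) * (- b) + (real j + t) * e \<and> y = - (real i + s) * (- b) + (real j + t) * e}"
  define m where "m = max 0 (- c)"
  have cm: "\<bar>c\<bar> = c + 2 * m" by (auto simp: m_def)
  have anti: "lam ! j \<le> lam ! i" if "i \<le> j" "j < length lam" for i j
    using lam that by (auto simp: is_partition_def sorted_wrt_iff_nth_less le_less)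
  have tel: "(\<Sum>q<i. max 0 (b * (real q + 1) - max (b * q) m)) = max (b * i) m - m" for i
  proof (induction i)
    case (Suc i)
    have "b * real i \<le> b * (real i + 1)" using b by (intro mult_left_mono) auto
    then show ?case using Suc by (auto simp: max_def add.commute)
  qed (simp add: m_def)
  have mm: "max (b * real i) (- c) = max (b * i) m" for i
    using mult_nonneg_nonneg[of b "real i"] b by (auto simp: m_def max_def simp del: mult_nonneg_nonneg)
  have strip_le: "strip b e lam c q \<le> max 0 (b * (real q + 1) - max (b * q) m)" for q
    unfolding strip_def mm by (auto simp: max_def min_def)
  have strip0: "0 \<le> strip b e lam c q" for q by (simp add: strip_def)
  have ub: "y \<le> \<bar>c\<bar> + 2 * ?S" if y: "y \<in> ?Y" for y
  proof -
    obtain i j s t where ij: "i < length lam" "j < lam ! i" "0 \<le> s" "s \<le> 1" "0 \<le> t" "t \<le> 1"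
      "c = (real i + s) * (- b) + (real j + t) * e" "y = - (real i + s) * (- b) + (real j + t) * e"
      using y by auto
    define \<sigma> where "\<sigma> = b * (real i + s)"
    have ys: "y = c + 2 * \<sigma>" using ij(7,8) by (simp add: \<sigma>_def algebra_simps)
    have s1: "b * i \<le> \<sigma>" "\<sigma> \<le> b * (real i + 1)" using ij b by (auto simp: \<sigma>_def)
    have cs: "c + \<sigma> = (real j + t) * e" using ij(7) by (simp add: \<sigma>_def algebra_simps)
    have "real j + t \<le> real (lam ! i)" using ij by linarith
    then have s2: "c + \<sigma> \<le> e * lam ! i" unfolding cs using e by (simp add: mult.commute)
    have "0 \<le> c + \<sigma>" unfolding cs using ij e by simp
    then have ms: "m \<le> \<sigma>" using s1 b by (auto simp: m_def intro: order_trans[of 0 "b * real i"])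
    have row: "max 0 (b * (real q + 1) - max (b * q) m) \<le> strip b e lam c q" if "q < i" for q
    proof -
      have "b * (real q + 1) \<le> b * i" using that b by (intro mult_left_mono) auto
      then have "c + b * (real q + 1) \<le> e * lam ! i" using s1 s2 by linarith
      also have "\<dots> \<le> e * lam ! q" using anti[of q i] that ij e by simp
      finally show ?thesis unfolding strip_def mm by (simp add: min_def)
    qed
    have "\<sigma> - max (b * i) m \<le> strip b e lam c i"
      unfolding strip_def mm using s1 s2 by (simp add: min_def max_def)
    moreover have "(\<Sum>q<i. max 0 (b * (real q + 1) - max (b * q) m)) \<le> (\<Sum>q<i. strip b e lam c q)"
      by (rule sum_mono) (use row in auto)
    ultimately have "\<sigma> - m \<le> (\<Sum>q<Suc i. strip b e lam c q)" unfolding tel by simp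
    also have "\<dots> \<le> ?S" by (rule sum_mono2) (use ij strip0 in auto)
    finally show ?thesis using ys cm by simp
  qed
  have att: "\<bar>c\<bar> + 2 * ?S \<in> insert \<bar>c\<bar> ?Y"
  proof (cases "?S = 0")
    case False
    define Q where "Q = {i. i < length lam \<and> strip b e lam c i \<noteq> 0}"
    have Q: "finite Q" "Q \<noteq> {}" using False by (auto simp: Q_def intro: ccontr)
    define i where "i = Max Q"
    have i: "i < length lam" "strip b e lam c i \<noteq> 0" using Max_in[OF Q] by (auto simp: i_def Q_def)
    have iz: "strip b e lam c q = 0" if "q < length lam" "i < q" for q
    proof (rule ccontr)
      assume "strip b e lam c q \<noteq> 0"
      then have "q \<in> Q" using that by (simp add: Q_def)
      then show False using Max_ge[OF Q(1), of q] that by (simp add: i_def)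
    qed
    define \<sigma> where "\<sigma> = min (b * (real i + 1)) (e * lam ! i - c)"
    have sp: "strip b e lam c i = \<sigma> - max (b * i) m" and s0: "max (b * i) m < \<sigma>"
      using i(2) unfolding strip_def mm \<sigma>_def by (auto simp: max_def split: if_splits)
    have "?S = (\<Sum>q<Suc i. strip b e lam c q)"
      by (rule sum.mono_neutral_right) (use i iz in auto)
    also have "\<dots> \<le> (\<Sum>q<i. max 0 (b * (real q + 1) - max (b * q) m)) + (\<sigma> - max (b * i) m)"
      using sum_mono[of "{..<i}" "strip b e lam c" "\<lambda>q. max 0 (b * (real q + 1) - max (b * q) m)"] strip_le sp by simp
    also have "\<dots> = \<sigma> - m" unfolding tel by simp
    finally have Sle: "?S \<le> \<sigma> - m" .
    define \<tau> where "\<tau> = (c + \<sigma>) / e"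
    have mc: "- c \<le> m" by (simp add: m_def)
    have t0: "0 < \<tau>" using s0 mc e by (simp add: \<tau>_def)
    have t1: "\<tau> \<le> lam ! i" using e by (simp add: \<tau>_def \<sigma>_def min_def field_simps)
    \<comment> \<open>The ceiling, because \<open>t = 1\<close> is allowed: for
      \<open>\<tau> = lam ! i\<close> the point lies on the far side of the last box, where the
      floor would name a column outside the row.\<close>
    define j where "j = nat (\<lceil>\<tau>\<rceil> - 1)"
    have cj: "0 \<le> \<lceil>\<tau>\<rceil> - 1" using t0 by (simp add: le_ceiling_iff)
    have j1: "real j < \<tau>" "\<tau> \<le> real j + 1" using cj by (auto simp: j_def of_nat_nat) linarith+
    have jl: "j < lam ! i" using j1 t1 by linarith
    have y: "c + 2 * \<sigma> \<in> ?Y"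
    proof -
      have "\<sigma> / b - real i \<in> {0..1}" using s0 b by (auto simp: \<sigma>_def min_def field_simps max_def split: if_splits)
      moreover have "\<tau> - real j \<in> {0..1}" using j1 by auto
      moreover have "c = (real i + (\<sigma> / b - real i)) * (- b) + (real j + (\<tau> - real j)) * e"
        using b e by (simp add: \<tau>_def)
      moreover have "c + 2 * \<sigma> = - (real i + (\<sigma> / b - real i)) * (- b) + (real j + (\<tau> - real j)) * e"
        using b e by (simp add: \<tau>_def)
      ultimately show ?thesis using i(1) jl by blast
    qed
    from ub[OF y] Sle cm have "c + 2 * \<sigma> = \<bar>c\<bar> + 2 * ?S" by linarith
    then show ?thesis using y by simp
  qed simp
  have S0: "0 \<le> ?S" by (rule sum_nonneg) (simp add: strip0)
  show ?thesis unfolding profile_def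
  proof (rule cSup_eq_maximum[OF att])
    fix x assume "x \<in> insert \<bar>c\<bar> ?Y"
    then show "x \<le> \<bar>c\<bar> + 2 * ?S"
    proof (rule insertE)
      assume "x = \<bar>c\<bar>"
      then show ?thesis using S0 by simp
    qed (rule ub)
  qed
qed

lemma overlap_abs:
  fixes L A B c :: real
  assumes "0 \<le> L" "0 < B"
  shows "2 * max 0 (min (A + B) (L - c) - max A (- c)) = \<bar>c - (L - A)\<bar> - \<bar>c - (L - A - B)\<bar> - \<bar>c + A\<bar> + \<bar>c + (A + B)\<bar>"
  using assms unfolding max_def min_def abs_real_def by (smt (verit))

lemma strip_abs:
  assumes "b > 0" "e > 0"
  shows "2 * strip b e lam c i = \<bar>c - (e * lam ! i - b * i)\<bar> - \<bar>c - (e * lam ! i - b * i - b)\<bar> - \<bar>c - (- b * i)\<bar> + \<bar>c - (- b * (real i + 1))\<bar>"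
  using overlap_abs[of "e * lam ! i" b "b * i" c] assms unfolding strip_def
  by (simp add: distrib_left)

text \<open>The kinks at \<open>- b * i\<close> and \<open>- b * (i + 1)\<close> telescope over the
  rows and replace \<open>\<bar>c\<bar>\<close> by a single kink at \<open>- b * length lam\<close>;
  every row keeps the two kinks at its outer end.\<close>

lemma profile_abs:
  assumes b: "b > 0" and e: "e > 0" and lam: "is_partition lam"
  shows "profile (- b) e lam c = \<bar>c - (- b * length lam)\<bar> +
    (\<Sum>i<length lam. \<bar>c - (e * lam ! i - b * i)\<bar> - \<bar>c - (e * lam ! i - b * i - b)\<bar>)"
proof -
  have "(\<Sum>i<k. \<bar>c - (- b * (real i + 1))\<bar> - \<bar>c - (- b * i)\<bar>) = \<bar>c - (- b * k)\<bar> - \<bar>c\<bar>" for k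
    by (induction k) (auto simp: add.commute)
  moreover have "2 * (\<Sum>i<length lam. strip b e lam c i) =
     (\<Sum>i<length lam. \<bar>c - (e * lam ! i - b * i)\<bar> - \<bar>c - (e * lam ! i - b * i - b)\<bar>) +
     (\<Sum>i<length lam. \<bar>c - (- b * (real i + 1))\<bar> - \<bar>c - (- b * i)\<bar>)"
    unfolding sum.distrib[symmetric] sum_distrib_left
    by (intro sum.cong refl) (simp add: strip_abs[OF b e])
  ultimately show ?thesis unfolding profile_eq_strip[OF assms] by simp
qed

text \<open>For \<open>l \<ge> 2\<close> a kink at \<open>a\<close> contributes \<open>a ^ l\<close>
  by \<open>abs_moment\<close>. The kinks have total mass one and mean zero, so the
  \<open>absD\<close> terms cancel and a single \<open>absC\<close> is left, which
  \<open>ch_compact\<close> removes.\<close>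

lemma ch_profile:
  assumes b: "b > 0" and e: "e > 0" and lam: "is_partition lam"
  shows "ch l (profile (- b) e lam) = b ^ l * csum (e / b) lam l"
proof -
  let ?n = "length lam"
  let ?x = "\<lambda>i. e * lam ! i - b * real i"
  have scale: "b ^ l * csum (e / b) lam l = (- b * ?n) ^ l + (\<Sum>i<?n. ?x i ^ l - (?x i - b) ^ l)"
  proof -
    have "b ^ l * (e / b * lam ! i - i) ^ l = ?x i ^ l" "b ^ l * (e / b * lam ! i - i - 1) ^ l = (?x i - b) ^ l"
      "b ^ l * (- real ?n) ^ l = (- b * ?n) ^ l" for i
      unfolding power_mult_distrib[symmetric] using b by (simp_all add: right_diff_distrib)
    then show ?thesis by (simp only: csum_def distrib_left sum_distrib_left right_diff_distrib)
  qed
  consider "l = 0" | "l = 1" | "l \<ge> 2" by linarith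
  then show ?thesis
  proof cases
    case 1
    then show ?thesis by (simp add: ch_def csum_def)
  next
    case 2
    then show ?thesis unfolding scale by (simp add: ch_def)
  next
    case 3
    define R where "R = 1 + \<bar>b * ?n\<bar> + b + (\<Sum>i<?n. \<bar>?x i\<bar>)"
    have s0: "0 \<le> (\<Sum>i<?n. \<bar>?x i\<bar>)" by (rule sum_nonneg) simp
    have R: "R > 0" using b s0 abs_ge_zero[of "b * ?n"] unfolding R_def by linarith
    have xi: "\<bar>?x i\<bar> \<le> R - b" if "i < ?n" for i
      using member_le_sum[of i "{..<?n}" "\<lambda>i. \<bar>?x i\<bar>"] that unfolding R_def by auto
    have xR: "\<bar>?x i\<bar> \<le> R" "\<bar>?x i - b\<bar> \<le> R" if "i < ?n" for i
      using xi[OF that] b by (auto simp: abs_le_iff)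
    have nR: "\<bar>- b * ?n\<bar> \<le> R" using b s0 unfolding R_def mult_minus_left abs_minus by linarith
    note pa = profile_abs[OF assms]
    have cont: "continuous_on UNIV (profile (- b) e lam)"
      unfolding pa[abs_def] by (intro continuous_intros)
    have far: "profile (- b) e lam c = \<bar>c\<bar>" if "R \<le> \<bar>c\<bar>" for c
    proof (cases "c > 0")
      case True
      then have eq: "\<bar>c - a\<bar> = c - a" if "\<bar>a\<bar> \<le> R" for a using that \<open>R \<le> \<bar>c\<bar>\<close> by auto
      have "(\<Sum>i<?n. \<bar>c - ?x i\<bar> - \<bar>c - (?x i - b)\<bar>) = (\<Sum>i<?n. - b)"
        by (intro sum.cong refl) (use eq xR in auto)
      then show ?thesis unfolding pa eq[OF nR] using True by (simp add: mult.commute)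
    next
      case False
      then have eq: "\<bar>c - a\<bar> = a - c" if "\<bar>a\<bar> \<le> R" for a using that \<open>R \<le> \<bar>c\<bar>\<close> by auto
      have "(\<Sum>i<?n. \<bar>c - ?x i\<bar> - \<bar>c - (?x i - b)\<bar>) = (\<Sum>i<?n. b)"
        by (intro sum.cong refl) (use eq xR in auto)
      then show ?thesis unfolding pa eq[OF nR] using False by (simp add: mult.commute)
    qed
    let ?k = "real (l * (l - 1)) / 2"
    let ?m = "\<lambda>a. (a ^ l + absC l R + absD l R * a) / ?k"
    have I: "((\<lambda>c. \<bar>c - (- b * ?n)\<bar> * c ^ (l - 2) + (\<Sum>i<?n. \<bar>c - ?x i\<bar> * c ^ (l - 2) - \<bar>c - (?x i - b)\<bar> * c ^ (l - 2)))
       has_integral ?m (- b * ?n) + (\<Sum>i<?n. ?m (?x i) - ?m (?x i - b))) {-R..R}"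
      by (intro has_integral_add has_integral_sum has_integral_diff abs_moment finite_lessThan nR 3) (use xR in auto)
    have "?m (- b * ?n) + (\<Sum>i<?n. ?m (?x i) - ?m (?x i - b)) =
       ((- b * ?n) ^ l + absC l R + absD l R * (- b * ?n) + (\<Sum>i<?n. ?x i ^ l - (?x i - b) ^ l + absD l R * b)) / ?k"
      unfolding add_divide_distrib sum_divide_distrib
      by (intro arg_cong2[where f = "(+)"] sum.cong refl) (simp_all add: algebra_simps add_divide_distrib diff_divide_distrib)
    also have "\<dots> = (b ^ l * csum (e / b) lam l + absC l R) / ?k"
      unfolding scale sum.distrib by (simp add: algebra_simps)
    finally have J: "?m (- b * ?n) + (\<Sum>i<?n. ?m (?x i) - ?m (?x i - b)) = (b ^ l * csum (e / b) lam l + absC l R) / ?k" .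
    have "ch l (profile (- b) e lam) = ?k * ((b ^ l * csum (e / b) lam l + absC l R) / ?k) - absC l R"
    proof (rule ch_compact[OF cont far R 3])
      show "((\<lambda>c. profile (- b) e lam c * c ^ (l - 2)) has_integral (b ^ l * csum (e / b) lam l + absC l R) / ?k) {- R..R}"
        using I unfolding J by (rule has_integral_eq[rotated]) (simp add: pa distrib_right sum_distrib_right left_diff_distrib)
    qed
    moreover have "k * (X / k) = X" if "k \<noteq> 0" for k X :: real using that by simp
    moreover have "?k \<noteq> 0" using 3 by simp
    ultimately show ?thesis by (metis add_diff_cancel_right')
  qed
qed

section \<open>Absolutely convergent Fourier series\<close>

no_notation Infinite_Set_Sum.abs_summable_on (infix \<open>abs'_summable'_on\<close> 50)

lemma abs_summable_pair_product:
  fixes a :: "'a \<Rightarrow> 'c::real_normed_div_algebra" and b :: "'b \<Rightarrow> 'c"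
  assumes a: "a abs_summable_on A" and b: "b abs_summable_on B"
  shows "(\<lambda>(x, y). a x * b y) abs_summable_on A \<times> B"
proof -
  have "(\<lambda>(x, y). norm (a x) * norm (b y)) summable_on Sigma A (\<lambda>_. B)"
  proof (rule summable_on_SigmaI)
    show "((\<lambda>y. (case (x, y) of (x, y) \<Rightarrow> norm (a x) * norm (b y))) has_sum norm (a x) * infsum (\<lambda>y. norm (b y)) B) B" for x
      using has_sum_cmult_right[OF has_sum_infsum[OF b], of "norm (a x)"] by simp
    show "(\<lambda>x. norm (a x) * infsum (\<lambda>y. norm (b y)) B) summable_on A"
      by (rule summable_on_cmult_left[OF a])
  qed auto
  then show ?thesis by (simp add: norm_mult case_prod_unfold)
qed

lemma infsum_pair_product:
  fixes a :: "'a \<Rightarrow> 'c::{real_normed_field,banach}" and b :: "'b \<Rightarrow> 'c"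
  assumes a: "a abs_summable_on A" and b: "b abs_summable_on B"
  shows "infsum (\<lambda>(x, y). a x * b y) (A \<times> B) = infsum a A * infsum b B"
proof -
  have s: "(\<lambda>(x, y). a x * b y) summable_on A \<times> B"
    by (rule abs_summable_summable[OF abs_summable_pair_product[OF a b]])
  have "infsum (\<lambda>(x, y). a x * b y) (A \<times> B) = (\<Sum>\<^sub>\<infinity>x\<in>A. \<Sum>\<^sub>\<infinity>y\<in>B. a x * b y)"
    using infsum_Sigma'_banach[OF s] by simp
  also have "\<dots> = (\<Sum>\<^sub>\<infinity>x\<in>A. a x * infsum b B)" by (simp add: infsum_cmult_right')
  also have "\<dots> = infsum a A * infsum b B" by (simp add: infsum_cmult_left')
  finally show ?thesis .
qed

lemma infsum_single:
  assumes "\<And>x. x \<noteq> k \<Longrightarrow> f x = 0"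
  shows "infsum f UNIV = f k"
proof -
  have "infsum f UNIV = infsum f {k}" by (rule infsum_cong_neutral) (use assms in auto)
  then show ?thesis by simp
qed

definition fser :: "(int \<Rightarrow> complex) \<Rightarrow> real \<Rightarrow> complex" where
  "fser a \<theta> = (\<Sum>\<^sub>\<infinity>m. a m * cis (of_int m * \<theta>))"

definition fconv :: "(int \<Rightarrow> complex) \<Rightarrow> (int \<Rightarrow> complex) \<Rightarrow> int \<Rightarrow> complex" where
  "fconv a b m = (\<Sum>\<^sub>\<infinity>i. a i * b (m - i))"

abbreviation abs_sum :: "(int \<Rightarrow> complex) \<Rightarrow> bool" where
  "abs_sum a \<equiv> (\<lambda>m. norm (a m)) summable_on UNIV"

definition cmean :: "(real \<Rightarrow> complex) \<Rightarrow> complex" where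
  "cmean g = integral {0..2*pi} g / of_real (2 * pi)"

lemma abs_sum_twist: "abs_sum a \<Longrightarrow> (\<lambda>m. a m * cis (of_int m * \<theta>)) abs_summable_on UNIV"
  by (simp add: norm_mult)

lemma fconv_pairs:
  assumes a: "abs_sum a" and b: "abs_sum b"
  shows "(\<lambda>(m, i). a i * b (m - i)) abs_summable_on (UNIV :: (int \<times> int) set)"
proof -
  have "(\<lambda>(x, y). a x * b y) abs_summable_on UNIV \<times> UNIV"
    by (rule abs_summable_pair_product[OF a b])
  moreover have "(\<lambda>p. norm (case p of (x, y) \<Rightarrow> a x * b y)) summable_on UNIV \<times> UNIV \<longleftrightarrow>
     (\<lambda>p. norm (case p of (m, i) \<Rightarrow> a i * b (m - i))) summable_on UNIV"
    by (rule summable_on_reindex_bij_witness[of _ "\<lambda>(m, i). (i, m - i)" "\<lambda>(x, y). (x + y, x)"]) auto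
  ultimately show ?thesis by simp
qed

lemma fconv_abs_sum:
  assumes a: "abs_sum a" and b: "abs_sum b"
  shows "abs_sum (fconv a b)"
proof -
  let ?f = "\<lambda>(m, i). a i * b (m - i)"
  have s: "?f abs_summable_on Sigma UNIV (\<lambda>_. UNIV)" using fconv_pairs[OF a b] by simp
  then have 1: "(\<lambda>i. ?f (m, i)) abs_summable_on UNIV" and 2: "(\<lambda>m. infsum (\<lambda>i. norm (?f (m, i))) UNIV) abs_summable_on UNIV" for m
    using Infinite_Sum.abs_summable_on_Sigma_iff[of ?f UNIV "\<lambda>_. UNIV"] by auto
  show ?thesis
  proof (rule Infinite_Sum.abs_summable_on_comparison_test[OF 2])
    fix m
    have "norm (fconv a b m) \<le> infsum (\<lambda>i. norm (?f (m, i))) UNIV"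
      unfolding fconv_def using norm_infsum_bound[OF 1[of m]] by simp
    also have "\<dots> \<le> norm (infsum (\<lambda>i. norm (?f (m, i))) UNIV)" by simp
    finally show "norm (fconv a b m) \<le> norm (infsum (\<lambda>i. norm (?f (m, i))) UNIV)" .
  qed
qed

lemma fser_fconv:
  assumes a: "abs_sum a" and b: "abs_sum b"
  shows "fser (fconv a b) \<theta> = fser a \<theta> * fser b \<theta>"
proof -
  let ?a = "\<lambda>m. a m * cis (of_int m * \<theta>)" and ?b = "\<lambda>m. b m * cis (of_int m * \<theta>)"
  have "fser a \<theta> * fser b \<theta> = infsum (\<lambda>(x, y). ?a x * ?b y) (UNIV \<times> UNIV)"
    unfolding fser_def by (rule infsum_pair_product[symmetric]) (use abs_sum_twist a b in auto)
  also have "\<dots> = infsum (\<lambda>(m, i). ?a i * ?b (m - i)) (UNIV \<times> UNIV)"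
    by (rule infsum_reindex_bij_witness[of _ "\<lambda>(m, i). (i, m - i)" "\<lambda>(x, y). (x + y, x)"]) auto
  also have "\<dots> = (\<Sum>\<^sub>\<infinity>m. \<Sum>\<^sub>\<infinity>i. ?a i * ?b (m - i))"
  proof -
    have "(\<lambda>(m, i). ?a i * ?b (m - i)) abs_summable_on UNIV"
      by (rule fconv_pairs) (use abs_sum_twist a b in auto)
    then have "(\<lambda>(m, i). ?a i * ?b (m - i)) summable_on UNIV \<times> UNIV"
      using abs_summable_summable by fastforce
    from infsum_Sigma'_banach[OF this] show ?thesis by simp
  qed
  also have "\<dots> = (\<Sum>\<^sub>\<infinity>m. fconv a b m * cis (of_int m * \<theta>))"
  proof (intro infsum_cong)
    fix m
    have "(\<Sum>\<^sub>\<infinity>i. ?a i * ?b (m - i)) = (\<Sum>\<^sub>\<infinity>i. (a i * b (m - i)) * cis (of_int m * \<theta>))"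
    proof (intro infsum_cong)
      fix i
      have "cis (of_int i * \<theta>) * cis (of_int (m - i) * \<theta>) = cis (of_int m * \<theta>)"
        by (simp add: cis_mult algebra_simps)
      moreover have "?a i * ?b (m - i) = (a i * b (m - i)) * (cis (of_int i * \<theta>) * cis (of_int (m - i) * \<theta>))"
        by (simp only: mult_ac)
      ultimately show "?a i * ?b (m - i) = (a i * b (m - i)) * cis (of_int m * \<theta>)"
        by (simp only:)
    qed
    also have "\<dots> = fconv a b m * cis (of_int m * \<theta>)"
      unfolding fconv_def by (rule infsum_cmult_left')
    finally show "(\<Sum>\<^sub>\<infinity>i. ?a i * ?b (m - i)) = fconv a b m * cis (of_int m * \<theta>)" .
  qed
  finally show ?thesis by (simp add: fser_def)
qed

lemma integral_cis:
  fixes k :: int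
  shows "((\<lambda>\<theta>. cis (of_int k * \<theta>)) has_integral (if k = 0 then of_real (2 * pi) else 0)) {0..2*pi}"
proof (cases "k = 0")
  case True
  then show ?thesis using has_integral_const_real[of "1 :: complex" 0 "2 * pi"] by (simp add: scaleR_conv_of_real)
next
  case False
  have "((\<lambda>\<theta>. cis (of_int k * \<theta>)) has_integral cis (of_int k * (2 * pi)) / (\<i> * of_int k) - cis (of_int k * 0) / (\<i> * of_int k)) {0..2*pi}"
  proof (rule fundamental_theorem_of_calculus)
    fix x :: real
    have "((\<lambda>z. exp (\<i> * of_int k * z) / (\<i> * of_int k)) has_field_derivative exp (\<i> * of_int k * of_real x)) (at (of_real x))"
      using False by (auto intro!: derivative_eq_intros)
    then have "((\<lambda>\<theta>. exp (\<i> * of_int k * of_real \<theta>) / (\<i> * of_int k)) has_vector_derivative exp (\<i> * of_int k * of_real x)) (at x within {0..2*pi})"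
      by (rule has_vector_derivative_at_within[OF has_vector_derivative_real_field])
    then show "((\<lambda>\<theta>. cis (of_int k * \<theta>) / (\<i> * of_int k)) has_vector_derivative cis (of_int k * x)) (at x within {0..2*pi})"
      by (simp add: cis_conv_exp mult.assoc)
  qed simp
  moreover have "cis (of_int k * (2 * pi)) = 1"
    using cos_int_2pin[of k] sin_int_2pin[of k] by (simp add: complex_eq_iff mult_ac)
  ultimately show ?thesis using False by simp
qed

lemma fser_mean:
  assumes "abs_sum a"
  shows "continuous_on UNIV (fser a)" "cmean (fser a) = a 0"
proof -
  have u: "uniform_limit UNIV (\<lambda>X \<theta>. \<Sum>m\<in>X. a m * cis (of_int m * \<theta>)) (fser a) (finite_subsets_at_top UNIV)"
    unfolding fser_def by (rule Weierstrass_m_test_general[where M = "\<lambda>m. norm (a m)"]) (use assms in \<open>auto simp: norm_mult\<close>)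
  have c: "continuous_on S (\<lambda>\<theta>. \<Sum>m\<in>X. a m * cis (of_int m * \<theta>))" for S X
    by (intro continuous_intros continuous_on_cis)
  show "continuous_on UNIV (fser a)"
    by (rule uniform_limit_theorem[OF _ u]) (auto intro!: always_eventually c)
  have u': "uniform_limit (cbox 0 (2 * pi)) (\<lambda>X \<theta>. \<Sum>m\<in>X. a m * cis (of_int m * \<theta>)) (fser a) (finite_subsets_at_top UNIV)"
    by (rule uniform_limit_on_subset[OF u]) auto
  obtain I J where IJ: "\<And>X. ((\<lambda>\<theta>. \<Sum>m\<in>X. a m * cis (of_int m * \<theta>)) has_integral I X) (cbox 0 (2 * pi))"
    "(fser a has_integral J) (cbox 0 (2 * pi))" "(I \<longlongrightarrow> J) (finite_subsets_at_top UNIV)"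
    by (rule uniform_limit_integral_cbox[OF u' c]) auto
  have I: "I X = (if 0 \<in> X then a 0 * of_real (2 * pi) else 0)" if "finite X" for X
  proof -
    have "((\<lambda>\<theta>. \<Sum>m\<in>X. a m * cis (of_int m * \<theta>)) has_integral (\<Sum>m\<in>X. a m * (if m = 0 then of_real (2 * pi) else 0))) (cbox 0 (2 * pi))"
      by (intro has_integral_sum has_integral_mult_right that) (use integral_cis in auto)
    then have "I X = (\<Sum>m\<in>X. a m * (if m = 0 then of_real (2 * pi) else 0))" by (rule has_integral_unique[OF IJ(1)])
    also have "\<dots> = (\<Sum>m\<in>X. if m = 0 then a 0 * of_real (2 * pi) else 0)" by (rule sum.cong) auto
    finally show ?thesis using that by simp
  qed
  have "eventually (\<lambda>X. I X = a 0 * of_real (2 * pi)) (finite_subsets_at_top UNIV)"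
    unfolding eventually_finite_subsets_at_top by (rule exI[of _ "{0}"]) (auto simp: I)
  then have "(I \<longlongrightarrow> a 0 * of_real (2 * pi)) (finite_subsets_at_top UNIV)" by (rule tendsto_eventually)
  then have "J = a 0 * of_real (2 * pi)" by (rule tendsto_unique[OF _ IJ(3), rotated]) simp
  then have "integral {0..2*pi} (fser a) = a 0 * of_real (2 * pi)" using IJ(2) by (simp add: integral_unique)
  then show "cmean (fser a) = a 0" by (simp add: cmean_def)
qed

definition fcnj :: "(int \<Rightarrow> complex) \<Rightarrow> int \<Rightarrow> complex" where
  "fcnj a m = cnj (a (- m))"

lemma fcnj_abs_sum: "abs_sum a \<Longrightarrow> abs_sum (fcnj a)"
  by (rule summable_on_reindex_bij_witness[of UNIV uminus uminus UNIV "\<lambda>m. norm (a m)" "\<lambda>m. norm (fcnj a m)", THEN iffD2])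
     (auto simp: fcnj_def)

lemma fser_fcnj: "fser (fcnj a) \<theta> = cnj (fser a \<theta>)"
proof -
  have "fser (fcnj a) \<theta> = (\<Sum>\<^sub>\<infinity>m. cnj (a m * cis (of_int m * \<theta>)))"
    unfolding fser_def
    by (rule infsum_reindex_bij_witness[of _ uminus uminus]) (auto simp: fcnj_def cis_cnj)
  then show ?thesis unfolding fser_def by (simp only: infsum_cnj)
qed

lemma fser_delta: "fser (\<lambda>m. if m = k then c else 0) \<theta> = c * cis (of_int k * \<theta>)"
  unfolding fser_def
  by (subst infsum_single[of k]) auto

lemma abs_sum_delta: "abs_sum (\<lambda>m. if m = k then c else 0)"
  by (rule finite_nonzero_values_imp_summable_on) (rule finite_subset[of _ "{k}"], auto)

text \<open>Multiplying by \<open>cis (- k * \<theta>)\<close>, itself a Fourier series, and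
  averaging recovers the \<open>k\<close>-th coefficient.\<close>

lemma fser_inj:
  assumes a: "abs_sum a" and b: "abs_sum b" and eq: "\<And>\<theta>. fser a \<theta> = fser b \<theta>"
  shows "a = b"
proof
  fix k
  have coeff: "cmean (\<lambda>\<theta>. fser c \<theta> * cis (of_int (-k) * \<theta>)) = c k" if c: "abs_sum c" for c
  proof -
    let ?d = "\<lambda>m::int. if m = -k then 1 else 0 :: complex"
    have "(\<lambda>\<theta>. fser c \<theta> * cis (of_int (-k) * \<theta>)) = fser (fconv c ?d)"
      by (rule ext) (simp add: fser_fconv[OF c abs_sum_delta] fser_delta del: of_int_minus)
    then have "cmean (\<lambda>\<theta>. fser c \<theta> * cis (of_int (-k) * \<theta>)) = fconv c ?d 0"
      by (simp only: fser_mean(2)[OF fconv_abs_sum[OF c abs_sum_delta]])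
    also have "\<dots> = c k" unfolding fconv_def by (subst infsum_single[of k]) auto
    finally show ?thesis .
  qed
  show "a k = b k" using coeff[OF a] coeff[OF b] eq by simp
qed

lemma fser_add: "abs_sum a \<Longrightarrow> abs_sum b \<Longrightarrow> fser (\<lambda>m. a m + b m) \<theta> = fser a \<theta> + fser b \<theta>"
  unfolding fser_def distrib_right
  by (rule infsum_add[OF abs_summable_summable[OF abs_sum_twist] abs_summable_summable[OF abs_sum_twist]])

lemma abs_sum_add: "abs_sum a \<Longrightarrow> abs_sum b \<Longrightarrow> abs_sum (\<lambda>m. a m + b m)"
  by (rule Infinite_Sum.abs_summable_on_comparison_test'[OF summable_on_add[of "\<lambda>m. norm (a m)" _ "\<lambda>m. norm (b m)"]]) (auto intro: norm_triangle_ineq)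

lemma fser_uminus: "fser (\<lambda>m. - a m) \<theta> = - fser a \<theta>"
  unfolding fser_def by (simp add: infsum_uminus)

lemma abs_sum_restrict: "abs_sum a \<Longrightarrow> abs_sum (\<lambda>m. if P m then a m else 0)"
  by (rule Infinite_Sum.abs_summable_on_comparison_test[of a]) auto

lemma fser_sum: "finite S \<Longrightarrow> (\<And>i. i \<in> S \<Longrightarrow> abs_sum (a i)) \<Longrightarrow> fser (\<lambda>m. \<Sum>i\<in>S. a i m) \<theta> = (\<Sum>i\<in>S. fser (a i) \<theta>) \<and> abs_sum (\<lambda>m. \<Sum>i\<in>S. a i m)"
proof (induction S rule: finite_induct)
  case empty
  then show ?case by (simp add: fser_def)
next
  case (insert x S)
  then show ?case using fser_add[of "a x" "\<lambda>m. \<Sum>i\<in>S. a i m" \<theta>] abs_sum_add[of "a x" "\<lambda>m. \<Sum>i\<in>S. a i m"] by simp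
qed

section \<open>The Toeplitz operator of the symbol\<close>

definition vhat :: "(nat \<Rightarrow> complex) \<Rightarrow> int \<Rightarrow> complex" where
  "vhat V m = (if m > 0 then V (nat m) else if m < 0 then cnj (V (nat (- m))) else 0)"

definition vfun :: "(nat \<Rightarrow> complex) \<Rightarrow> real \<Rightarrow> real" where
  "vfun V \<theta> = Re (symbol V (cis \<theta>))"

definition abs_coeffs :: "(nat \<Rightarrow> complex) \<Rightarrow> bool" where
  "abs_coeffs V \<longleftrightarrow> (\<lambda>k. norm (V (Suc k))) summable_on UNIV"

lemma vhat_halves:
  assumes V: "abs_coeffs V"
  shows "((\<lambda>m. vhat V m * cis (of_int m * \<theta>)) has_sum (\<Sum>\<^sub>\<infinity>k. V (Suc k) * cis \<theta> ^ Suc k)) {0<..}"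
    and "((\<lambda>m. vhat V m * cis (of_int m * \<theta>)) has_sum (\<Sum>\<^sub>\<infinity>k. cnj (V (Suc k)) * inverse (cis \<theta>) ^ Suc k)) {..<0}"
    and "(\<lambda>k. norm (V (Suc k) * cis \<theta> ^ Suc k)) summable_on UNIV"
    and "(\<lambda>k. norm (cnj (V (Suc k)) * inverse (cis \<theta>) ^ Suc k)) summable_on UNIV"
proof -
  have p: "cis \<theta> ^ Suc (nat (m - 1)) = cis (of_int m * \<theta>)" if "m > 0" for m :: int
  proof -
    have "real (Suc (nat (m - 1))) = of_int m" using that by simp
    then show ?thesis using Complex.DeMoivre[of \<theta> "Suc (nat (m - 1))"] by metis
  qed
  have q: "inverse (cis \<theta>) ^ Suc (nat (- m - 1)) = cis (of_int m * \<theta>)" if "m < 0" for m :: int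
  proof -
    have "real (Suc (nat (- m - 1))) = - of_int m" using that by simp
    then show ?thesis using Complex.DeMoivre[of "- \<theta>" "Suc (nat (- m - 1))"] by (metis cis_inverse minus_mult_minus)
  qed
  show a: "(\<lambda>k. norm (V (Suc k) * cis \<theta> ^ Suc k)) summable_on UNIV"
    and b: "(\<lambda>k. norm (cnj (V (Suc k)) * inverse (cis \<theta>) ^ Suc k)) summable_on UNIV"
    using V by (simp_all add: abs_coeffs_def norm_mult norm_power norm_inverse del: power_Suc)
  have "((\<lambda>k. V (Suc k) * cis \<theta> ^ Suc k) has_sum (\<Sum>\<^sub>\<infinity>k. V (Suc k) * cis \<theta> ^ Suc k)) UNIV"
    by (rule has_sum_infsum[OF abs_summable_summable[OF a]])
  then show "((\<lambda>m. vhat V m * cis (of_int m * \<theta>)) has_sum (\<Sum>\<^sub>\<infinity>k. V (Suc k) * cis \<theta> ^ Suc k)) {0<..}"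
    by (rule has_sum_reindex_bij_witness[of _ "\<lambda>k. int (Suc k)" "\<lambda>m. nat (m - 1)", THEN iffD2, rotated -1])
       (auto simp: vhat_def p simp del: power_Suc intro!: arg_cong2[where f = "(*)"] arg_cong[where f = V])
  have "((\<lambda>k. cnj (V (Suc k)) * inverse (cis \<theta>) ^ Suc k) has_sum (\<Sum>\<^sub>\<infinity>k. cnj (V (Suc k)) * inverse (cis \<theta>) ^ Suc k)) UNIV"
    by (rule has_sum_infsum[OF abs_summable_summable[OF b]])
  then show "((\<lambda>m. vhat V m * cis (of_int m * \<theta>)) has_sum (\<Sum>\<^sub>\<infinity>k. cnj (V (Suc k)) * inverse (cis \<theta>) ^ Suc k)) {..<0}"
    by (rule has_sum_reindex_bij_witness[of _ "\<lambda>k. - int (Suc k)" "\<lambda>m. nat (- m - 1)", THEN iffD2, rotated -1])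
       (auto simp: vhat_def q[unfolded cis_inverse] simp del: power_Suc intro!: arg_cong2[where f = "(*)"] arg_cong[where f = V])
qed

lemma vhat_abs_sum:
  assumes V: "abs_coeffs V"
  shows "abs_sum (vhat V)"
proof -
  have "(\<lambda>m. norm (vhat V m)) summable_on {0<..} \<longleftrightarrow> (\<lambda>k. norm (V (Suc k))) summable_on UNIV"
    by (rule summable_on_reindex_bij_witness[of _ "\<lambda>k. int (Suc k)" "\<lambda>m. nat (m - 1)"])
       (auto simp: vhat_def Suc_nat_eq_nat_zadd1)
  moreover have "(\<lambda>m. norm (vhat V m)) summable_on {..<0} \<longleftrightarrow> (\<lambda>k. norm (V (Suc k))) summable_on UNIV"
    by (rule summable_on_reindex_bij_witness[of _ "\<lambda>k. - int (Suc k)" "\<lambda>m. nat (- m - 1)"])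
       (auto simp: vhat_def Suc_nat_eq_nat_zadd1)
  ultimately have "(\<lambda>m. norm (vhat V m)) summable_on ({0<..} \<union> ({..<0} \<union> {0}))"
    using V unfolding abs_coeffs_def by (intro summable_on_Un_disjoint) auto
  moreover have "{0<..} \<union> ({..<0} \<union> {0::int}) = UNIV" by auto
  ultimately show ?thesis by (simp only:)
qed

lemma fser_vhat:
  assumes V: "abs_coeffs V"
  shows "fser (vhat V) \<theta> = of_real (vfun V \<theta>)"
proof -
  let ?p = "\<lambda>k. V (Suc k) * cis \<theta> ^ Suc k" and ?q = "\<lambda>k. cnj (V (Suc k)) * inverse (cis \<theta>) ^ Suc k"
  note h = vhat_halves[OF V, of \<theta>]
  have "((\<lambda>m. vhat V m * cis (of_int m * \<theta>)) has_sum (infsum ?p UNIV + infsum ?q UNIV)) ({0<..} \<union> {..<0})"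
    by (rule has_sum_Un_disjoint[OF h(1,2)]) auto
  then have "((\<lambda>m. vhat V m * cis (of_int m * \<theta>)) has_sum (infsum ?p UNIV + infsum ?q UNIV)) UNIV"
    by (rule has_sum_cong_neutral[THEN iffD1, rotated -1]) (auto simp: vhat_def)
  then have "fser (vhat V) \<theta> = infsum ?p UNIV + infsum ?q UNIV"
    unfolding fser_def by (rule infsumI)
  also have "\<dots> = symbol V (cis \<theta>)"
  proof -
    have "?p sums infsum ?p UNIV" "?q sums infsum ?q UNIV"
      by (rule has_sum_imp_sums[OF has_sum_infsum[OF abs_summable_summable]], rule h)+
    from sums_add[OF this(2,1)] show ?thesis unfolding symbol_def by (simp add: sums_iff add.commute)
  qed
  finally have e: "fser (vhat V) \<theta> = symbol V (cis \<theta>)" .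
  have "fcnj (vhat V) = vhat V" by (auto simp: fcnj_def vhat_def fun_eq_iff)
  then have "cnj (fser (vhat V) \<theta>) = fser (vhat V) \<theta>" using fser_fcnj[of "vhat V" \<theta>] by simp
  then have "Im (fser (vhat V) \<theta>) = 0" by (simp add: complex_eq_iff)
  then show ?thesis using e by (simp add: vfun_def complex_eq_iff)
qed

text \<open>The index \<open>l - k\<close>, transposed against the usual convention, makes
  \<open>V j\<close> couple \<open>k\<close> to \<open>k + j\<close>, as the creation term of
  \<open>lax\<close> does once \<open>p_j\<close> is evaluated at \<open>V j\<close>.\<close>

definition toep :: "(nat \<Rightarrow> complex) \<Rightarrow> (nat \<Rightarrow> complex) \<Rightarrow> nat \<Rightarrow> complex" where
  "toep V g k = (\<Sum>\<^sub>\<infinity>l. vhat V (int l - int k) * g l)"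

definition tau :: "(nat \<Rightarrow> complex) \<Rightarrow> nat \<Rightarrow> complex" where
  "tau V k = (toep V ^^ k) (\<lambda>i. if i = 0 then 1 else 0) 0"

text \<open>The transposed convention places the Hardy space on nonpositive frequencies, so that
  \<open>toep\<close> becomes convolution with \<open>vhat\<close> followed by cutting off positive
  frequencies.\<close>

definition xseq :: "(nat \<Rightarrow> complex) \<Rightarrow> nat \<Rightarrow> int \<Rightarrow> complex" where
  "xseq V k m = (if m \<le> 0 then (toep V ^^ k) (\<lambda>i. if i = 0 then 1 else 0) (nat (- m)) else 0)"

lemma xseq_Suc: "xseq V (Suc k) m = (if m \<le> 0 then fconv (vhat V) (xseq V k) m else 0)"
proof (cases "m \<le> 0")
  case True
  let ?g = "(toep V ^^ k) (\<lambda>i. if i = 0 then 1 else 0)"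
  have "xseq V (Suc k) m = (\<Sum>\<^sub>\<infinity>l. vhat V (int l - int (nat (- m))) * ?g l)"
    using True by (simp add: xseq_def toep_def)
  also have "\<dots> = (\<Sum>\<^sub>\<infinity>i\<in>{m..}. vhat V i * xseq V k (m - i))"
    using True
    by (intro infsum_reindex_bij_witness[of _ "\<lambda>i. nat (i - m)" "\<lambda>l. int l + m"]) (auto simp: xseq_def)
  also have "\<dots> = fconv (vhat V) (xseq V k) m"
    unfolding fconv_def by (rule infsum_cong_neutral) (auto simp: xseq_def)
  finally show ?thesis using True by simp
qed (simp add: xseq_def)

lemma xseq_0: "xseq V 0 = (\<lambda>m. if m = 0 then 1 else 0)"
  by (auto simp: xseq_def fun_eq_iff)

lemma xseq_abs_sum: "abs_coeffs V \<Longrightarrow> abs_sum (xseq V k)"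
proof (induction k)
  case 0
  then show ?case using abs_sum_delta[of 0 1] by (simp add: xseq_0)
next
  case (Suc k)
  then show ?case
    unfolding xseq_Suc[abs_def] by (intro abs_sum_restrict fconv_abs_sum vhat_abs_sum) auto
qed

lemma cmean_cnj: "cmean (\<lambda>\<theta>. cnj (f \<theta>)) = cnj (cmean f)"
  by (simp add: cmean_def integral_cnj)

lemma fconv_one_sided:
  assumes a: "\<And>m. m < 0 \<Longrightarrow> a m = 0" and b: "\<And>m. m < 0 \<Longrightarrow> b m = 0"
  shows "m < 0 \<Longrightarrow> fconv a b m = 0" "fconv a b 0 = a 0 * b 0"
proof -
  show "fconv a b m = 0" if "m < 0"
  proof -
    have "a i * b (m - i) = 0" for i using a[of i] b[of "m - i"] that by (cases "i < 0") auto
    then show ?thesis unfolding fconv_def by (intro infsum_0)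
  qed
  have "a i * b (0 - i) = 0" if "i \<noteq> 0" for i using a[of i] b[of "- i"] that by (cases "i < 0") auto
  then show "fconv a b 0 = a 0 * b 0" unfolding fconv_def by (subst infsum_single[of 0]) auto
qed

text \<open>Let \<open>X(u) = \<Sum> u\<^sup>k X\<^sub>k\<close> be the Fourier series of the Toeplitz resolvent applied to the vacuum.
  Then \<open>(1 - u v) X(u) cnj X(u)\<close> is real and has no negative frequencies, hence it is the constant
  \<open>\<Sum> \<tau>\<^sub>n u\<^sup>n\<close>. Dividing by \<open>1 - u v\<close> and averaging over the circle gives the identity, since by
  self-adjointness each \<open>X\<^sub>i cnj X\<^sub>n\<^sub>-\<^sub>i\<close> has mean \<open>\<tau>\<^sub>n\<close>.\<close>
lemma szego_identity:
  assumes V: "abs_coeffs V"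
  shows "of_nat (Suc n) * tau V n = (\<Sum>k\<le>n. tau V k * cmean (\<lambda>\<theta>. of_real (vfun V \<theta> ^ (n - k))))"
proof -
  define X where "X k = fser (xseq V k)" for k
  define v where "v \<theta> = complex_of_real (vfun V \<theta>)" for \<theta>
  \<comment> \<open>The part that the projection cuts off, of strictly positive frequency.\<close>
  define y where "y k m = (if m > 0 then fconv (vhat V) (xseq V k) m else 0)" for k m
  have ax: "abs_sum (xseq V k)" for k by (rule xseq_abs_sum[OF V])
  have av: "abs_sum (vhat V)" by (rule vhat_abs_sum[OF V])
  have ay: "abs_sum (y k)" for k unfolding y_def[abs_def] by (intro abs_sum_restrict fconv_abs_sum av ax)
  have fv: "fser (vhat V) \<theta> = v \<theta>" for \<theta> by (simp add: v_def fser_vhat[OF V])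
  have vX: "v \<theta> * X k \<theta> = X (Suc k) \<theta> + fser (y k) \<theta>" for k \<theta>
  proof -
    have "v \<theta> * X k \<theta> = fser (fconv (vhat V) (xseq V k)) \<theta>" by (simp add: fser_fconv[OF av ax] fv X_def)
    also have "fconv (vhat V) (xseq V k) = (\<lambda>m. xseq V (Suc k) m + y k m)"
      by (auto simp: xseq_Suc y_def fun_eq_iff)
    finally show ?thesis by (simp add: fser_add[OF ax ay] X_def)
  qed
  have X0: "X 0 \<theta> = 1" for \<theta> by (simp add: X_def xseq_0 fser_delta)
  \<comment> \<open>The coefficients of \<open>(1 - u v) X(u)\<close> in the notation above the
    lemma: the projected parts cancel, and what remains has no negative frequencies.\<close>
  define u where "u k = (case k of 0 \<Rightarrow> (\<lambda>m. if m = 0 then 1 else 0) | Suc j \<Rightarrow> (\<lambda>m. - y j m))" for k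
  have au: "abs_sum (u k)" for k using ay abs_sum_delta[of 0 1] by (cases k) (auto simp: u_def)
  have u0: "u k 0 = (if k = 0 then 1 else 0)" and um: "m < 0 \<Longrightarrow> u k m = 0" for k m
    by (cases k; simp add: u_def y_def)+
  define Z where "Z n \<theta> = (\<Sum>i\<le>n. X i \<theta> * cnj (X (n - i) \<theta>))" for n \<theta>
  define w where "w n m = (\<Sum>i\<le>n. fconv (u i) (fcnj (xseq V (n - i))) m)" for n m
  have aw: "abs_sum (w n)" and fw: "fser (w n) \<theta> = (\<Sum>i\<le>n. fser (u i) \<theta> * cnj (X (n - i) \<theta>))" for n \<theta>
    using fser_sum[of "{..n}" "\<lambda>i. fconv (u i) (fcnj (xseq V (n - i)))" \<theta>] fconv_abs_sum[OF au fcnj_abs_sum[OF ax]]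
    unfolding w_def[abs_def] by (auto simp: fser_fconv[OF au fcnj_abs_sum[OF ax]] fser_fcnj X_def)
  have fx: "fcnj (xseq V k) m = 0" if "m < 0" for k m using that by (simp add: fcnj_def xseq_def)
  have fx0: "fcnj (xseq V k) 0 = cnj (tau V k)" for k by (simp add: fcnj_def xseq_def tau_def)
  have wm: "w n m = 0" if "m < 0" for n m
    unfolding w_def using that by (intro sum.neutral ballI fconv_one_sided(1) um fx)
  have w0: "w n 0 = cnj (tau V n)" for n
  proof -
    have "w n 0 = (\<Sum>i\<le>n. u i 0 * fcnj (xseq V (n - i)) 0)"
      unfolding w_def by (intro sum.cong refl fconv_one_sided(2) um fx)
    also have "\<dots> = (\<Sum>i\<le>n. if i = 0 then cnj (tau V n) else 0)"
      by (intro sum.cong) (auto simp: u0 fx0)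
    finally show ?thesis by simp
  qed
  have fu: "fser (u i) \<theta> = X i \<theta> - (case i of 0 \<Rightarrow> 0 | Suc j \<Rightarrow> v \<theta> * X j \<theta>)" for i \<theta>
    by (cases i) (simp_all add: u_def X0 fser_delta fser_uminus vX)
  have W: "fser (w n) \<theta> = Z n \<theta> - (case n of 0 \<Rightarrow> 0 | Suc j \<Rightarrow> v \<theta> * Z j \<theta>)" for n \<theta>
  proof -
    have "fser (w n) \<theta> = Z n \<theta> - (\<Sum>i\<le>n. (case i of 0 \<Rightarrow> 0 | Suc j \<Rightarrow> v \<theta> * X j \<theta>) * cnj (X (n - i) \<theta>))"
      unfolding fw fu Z_def by (simp add: left_diff_distrib sum_subtractf)
    also have "(\<Sum>i\<le>n. (case i of 0 \<Rightarrow> 0 | Suc j \<Rightarrow> v \<theta> * X j \<theta>) * cnj (X (n - i) \<theta>)) = (case n of 0 \<Rightarrow> 0 | Suc j \<Rightarrow> v \<theta> * Z j \<theta>)"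
      by (cases n) (simp_all add: sum.atMost_Suc_shift Z_def sum_distrib_left mult.assoc del: sum.atMost_Suc)
    finally show ?thesis .
  qed
  have Zr: "cnj (Z n \<theta>) = Z n \<theta>" for n \<theta>
  proof -
    have "cnj (Z n \<theta>) = (\<Sum>i\<le>n. X (n - i) \<theta> * cnj (X i \<theta>))" by (simp add: Z_def mult.commute)
    also have "\<dots> = Z n \<theta>" unfolding Z_def
      by (rule sum.reindex_bij_witness[of _ "\<lambda>i. n - i" "\<lambda>i. n - i"]) auto
    finally show ?thesis .
  qed
  have "cnj (fser (w n) \<theta>) = fser (w n) \<theta>" for n \<theta>
    unfolding W by (cases n) (simp_all add: Zr v_def)
  \<comment> \<open>A real series has conjugate-symmetric coefficients; without negative frequencies
    it is therefore constant.\<close>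
  then have "fcnj (w n) = w n" for n
    by (intro fser_inj fcnj_abs_sum aw) (simp add: fser_fcnj)
  then have wc: "cnj (w n (- m)) = w n m" for n m by (metis fcnj_def)
  have wz: "w n m = 0" if "m \<noteq> 0" for n m
    using wc[of n m] wm[of m n] wm[of "- m" n] that by (cases "m < 0") auto
  have tr: "cnj (tau V n) = tau V n" for n using wc[of n 0] w0[of n] by simp
  have "w n = (\<lambda>m. if m = 0 then tau V n else 0)" for n using wz w0 tr by (auto simp: fun_eq_iff)
  then have fwt: "fser (w n) \<theta> = tau V n" for n \<theta> by (simp add: fser_delta)
  \<comment> \<open>Division by \<open>1 - u v\<close> as a formal power series.\<close>
  have Zv: "Z n \<theta> = (\<Sum>k\<le>n. tau V k * v \<theta> ^ (n - k))" for n \<theta>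
  proof (induction n)
    case 0
    then show ?case using W[of 0 \<theta>] fwt[of 0 \<theta>] by simp
  next
    case (Suc n)
    have "Z (Suc n) \<theta> = tau V (Suc n) + v \<theta> * Z n \<theta>"
      using W[of "Suc n" \<theta>] fwt[of "Suc n" \<theta>] by (simp add: algebra_simps)
    also have "v \<theta> * Z n \<theta> = (\<Sum>k\<le>n. tau V k * v \<theta> ^ (Suc n - k))"
      unfolding Suc sum_distrib_left by (intro sum.cong) (auto simp: Suc_diff_le)
    finally show ?case by simp
  qed
  define ip where "ip i j = fconv (xseq V i) (fcnj (xseq V j)) 0" for i j
  have cX: "cmean (\<lambda>\<theta>. X i \<theta> * cnj (X j \<theta>)) = ip i j" for i j
  proof -
    have "(\<lambda>\<theta>. X i \<theta> * cnj (X j \<theta>)) = fser (fconv (xseq V i) (fcnj (xseq V j)))"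
      by (simp add: fun_eq_iff fser_fconv[OF ax fcnj_abs_sum[OF ax]] fser_fcnj X_def)
    then show ?thesis by (simp only: fser_mean(2)[OF fconv_abs_sum[OF ax fcnj_abs_sum[OF ax]]] ip_def)
  qed
  \<comment> \<open>The cut-off part is orthogonal to the Hardy space, so inside a mean the
    projection may be dropped. This makes the operator symmetric and \<open>ip i j\<close> a
    function of \<open>i + j\<close>.\<close>
  have yX: "fconv (y i) (fcnj (xseq V j)) 0 = 0" for i j
    by (subst fconv_one_sided(2)) (auto simp: y_def fx)
  have shift: "fconv (fconv (vhat V) (xseq V i)) (fcnj (xseq V j)) 0 = ip (Suc i) j" for i j
  proof -
    let ?c = "fcnj (xseq V j)"
    have "fser (fconv (fconv (vhat V) (xseq V i)) ?c) \<theta> = fser (\<lambda>m. fconv (xseq V (Suc i)) ?c m + fconv (y i) ?c m) \<theta>" for \<theta>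
      using vX[of \<theta> i]
      by (simp add: fser_add fser_fconv fconv_abs_sum ax av ay fcnj_abs_sum fv X_def distrib_right)
    then have "fconv (fconv (vhat V) (xseq V i)) ?c = (\<lambda>m. fconv (xseq V (Suc i)) ?c m + fconv (y i) ?c m)"
      by (intro fser_inj abs_sum_add fconv_abs_sum ax av ay fcnj_abs_sum)
    then show ?thesis using yX by (simp add: ip_def)
  qed
  have cm: "cmean (\<lambda>\<theta>. v \<theta> * (X i \<theta> * cnj (X j \<theta>))) = ip (Suc i) j" for i j
  proof -
    have "(\<lambda>\<theta>. v \<theta> * (X i \<theta> * cnj (X j \<theta>))) = fser (fconv (fconv (vhat V) (xseq V i)) (fcnj (xseq V j)))"
      by (simp add: fun_eq_iff fser_fconv fconv_abs_sum ax av fcnj_abs_sum fser_fcnj X_def fv mult.assoc)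
    then show ?thesis
      using shift by (simp only: fser_mean(2)[OF fconv_abs_sum[OF fconv_abs_sum[OF av ax] fcnj_abs_sum[OF ax]]])
  qed
  have ipc: "ip j i = cnj (ip i j)" for i j
    unfolding cX[symmetric] cmean_cnj[symmetric] by (simp add: mult.commute)
  have ips: "ip (Suc i) j = ip i (Suc j)" for i j
  proof -
    have "ip i (Suc j) = cnj (cmean (\<lambda>\<theta>. v \<theta> * (X j \<theta> * cnj (X i \<theta>))))" by (subst ipc) (simp add: cm)
    also have "\<dots> = cmean (\<lambda>\<theta>. v \<theta> * (X i \<theta> * cnj (X j \<theta>)))"
      unfolding cmean_cnj[symmetric] by (simp add: v_def mult_ac)
    finally show ?thesis by (simp add: cm)
  qed
  have ipt: "ip i j = tau V (i + j)" for i j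
  proof (induction j arbitrary: i)
    case 0
    have "fcnj (xseq V 0) = (\<lambda>m. if m = 0 then 1 else 0)" by (auto simp: fcnj_def xseq_0 fun_eq_iff)
    then have "ip i 0 = (\<Sum>\<^sub>\<infinity>l. xseq V i l * (if l = 0 then 1 else 0))" by (simp add: ip_def fconv_def)
    also have "\<dots> = xseq V i 0" by (subst infsum_single[of 0]) auto
    finally show ?case by (simp add: xseq_def tau_def)
  next
    case (Suc j)
    then show ?case using ips[of i j] by simp
  qed
  have cont: "continuous_on S (X i)" for S i
    unfolding X_def using fser_mean(1)[OF ax] continuous_on_subset by blast
  have contv: "continuous_on S v" for S
    using fser_mean(1)[OF av] continuous_on_subset[of UNIV "fser (vhat V)" S] by (simp add: fv[abs_def, symmetric] fun_eq_iff fv[symmetric] cong: continuous_on_cong)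
  have cs: "cmean (\<lambda>\<theta>. \<Sum>i\<le>n. f i \<theta>) = (\<Sum>i\<le>n. cmean (f i))" if "\<And>i. i \<le> n \<Longrightarrow> continuous_on {0..2*pi} (f i)" for f :: "nat \<Rightarrow> real \<Rightarrow> complex" and n
    unfolding cmean_def using that
    by (subst integral_sum) (auto intro!: integrable_continuous_real simp: sum_divide_distrib)
  have "of_nat (Suc n) * tau V n = (\<Sum>i\<le>n. ip i (n - i))" by (simp add: ipt)
  also have "\<dots> = cmean (Z n)" unfolding Z_def[abs_def] cX[symmetric]
    by (rule cs[symmetric]) (intro continuous_intros cont)
  also have "\<dots> = cmean (\<lambda>\<theta>. \<Sum>k\<le>n. tau V k * v \<theta> ^ (n - k))" by (simp add: Zv[abs_def])
  also have "\<dots> = (\<Sum>k\<le>n. cmean (\<lambda>\<theta>. tau V k * v \<theta> ^ (n - k)))"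
    by (rule cs) (intro continuous_intros contv)
  also have "\<dots> = (\<Sum>k\<le>n. tau V k * cmean (\<lambda>\<theta>. v \<theta> ^ (n - k)))"
    by (simp add: cmean_def)
  finally show ?thesis by (simp add: v_def)
qed

section \<open>The limit shape\<close>

lemma analytic_abs_coeffs:
  assumes "analytic_symbol V"
  shows "abs_coeffs V"
proof -
  obtain r where r: "r > 1" "summable (\<lambda>k. norm (V (Suc k)) * r ^ Suc k)"
    using assms by (auto simp: analytic_symbol_def)
  have "summable (\<lambda>k. norm (V (Suc k)))"
  proof (rule summable_comparison_test'[OF r(2)])
    fix k :: nat
    have "1 \<le> r ^ Suc k" using r(1) by (intro one_le_power) auto
    then show "norm (norm (V (Suc k))) \<le> norm (V (Suc k)) * r ^ Suc k"
      by (simp add: mult_le_cancel_left1 del: power_Suc)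
  qed
  then have "(\<lambda>k. norm (V (Suc k))) summable_on UNIV"
    by (intro norm_summable_imp_summable_on) simp
  then show ?thesis by (simp add: abs_coeffs_def)
qed

lemma vfun_continuous:
  assumes V: "abs_coeffs V"
  shows "continuous_on S (vfun V)"
proof -
  have "continuous_on S (fser (vhat V))"
    using fser_mean(1)[OF vhat_abs_sum[OF V]] continuous_on_subset by blast
  then have "continuous_on S (\<lambda>\<theta>. Re (fser (vhat V) \<theta>))" by (intro continuous_intros)
  then show ?thesis by (simp add: fser_vhat[OF V])
qed

lemma vfun_bounded:
  assumes V: "abs_coeffs V"
  shows "\<exists>R>0. \<forall>\<theta>. \<bar>vfun V \<theta>\<bar> \<le> R"
proof -
  define R where "R = infsum (\<lambda>m. norm (vhat V m)) UNIV"
  have "\<bar>vfun V \<theta>\<bar> \<le> R" for \<theta>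
  proof -
    have "\<bar>vfun V \<theta>\<bar> = norm (fser (vhat V) \<theta>)" by (simp add: fser_vhat[OF V])
    also have "\<dots> \<le> R"
      unfolding fser_def R_def using norm_infsum_bound[OF abs_sum_twist[OF vhat_abs_sum[OF V]], of \<theta>]
      by (simp add: norm_mult)
    finally show ?thesis .
  qed
  then show ?thesis by (intro exI[of _ "max 1 R"]) (auto simp: le_max_iff_disj)
qed

text \<open>The average of the kinks \<open>\<bar>c - v(e\<^sup>i\<^sup>\<theta>)\<bar>\<close> over the circle: its second derivative is twice the
  push-forward of the normalised uniform measure along the symbol.\<close>
definition cshape :: "(nat \<Rightarrow> complex) \<Rightarrow> real \<Rightarrow> real" where
  "cshape V c = integral {0..2*pi} (\<lambda>\<theta>. \<bar>c - vfun V \<theta>\<bar>) / (2 * pi)"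

definition vmom :: "(nat \<Rightarrow> complex) \<Rightarrow> nat \<Rightarrow> real" where
  "vmom V l = integral {0..2*pi} (\<lambda>\<theta>. vfun V \<theta> ^ l) / (2 * pi)"

lemma vmom_cmean:
  assumes V: "abs_coeffs V"
  shows "cmean (\<lambda>\<theta>. of_real (vfun V \<theta> ^ l)) = of_real (vmom V l)"
proof -
  have "(\<lambda>\<theta>. vfun V \<theta> ^ l) integrable_on {0..2*pi}"
    by (intro integrable_continuous_real continuous_intros vfun_continuous[OF V])
  from integral_linear[OF this bounded_linear_of_real[where 'a = complex]]
  show ?thesis unfolding cmean_def vmom_def by (simp only: comp_def of_real_divide)
qed

lemma vmom_1:
  assumes V: "abs_coeffs V"
  shows "vmom V 1 = 0"
proof -
  have "of_real (vmom V 1) = cmean (fser (vhat V))"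
    unfolding vmom_cmean[OF V, symmetric] by (simp add: fser_vhat[OF V, abs_def])
  also have "\<dots> = 0" by (simp add: fser_mean(2)[OF vhat_abs_sum[OF V]] vhat_def)
  finally show ?thesis by simp
qed

context
  fixes V :: "nat \<Rightarrow> complex"
  assumes V: "abs_coeffs V"
begin

lemma int_abs: "(\<lambda>\<theta>. \<bar>c - vfun V \<theta>\<bar>) integrable_on {0..2*pi}"
  by (intro integrable_continuous_real continuous_intros vfun_continuous[OF V])

lemma int_v: "vfun V integrable_on {0..2*pi}"
  by (intro integrable_continuous_real vfun_continuous[OF V])

lemma cshape_lipschitz: "\<bar>cshape V x - cshape V y\<bar> \<le> \<bar>x - y\<bar>"
proof -
  have "norm (integral {0..2*pi} (\<lambda>\<theta>. \<bar>x - vfun V \<theta>\<bar> - \<bar>y - vfun V \<theta>\<bar>)) \<le> integral {0..2*pi} (\<lambda>\<theta>. \<bar>x - y\<bar>)"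
    by (rule integral_norm_bound_integral) (auto intro!: integrable_diff int_abs)
  then have "\<bar>integral {0..2*pi} (\<lambda>\<theta>. \<bar>x - vfun V \<theta>\<bar>) - integral {0..2*pi} (\<lambda>\<theta>. \<bar>y - vfun V \<theta>\<bar>)\<bar> \<le> 2 * pi * \<bar>x - y\<bar>"
    by (simp add: Henstock_Kurzweil_Integration.integral_diff[OF int_abs int_abs])
  then show ?thesis
    unfolding cshape_def diff_divide_distrib[symmetric] by (simp add: field_simps)
qed

lemma cshape_continuous: "continuous_on S (cshape V)"
  unfolding continuous_on_iff using cshape_lipschitz
  by (metis dist_real_def dual_order.strict_trans2)

text \<open>Beyond the range of the symbol the absolute value opens with constant sign, and the
  remaining linear term integrates to 0 because the symbol has no constant Fourier
  coefficient.\<close>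

lemma cshape_far:
  assumes R: "\<And>\<theta>. \<bar>vfun V \<theta>\<bar> \<le> R" and c: "R \<le> \<bar>c\<bar>"
  shows "cshape V c = \<bar>c\<bar>"
proof -
  define s where "s = (if c \<ge> 0 then 1 else - 1 :: real)"
  have "\<bar>c - vfun V \<theta>\<bar> = \<bar>c\<bar> - s * vfun V \<theta>" for \<theta>
    using R[of \<theta>] c by (auto simp: s_def)
  then have "integral {0..2*pi} (\<lambda>\<theta>. \<bar>c - vfun V \<theta>\<bar>) = integral {0..2*pi} (\<lambda>\<theta>. \<bar>c\<bar> - s * vfun V \<theta>)" by simp
  also have "\<dots> = \<bar>c\<bar> * (2 * pi) - s * integral {0..2*pi} (vfun V)"
    by (subst Henstock_Kurzweil_Integration.integral_diff) (auto intro!: integrable_continuous_real continuous_intros vfun_continuous[OF V])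
  also have "integral {0..2*pi} (vfun V) = 0" using vmom_1[OF V] by (simp add: vmom_def)
  finally show ?thesis by (simp add: cshape_def)
qed

lemma pushF_level:
  "pushF V c = measure lborel {\<theta>\<in>{0..2*pi}. vfun V \<theta> < c} / (2 * pi)"
    and level_sets: "{\<theta>\<in>{0..2*pi}. vfun V \<theta> < c} \<in> sets lborel"
proof -
  have m: "vfun V \<in> borel_measurable borel" by (rule borel_measurable_continuous_onI[OF vfun_continuous[OF V]])
  have "{\<theta>\<in>{0..2*pi}. vfun V \<theta> < c} = {0..2*pi} \<inter> vfun V -` {..<c}" by auto
  then show s: "{\<theta>\<in>{0..2*pi}. vfun V \<theta> < c} \<in> sets lborel"
    using measurable_sets[OF m, of "{..<c}"] by auto
  have "{\<theta>\<in>{0..<2*pi}. vfun V \<theta> < c} = {\<theta>\<in>{0..2*pi}. vfun V \<theta> < c} - {2*pi}" by auto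
  moreover have "measure lborel ({\<theta>\<in>{0..2*pi}. vfun V \<theta> < c} - {2*pi}) = measure lborel {\<theta>\<in>{0..2*pi}. vfun V \<theta> < c}"
    using s by (intro measure_Diff_null_set) auto
  ultimately show "pushF V c = measure lborel {\<theta>\<in>{0..2*pi}. vfun V \<theta> < c} / (2 * pi)"
    by (simp add: pushF_def vfun_def)
qed

lemma level_integral:
  "((\<lambda>\<theta>. if vfun V \<theta> < c then 1 else 0) has_integral 2 * pi * pushF V c) {0..2*pi}"
proof -
  let ?A = "{\<theta>\<in>{0..2*pi}. vfun V \<theta> < c}"
  have "emeasure lborel ?A \<le> emeasure lborel {0..2*pi}" by (rule emeasure_mono) auto
  also have "\<dots> < \<infinity>" by simp
  finally have "((\<lambda>x. 1::real) has_integral measure lborel ?A) ?A"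
    using level_sets[of c] by (intro has_integral_measure_lborel) auto
  then have "((\<lambda>x. if x \<in> ?A then 1 else 0 :: real) has_integral measure lborel ?A) {0..2*pi}"
    by (subst has_integral_restrict) auto
  then have "((\<lambda>\<theta>. if vfun V \<theta> < c then 1 else 0) has_integral measure lborel ?A) {0..2*pi}"
    by (rule has_integral_eq[rotated]) auto
  then show ?thesis by (simp add: pushF_level)
qed

text \<open>Pointwise in \<theta>, the increment of \<open>\<bar>c - vfun V \<theta>\<bar>\<close>
  over a step \<open>h\<close> is \<open>h\<close> where the symbol is below \<open>c\<close> and at
  least \<open>-h\<close> elsewhere; it is \<open>-h\<close> where the symbol is at least
  \<open>c + h\<close> and at most \<open>h\<close> elsewhere. Averaging gives both bounds.\<close>

lemma cshape_slope:
  assumes "h > 0"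
  shows "h * (2 * pushF V c - 1) \<le> cshape V (c + h) - cshape V c"
    and "cshape V (c + h) - cshape V c \<le> h * (2 * pushF V (c + h) - 1)"
proof -
  have D: "((\<lambda>\<theta>. \<bar>c + h - vfun V \<theta>\<bar> - \<bar>c - vfun V \<theta>\<bar>) has_integral 2 * pi * (cshape V (c + h) - cshape V c)) {0..2*pi}"
    using has_integral_diff[OF integrable_integral[OF int_abs[of "c + h"]] integrable_integral[OF int_abs[of c]]]
    by (simp add: cshape_def diff_divide_distrib[symmetric])
  have L: "((\<lambda>\<theta>. h * (2 * (if vfun V \<theta> < d then 1 else 0) - 1)) has_integral 2 * pi * (h * (2 * pushF V d - 1))) {0..2*pi}" for d
  proof -
    have "((\<lambda>\<theta>. h * (2 * (if vfun V \<theta> < d then 1 else 0) - 1)) has_integral h * (2 * (2 * pi * pushF V d) - (2 * pi - 0) *\<^sub>R 1)) {0..2*pi}"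
      by (intro has_integral_mult_right has_integral_diff level_integral) (use has_integral_const_real[of "1::real" 0 "2*pi"] in simp)
    then show ?thesis by (simp add: algebra_simps)
  qed
  have "2 * pi * (h * (2 * pushF V c - 1)) \<le> 2 * pi * (cshape V (c + h) - cshape V c)"
    by (rule has_integral_le[OF L D]) (use assms in auto)
  then show "h * (2 * pushF V c - 1) \<le> cshape V (c + h) - cshape V c"
    by (rule mult_left_le_imp_le) simp
  have "2 * pi * (cshape V (c + h) - cshape V c) \<le> 2 * pi * (h * (2 * pushF V (c + h) - 1))"
    by (rule has_integral_le[OF D L]) (use assms in auto)
  then show "cshape V (c + h) - cshape V c \<le> h * (2 * pushF V (c + h) - 1)"
    by (rule mult_left_le_imp_le) simp
qed

lemma pushF_mono: "mono (pushF V)"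
proof (rule monoI)
  fix x y :: real assume "x \<le> y"
  have "2 * pi * pushF V x \<le> 2 * pi * pushF V y"
    by (rule has_integral_le[OF level_integral level_integral]) (use \<open>x \<le> y\<close> in auto)
  then show "pushF V x \<le> pushF V y" by (rule mult_left_le_imp_le) simp
qed

text \<open>Two values of \<open>pushF\<close> enclose the difference quotient. At an atom of the
  push-forward the one-sided derivatives differ; by monotonicity of \<open>pushF\<close> such points
  are countable, which the almost-everywhere statement tolerates.\<close>

lemma cshape_deriv:
  assumes "isCont (pushF V) c"
  shows "(cshape V has_real_derivative (2 * pushF V c - 1)) (at c)"
proof -
  have lim: "((\<lambda>h. 2 * pushF V (c + h) - 1) \<longlongrightarrow> 2 * pushF V c - 1) (at 0)"
    using assms by (intro tendsto_intros) (auto simp: isCont_def LIM_offset_zero_iff)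
  have "\<bar>(cshape V (c + h) - cshape V c) / h - (2 * pushF V c - 1)\<bar> \<le> \<bar>(2 * pushF V (c + h) - 1) - (2 * pushF V c - 1)\<bar>"
    if "h \<noteq> 0" for h
  proof (cases "h > 0")
    case True
    then have "2 * pushF V c - 1 \<le> (cshape V (c + h) - cshape V c) / h" "(cshape V (c + h) - cshape V c) / h \<le> 2 * pushF V (c + h) - 1"
      using cshape_slope[OF True, of c] by (simp_all add: field_simps)
    then show ?thesis by linarith
  next
    case False
    then have h: "- h > 0" using that by simp
    have "(cshape V (c + h) - cshape V c) / h = (cshape V c - cshape V (c + h)) / (- h)"
      by (simp add: minus_divide_right[symmetric] diff_divide_distrib)
    moreover have "2 * pushF V (c + h) - 1 \<le> (cshape V c - cshape V (c + h)) / (- h)" "(cshape V c - cshape V (c + h)) / (- h) \<le> 2 * pushF V c - 1"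
    proof -
      have e: "c + h + - h = c" by simp
      note cshape_slope[OF h, of "c + h", unfolded e]
      then show "2 * pushF V (c + h) - 1 \<le> (cshape V c - cshape V (c + h)) / (- h)" "(cshape V c - cshape V (c + h)) / (- h) \<le> 2 * pushF V c - 1"
        unfolding pos_le_divide_eq[OF h] pos_divide_le_eq[OF h] by (simp_all only: mult.commute)
    qed
    ultimately show ?thesis by linarith
  qed
  note bound = this
  have "eventually (\<lambda>h::real. h \<noteq> 0) (at 0)" by (rule eventually_neq_at_within)
  then have "eventually (\<lambda>h. norm ((cshape V (c + h) - cshape V c) / h - (2 * pushF V c - 1)) \<le> \<bar>(2 * pushF V (c + h) - 1) - (2 * pushF V c - 1)\<bar>) (at 0)"
    by (rule eventually_mono) (unfold real_norm_def, rule bound)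
  then have "((\<lambda>h. (cshape V (c + h) - cshape V c) / h - (2 * pushF V c - 1)) \<longlongrightarrow> 0) (at 0)"
    by (rule Lim_null_comparison[OF _ tendsto_rabs_zero[OF LIM_zero[OF lim]]])
  then show ?thesis unfolding DERIV_def by (rule LIM_zero_cancel)
qed

lemma limit_shape_cshape: "limit_shape V (cshape V)"
proof -
  obtain R where R: "R > 0" "\<And>\<theta>. \<bar>vfun V \<theta>\<bar> \<le> R" using vfun_bounded[OF V] by blast
  have far: "cshape V c = \<bar>c\<bar>" if "R \<le> \<bar>c\<bar>" for c using cshape_far[OF R(2) that] .
  have "continuous_on {-R..R} (\<lambda>c. cshape V c - \<bar>c\<bar>)" by (intro continuous_intros cshape_continuous)
  then have "set_integrable lborel {-R..R} (\<lambda>c. cshape V c - \<bar>c\<bar>)" by (rule borel_integrable_atLeastAtMost')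
  moreover have "indicat_real {-R..R} c *\<^sub>R (cshape V c - \<bar>c\<bar>) = cshape V c - \<bar>c\<bar>" for c
    using far[of c] by (cases "R \<le> \<bar>c\<bar>") (auto simp: indicator_def not_le abs_less_iff)
  ultimately have int: "integrable lborel (\<lambda>c. cshape V c - \<bar>c\<bar>)" unfolding set_integrable_def by (simp only:)
  have nn: "0 \<le> cshape V c" for c
    unfolding cshape_def by (intro divide_nonneg_nonneg Henstock_Kurzweil_Integration.integral_nonneg int_abs) auto
  have "countable {c. \<not> isCont (pushF V) c}" by (rule mono_ctble_discont[OF pushF_mono])
  then have "{c. \<not> isCont (pushF V) c} \<in> null_sets lborel" by (rule countable_imp_null_set_lborel)
  then have ae: "AE c in lborel. (cshape V has_real_derivative (2 * pushF V c - 1)) (at c)"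
    by (rule AE_I') (use cshape_deriv in auto)
  show ?thesis unfolding limit_shape_def cont_profile_def
    using cshape_lipschitz nn int far ae by blast
qed

text \<open>For \<open>l \<ge> 2\<close>, exchanging the integrals over \<open>c\<close> and
  \<theta> reduces the claim to \<open>abs_moment\<close> at each value of the symbol; mean zero of
  the symbol removes the \<open>absD\<close> term.\<close>

lemma ch_cshape: "ch l (cshape V) = vmom V l"
proof -
  consider "l = 0" | "l = 1" | "l \<ge> 2" by linarith
  then show ?thesis
  proof cases
    case 1
    then show ?thesis by (simp add: ch_def vmom_def)
  next
    case 2
    then show ?thesis using vmom_1[OF V] by (simp add: ch_def)
  next
    case 3
    obtain R where R: "R > 0" "\<And>\<theta>. \<bar>vfun V \<theta>\<bar> \<le> R" using vfun_bounded[OF V] by blast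
    let ?k = "real (l * (l - 1)) / 2"
    have k: "?k \<noteq> 0" using 3 by simp
    have cont: "continuous_on (cbox (- R, 0) (R, 2 * pi)) (\<lambda>(c, \<theta>). \<bar>c - vfun V \<theta>\<bar> * c ^ (l - 2))"
      by (auto simp: case_prod_unfold intro!: continuous_intros continuous_on_compose2[OF vfun_continuous[OF V, of UNIV]])
    have int: "(\<lambda>c. cshape V c * c ^ (l - 2)) integrable_on {-R..R}"
      by (intro integrable_continuous_real continuous_intros cshape_continuous)
    have vp: "(\<lambda>\<theta>. vfun V \<theta> ^ l) integrable_on {0..2*pi}"
      by (intro integrable_continuous_real continuous_intros vfun_continuous[OF V])
    have "integral {-R..R} (\<lambda>c. cshape V c * c ^ (l - 2)) = integral {-R..R} (\<lambda>c. integral {0..2*pi} (\<lambda>\<theta>. \<bar>c - vfun V \<theta>\<bar> * c ^ (l - 2)) / (2 * pi))"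
      by (simp add: cshape_def)
    also have "\<dots> = integral {-R..R} (\<lambda>c. integral {0..2*pi} (\<lambda>\<theta>. \<bar>c - vfun V \<theta>\<bar> * c ^ (l - 2))) / (2 * pi)"
      by simp
    also have "integral {-R..R} (\<lambda>c. integral {0..2*pi} (\<lambda>\<theta>. \<bar>c - vfun V \<theta>\<bar> * c ^ (l - 2))) =
        integral {0..2*pi} (\<lambda>\<theta>. integral {-R..R} (\<lambda>c. \<bar>c - vfun V \<theta>\<bar> * c ^ (l - 2)))"
      using integral_swap_continuous[OF cont] by simp
    also have "\<dots> = integral {0..2*pi} (\<lambda>\<theta>. (vfun V \<theta> ^ l + absC l R + absD l R * vfun V \<theta>) / ?k)"
      by (intro integral_cong integral_unique abs_moment R 3)
    also have "\<dots> = (integral {0..2*pi} (\<lambda>\<theta>. vfun V \<theta> ^ l) + absC l R * (2 * pi) + absD l R * integral {0..2*pi} (vfun V)) / ?k"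
    proof (rule integral_unique)
      show "((\<lambda>\<theta>. (vfun V \<theta> ^ l + absC l R + absD l R * vfun V \<theta>) / ?k) has_integral
        (integral {0..2*pi} (\<lambda>\<theta>. vfun V \<theta> ^ l) + absC l R * (2 * pi) + absD l R * integral {0..2*pi} (vfun V)) / ?k) {0..2*pi}"
        by (intro has_integral_divide has_integral_add has_integral_mult_right integrable_integral vp int_v)
           (use has_integral_const_real[of "absC l R" 0 "2*pi"] in \<open>simp add: mult.commute\<close>)
    qed
    also have "integral {0..2*pi} (vfun V) = 0" using vmom_1[OF V] by (simp add: vmom_def)
    finally have J: "integral {-R..R} (\<lambda>c. cshape V c * c ^ (l - 2)) = (vmom V l + absC l R) / ?k"
      by (simp add: vmom_def field_simps)
    have "ch l (cshape V) = ?k * ((vmom V l + absC l R) / ?k) - absC l R"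
      by (rule ch_compact[OF cshape_continuous cshape_far[OF R(2)] R(1) 3]) (use integrable_integral[OF int] J in simp_all)
    moreover have "k * (X / k) = X" if "k \<noteq> 0" for k X :: real using that by simp
    ultimately show ?thesis using k by (metis add_diff_cancel_right')
  qed
qed

end

section \<open>Weighted summability\<close>

lemma abs_summable_Sigma_finite:
  fixes f :: "'a \<times> 'b \<Rightarrow> 'c::banach"
  assumes fin: "\<And>p. p \<in> A \<Longrightarrow> finite (J p)"
  shows "(\<lambda>x. norm (f x)) summable_on Sigma A J \<longleftrightarrow> (\<lambda>p. \<Sum>j\<in>J p. norm (f (p, j))) summable_on A"
proof
  assume "(\<lambda>x. norm (f x)) summable_on Sigma A J"
  from summable_on_SigmaD[OF this] have "(\<lambda>p. infsum (\<lambda>j. norm (f (p, j))) (J p)) summable_on A"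
    using fin by (simp add: summable_on_finite)
  then show "(\<lambda>p. \<Sum>j\<in>J p. norm (f (p, j))) summable_on A"
    by (rule summable_on_cong[THEN iffD1, rotated]) (use fin in simp)
next
  assume "(\<lambda>p. \<Sum>j\<in>J p. norm (f (p, j))) summable_on A"
  then show "(\<lambda>x. norm (f x)) summable_on Sigma A J"
    by (rule summable_on_SigmaI[rotated]) (use fin in \<open>auto intro: has_sum_finite\<close>)
qed

lemma infsum_Sigma_finite:
  fixes f :: "'a \<times> 'b \<Rightarrow> 'c::banach"
  assumes fin: "\<And>p. p \<in> A \<Longrightarrow> finite (J p)" and s: "(\<lambda>x. norm (f x)) summable_on Sigma A J"
  shows "infsum f (Sigma A J) = (\<Sum>\<^sub>\<infinity>p\<in>A. \<Sum>j\<in>J p. f (p, j))"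
  unfolding infsum_Sigma_banach[OF abs_summable_summable[OF s], symmetric]
  by (rule infsum_cong) (use fin in simp)

definition all_pairs :: "(nat \<times> nat multiset) set" where
  "all_pairs = UNIV \<times> pos_mset"

lemma all_pairs_move:
  fixes F :: "nat \<Rightarrow> nat multiset \<Rightarrow> nat \<Rightarrow> 'c::banach"
  shows "(\<lambda>(k, \<mu>). \<Sum>j=1..k. norm (F (k - j) (add_mset j \<mu>) j)) summable_on all_pairs \<longleftrightarrow>
         (\<lambda>(k, \<mu>). \<Sum>j\<in>set_mset \<mu>. norm (F k \<mu> j)) summable_on all_pairs" (is "?A \<longleftrightarrow> ?B")
    and "(\<lambda>(k, \<mu>). \<Sum>j\<in>set_mset \<mu>. norm (F k \<mu> j)) summable_on all_pairs \<Longrightarrow>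
         (\<Sum>\<^sub>\<infinity>(k, \<mu>)\<in>all_pairs. \<Sum>j=1..k. F (k - j) (add_mset j \<mu>) j) = (\<Sum>\<^sub>\<infinity>(k, \<mu>)\<in>all_pairs. \<Sum>j\<in>set_mset \<mu>. F k \<mu> j)"
proof -
  let ?S = "{((k, \<mu>), j). \<mu> \<in> pos_mset \<and> 1 \<le> j \<and> j \<le> k \<and> True}"
  let ?T = "{((k, \<mu>), j). \<mu> \<in> pos_mset \<and> j \<in># \<mu> \<and> True}"
  let ?f = "\<lambda>((k, \<mu>), j). F (k - j) (add_mset j \<mu>) j" and ?g = "\<lambda>((k, \<mu>), j). F k \<mu> j"
  let ?b = "\<lambda>((k, \<mu>), j). ((k - j, add_mset j \<mu>), j)"
  have bij: "bij_betw ?b ?S ?T" using move_part_bij[where P = "\<lambda>_. True"] by simp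
  have S: "?S = Sigma all_pairs (\<lambda>(k, \<mu>). {1..k})" and T: "?T = Sigma all_pairs (\<lambda>(k, \<mu>). set_mset \<mu>)"
    by (auto simp: all_pairs_def)
  have fb: "?f x = ?g (?b x)" for x by (simp add: case_prod_unfold)
  have "?A \<longleftrightarrow> (\<lambda>x. norm (?f x)) summable_on ?S"
    unfolding S by (subst abs_summable_Sigma_finite) (auto simp: case_prod_unfold)
  also have "\<dots> \<longleftrightarrow> (\<lambda>x. norm (?g x)) summable_on ?T"
    unfolding fb by (rule summable_on_reindex_bij_betw[OF bij])
  also have "\<dots> \<longleftrightarrow> ?B"
    unfolding T by (subst abs_summable_Sigma_finite) (auto simp: case_prod_unfold)
  finally show AB: "?A \<longleftrightarrow> ?B" .
  assume B: ?B
  have sT: "(\<lambda>x. norm (?g x)) summable_on ?T"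
    using B unfolding T by (subst abs_summable_Sigma_finite) (auto simp: case_prod_unfold)
  have sS: "(\<lambda>x. norm (?f x)) summable_on ?S"
    using B AB unfolding S by (subst abs_summable_Sigma_finite) (auto simp: case_prod_unfold)
  have "(\<Sum>\<^sub>\<infinity>(k, \<mu>)\<in>all_pairs. \<Sum>j=1..k. F (k - j) (add_mset j \<mu>) j) = infsum ?f ?S"
    using sS unfolding S by (subst infsum_Sigma_finite) (auto simp: case_prod_unfold)
  also have "\<dots> = infsum ?g ?T"
    unfolding fb by (rule infsum_reindex_bij_betw[OF bij])
  also have "\<dots> = (\<Sum>\<^sub>\<infinity>(k, \<mu>)\<in>all_pairs. \<Sum>j\<in>set_mset \<mu>. F k \<mu> j)"
    using sT unfolding T by (subst infsum_Sigma_finite) (auto simp: case_prod_unfold)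
  finally show "(\<Sum>\<^sub>\<infinity>(k, \<mu>)\<in>all_pairs. \<Sum>j=1..k. F (k - j) (add_mset j \<mu>) j) = (\<Sum>\<^sub>\<infinity>(k, \<mu>)\<in>all_pairs. \<Sum>j\<in>set_mset \<mu>. F k \<mu> j)" .
qed

lemma all_pairs_move_down:
  fixes F :: "nat \<Rightarrow> nat multiset \<Rightarrow> nat \<Rightarrow> 'c::banach"
  shows "(\<lambda>(k, \<mu>). \<Sum>j\<in>set_mset \<mu>. norm (F (k + j) (\<mu> - {#j#}) j)) summable_on all_pairs \<longleftrightarrow>
         (\<lambda>(k, \<mu>). \<Sum>j=1..k. norm (F k \<mu> j)) summable_on all_pairs"
    and "(\<lambda>(k, \<mu>). \<Sum>j=1..k. norm (F k \<mu> j)) summable_on all_pairs \<Longrightarrow>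
         (\<Sum>\<^sub>\<infinity>(k, \<mu>)\<in>all_pairs. \<Sum>j\<in>set_mset \<mu>. F (k + j) (\<mu> - {#j#}) j) = (\<Sum>\<^sub>\<infinity>(k, \<mu>)\<in>all_pairs. \<Sum>j=1..k. F k \<mu> j)"
proof -
  have e: "(\<Sum>j=1..k. G (F (k - j + j) (add_mset j \<mu> - {#j#}) j)) = (\<Sum>j=1..k. G (F k \<mu> j))" for k \<mu> and G :: "'c \<Rightarrow> 'd::comm_monoid_add"
    by (rule sum.cong) auto
  note m = all_pairs_move[of "\<lambda>k \<mu> j. F (k + j) (\<mu> - {#j#}) j"]
  show 1: "(\<lambda>(k, \<mu>). \<Sum>j\<in>set_mset \<mu>. norm (F (k + j) (\<mu> - {#j#}) j)) summable_on all_pairs \<longleftrightarrow>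
         (\<lambda>(k, \<mu>). \<Sum>j=1..k. norm (F k \<mu> j)) summable_on all_pairs"
    using m(1) unfolding e[of norm] by simp
  assume "(\<lambda>(k, \<mu>). \<Sum>j=1..k. norm (F k \<mu> j)) summable_on all_pairs"
  with m(2) show "(\<Sum>\<^sub>\<infinity>(k, \<mu>)\<in>all_pairs. \<Sum>j\<in>set_mset \<mu>. F (k + j) (\<mu> - {#j#}) j) = (\<Sum>\<^sub>\<infinity>(k, \<mu>)\<in>all_pairs. \<Sum>j=1..k. F k \<mu> j)"
    unfolding e[of "\<lambda>x. x"] 1 by simp
qed

text \<open>\<open>D\<close> is chosen to bound all norms of \<open>V j\<close>, so its power
  dominates evaluation at \<open>V\<close>; the power of \<open>r\<close> provides the slack that
  absorbs factors growing with the degree.\<close>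

definition wt :: "real \<Rightarrow> real \<Rightarrow> nat \<Rightarrow> nat multiset \<Rightarrow> real" where
  "wt D r k \<mu> = r ^ (k + sum_mset \<mu>) * D ^ size \<mu>"

lemma wt_nonneg: "r \<ge> 0 \<Longrightarrow> D \<ge> 0 \<Longrightarrow> wt D r k \<mu> \<ge> 0"
  by (simp add: wt_def)

definition wsum :: "real \<Rightarrow> real \<Rightarrow> (nat \<Rightarrow> nat multiset \<Rightarrow> real) \<Rightarrow> bool" where
  "wsum D r G \<longleftrightarrow> (\<lambda>(k, \<mu>). wt D r k \<mu> * G k \<mu>) summable_on all_pairs"

lemma degree_growth:
  fixes r r' :: real
  assumes "0 < r" "r < r'"
  shows "\<exists>C>0. \<forall>n. real n * r ^ n \<le> C * r' ^ n"
proof -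
  have "(\<lambda>n. real n * (r / r') ^ n) \<longlonglongrightarrow> 0"
    using powser_times_n_limit_0[of "r / r'"] assms by simp
  then have "Bseq (\<lambda>n. real n * (r / r') ^ n)" using convergentI convergent_imp_Bseq by blast
  then obtain C where C: "C > 0" "\<And>n. norm (real n * (r / r') ^ n) \<le> C" by (auto simp: Bseq_def)
  have "real n * r ^ n \<le> C * r' ^ n" for n
    using C(2)[of n] assms by (simp add: power_divide field_simps)
  then show ?thesis using C(1) by blast
qed

text \<open>Up to constants, the growing factors are \<open>k\<close>, the number of parts that can
  be moved, and the total of \<open>j * count \<mu> j\<close>. Each is at most the degree, and a
  factor of the degree only costs the passage from \<open>r'\<close> to a smaller \<open>r\<close>
  by \<open>degree_growth\<close>. The shift by \<open>c\<close> is a convolution and needs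
  summability against \<open>r ^ j\<close>.\<close>

lemma wsum_lax:
  fixes h \<kappa> D r r' :: real
  assumes D: "D \<ge> 1" and r: "1 \<le> r" "r < r'" and nn: "h \<ge> 0" "\<kappa> \<ge> 0" "\<And>j. c j \<ge> 0" "\<And>k \<mu>. G k \<mu> \<ge> 0"
    and c: "(\<lambda>j. c j * r ^ j) summable_on {1..}" and G: "wsum D r' G"
  shows "wsum D r (lax h \<kappa> c G)"
proof -
  obtain C where C: "C > 0" "\<And>n. real n * r ^ n \<le> C * r' ^ n" using degree_growth[of r r'] r by auto
  have rr: "r ^ n \<le> r' ^ n" for n using r by (intro power_mono) auto
  have D0: "0 \<le> D ^ n" for n using D by simp
  have wr: "real m * wt D r k \<mu> \<le> C * wt D r' k \<mu>" if "m \<le> k + sum_mset \<mu>" for m k \<mu>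
  proof -
    have "real m * r ^ (k + sum_mset \<mu>) \<le> real (k + sum_mset \<mu>) * r ^ (k + sum_mset \<mu>)"
      using that r by (intro mult_right_mono) (simp_all del: of_nat_add of_nat_sum_mset)
    also have "\<dots> \<le> C * r' ^ (k + sum_mset \<mu>)" by (rule C)
    finally show ?thesis unfolding wt_def using D0[of "size \<mu>"]
      by (simp only: mult.assoc[symmetric] mult_right_mono)
  qed
  have base: "(\<lambda>(k, \<mu>). K * (wt D r' k \<mu> * G k \<mu>)) summable_on all_pairs" for K
    using summable_on_cmult_right[of "\<lambda>(k, \<mu>). wt D r' k \<mu> * G k \<mu>" all_pairs K] G
    by (simp add: wsum_def case_prod_unfold)
  have wn: "0 \<le> wt D r k \<mu>" for k \<mu> using D r by (intro wt_nonneg) auto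
  have T4: "(\<lambda>(k, \<mu>). wt D r k \<mu> * (\<kappa> * real k * G k \<mu>)) summable_on all_pairs"
  proof (rule summable_on_comparison_test[OF base[of "\<kappa> * C"]], clarify)
    fix k \<mu>
    have "\<kappa> * (real k * wt D r k \<mu>) * G k \<mu> \<le> \<kappa> * (C * wt D r' k \<mu>) * G k \<mu>"
      by (intro mult_right_mono mult_left_mono wr nn) auto
    then show "wt D r k \<mu> * (\<kappa> * real k * G k \<mu>) \<le> \<kappa> * C * (wt D r' k \<mu> * G k \<mu>)"
      by (simp add: mult_ac)
  qed (use wn nn in auto)
  have T3: "(\<lambda>(k, \<mu>). \<Sum>j\<in>set_mset \<mu>. wt D r k \<mu> * G (k + j) (\<mu> - {#j#})) summable_on all_pairs"
  proof -
    define F where "F k \<mu> j = wt D r (k - j) (add_mset j \<mu>) * G k \<mu>" for k \<mu> j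
    have Fn: "0 \<le> F k \<mu> j" for k \<mu> j using wn nn by (simp add: F_def)
    have "(\<lambda>(k, \<mu>). \<Sum>j=1..k. norm (F k \<mu> j)) summable_on all_pairs"
    proof (rule summable_on_comparison_test[OF base[of "D * C"]], clarify)
      fix k \<mu>
      have "(\<Sum>j=1..k. norm (F k \<mu> j)) = (\<Sum>j=1..k. D * wt D r k \<mu> * G k \<mu>)"
        by (intro sum.cong refl) (use wn nn D r in \<open>auto simp: F_def wt_def\<close>)
      also have "\<dots> = D * (real k * wt D r k \<mu>) * G k \<mu>" by simp
      also have "\<dots> \<le> D * (C * wt D r' k \<mu>) * G k \<mu>"
        using D by (intro mult_right_mono mult_left_mono wr nn) auto
      finally show "(\<Sum>j=1..k. norm (F k \<mu> j)) \<le> D * C * (wt D r' k \<mu> * G k \<mu>)" by (simp add: mult_ac)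
    qed (auto intro: sum_nonneg)
    then have "(\<lambda>(k, \<mu>). \<Sum>j\<in>set_mset \<mu>. norm (F (k + j) (\<mu> - {#j#}) j)) summable_on all_pairs"
      by (simp only: all_pairs_move_down(1))
    then show ?thesis
      by (rule summable_on_cong[THEN iffD1, rotated]) (auto simp: F_def Fn wn nn intro!: sum.cong)
  qed
  have T1: "(\<lambda>(k, \<mu>). \<Sum>j=1..k. wt D r k \<mu> * (h * real (j * Suc (count \<mu> j)) * G (k - j) (add_mset j \<mu>))) summable_on all_pairs"
  proof -
    define F where "F k \<mu> j = wt D r (k + j) (\<mu> - {#j#}) * (h * real (j * count \<mu> j) * G k \<mu>)" for k \<mu> j
    have Fn: "0 \<le> F k \<mu> j" for k \<mu> j using wn nn by (simp add: F_def)
    have "(\<lambda>(k, \<mu>). \<Sum>j\<in>set_mset \<mu>. norm (F k \<mu> j)) summable_on all_pairs"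
    proof (rule summable_on_comparison_test[OF base[of "h * C"]], clarify)
      fix k \<mu>
      have "norm (F k \<mu> j) \<le> real (count \<mu> j * j) * (h * wt D r k \<mu> * G k \<mu>)" if j: "j \<in># \<mu>" for j
      proof -
        obtain \<nu> where \<nu>: "\<mu> = add_mset j \<nu>" using j by (auto dest: multi_member_split)
        have "D ^ size \<nu> \<le> D ^ size \<mu>" using D by (intro power_increasing) (auto simp: \<nu>)
        then have "wt D r (k + j) (\<mu> - {#j#}) \<le> wt D r k \<mu>"
          using r unfolding wt_def by (simp add: \<nu> add.assoc mult_left_mono)
        then have "F k \<mu> j \<le> wt D r k \<mu> * (h * real (j * count \<mu> j) * G k \<mu>)"
          unfolding F_def using nn by (intro mult_right_mono) auto
        then show ?thesis using Fn by (simp add: mult_ac)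
      qed
      then have "(\<Sum>j\<in>set_mset \<mu>. norm (F k \<mu> j)) \<le> (\<Sum>j\<in>set_mset \<mu>. real (count \<mu> j * j) * (h * wt D r k \<mu> * G k \<mu>))"
        by (intro sum_mono) auto
      also have "\<dots> = (\<Sum>j\<in>set_mset \<mu>. real (count \<mu> j * j)) * (h * wt D r k \<mu> * G k \<mu>)" by (simp only: sum_distrib_right)
      also have "(\<Sum>j\<in>set_mset \<mu>. real (count \<mu> j * j)) = real (sum_mset \<mu>)"
        using sum_mset_eq_sum_count[of "\<lambda>j. j" \<mu>] by (simp del: of_nat_sum_mset)
      also have "real (sum_mset \<mu>) * (h * wt D r k \<mu> * G k \<mu>) = h * (real (sum_mset \<mu>) * wt D r k \<mu>) * G k \<mu>" by (simp only: mult_ac)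
      also have "\<dots> \<le> h * (C * wt D r' k \<mu>) * G k \<mu>"
        by (intro mult_right_mono mult_left_mono wr nn) auto
      finally show "(\<Sum>j\<in>set_mset \<mu>. norm (F k \<mu> j)) \<le> h * C * (wt D r' k \<mu> * G k \<mu>)" by (simp only: mult_ac)
    qed (auto intro: sum_nonneg)
    then have "(\<lambda>(k, \<mu>). \<Sum>j=1..k. norm (F (k - j) (add_mset j \<mu>) j)) summable_on all_pairs"
      by (simp only: all_pairs_move(1))
    then show ?thesis
      by (rule summable_on_cong[THEN iffD1, rotated]) (auto simp: F_def wn nn abs_mult intro!: sum.cong)
  qed
  have T2: "(\<lambda>(k, \<mu>). \<Sum>j=1..k. wt D r k \<mu> * (c j * G (k - j) \<mu>)) summable_on all_pairs"
  proof -
    have g: "(\<lambda>(k, \<mu>). wt D r k \<mu> * G k \<mu>) summable_on all_pairs"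
    proof (rule summable_on_comparison_test[OF base[of 1]], clarify)
      fix k \<mu>
      show "wt D r k \<mu> * G k \<mu> \<le> 1 * (wt D r' k \<mu> * G k \<mu>)"
        using rr D0 nn unfolding wt_def by (simp add: mult_right_mono)
    qed (use wn nn in auto)
    have "(\<lambda>(p, j). (case p of (k, \<mu>) \<Rightarrow> wt D r k \<mu> * G k \<mu>) * (c j * r ^ j)) abs_summable_on all_pairs \<times> {1..}"
      by (rule abs_summable_pair_product)
         (use g c wn nn r in \<open>auto simp: case_prod_unfold abs_mult cong: summable_on_cong\<close>)
    then have "(\<lambda>((k, \<mu>), j). wt D r k \<mu> * G k \<mu> * (c j * r ^ j)) summable_on all_pairs \<times> {1..}"
      by (rule summable_on_cong[THEN iffD1, rotated]) (use wn nn r in \<open>auto simp: abs_mult\<close>)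
    also have "?this \<longleftrightarrow> (\<lambda>x. norm (case x of ((k, \<mu>), j) \<Rightarrow> wt D r k \<mu> * (c j * G (k - j) \<mu>))) summable_on Sigma all_pairs (\<lambda>(k, \<mu>). {1..k})"
      by (rule summable_on_reindex_bij_witness[of _ "\<lambda>((k, \<mu>), j). ((k - j, \<mu>), j)" "\<lambda>((k, \<mu>), j). ((k + j, \<mu>), j)"])
         (use wn nn r D in \<open>auto simp: all_pairs_def wt_def power_add abs_mult\<close>)
    also have "\<dots> \<longleftrightarrow> (\<lambda>(k, \<mu>). \<Sum>j=1..k. wt D r k \<mu> * (c j * G (k - j) \<mu>)) summable_on all_pairs"
      by (subst abs_summable_Sigma_finite) (use wn nn in \<open>auto simp: case_prod_unfold abs_mult\<close>)
    finally show ?thesis .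
  qed
  have "(\<lambda>p. (case p of (k, \<mu>) \<Rightarrow> \<Sum>j=1..k. wt D r k \<mu> * (h * real (j * Suc (count \<mu> j)) * G (k - j) (add_mset j \<mu>))) +
      (case p of (k, \<mu>) \<Rightarrow> \<Sum>j=1..k. wt D r k \<mu> * (c j * G (k - j) \<mu>)) +
      (case p of (k, \<mu>) \<Rightarrow> \<Sum>j\<in>set_mset \<mu>. wt D r k \<mu> * G (k + j) (\<mu> - {#j#})) +
      (case p of (k, \<mu>) \<Rightarrow> wt D r k \<mu> * (\<kappa> * real k * G k \<mu>))) summable_on all_pairs"
    by (intro summable_on_add T1 T2 T3 T4)
  then show ?thesis unfolding wsum_def
  proof (rule summable_on_cong[THEN iffD1, rotated])
    fix p assume p: "p \<in> all_pairs"
    obtain k \<mu> where km: "p = (k, \<mu>)" by force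
    have "set_mset \<mu> - {0} = set_mset \<mu>" using p km by (auto simp: all_pairs_def pos_mset_def)
    then show "(case p of (k, \<mu>) \<Rightarrow> \<Sum>j=1..k. wt D r k \<mu> * (h * real (j * Suc (count \<mu> j)) * G (k - j) (add_mset j \<mu>))) +
      (case p of (k, \<mu>) \<Rightarrow> \<Sum>j=1..k. wt D r k \<mu> * (c j * G (k - j) \<mu>)) +
      (case p of (k, \<mu>) \<Rightarrow> \<Sum>j\<in>set_mset \<mu>. wt D r k \<mu> * G (k + j) (\<mu> - {#j#})) +
      (case p of (k, \<mu>) \<Rightarrow> wt D r k \<mu> * (\<kappa> * real k * G k \<mu>)) = (case p of (k, \<mu>) \<Rightarrow> wt D r k \<mu> * lax h \<kappa> c G k \<mu>)"
      unfolding km lax_def by (simp add: distrib_left sum_distrib_left)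
  qed
qed

section \<open>Conjugation by the coherent state\<close>

text \<open>The product of two symmetric functions in power-sum coefficients, since the product for
  \<open>\<nu>\<close> times the product for \<open>\<rho>\<close> is the product for
  \<open>\<nu> + \<rho>\<close>.\<close>

definition star :: "(nat multiset \<Rightarrow> 'a::comm_ring_1) \<Rightarrow> (nat multiset \<Rightarrow> 'a) \<Rightarrow> nat multiset \<Rightarrow> 'a" where
  "star f \<Psi> \<mu> = (\<Sum>\<nu>\<in>{\<nu>. \<nu> \<subseteq># \<mu>}. f \<nu> * \<Psi> (\<mu> - \<nu>))"

lemma finite_submsets: "finite {\<nu>. \<nu> \<subseteq># \<mu>}"
proof (induction \<mu>)
  case (add x \<mu>)
  have "{\<nu>. \<nu> \<subseteq># add_mset x \<mu>} \<subseteq> {\<nu>. \<nu> \<subseteq># \<mu>} \<union> add_mset x ` {\<nu>. \<nu> \<subseteq># \<mu>}"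
  proof
    fix \<nu> assume "\<nu> \<in> {\<nu>. \<nu> \<subseteq># add_mset x \<mu>}"
    then have n: "\<nu> \<subseteq># add_mset x \<mu>" by simp
    show "\<nu> \<in> {\<nu>. \<nu> \<subseteq># \<mu>} \<union> add_mset x ` {\<nu>. \<nu> \<subseteq># \<mu>}"
    proof (cases "x \<in># \<nu>")
      case True
      then obtain \<rho> where "\<nu> = add_mset x \<rho>" by (auto dest: multi_member_split)
      then show ?thesis using n by auto
    next
      case False
      have "count \<nu> i \<le> count \<mu> i" for i
        using mset_subset_eq_count[OF n, of i] False by (cases "i = x") (auto simp: not_in_iff)
      then show ?thesis by (simp add: mset_subset_eqI)
    qed
  qed
  then show ?case by (rule finite_subset) (use add in auto)
qed (simp add: subset_mset.le_zero_eq)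

lemma star_part:
  fixes F :: "nat multiset \<Rightarrow> nat multiset \<Rightarrow> 'a::comm_monoid_add"
  shows "(\<Sum>\<nu>\<in>{\<nu>. \<nu> \<subseteq># add_mset j \<mu> \<and> j \<in># \<nu>}. F \<nu> (add_mset j \<mu> - \<nu>)) = (\<Sum>\<nu>\<in>{\<nu>. \<nu> \<subseteq># \<mu>}. F (add_mset j \<nu>) (\<mu> - \<nu>))"
  by (rule sum.reindex_bij_witness[of _ "add_mset j" "\<lambda>\<nu>. \<nu> - {#j#}"])
     (auto dest!: multi_member_split)

text \<open>Multiplication by \<open>p_j\<close> may be attached to either factor of a product; here
  it goes to the first, away from the coherent state.\<close>

lemma star_down:
  "(\<Sum>j\<in>set_mset \<mu> - {0}. star (G j) \<Psi> (\<mu> - {#j#})) = star (\<lambda>\<nu>. \<Sum>j\<in>set_mset \<nu> - {0}. G j (\<nu> - {#j#})) \<Psi> \<mu>"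
proof -
  have 1: "star (G j) \<Psi> (\<mu> - {#j#}) = (\<Sum>\<nu>\<in>{\<nu>. \<nu> \<subseteq># \<mu> \<and> j \<in># \<nu>}. G j (\<nu> - {#j#}) * \<Psi> (\<mu> - \<nu>))" if jm: "j \<in># \<mu>" for j
  proof -
    obtain \<rho> where \<rho>: "\<mu> = add_mset j \<rho>" using multi_member_split[OF jm] by blast
    show ?thesis unfolding \<rho> using star_part[where j = j and \<mu> = \<rho> and F = "\<lambda>\<nu> \<kappa>. G j (\<nu> - {#j#}) * \<Psi> \<kappa>"] by (simp add: star_def)
  qed
  have "(\<Sum>j\<in>set_mset \<mu> - {0}. star (G j) \<Psi> (\<mu> - {#j#})) = (\<Sum>j\<in>set_mset \<mu> - {0}. \<Sum>\<nu>\<in>{\<nu>\<in>{\<nu>. \<nu> \<subseteq># \<mu>}. j \<in># \<nu>}. G j (\<nu> - {#j#}) * \<Psi> (\<mu> - \<nu>))"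
    by (intro sum.cong) (auto simp: 1)
  also have "\<dots> = (\<Sum>j\<in>set_mset \<mu> - {0}. \<Sum>\<nu>\<in>{\<nu>. \<nu> \<subseteq># \<mu>}. if j \<in># \<nu> then G j (\<nu> - {#j#}) * \<Psi> (\<mu> - \<nu>) else 0)"
    by (subst sum.inter_filter) (auto simp: finite_submsets)
  also have "\<dots> = (\<Sum>\<nu>\<in>{\<nu>. \<nu> \<subseteq># \<mu>}. \<Sum>j\<in>set_mset \<mu> - {0}. if j \<in># \<nu> then G j (\<nu> - {#j#}) * \<Psi> (\<mu> - \<nu>) else 0)"
    by (rule sum.swap)
  also have "\<dots> = (\<Sum>\<nu>\<in>{\<nu>. \<nu> \<subseteq># \<mu>}. \<Sum>j\<in>set_mset \<nu> - {0}. G j (\<nu> - {#j#}) * \<Psi> (\<mu> - \<nu>))"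
    by (intro sum.cong refl sum.mono_neutral_cong_right) (auto dest: mset_subset_eqD)
  finally show ?thesis by (simp add: star_def sum_distrib_right)
qed

text \<open>The Leibniz rule for the derivative in \<open>p_j\<close>: the multiplicity of
  \<open>j\<close> in the product is the sum of its multiplicities in the two factors.\<close>

lemma star_up:
  "of_nat (Suc (count \<mu> j)) * star f \<Psi> (add_mset j \<mu>) =
     star (\<lambda>\<nu>. of_nat (Suc (count \<nu> j)) * f (add_mset j \<nu>)) \<Psi> \<mu> + star f (\<lambda>\<rho>. of_nat (Suc (count \<rho> j)) * \<Psi> (add_mset j \<rho>)) \<mu>"
proof -
  let ?N = "{\<nu>. \<nu> \<subseteq># add_mset j \<mu>}"
  have "of_nat (Suc (count \<mu> j)) * star f \<Psi> (add_mset j \<mu>) =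
     (\<Sum>\<nu>\<in>?N. of_nat (count \<nu> j) * f \<nu> * \<Psi> (add_mset j \<mu> - \<nu>)) + (\<Sum>\<nu>\<in>?N. f \<nu> * (of_nat (count (add_mset j \<mu> - \<nu>) j) * \<Psi> (add_mset j \<mu> - \<nu>)))"
    unfolding star_def sum_distrib_left sum.distrib[symmetric]
  proof (intro sum.cong refl)
    fix \<nu> assume "\<nu> \<in> ?N"
    then have "count \<nu> j \<le> count (add_mset j \<mu>) j" by (simp only: mem_Collect_eq mset_subset_eq_count)
    then have e: "of_nat (Suc (count \<mu> j)) = (of_nat (count \<nu> j) + of_nat (count (add_mset j \<mu> - \<nu>) j) :: 'a)"
      by (simp flip: of_nat_add)
    show "of_nat (Suc (count \<mu> j)) * (f \<nu> * \<Psi> (add_mset j \<mu> - \<nu>)) = of_nat (count \<nu> j) * f \<nu> * \<Psi> (add_mset j \<mu> - \<nu>) +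
        f \<nu> * (of_nat (count (add_mset j \<mu> - \<nu>) j) * \<Psi> (add_mset j \<mu> - \<nu>))"
      unfolding e by (simp add: algebra_simps)
  qed
  also have "(\<Sum>\<nu>\<in>?N. of_nat (count \<nu> j) * f \<nu> * \<Psi> (add_mset j \<mu> - \<nu>)) =
     (\<Sum>\<nu>\<in>{\<nu>. \<nu> \<subseteq># add_mset j \<mu> \<and> j \<in># \<nu>}. of_nat (count \<nu> j) * f \<nu> * \<Psi> (add_mset j \<mu> - \<nu>))"
    by (rule sum.mono_neutral_right) (auto simp: finite_submsets not_in_iff)
  also have "\<dots> = star (\<lambda>\<nu>. of_nat (Suc (count \<nu> j)) * f (add_mset j \<nu>)) \<Psi> \<mu>"
    using star_part[where j = j and \<mu> = \<mu> and F = "\<lambda>\<nu> \<kappa>. of_nat (count \<nu> j) * f \<nu> * \<Psi> \<kappa>"] by (simp add: star_def)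
  also have "(\<Sum>\<nu>\<in>?N. f \<nu> * (of_nat (count (add_mset j \<mu> - \<nu>) j) * \<Psi> (add_mset j \<mu> - \<nu>))) =
     (\<Sum>\<nu>\<in>{\<nu>. \<nu> \<subseteq># \<mu>}. f \<nu> * (of_nat (count (add_mset j \<mu> - \<nu>) j) * \<Psi> (add_mset j \<mu> - \<nu>)))"
  proof (rule sum.mono_neutral_right)
    show "{\<nu>. \<nu> \<subseteq># \<mu>} \<subseteq> ?N" by (auto intro: subset_mset.order_trans)
    show "\<forall>\<nu>\<in>?N - {\<nu>. \<nu> \<subseteq># \<mu>}. f \<nu> * (of_nat (count (add_mset j \<mu> - \<nu>) j) * \<Psi> (add_mset j \<mu> - \<nu>)) = 0"
    proof
      fix \<nu> assume n: "\<nu> \<in> ?N - {\<nu>. \<nu> \<subseteq># \<mu>}"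
      have "count (add_mset j \<mu> - \<nu>) j = 0"
      proof (rule ccontr)
        assume z: "count (add_mset j \<mu> - \<nu>) j \<noteq> 0"
        have "count \<nu> i \<le> count \<mu> i" for i
        proof (cases "i = j")
          case True
          then show ?thesis using z by simp
        next
          case False
          have "count \<nu> i \<le> count (add_mset j \<mu>) i" using n by (intro mset_subset_eq_count) auto
          then show ?thesis using False by simp
        qed
        then show False using n by (simp add: mset_subset_eqI)
      qed
      then show "f \<nu> * (of_nat (count (add_mset j \<mu> - \<nu>) j) * \<Psi> (add_mset j \<mu> - \<nu>)) = 0" by simp
    qed
  qed (rule finite_submsets)
  also have "\<dots> = star f (\<lambda>\<rho>. of_nat (Suc (count \<rho> j)) * \<Psi> (add_mset j \<rho>)) \<mu>"
    unfolding star_def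
  proof (intro sum.cong refl)
    fix \<nu> assume "\<nu> \<in> {\<nu>. \<nu> \<subseteq># \<mu>}"
    then obtain \<kappa> where "\<mu> = \<nu> + \<kappa>" by (auto simp: mset_subset_eq_exists_conv)
    then have "add_mset j \<mu> - \<nu> = add_mset j (\<mu> - \<nu>)" by simp
    then show "f \<nu> * (of_nat (count (add_mset j \<mu> - \<nu>) j) * \<Psi> (add_mset j \<mu> - \<nu>)) = f \<nu> * (of_nat (Suc (count (\<mu> - \<nu>) j)) * \<Psi> (add_mset j (\<mu> - \<nu>)))"
      by simp
  qed
  finally show ?thesis .
qed

lemma star_cmult: "star (\<lambda>\<nu>. c * f \<nu>) \<Psi> \<mu> = c * star f \<Psi> \<mu>" "star f (\<lambda>\<nu>. c * \<Psi> \<nu>) \<mu> = c * star f \<Psi> \<mu>"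
  by (simp_all add: star_def sum_distrib_left mult_ac)

lemma star_sum: "star (\<lambda>\<nu>. \<Sum>x\<in>S. f x \<nu>) \<Psi> \<mu> = (\<Sum>x\<in>S. star (f x) \<Psi> \<mu>)"
  unfolding star_def sum_distrib_right by (rule sum.swap)

lemma star_add: "star (\<lambda>\<nu>. f \<nu> + g \<nu>) \<Psi> \<mu> = star f \<Psi> \<mu> + star g \<Psi> \<mu>"
  by (simp add: star_def distrib_right sum.distrib)

text \<open>The hypothesis makes \<open>\<Psi>\<close> an eigenvector of every annihilation
  operator, with eigenvalues \<open>c j\<close>. By the Leibniz rule annihilation of a product with
  \<open>\<Psi>\<close> differentiates the first factor and adds the constant \<open>c j\<close>;
  the other terms of the operator do not touch \<open>\<Psi>\<close>.\<close>

lemma lax_star: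
  assumes \<Psi>: "\<And>j \<mu>. j \<ge> 1 \<Longrightarrow> h * of_nat (j * Suc (count \<mu> j)) * \<Psi> (add_mset j \<mu>) = c j * \<Psi> \<mu>"
  shows "lax h \<kappa> (\<lambda>_. 0) (\<lambda>k. star (G k) \<Psi>) = (\<lambda>k. star (lax h \<kappa> c G k) \<Psi>)"
proof (intro ext)
  fix k \<mu>
  have up: "h * of_nat (j * Suc (count \<mu> j)) * star f \<Psi> (add_mset j \<mu>) =
    star (\<lambda>\<nu>. h * of_nat (j * Suc (count \<nu> j)) * f (add_mset j \<nu>)) \<Psi> \<mu> + star (\<lambda>\<nu>. c j * f \<nu>) \<Psi> \<mu>" if "j \<ge> 1" for j f
  proof -
    have "h * of_nat (j * Suc (count \<mu> j)) * star f \<Psi> (add_mset j \<mu>) = h * of_nat j * (of_nat (Suc (count \<mu> j)) * star f \<Psi> (add_mset j \<mu>))"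
      by (simp only: of_nat_mult mult.assoc)
    also have "\<dots> = h * of_nat j * star (\<lambda>\<nu>. of_nat (Suc (count \<nu> j)) * f (add_mset j \<nu>)) \<Psi> \<mu> +
       h * of_nat j * star f (\<lambda>\<rho>. of_nat (Suc (count \<rho> j)) * \<Psi> (add_mset j \<rho>)) \<mu>"
      unfolding star_up by (rule distrib_left)
    also have "h * of_nat j * star (\<lambda>\<nu>. of_nat (Suc (count \<nu> j)) * f (add_mset j \<nu>)) \<Psi> \<mu> = star (\<lambda>\<nu>. h * of_nat (j * Suc (count \<nu> j)) * f (add_mset j \<nu>)) \<Psi> \<mu>"
      unfolding star_cmult(1)[symmetric] by (simp only: of_nat_mult mult.assoc)
    also have "h * of_nat j * star f (\<lambda>\<rho>. of_nat (Suc (count \<rho> j)) * \<Psi> (add_mset j \<rho>)) \<mu> = star f (\<lambda>\<rho>. h * of_nat (j * Suc (count \<rho> j)) * \<Psi> (add_mset j \<rho>)) \<mu>"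
      unfolding star_cmult(2)[symmetric] by (simp only: of_nat_mult mult.assoc)
    also have "\<dots> = star (\<lambda>\<nu>. c j * f \<nu>) \<Psi> \<mu>" by (simp only: \<Psi>[OF that] star_cmult)
    finally show ?thesis .
  qed
  have "lax h \<kappa> (\<lambda>_. 0) (\<lambda>k. star (G k) \<Psi>) k \<mu> =
     (\<Sum>j=1..k. star (\<lambda>\<nu>. h * of_nat (j * Suc (count \<nu> j)) * G (k - j) (add_mset j \<nu>)) \<Psi> \<mu> + star (\<lambda>\<nu>. c j * G (k - j) \<nu>) \<Psi> \<mu>) +
     (\<Sum>j\<in>set_mset \<mu> - {0}. star (G (k + j)) \<Psi> (\<mu> - {#j#})) + \<kappa> * of_nat k * star (G k) \<Psi> \<mu>"
  proof -
    have "(\<Sum>j=1..k. h * of_nat (j * Suc (count \<mu> j)) * star (G (k - j)) \<Psi> (add_mset j \<mu>)) =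
       (\<Sum>j=1..k. star (\<lambda>\<nu>. h * of_nat (j * Suc (count \<nu> j)) * G (k - j) (add_mset j \<nu>)) \<Psi> \<mu> + star (\<lambda>\<nu>. c j * G (k - j) \<nu>) \<Psi> \<mu>)"
      by (intro sum.cong refl up) auto
    then show ?thesis unfolding lax_def by (simp only:) simp
  qed
  also have "\<dots> = star (lax h \<kappa> c G k) \<Psi> \<mu>"
    unfolding lax_def[abs_def] star_add star_sum star_down star_cmult sum.distrib by (simp only: add.assoc)
  finally show "lax h \<kappa> (\<lambda>_. 0) (\<lambda>k. star (G k) \<Psi>) k \<mu> = star (lax h \<kappa> c G k) \<Psi> \<mu>" .
qed

lemma vac_star:
  assumes \<Psi>: "\<And>j \<mu>. j \<ge> 1 \<Longrightarrow> h * of_nat (j * Suc (count \<mu> j)) * \<Psi> (add_mset j \<mu>) = c j * \<Psi> \<mu>"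
  shows "vac h \<kappa> (\<lambda>_. 0) m (star f \<Psi>) = star (vac h \<kappa> c m f) \<Psi>"
proof -
  have "(lax h \<kappa> (\<lambda>_. 0) ^^ m) (\<lambda>k. star (G k) \<Psi>) = (\<lambda>k. star ((lax h \<kappa> c ^^ m) G k) \<Psi>)" for G
    by (induction m) (simp_all add: lax_star[OF \<Psi>])
  moreover have "lift0 (star f \<Psi>) = (\<lambda>k. star (lift0 f k) \<Psi>)"
    by (auto simp: lift0_def star_def fun_eq_iff)
  ultimately show ?thesis by (simp add: vac_def)
qed

definition one0 :: "nat multiset \<Rightarrow> 'a::comm_ring_1" where
  "one0 \<mu> = (if \<mu> = {#} then 1 else 0)"

lemma star_one0: "star one0 \<Psi> = \<Psi>"
proof
  fix \<mu>
  have "star one0 \<Psi> \<mu> = (\<Sum>\<nu>\<in>{\<nu>. \<nu> \<subseteq># \<mu>}. if \<nu> = {#} then \<Psi> \<mu> else 0)"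
    unfolding star_def by (rule sum.cong) (auto simp: one0_def)
  then show "star one0 \<Psi> \<mu> = \<Psi> \<mu>" by (simp add: finite_submsets)
qed

lemma foldr_vac_star:
  assumes \<Psi>: "\<And>j \<mu>. j \<ge> 1 \<Longrightarrow> h * of_nat (j * Suc (count \<mu> j)) * \<Psi> (add_mset j \<mu>) = c j * \<Psi> \<mu>"
  shows "foldr (vac h \<kappa> (\<lambda>_. 0)) ks \<Psi> = star (foldr (vac h \<kappa> c) ks one0) \<Psi>"
  by (induction ks) (simp_all add: star_one0 vac_star[OF \<Psi>])

section \<open>Evaluation at the symbol and the norm of the coherent state\<close>

definition vprod :: "(nat \<Rightarrow> complex) \<Rightarrow> nat multiset \<Rightarrow> complex" where
  "vprod V \<mu> = prod_mset (image_mset V \<mu>)"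

lemma vprod_simps [simp]: "vprod V {#} = 1" "vprod V (add_mset j \<mu>) = V j * vprod V \<mu>" "vprod V (\<mu> + \<nu>) = vprod V \<mu> * vprod V \<nu>"
  by (simp_all add: vprod_def)

lemma ev_star:
  fixes f \<Psi> :: "nat multiset \<Rightarrow> complex"
  assumes f: "(\<lambda>\<mu>. norm (vprod V \<mu> * f \<mu>)) summable_on pos_mset" and P: "(\<lambda>\<mu>. norm (vprod V \<mu> * \<Psi> \<mu>)) summable_on pos_mset"
  shows "((\<lambda>\<mu>. vprod V \<mu> * star f \<Psi> \<mu>) has_sum (infsum (\<lambda>\<mu>. vprod V \<mu> * f \<mu>) pos_mset * infsum (\<lambda>\<mu>. vprod V \<mu> * \<Psi> \<mu>) pos_mset)) pos_mset"
proof -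
  let ?a = "\<lambda>\<mu>. vprod V \<mu> * f \<mu>" and ?b = "\<lambda>\<mu>. vprod V \<mu> * \<Psi> \<mu>"
  let ?F = "\<lambda>(\<mu>, \<nu>). vprod V \<mu> * (f \<nu> * \<Psi> (\<mu> - \<nu>))"
  have "((\<lambda>(x, y). ?a x * ?b y) has_sum (infsum ?a pos_mset * infsum ?b pos_mset)) (pos_mset \<times> pos_mset)"
    unfolding infsum_pair_product[OF f P, symmetric]
    by (rule has_sum_infsum[OF abs_summable_summable[OF abs_summable_pair_product[OF f P]]])
  also have "?this \<longleftrightarrow> (?F has_sum (infsum ?a pos_mset * infsum ?b pos_mset)) (Sigma pos_mset (\<lambda>\<mu>. {\<nu>. \<nu> \<subseteq># \<mu>}))"
  proof (rule has_sum_reindex_bij_witness[of _ "\<lambda>(\<mu>, \<nu>). (\<nu>, \<mu> - \<nu>)" "\<lambda>(\<nu>, \<rho>). (\<nu> + \<rho>, \<nu>)"])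
    fix b assume b: "b \<in> Sigma pos_mset (\<lambda>\<mu>. {\<nu>. \<nu> \<subseteq># \<mu>})"
    then show "(case b of (\<mu>, \<nu>) \<Rightarrow> (\<nu>, \<mu> - \<nu>)) \<in> pos_mset \<times> pos_mset"
      by (auto simp: pos_mset_def dest: mset_subset_eqD in_diffD)
  qed (auto simp: pos_mset_def mult_ac)
  finally have S: "(?F has_sum (infsum ?a pos_mset * infsum ?b pos_mset)) (Sigma pos_mset (\<lambda>\<mu>. {\<nu>. \<nu> \<subseteq># \<mu>}))" .
  show ?thesis
  proof (rule has_sum_SigmaD[OF S])
    fix \<mu>
    have "((\<lambda>\<nu>. ?F (\<mu>, \<nu>)) has_sum (\<Sum>\<nu>\<in>{\<nu>. \<nu> \<subseteq># \<mu>}. ?F (\<mu>, \<nu>))) {\<nu>. \<nu> \<subseteq># \<mu>}"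
      by (rule has_sum_finite[OF finite_submsets])
    then show "((\<lambda>\<nu>. ?F (\<mu>, \<nu>)) has_sum vprod V \<mu> * star f \<Psi> \<mu>) {\<nu>. \<nu> \<subseteq># \<mu>}"
      by (simp add: star_def sum_distrib_left)
  qed
qed

text \<open>The coefficients of \<open>exp (\<Sum>j. cnj (V j) * p_j / (h * j))\<close>, the
  coherent state.\<close>

definition coh :: "(nat \<Rightarrow> complex) \<Rightarrow> real \<Rightarrow> nat multiset \<Rightarrow> complex" where
  "coh V h \<mu> = cnj (vprod V \<mu>) / of_real (zz \<mu> * h ^ size \<mu>)"

lemma coh_step:
  assumes "h > 0" "j \<ge> 1"
  shows "of_real h * of_nat (j * Suc (count \<mu> j)) * coh V h (add_mset j \<mu>) = cnj (V j) * coh V h \<mu>"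
proof -
  define a where "a = complex_of_real h" 
  define b where "b = (of_nat (j * Suc (count \<mu> j)) :: complex)"
  have "j * Suc (count \<mu> j) \<noteq> 0" using assms by simp
  then have "a \<noteq> 0" "b \<noteq> 0" using assms(1) unfolding a_def b_def of_nat_eq_0_iff by auto
  moreover define Z where "Z = complex_of_real (zz \<mu> * h ^ size \<mu>)"
  moreover have e: "complex_of_real (zz (add_mset j \<mu>) * h ^ size (add_mset j \<mu>)) = Z * (a * b)"
    by (simp add: zz_add a_def b_def Z_def algebra_simps)
  ultimately show ?thesis unfolding coh_def a_def[symmetric] b_def[symmetric] Z_def[symmetric] e by simp
qed

definition cohw :: "(nat \<Rightarrow> complex) \<Rightarrow> real \<Rightarrow> nat multiset \<Rightarrow> real" where
  "cohw V h \<mu> = (norm (vprod V \<mu>))\<^sup>2 / (zz \<mu> * h ^ size \<mu>)"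

lemma vprod_coh: "vprod V \<mu> * coh V h \<mu> = of_real (cohw V h \<mu>)"
  by (simp add: coh_def cohw_def complex_norm_square[symmetric])

lemma cohw_nonneg: "h > 0 \<Longrightarrow> cohw V h \<mu> \<ge> 0"
  unfolding cohw_def zz_def by (intro divide_nonneg_nonneg mult_nonneg_nonneg prod_nonneg) auto

lemma cohw_add:
  assumes "h > 0" "j \<ge> 1"
  shows "real (Suc (count \<mu> j)) * cohw V h (add_mset j \<mu>) = (norm (V j))\<^sup>2 / (h * real j) * cohw V h \<mu>"
proof -
  define b where "b = real (Suc (count \<mu> j))"
  have "b \<noteq> 0" "real j \<noteq> 0" using assms by (auto simp: b_def)
  moreover have "zz (add_mset j \<mu>) * h ^ size (add_mset j \<mu>) = zz \<mu> * h ^ size \<mu> * (h * (real j * b))"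
    by (simp add: zz_add b_def algebra_simps)
  ultimately show ?thesis unfolding cohw_def b_def[symmetric] using assms
    by (simp add: norm_mult power_mult_distrib)
qed

text \<open>Marking one part of a multiset of size \<open>m + 1\<close> counts the multiset
  \<open>m + 1\<close> times; by \<open>cohw_add\<close>, removing the marked part splits off one
  factor \<open>S\<close>. Hence the factorial.\<close>

lemma cohw_size_sum:
  assumes h: "h > 0" and S: "((\<lambda>j. (norm (V j))\<^sup>2 / (h * real j)) has_sum S) {1..}"
  shows "(cohw V h has_sum (S ^ m / fact m)) {\<mu>\<in>pos_mset. size \<mu> = m}"
proof (induction m)
  case 0
  have "{\<mu>\<in>pos_mset. size \<mu> = 0} = {{#}}" by (auto simp: pos_mset_def)
  moreover have "cohw V h {#} = 1" by (simp add: cohw_def)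
  ultimately show ?case using has_sum_finite[of "{{#}}" "cohw V h"] by simp
next
  case (Suc m)
  let ?x = "\<lambda>j. (norm (V j))\<^sup>2 / (h * real j)"
  let ?P = "\<lambda>m. {\<mu>\<in>pos_mset. size \<mu> = m}"
  have xn: "?x j \<ge> 0" for j using h by simp
  have "(\<lambda>\<mu>. norm (cohw V h \<mu>)) = cohw V h" "(\<lambda>j. norm (?x j)) = ?x"
    using cohw_nonneg[OF h] xn by (simp_all only: fun_eq_iff real_norm_def abs_of_nonneg) blast+
  then have a1: "(\<lambda>\<mu>. norm (cohw V h \<mu>)) summable_on ?P m" and a2: "(\<lambda>j. norm (?x j)) summable_on {1..}"
    using has_sum_imp_summable[OF Suc] has_sum_imp_summable[OF S] by (simp_all only:)
  have "((\<lambda>(\<mu>, j). cohw V h \<mu> * ?x j) has_sum (S ^ m / fact m * S)) (?P m \<times> {1..})"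
    using has_sum_infsum[OF abs_summable_summable[OF abs_summable_pair_product[OF a1 a2]]] infsum_pair_product[OF a1 a2]
      infsumI[OF Suc] infsumI[OF S] by simp
  also have "?this \<longleftrightarrow> ((\<lambda>(\<mu>, j). real (count \<mu> j) * cohw V h \<mu>) has_sum (S ^ m / fact m * S)) (Sigma (?P (Suc m)) set_mset)"
  proof (rule has_sum_reindex_bij_witness[of _ "\<lambda>(\<mu>, j). (\<mu> - {#j#}, j)" "\<lambda>(\<mu>, j). (add_mset j \<mu>, j)"])
    fix b assume "b \<in> Sigma (?P (Suc m)) set_mset"
    then show "(case b of (\<mu>, j) \<Rightarrow> (\<mu> - {#j#}, j)) \<in> ?P m \<times> {1..}"
      by (auto simp: pos_mset_def size_Diff_singleton Suc_le_eq dest: in_diffD intro!: gr0I)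
  next
    fix a :: "nat multiset \<times> nat" assume "a \<in> ?P m \<times> {1..}"
    then show "(case (case a of (\<mu>, j) \<Rightarrow> (add_mset j \<mu>, j)) of (\<mu>, j) \<Rightarrow> real (count \<mu> j) * cohw V h \<mu>) = (case a of (\<mu>, j) \<Rightarrow> cohw V h \<mu> * ?x j)"
      using cohw_add[OF h] by (auto simp: mult.commute simp del: of_nat_Suc)
  qed (auto simp: pos_mset_def)
  finally have T: "((\<lambda>(\<mu>, j). real (count \<mu> j) * cohw V h \<mu>) has_sum (S ^ m / fact m * S)) (Sigma (?P (Suc m)) set_mset)" .
  have "((\<lambda>\<mu>. real (Suc m) * cohw V h \<mu>) has_sum (S ^ m / fact m * S)) (?P (Suc m))"
  proof (rule has_sum_SigmaD[OF T])
    fix \<mu> assume "\<mu> \<in> ?P (Suc m)"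
    then have "(\<Sum>j\<in>set_mset \<mu>. count \<mu> j) = Suc m" by (simp add: size_multiset_overloaded_eq)
    then have "(\<Sum>j\<in>set_mset \<mu>. real (count \<mu> j) * cohw V h \<mu>) = real (Suc m) * cohw V h \<mu>"
      by (simp only: sum_distrib_right[symmetric] of_nat_sum[symmetric])
    then show "((\<lambda>j. case (\<mu>, j) of (\<mu>, j) \<Rightarrow> real (count \<mu> j) * cohw V h \<mu>) has_sum real (Suc m) * cohw V h \<mu>) (set_mset \<mu>)"
      using has_sum_finite[of "set_mset \<mu>" "\<lambda>j. real (count \<mu> j) * cohw V h \<mu>"] by simp
  qed
  from has_sum_cmult_right[OF this, of "1 / real (Suc m)"] show ?case
    by (simp add: field_simps del: of_nat_Suc)
qed

lemma cohw_has_sum: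
  assumes h: "h > 0" and S: "((\<lambda>j. (norm (V j))\<^sup>2 / (h * real j)) has_sum S) {1..}"
  shows "(cohw V h has_sum exp S) pos_mset"
proof -
  let ?P = "\<lambda>m. {\<mu>\<in>pos_mset. size \<mu> = m}"
  have S0: "S \<ge> 0" by (rule has_sum_nonneg[OF S]) (use h in auto)
  have "(\<lambda>m. S ^ m / fact m) sums exp S"
    using exp_converges[of S] by (simp add: divide_inverse mult.commute)
  then have E: "((\<lambda>m. S ^ m / fact m) has_sum exp S) UNIV"
    by (rule sums_nonneg_imp_has_sum) (use S0 in auto)
  have "((\<lambda>(m, \<mu>). cohw V h \<mu>) has_sum exp S) (Sigma UNIV ?P)"
  proof (rule has_sum_SigmaI[OF _ E])
    show "((\<lambda>\<mu>. case (m, \<mu>) of (m, \<mu>) \<Rightarrow> cohw V h \<mu>) has_sum S ^ m / fact m) (?P m)" for m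
      using cohw_size_sum[OF h S, of m] by simp
    show "(\<lambda>(m, \<mu>). cohw V h \<mu>) summable_on Sigma UNIV ?P"
      by (rule summable_on_SigmaI[OF _ has_sum_imp_summable[OF E]])
         (use cohw_size_sum[OF h S] cohw_nonneg[OF h] in auto)
  qed
  also have "?this \<longleftrightarrow> (cohw V h has_sum exp S) pos_mset"
    by (rule has_sum_reindex_bij_witness[of _ "\<lambda>\<mu>. (size \<mu>, \<mu>)" snd]) auto
  finally show ?thesis .
qed

section \<open>Dominated convergence and nonnegative majorants\<close>

lemma dominated_infsum:
  fixes f :: "'e \<Rightarrow> 'x \<Rightarrow> 'c::banach"
  assumes lim: "\<And>x. x \<in> A \<Longrightarrow> ((\<lambda>e. f e x) \<longlongrightarrow> g x) F" and dom: "eventually (\<lambda>e. \<forall>x\<in>A. norm (f e x) \<le> M x) F"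
    and M: "M summable_on A" and g: "\<And>x. x \<in> A \<Longrightarrow> norm (g x) \<le> M x"
  shows "((\<lambda>e. infsum (f e) A) \<longlongrightarrow> infsum g A) F"
\<comment> \<open>On the set \<open>S\<close> of parameters at which the bound holds, the
  Weierstrass test makes the finite partial sums converge uniformly, so the two limits may be
  exchanged; the filter eventually lies in \<open>S\<close>.\<close>
proof (rule swap_uniform_limit'[where f = "\<lambda>X e. \<Sum>x\<in>X. f e x" and g = "sum g" and S = "{e. \<forall>x\<in>A. norm (f e x) \<le> M x}"])
  show "\<forall>\<^sub>F X in finite_subsets_at_top A. ((\<lambda>e. \<Sum>x\<in>X. f e x) \<longlongrightarrow> (\<Sum>x\<in>X. g x)) F"
    unfolding eventually_finite_subsets_at_top by (rule exI[of _ "{}"]) (auto intro!: tendsto_sum lim)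
  have "g summable_on A" by (rule abs_summable_summable) (rule Infinite_Sum.abs_summable_on_comparison_test'[OF M g])
  then show "(sum g \<longlongrightarrow> infsum g A) (finite_subsets_at_top A)"
    using has_sum_infsum has_sum_def by blast
  show "uniform_limit {e. \<forall>x\<in>A. norm (f e x) \<le> M x} (\<lambda>X e. \<Sum>x\<in>X. f e x) (\<lambda>e. infsum (f e) A) (finite_subsets_at_top A)"
    by (rule Weierstrass_m_test_general[OF _ M]) auto
qed (use dom in auto)

lemma lax_nonneg:
  fixes h \<kappa> :: real
  assumes "h \<ge> 0" "\<kappa> \<ge> 0" "\<And>j. c j \<ge> 0" "\<And>k \<mu>. G k \<mu> \<ge> 0"
  shows "lax h \<kappa> c G k \<mu> \<ge> 0"
  unfolding lax_def using assms by (intro add_nonneg_nonneg sum_nonneg mult_nonneg_nonneg) auto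

lemma lax_pow_nonneg:
  fixes h \<kappa> :: real
  assumes "h \<ge> 0" "\<kappa> \<ge> 0" "\<And>j. c j \<ge> 0" "\<And>k \<mu>. G k \<mu> \<ge> 0"
  shows "(lax h \<kappa> c ^^ m) G k \<mu> \<ge> 0"
  using assms by (induction m arbitrary: k \<mu>) (auto intro: lax_nonneg)

lemma lax_norm_le:
  fixes G :: "nat \<Rightarrow> nat multiset \<Rightarrow> complex"
  assumes "norm h \<le> h0" "norm \<kappa> \<le> \<kappa>0" "\<And>j. norm (c j) \<le> c0 j" "\<And>k \<mu>. norm (G k \<mu>) \<le> G0 k \<mu>"
  shows "norm (lax h \<kappa> c G k \<mu>) \<le> lax h0 \<kappa>0 c0 G0 k \<mu>"
proof -
  have 1: "norm (\<Sum>j=1..k. h * of_nat (j * Suc (count \<mu> j)) * G (k - j) (add_mset j \<mu>)) \<le> (\<Sum>j=1..k. h0 * real (j * Suc (count \<mu> j)) * G0 (k - j) (add_mset j \<mu>))"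
    by (intro sum_norm_le) (auto simp only: norm_mult norm_of_nat intro!: mult_mono assms order_trans[OF norm_ge_zero assms(1)] mult_nonneg_nonneg norm_ge_zero of_nat_0_le_iff)
  have 2: "norm (\<Sum>j=1..k. c j * G (k - j) \<mu>) \<le> (\<Sum>j=1..k. c0 j * G0 (k - j) \<mu>)"
    by (intro sum_norm_le) (auto simp: norm_mult intro!: mult_mono assms order_trans[OF norm_ge_zero assms(3)])
  have 3: "norm (\<Sum>j\<in>set_mset \<mu> - {0}. G (k + j) (\<mu> - {#j#})) \<le> (\<Sum>j\<in>set_mset \<mu> - {0}. G0 (k + j) (\<mu> - {#j#}))"
    by (intro sum_norm_le assms)
  have 4: "norm (\<kappa> * of_nat k * G k \<mu>) \<le> \<kappa>0 * real k * G0 k \<mu>"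
    by (auto simp: norm_mult intro!: mult_mono assms order_trans[OF norm_ge_zero assms(2)] mult_nonneg_nonneg)
  show ?thesis unfolding lax_def
    by (rule order_trans[OF norm_triangle_ineq add_mono[OF order_trans[OF norm_triangle_ineq
          add_mono[OF order_trans[OF norm_triangle_ineq add_mono[OF 1 2]] 3]] 4]])
qed

lemma vac_norm_le:
  fixes f :: "nat multiset \<Rightarrow> complex"
  assumes "norm h \<le> h0" "norm \<kappa> \<le> \<kappa>0" "\<And>j. norm (c j) \<le> c0 j" "\<And>\<mu>. norm (f \<mu>) \<le> f0 \<mu>"
  shows "norm (vac h \<kappa> c m f \<mu>) \<le> vac h0 \<kappa>0 c0 m f0 \<mu>"
proof -
  have "norm ((lax h \<kappa> c ^^ m) (lift0 f) k \<mu>) \<le> (lax h0 \<kappa>0 c0 ^^ m) (lift0 f0) k \<mu>" for k \<mu>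
  proof (induction m arbitrary: k \<mu>)
    case 0
    then show ?case using assms(4) by (simp add: lift0_def)
  next
    case (Suc m)
    then show ?case using assms by (simp add: lax_norm_le)
  qed
  then show ?thesis by (simp add: vac_def)
qed

lemma foldr_vac_norm_le:
  assumes "norm (h::complex) \<le> h0" "norm \<kappa> \<le> \<kappa>0" "\<And>j. norm (c j) \<le> c0 j"
  shows "norm (foldr (vac h \<kappa> c) ks one0 \<mu>) \<le> foldr (vac h0 \<kappa>0 c0) ks one0 \<mu>"
proof (induction ks arbitrary: \<mu>)
  case (Cons k ks)
  then show ?case using vac_norm_le[OF assms, of "foldr (vac h \<kappa> c) ks one0" "foldr (vac h0 \<kappa>0 c0) ks one0"] by simp
qed (simp add: one0_def)

lemma foldr_vac_wsum:
  fixes h \<kappa> D \<rho> :: real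
  assumes D: "D \<ge> 1" and nn: "h \<ge> 0" "\<kappa> \<ge> 0" "\<And>j. c j \<ge> 0"
    and c: "\<And>r. 1 \<le> r \<Longrightarrow> r < \<rho> \<Longrightarrow> (\<lambda>j. c j * r ^ j) summable_on {1..}"
  shows "(\<forall>\<mu>. foldr (vac h \<kappa> c) ks one0 \<mu> \<ge> 0) \<and> (\<forall>r. 1 \<le> r \<longrightarrow> r < \<rho> \<longrightarrow> wsum D r (lift0 (foldr (vac h \<kappa> c) ks one0)))"
proof (induction ks)
  case Nil
  have "wsum D r (lift0 one0)" for r
    unfolding wsum_def
    by (rule finite_nonzero_values_imp_summable_on, rule finite_subset[of _ "{(0, {#})}"]) (auto simp: lift0_def one0_def split: if_splits)
  moreover have "(one0 \<mu> :: real) \<ge> 0" for \<mu> by (simp add: one0_def)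
  ultimately show ?case by simp
next
  case (Cons m ks)
  let ?f = "foldr (vac h \<kappa> c) ks one0"
  have f0: "lift0 ?f k \<mu> \<ge> 0" for k \<mu> using Cons by (simp add: lift0_def)
  have pn: "(lax h \<kappa> c ^^ i) (lift0 ?f) k \<mu> \<ge> 0" for i k \<mu> by (rule lax_pow_nonneg[OF nn f0])
  have ws: "wsum D r ((lax h \<kappa> c ^^ i) (lift0 ?f))" if "1 \<le> r" "r < \<rho>" for i r
    using that
  proof (induction i arbitrary: r)
    case 0
    then show ?case using Cons by simp
  next
    case (Suc i)
    \<comment> \<open>The claim holds for every radius below \<open>\<rho>\<close>, so each
      application may start at the midpoint and shrink to \<open>r\<close>; any number of
      applications is affordable.\<close>
    have "wsum D ((r + \<rho>) / 2) ((lax h \<kappa> c ^^ i) (lift0 ?f))" using Suc.prems by (intro Suc.IH) auto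
    then have "wsum D r (lax h \<kappa> c ((lax h \<kappa> c ^^ i) (lift0 ?f)))"
      by (rule wsum_lax[OF D Suc.prems(1) _ nn pn c[OF Suc.prems], rotated]) (use Suc.prems in auto)
    then show ?case by simp
  qed
  have v: "vac h \<kappa> c m ?f \<mu> \<ge> 0" for \<mu> using pn by (simp add: vac_def)
  have "wsum D r (lift0 (vac h \<kappa> c m ?f))" if "1 \<le> r" "r < \<rho>" for r
    unfolding wsum_def
  proof (rule summable_on_comparison_test[OF ws[OF that, of m, unfolded wsum_def]], clarify)
    fix k \<mu>
    show "wt D r k \<mu> * lift0 (vac h \<kappa> c m ?f) k \<mu> \<le> wt D r k \<mu> * (lax h \<kappa> c ^^ m) (lift0 ?f) k \<mu>"
      using wt_nonneg[of r D] that D pn by (intro mult_left_mono) (auto simp: lift0_def vac_def)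
  qed (use wt_nonneg[of r D] that D v in \<open>auto simp: lift0_def\<close>)
  then show ?case using v by simp
qed

lemma tendsto_foldr_vac:
  fixes h \<kappa> :: "'e \<Rightarrow> complex"
  assumes h: "(h \<longlongrightarrow> h0) F" and \<kappa>: "(\<kappa> \<longlongrightarrow> \<kappa>0) F"
  shows "((\<lambda>e. foldr (vac (h e) (\<kappa> e) c) ks one0 \<mu>) \<longlongrightarrow> foldr (vac h0 \<kappa>0 c) ks one0 \<mu>) F"
proof (induction ks arbitrary: \<mu>)
  case (Cons m ks)
  have "((\<lambda>e. (lax (h e) (\<kappa> e) c ^^ i) (lift0 (foldr (vac (h e) (\<kappa> e) c) ks one0)) k \<mu>) \<longlongrightarrow>
      (lax h0 \<kappa>0 c ^^ i) (lift0 (foldr (vac h0 \<kappa>0 c) ks one0)) k \<mu>) F" for i k \<mu>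
  proof (induction i arbitrary: k \<mu>)
    case 0
    then show ?case using Cons by (cases "k = 0") (auto simp: lift0_def)
  next
    case (Suc i)
    have step: "((\<lambda>e. lax (h e) (\<kappa> e) c (G e) k \<mu>) \<longlongrightarrow> lax h0 \<kappa>0 c G0 k \<mu>) F"
      if "\<And>k \<mu>. ((\<lambda>e. G e k \<mu>) \<longlongrightarrow> G0 k \<mu>) F" for G G0
      unfolding lax_def by (intro tendsto_intros h \<kappa> that)
    show ?case using step[OF Suc] by simp
  qed
  from this[of m 0 \<mu>] show ?case unfolding foldr.simps comp_apply vac_def[where k = m] .
qed simp

section \<open>The classical limit\<close>

definition evk :: "(nat \<Rightarrow> complex) \<Rightarrow> (nat \<Rightarrow> nat multiset \<Rightarrow> complex) \<Rightarrow> nat \<Rightarrow> complex" where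
  "evk V G k = (\<Sum>\<^sub>\<infinity>\<mu>\<in>pos_mset. vprod V \<mu> * G k \<mu>)"

lemma vprod_remove: "j \<in># \<mu> \<Longrightarrow> vprod V \<mu> = V j * vprod V (\<mu> - {#j#})"
  by (metis insert_DiffM vprod_simps(2))

lemma vprod_norm_le:
  assumes "\<And>j. j \<ge> 1 \<Longrightarrow> norm (V j) \<le> D" "\<mu> \<in> pos_mset"
  shows "norm (vprod V \<mu>) \<le> D ^ size \<mu>"
  using assms(2)
proof (induction \<mu>)
  case (add j \<mu>)
  then have "j \<ge> 1" "\<mu> \<in> pos_mset" by (auto simp: pos_mset_def Suc_le_eq)
  then show ?case using add.IH assms(1)[of j] by (auto simp: norm_mult intro!: mult_mono order_trans[OF norm_ge_zero assms(1)])
qed simp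

lemma has_sum_finite_sum:
  fixes f :: "'i \<Rightarrow> 'b \<Rightarrow> 'c::real_normed_vector"
  assumes "finite I" "\<And>i. i \<in> I \<Longrightarrow> (f i has_sum s i) A"
  shows "((\<lambda>x. \<Sum>i\<in>I. f i x) has_sum (\<Sum>i\<in>I. s i)) A"
  using assms by (induction I rule: finite_induct) (auto intro!: has_sum_add)

text \<open>For vanishing \<open>h\<close> and \<open>\<kappa>\<close> no derivative is left, and
  evaluating \<open>p_j\<close> at \<open>V j\<close> is multiplicative, so creation becomes
  multiplication by a scalar and the operator collapses to the Toeplitz operator. The weight
  hypothesis justifies exchanging the sums over multisets and parts.\<close>

lemma evk_lax:
  fixes G :: "nat \<Rightarrow> nat multiset \<Rightarrow> complex"
  assumes D: "\<And>j. j \<ge> 1 \<Longrightarrow> norm (V j) \<le> D"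
    and G: "wsum D 1 (\<lambda>k \<mu>. norm (G k \<mu>))"
  shows "evk V (lax 0 0 (\<lambda>j. cnj (V j)) G) = toep V (evk V G)"
proof
  fix k
  have D0: "0 \<le> D" using D[of 1] norm_ge_zero[of "V 1"] by linarith
  have gs: "(\<lambda>(k, \<mu>). D ^ size \<mu> * norm (G k \<mu>)) summable_on all_pairs"
    using G by (simp add: wsum_def wt_def)
  have vs: "(\<lambda>\<mu>. norm (vprod V \<mu> * G k \<mu>)) summable_on pos_mset" for k
  proof -
    have "(\<lambda>(k, \<mu>). D ^ size \<mu> * norm (G k \<mu>)) summable_on Pair k ` pos_mset"
      by (rule summable_on_subset[OF gs]) (auto simp: all_pairs_def)
    then have "(\<lambda>\<mu>. D ^ size \<mu> * norm (G k \<mu>)) summable_on pos_mset"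
      by (subst (asm) summable_on_reindex) (auto simp: inj_on_def comp_def)
    then show ?thesis
      by (rule summable_on_comparison_test) (auto simp: norm_mult intro!: mult_right_mono vprod_norm_le D)
  qed
  have ts: "(\<lambda>(\<mu>, j). norm (V j * (vprod V \<mu> * G (k + j) \<mu>))) summable_on pos_mset \<times> {1..}"
  proof -
    have "(\<lambda>(k, \<mu>). D * (D ^ size \<mu> * norm (G k \<mu>))) summable_on (\<lambda>(\<mu>, j). (k + j, \<mu>)) ` (pos_mset \<times> {1..})"
    proof -
      have sub: "(\<lambda>(\<mu>, j). (k + j, \<mu>)) ` (pos_mset \<times> {1..}) \<subseteq> all_pairs" by (auto simp: all_pairs_def)
      show ?thesis using summable_on_cmult_right[OF summable_on_subset[OF gs sub], of D] by (simp add: case_prod_unfold)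
    qed
    then have "(\<lambda>(\<mu>, j). D * (D ^ size \<mu> * norm (G (k + j) \<mu>))) summable_on (pos_mset \<times> {1..})"
      by (subst (asm) summable_on_reindex) (auto simp: inj_on_def comp_def case_prod_unfold)
    then show ?thesis
      by (rule summable_on_comparison_test)
         (auto simp: norm_mult intro!: mult_mono mult_right_mono vprod_norm_le D D0 mult_nonneg_nonneg)
  qed
  have ts': "(\<lambda>x. norm (case x of (\<mu>, j) \<Rightarrow> V j * (vprod V \<mu> * G (k + j) \<mu>))) summable_on pos_mset \<times> {1..}"
    using ts by (simp add: case_prod_unfold)
  let ?T = "\<lambda>(\<mu>, j). vprod V \<mu> * G (k + j) (\<mu> - {#j#})"
  have Sg: "(\<lambda>x. norm (?T x)) summable_on Sigma pos_mset set_mset \<longleftrightarrow> (\<lambda>x. norm (case x of (\<mu>, j) \<Rightarrow> V j * (vprod V \<mu> * G (k + j) \<mu>))) summable_on pos_mset \<times> {1..}"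
    by (rule summable_on_reindex_bij_witness[of _ "\<lambda>(\<mu>, j). (add_mset j \<mu>, j)" "\<lambda>(\<mu>, j). (\<mu> - {#j#}, j)"])
       (auto simp: pos_mset_def Suc_le_eq norm_mult vprod_remove dest: in_diffD intro!: gr0I)
  have Ie: "infsum ?T (Sigma pos_mset set_mset) = infsum (\<lambda>(\<mu>, j). V j * (vprod V \<mu> * G (k + j) \<mu>)) (pos_mset \<times> {1..})"
    by (rule infsum_reindex_bij_witness[of _ "\<lambda>(\<mu>, j). (add_mset j \<mu>, j)" "\<lambda>(\<mu>, j). (\<mu> - {#j#}, j)"])
       (auto simp: pos_mset_def Suc_le_eq vprod_remove dest: in_diffD intro!: gr0I)
  have sT: "(\<lambda>x. norm (?T x)) summable_on Sigma pos_mset set_mset" using Sg ts' by blast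
  have down: "(\<Sum>\<^sub>\<infinity>\<mu>\<in>pos_mset. \<Sum>j\<in>set_mset \<mu>. ?T (\<mu>, j)) = (\<Sum>\<^sub>\<infinity>j\<in>{1..}. V j * evk V G (k + j))"
  proof -
    have "(\<Sum>\<^sub>\<infinity>\<mu>\<in>pos_mset. \<Sum>j\<in>set_mset \<mu>. ?T (\<mu>, j)) = infsum ?T (Sigma pos_mset set_mset)"
      by (rule infsum_Sigma_finite[symmetric]) (use sT in auto)
    also have "\<dots> = (\<Sum>\<^sub>\<infinity>\<mu>\<in>pos_mset. \<Sum>\<^sub>\<infinity>j\<in>{1..}. V j * (vprod V \<mu> * G (k + j) \<mu>))"
      unfolding Ie using infsum_Sigma'_banach[OF abs_summable_summable[OF ts']] by simp
    also have "\<dots> = (\<Sum>\<^sub>\<infinity>j\<in>{1..}. \<Sum>\<^sub>\<infinity>\<mu>\<in>pos_mset. V j * (vprod V \<mu> * G (k + j) \<mu>))"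
      by (rule infsum_swap_banach[OF abs_summable_summable[OF ts']])
    also have "\<dots> = (\<Sum>\<^sub>\<infinity>j\<in>{1..}. V j * evk V G (k + j))" by (simp add: infsum_cmult_right' evk_def)
    finally show ?thesis .
  qed
  have dsum: "(\<lambda>\<mu>. \<Sum>j\<in>set_mset \<mu>. ?T (\<mu>, j)) summable_on pos_mset"
  proof (rule abs_summable_summable, rule Infinite_Sum.abs_summable_on_comparison_test')
    show "(\<lambda>\<mu>. \<Sum>j\<in>set_mset \<mu>. norm (?T (\<mu>, j))) summable_on pos_mset"
      using sT by (subst (asm) abs_summable_Sigma_finite) auto
    show "norm (\<Sum>j\<in>set_mset \<mu>. ?T (\<mu>, j)) \<le> (\<Sum>j\<in>set_mset \<mu>. norm (?T (\<mu>, j)))" for \<mu> by (rule norm_sum)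
  qed
  have vsum: "(\<lambda>\<mu>. vprod V \<mu> * G k \<mu>) summable_on pos_mset" for k by (rule abs_summable_summable[OF vs])
  have usum: "((\<lambda>\<mu>. \<Sum>j=1..k. cnj (V j) * (vprod V \<mu> * G (k - j) \<mu>)) has_sum (\<Sum>j=1..k. cnj (V j) * evk V G (k - j))) pos_mset"
    unfolding evk_def by (intro has_sum_finite_sum finite_atLeastAtMost has_sum_cmult_right has_sum_infsum vsum)
  have "evk V (lax 0 0 (\<lambda>j. cnj (V j)) G) k = (\<Sum>\<^sub>\<infinity>\<mu>\<in>pos_mset. (\<Sum>j=1..k. cnj (V j) * (vprod V \<mu> * G (k - j) \<mu>)) + (\<Sum>j\<in>set_mset \<mu>. ?T (\<mu>, j)))"
    unfolding evk_def
  proof (rule infsum_cong)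
    fix \<mu> assume "\<mu> \<in> pos_mset"
    then have "set_mset \<mu> - {0} = set_mset \<mu>" by (auto simp: pos_mset_def)
    then show "vprod V \<mu> * lax 0 0 (\<lambda>j. cnj (V j)) G k \<mu> = (\<Sum>j=1..k. cnj (V j) * (vprod V \<mu> * G (k - j) \<mu>)) + (\<Sum>j\<in>set_mset \<mu>. ?T (\<mu>, j))"
      by (simp add: lax_def distrib_left sum_distrib_left mult_ac)
  qed
  also have "\<dots> = (\<Sum>j=1..k. cnj (V j) * evk V G (k - j)) + (\<Sum>\<^sub>\<infinity>j\<in>{1..}. V j * evk V G (k + j))"
    by (subst infsum_add[OF has_sum_imp_summable[OF usum] dsum]) (simp only: infsumI[OF usum] down)
  also have "\<dots> = toep V (evk V G) k"
  proof -
    let ?h = "\<lambda>l. vhat V (int l - int k) * evk V G l"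
    have tail: "(\<lambda>j. V j * evk V G (k + j)) summable_on {1..}"
    proof -
      have "(\<lambda>(j, \<mu>). V j * (vprod V \<mu> * G (k + j) \<mu>)) summable_on {1..} \<times> pos_mset"
        using abs_summable_summable[OF ts'] summable_on_swap[of "\<lambda>(\<mu>, j). V j * (vprod V \<mu> * G (k + j) \<mu>)" pos_mset "{1..}"]
        by (simp add: case_prod_unfold)
      from summable_on_SigmaD[OF this] show ?thesis
        by (simp add: evk_def infsum_cmult_right' summable_on_cmult_right[OF vsum])
    qed
    have e3: "?h summable_on {k<..} \<longleftrightarrow> (\<lambda>j. V j * evk V G (k + j)) summable_on {1..}"
      by (rule summable_on_reindex_bij_witness[of _ "\<lambda>j. k + j" "\<lambda>l. l - k"]) (auto simp: vhat_def nat_diff_distrib)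
    have i3: "infsum ?h {k<..} = (\<Sum>\<^sub>\<infinity>j\<in>{1..}. V j * evk V G (k + j))"
      by (rule infsum_reindex_bij_witness[of _ "\<lambda>j. k + j" "\<lambda>l. l - k"]) (auto simp: vhat_def nat_diff_distrib)
    have i1: "(\<Sum>l<k. ?h l) = (\<Sum>j=1..k. cnj (V j) * evk V G (k - j))"
      by (rule sum.reindex_bij_witness[of _ "\<lambda>j. k - j" "\<lambda>l. k - l"]) (auto simp: vhat_def of_nat_diff nat_diff_distrib)
    have "toep V (evk V G) k = infsum ?h ({..k} \<union> {k<..})" unfolding toep_def
      by (rule arg_cong[where f = "infsum ?h"]) auto
    also have "\<dots> = infsum ?h {..k} + infsum ?h {k<..}"
      by (rule infsum_Un_disjoint) (use e3 tail in auto)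
    also have "infsum ?h {..k} = (\<Sum>l<k. ?h l)" by (simp add: lessThan_Suc_atMost[symmetric] vhat_def)
    finally show ?thesis by (simp add: i1 i3)
  qed
  finally show "evk V (lax 0 0 (\<lambda>j. cnj (V j)) G) k = toep V (evk V G) k" .
qed

lemma toep_cmult: "toep V (\<lambda>l. c * g l) = (\<lambda>k. c * toep V g k)"
  unfolding toep_def by (rule ext) (simp add: mult.left_commute[of _ c] infsum_cmult_right')

lemma toep_pow_cmult: "(toep V ^^ m) (\<lambda>l. c * g l) = (\<lambda>k. c * (toep V ^^ m) g k)"
  by (induction m) (simp_all add: toep_cmult)

definition analytic_data :: "(nat \<Rightarrow> complex) \<Rightarrow> real \<Rightarrow> real \<Rightarrow> bool" where
  "analytic_data V D \<rho> \<longleftrightarrow> D \<ge> 1 \<and> \<rho> > 1 \<and> (\<forall>j\<ge>1. norm (V j) \<le> D) \<and>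
     (\<forall>r. 1 \<le> r \<longrightarrow> r < \<rho> \<longrightarrow> (\<lambda>j. norm (V j) * r ^ j) summable_on {1..})"

lemma analytic_data_exists:
  assumes "analytic_symbol V"
  shows "\<exists>D \<rho>. analytic_data V D \<rho>"
proof -
  obtain \<rho> where r: "\<rho> > 1" "summable (\<lambda>k. norm (V (Suc k)) * \<rho> ^ Suc k)"
    using assms by (auto simp: analytic_symbol_def)
  have s: "(\<lambda>j. norm (V j) * r ^ j) summable_on {1..}" if "1 \<le> r" "r < \<rho>" for r
  proof -
    have "summable (\<lambda>k. norm (V (Suc k)) * r ^ Suc k)"
    proof (rule summable_comparison_test'[OF r(2)])
      fix k :: nat
      show "norm (norm (V (Suc k)) * r ^ Suc k) \<le> norm (V (Suc k)) * \<rho> ^ Suc k"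
        using that power_mono[of r \<rho> "Suc k"] by (simp add: mult_left_mono norm_mult norm_power del: power_Suc)
    qed
    then have "(\<lambda>k. norm (V (Suc k)) * r ^ Suc k) summable_on UNIV"
      using that by (intro norm_summable_imp_summable_on) (simp add: abs_mult del: power_Suc)
    also have "?this \<longleftrightarrow> (\<lambda>j. norm (V j) * r ^ j) summable_on {1..}"
      by (rule summable_on_reindex_bij_witness[of _ "\<lambda>j. j - 1" Suc]) auto
    finally show ?thesis .
  qed
  have "(\<lambda>k. norm (V (Suc k)) * \<rho> ^ Suc k) \<longlonglongrightarrow> 0" by (rule summable_LIMSEQ_zero[OF r(2)])
  then have "Bseq (\<lambda>k. norm (V (Suc k)) * \<rho> ^ Suc k)" using convergentI convergent_imp_Bseq by blast
  then obtain K where K: "\<And>k. norm (norm (V (Suc k)) * \<rho> ^ Suc k) \<le> K" by (auto simp: Bseq_def)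
  have "norm (V j) \<le> max 1 K" if "j \<ge> 1" for j
  proof -
    obtain k where j: "j = Suc k" using \<open>j \<ge> 1\<close> by (cases j) auto
    have "norm (V j) * 1 \<le> norm (V j) * \<rho> ^ Suc k"
      using r(1) by (intro mult_left_mono one_le_power) auto
    also have "\<dots> \<le> K" using K[of k] r(1) by (simp add: j abs_mult del: power_Suc)
    finally show ?thesis by simp
  qed
  then show ?thesis using s r(1) unfolding analytic_data_def by (intro exI[of _ "max 1 K"] exI[of _ \<rho>]) auto
qed

definition vop :: "(nat \<Rightarrow> complex) \<Rightarrow> real \<Rightarrow> real \<Rightarrow> nat list \<Rightarrow> nat multiset \<Rightarrow> complex" where
  "vop V h \<kappa> ks = foldr (vac (of_real h) (of_real \<kappa>) (\<lambda>j. cnj (V j))) ks one0"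

text \<open>Replacing every coefficient by its absolute value only increases the terms, so \<open>vmaj\<close> dominates
  \<open>vop\<close> uniformly for small parameters.\<close>
definition vmaj :: "(nat \<Rightarrow> complex) \<Rightarrow> real \<Rightarrow> real \<Rightarrow> nat list \<Rightarrow> nat multiset \<Rightarrow> real" where
  "vmaj V h \<kappa> ks = foldr (vac h \<kappa> (\<lambda>j. norm (V j))) ks one0"

lemma vop_le_vmaj: "\<bar>h\<bar> \<le> h0 \<Longrightarrow> \<bar>\<kappa>\<bar> \<le> \<kappa>0 \<Longrightarrow> norm (vop V h \<kappa> ks \<mu>) \<le> vmaj V h0 \<kappa>0 ks \<mu>"
  unfolding vop_def vmaj_def by (rule foldr_vac_norm_le) auto

lemma vmaj_summable:
  assumes a: "analytic_data V D \<rho>" and nn: "h \<ge> 0" "\<kappa> \<ge> 0"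
  shows "(\<lambda>\<mu>. norm (vprod V \<mu>) * vmaj V h \<kappa> ks \<mu>) summable_on pos_mset" "vmaj V h \<kappa> ks \<mu> \<ge> 0"
proof -
  have *: "(\<forall>\<mu>. vmaj V h \<kappa> ks \<mu> \<ge> 0) \<and> (\<forall>r. 1 \<le> r \<longrightarrow> r < \<rho> \<longrightarrow> wsum D r (lift0 (vmaj V h \<kappa> ks)))"
    unfolding vmaj_def by (rule foldr_vac_wsum) (use a nn in \<open>auto simp: analytic_data_def\<close>)
  then show "vmaj V h \<kappa> ks \<mu> \<ge> 0" by blast
  have "wsum D 1 (lift0 (vmaj V h \<kappa> ks))" using * a by (auto simp: analytic_data_def)
  then have "(\<lambda>(k, \<mu>). D ^ size \<mu> * lift0 (vmaj V h \<kappa> ks) k \<mu>) summable_on all_pairs" by (simp add: wsum_def wt_def)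
  then have "(\<lambda>(k, \<mu>). D ^ size \<mu> * lift0 (vmaj V h \<kappa> ks) k \<mu>) summable_on Pair 0 ` pos_mset"
    by (rule summable_on_subset) (auto simp: all_pairs_def)
  then have "(\<lambda>\<mu>. D ^ size \<mu> * vmaj V h \<kappa> ks \<mu>) summable_on pos_mset"
    by (subst (asm) summable_on_reindex) (auto simp: inj_on_def comp_def lift0_def)
  then show "(\<lambda>\<mu>. norm (vprod V \<mu>) * vmaj V h \<kappa> ks \<mu>) summable_on pos_mset"
    by (rule summable_on_comparison_test) (use * a in \<open>auto simp: analytic_data_def intro!: mult_right_mono vprod_norm_le\<close>)
qed

lemma vop_summable:
  assumes a: "analytic_data V D \<rho>"
  shows "(\<lambda>\<mu>. norm (vprod V \<mu> * vop V h \<kappa> ks \<mu>)) summable_on pos_mset"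
  by (rule summable_on_comparison_test[OF vmaj_summable(1)[OF a, of "\<bar>h\<bar>" "\<bar>\<kappa>\<bar>" ks]])
     (auto simp: norm_mult intro!: mult_left_mono vop_le_vmaj)

text \<open>After evaluation at \<open>V\<close> the vector \<open>lift0 f\<close> is a number times
  the vacuum vector, so each further vacuum operator multiplies by one \<open>tau\<close>: in the
  classical limit the factors decouple.\<close>

lemma vop_classical:
  assumes a: "analytic_data V D \<rho>"
  shows "(\<Sum>\<^sub>\<infinity>\<mu>\<in>pos_mset. vprod V \<mu> * vop V 0 0 ks \<mu>) = (\<Prod>k\<leftarrow>ks. tau V k)"
proof (induction ks)
  case Nil
  have "(\<Sum>\<^sub>\<infinity>\<mu>\<in>pos_mset. vprod V \<mu> * vop V 0 0 [] \<mu>) = (\<Sum>\<^sub>\<infinity>\<mu>\<in>{{#}}. vprod V \<mu> * vop V 0 0 [] \<mu>)"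
    by (rule infsum_cong_neutral) (auto simp: vop_def one0_def pos_mset_def)
  then show ?case by (simp add: vop_def one0_def)
next
  case (Cons m ks)
  let ?L = "lax 0 0 (\<lambda>j. cnj (V j))" and ?M = "lax 0 0 (\<lambda>j. norm (V j)) :: _ \<Rightarrow> nat \<Rightarrow> nat multiset \<Rightarrow> real"
  let ?f = "vop V 0 0 ks" and ?g = "vmaj V 0 0 ks"
  have b: "(\<forall>\<mu>. ?g \<mu> \<ge> 0) \<and> (\<forall>r. 1 \<le> r \<longrightarrow> r < \<rho> \<longrightarrow> wsum D r (lift0 ?g))"
    unfolding vmaj_def by (rule foldr_vac_wsum) (use a in \<open>auto simp: analytic_data_def\<close>)
  have n0: "lift0 ?g k \<mu> \<ge> 0" for k \<mu> using b by (simp add: lift0_def)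
  have ws: "wsum D r ((?M ^^ i) (lift0 ?g))" if "1 \<le> r" "r < \<rho>" for i r
    using that
  proof (induction i arbitrary: r)
    case 0
    then show ?case using b by simp
  next
    case (Suc i)
    have "wsum D ((r + \<rho>) / 2) ((?M ^^ i) (lift0 ?g))" using Suc.prems by (intro Suc.IH) auto
    then have "wsum D r (?M ((?M ^^ i) (lift0 ?g)))"
      by (rule wsum_lax[rotated -1]) (use Suc.prems a n0 lax_pow_nonneg[of 0 0 "\<lambda>j. norm (V j)"] in \<open>auto simp: analytic_data_def\<close>)
    then show ?case by simp
  qed
  have le: "norm ((?L ^^ i) (lift0 ?f) k \<mu>) \<le> (?M ^^ i) (lift0 ?g) k \<mu>" for i k \<mu>
  proof (induction i arbitrary: k \<mu>)
    case 0
    then show ?case using vop_le_vmaj[of 0 0 0 0 V ks \<mu>] b by (cases "k = 0") (simp_all add: lift0_def)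
  next
    case (Suc i)
    then show ?case unfolding funpow.simps comp_apply by (intro lax_norm_le) auto
  qed
  have w1: "wsum D 1 (\<lambda>k \<mu>. norm ((?L ^^ i) (lift0 ?f) k \<mu>))" for i
  proof -
    have D: "D \<ge> 0" "1 < \<rho>" using a by (auto simp: analytic_data_def)
    show ?thesis unfolding wsum_def
      by (rule summable_on_comparison_test[OF ws[of 1 i, unfolded wsum_def]])
         (use D le wt_nonneg[of 1 D] in \<open>auto intro!: mult_left_mono\<close>)
  qed
  have "evk V ((?L ^^ i) (lift0 ?f)) = (toep V ^^ i) (evk V (lift0 ?f))" for i
    by (induction i) (use evk_lax[OF _ w1] a in \<open>auto simp: analytic_data_def\<close>)
  moreover have "evk V (lift0 ?f) = (\<lambda>k. (\<Prod>k\<leftarrow>ks. tau V k) * (if k = 0 then 1 else 0))"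
    using Cons by (auto simp: evk_def lift0_def fun_eq_iff)
  ultimately have "evk V ((?L ^^ m) (lift0 ?f)) 0 = (\<Prod>k\<leftarrow>ks. tau V k) * tau V m"
    by (simp only: toep_pow_cmult tau_def)
  then show ?case by (simp add: evk_def vop_def vac_def[where k = m] mult.commute)
qed

lemma vop_limit:
  assumes a: "analytic_data V D \<rho>"
    and h: "(h \<longlongrightarrow> 0) F" and \<kappa>: "(\<kappa> \<longlongrightarrow> 0) F"
  shows "((\<lambda>e. \<Sum>\<^sub>\<infinity>\<mu>\<in>pos_mset. vprod V \<mu> * vop V (h e) (\<kappa> e) ks \<mu>) \<longlongrightarrow> (\<Prod>k\<leftarrow>ks. tau V k)) F"
  unfolding vop_classical[OF a, symmetric]
proof (rule dominated_infsum[where M = "\<lambda>\<mu>. norm (vprod V \<mu>) * vmaj V 1 1 ks \<mu>"])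
  show "((\<lambda>e. vprod V \<mu> * vop V (h e) (\<kappa> e) ks \<mu>) \<longlongrightarrow> vprod V \<mu> * vop V 0 0 ks \<mu>) F" for \<mu>
    unfolding vop_def by (intro tendsto_mult tendsto_const tendsto_foldr_vac tendsto_of_real h \<kappa>)
  have "eventually (\<lambda>e. \<bar>h e\<bar> \<le> 1 \<and> \<bar>\<kappa> e\<bar> \<le> 1) F"
    using order_tendstoD(2)[OF tendsto_rabs_zero[OF h] zero_less_one] order_tendstoD(2)[OF tendsto_rabs_zero[OF \<kappa>] zero_less_one]
    by eventually_elim auto
  then show "eventually (\<lambda>e. \<forall>\<mu>\<in>pos_mset. norm (vprod V \<mu> * vop V (h e) (\<kappa> e) ks \<mu>) \<le> norm (vprod V \<mu>) * vmaj V 1 1 ks \<mu>) F"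
    by eventually_elim (auto simp: norm_mult intro!: mult_left_mono vop_le_vmaj)
  show "(\<lambda>\<mu>. norm (vprod V \<mu>) * vmaj V 1 1 ks \<mu>) summable_on pos_mset"
    by (rule vmaj_summable[OF a]) auto
  show "norm (vprod V \<mu> * vop V 0 0 ks \<mu>) \<le> norm (vprod V \<mu>) * vmaj V 1 1 ks \<mu>" for \<mu>
    by (auto simp: norm_mult intro!: mult_left_mono vop_le_vmaj)
qed

section \<open>Moments under the Jack measure\<close>

text \<open>Division by \<open>b ^ size \<mu>\<close> rewrites an element in the variables
  \<open>V_j = b * p_j\<close>. For \<open>b = - e2\<close> and
  \<open>\<alpha> = e1 / (- e2)\<close> the new constants \<open>\<alpha> * b\<^sup>2\<close> and
  \<open>b * (\<alpha> - 1)\<close> are \<open>- e1 * e2\<close> and \<open>e1 + e2\<close>.\<close>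

lemma lax_rescale:
  fixes b \<alpha> :: complex
  assumes b: "b \<noteq> 0"
  shows "b * lax \<alpha> (\<alpha> - 1) (\<lambda>_. 0) G k \<mu> / b ^ size \<mu> = lax (\<alpha> * b\<^sup>2) (b * (\<alpha> - 1)) (\<lambda>_. 0) (\<lambda>k \<mu>. G k \<mu> / b ^ size \<mu>) k \<mu>"
proof -
  have 1: "b * (\<Sum>j=1..k. \<alpha> * of_nat (j * Suc (count \<mu> j)) * G (k - j) (add_mset j \<mu>)) / b ^ size \<mu> =
     (\<Sum>j=1..k. \<alpha> * b\<^sup>2 * of_nat (j * Suc (count \<mu> j)) * (G (k - j) (add_mset j \<mu>) / b ^ size (add_mset j \<mu>)))"
    unfolding sum_distrib_left sum_divide_distrib
    by (intro sum.cong refl) (use b in \<open>simp add: power2_eq_square field_simps del: of_nat_mult of_nat_Suc\<close>)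
  have 2: "b * (\<Sum>j\<in>set_mset \<mu> - {0}. G (k + j) (\<mu> - {#j#})) / b ^ size \<mu> = (\<Sum>j\<in>set_mset \<mu> - {0}. G (k + j) (\<mu> - {#j#}) / b ^ size (\<mu> - {#j#}))"
    unfolding sum_distrib_left sum_divide_distrib
    by (intro sum.cong refl) (use b in \<open>auto dest!: multi_member_split simp: field_simps\<close>)
  show ?thesis unfolding lax_def 1[symmetric] 2[symmetric] by (simp add: add_divide_distrib distrib_left mult_ac)
qed

lemma foldr_vac_rescale:
  fixes b \<alpha> :: complex
  assumes b: "b \<noteq> 0"
  shows "b ^ sum_list ks * foldr (vac \<alpha> (\<alpha> - 1) (\<lambda>_. 0)) ks f \<mu> / b ^ size \<mu> =
     foldr (vac (\<alpha> * b\<^sup>2) (b * (\<alpha> - 1)) (\<lambda>_. 0)) ks (\<lambda>\<mu>. f \<mu> / b ^ size \<mu>) \<mu>"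
proof (induction ks arbitrary: \<mu>)
  case (Cons m ks)
  let ?g = "foldr (vac \<alpha> (\<alpha> - 1) (\<lambda>_. 0)) ks f"
  let ?g' = "foldr (vac (\<alpha> * b\<^sup>2) (b * (\<alpha> - 1)) (\<lambda>_. 0)) ks (\<lambda>\<mu>. f \<mu> / b ^ size \<mu>)"
  have g': "?g' = (\<lambda>\<mu>. b ^ sum_list ks * ?g \<mu> / b ^ size \<mu>)" using Cons by (simp add: fun_eq_iff)
  have "b ^ i * (b ^ sum_list ks * (lax \<alpha> (\<alpha> - 1) (\<lambda>_. 0) ^^ i) (lift0 ?g) k \<mu>) / b ^ size \<mu> =
     (lax (\<alpha> * b\<^sup>2) (b * (\<alpha> - 1)) (\<lambda>_. 0) ^^ i) (lift0 ?g') k \<mu>" for i k \<mu>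
  proof (induction i arbitrary: k \<mu>)
    case 0
    then show ?case by (simp add: g' lift0_def)
  next
    case (Suc i)
    let ?G = "(lax \<alpha> (\<alpha> - 1) (\<lambda>_. 0) ^^ i) (lift0 ?g)"
    have "(lax (\<alpha> * b\<^sup>2) (b * (\<alpha> - 1)) (\<lambda>_. 0) ^^ Suc i) (lift0 ?g') k \<mu> =
       lax (\<alpha> * b\<^sup>2) (b * (\<alpha> - 1)) (\<lambda>_. 0) (\<lambda>k \<mu>. (b ^ i * (b ^ sum_list ks * ?G k \<mu>)) / b ^ size \<mu>) k \<mu>"
      by (simp add: Suc)
    also have "\<dots> = b * lax \<alpha> (\<alpha> - 1) (\<lambda>_. 0) (\<lambda>k \<mu>. b ^ i * (b ^ sum_list ks * ?G k \<mu>)) k \<mu> / b ^ size \<mu>"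
      by (rule lax_rescale[OF b, symmetric])
    also have "lax \<alpha> (\<alpha> - 1) (\<lambda>_. 0) (\<lambda>k \<mu>. b ^ i * (b ^ sum_list ks * ?G k \<mu>)) k \<mu> = (b ^ i * b ^ sum_list ks) * lax \<alpha> (\<alpha> - 1) (\<lambda>_. 0) ?G k \<mu>"
      using lax_sum[of \<alpha> "\<alpha> - 1" "\<lambda>_. 0" "\<lambda>_. b ^ i * b ^ sum_list ks" "\<lambda>_. ?G" "{()}" k \<mu>] by (simp add: mult.assoc)
    finally show ?case by (simp add: mult.assoc)
  qed
  from this[of m 0 \<mu>] show ?case
    unfolding foldr.simps comp_apply vac_def[where k = m] by (simp add: power_add mult.assoc)
qed simp

locale jack_asymptotics =
  fixes V :: "nat \<Rightarrow> complex" and \<beta> :: real and D \<rho> :: real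
  assumes an: "analytic_symbol V" and ad: "analytic_data V D \<rho>" and beta: "\<beta> > 0"
begin

text \<open>The eigenvalues in the true normalisation: \<open>\<beta> / 2 * e\<close> is
  \<open>- e2\<close>, and each application of the operator was scaled by it.\<close>

definition mt :: "real \<Rightarrow> nat list \<Rightarrow> nat \<Rightarrow> real" where
  "mt e lam k = (\<beta> / 2 * e) ^ k * walk (2 / \<beta>) lam k 0"

definition pr :: "real \<Rightarrow> nat list \<Rightarrow> real" where
  "pr e lam = jack_prob (- (\<beta> / 2) * e) e V lam"

lemma Pi_has_sum:
  assumes e: "e > 0"
  shows "(cohw V (\<beta> / 2 * e\<^sup>2) has_sum jack_Pi (- (\<beta> / 2) * e) e V) pos_mset"
proof -
  let ?h = "\<beta> / 2 * e\<^sup>2"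
  have h: "?h > 0" using e beta by simp
  let ?x = "\<lambda>j. (norm (V j))\<^sup>2 / (?h * real j)"
  have D1: "D \<ge> 1" "\<And>j. j \<ge> 1 \<Longrightarrow> norm (V j) \<le> D" "(\<lambda>j. norm (V j) * 1 ^ j) summable_on {1..}"
    using ad unfolding analytic_data_def by (auto simp del: power_one)
  have "?x summable_on {1..}"
  proof (rule summable_on_comparison_test)
    show "(\<lambda>j. (D / ?h) * (norm (V j) * 1 ^ j)) summable_on {1..}"
      by (rule summable_on_cmult_right[OF D1(3)])
    fix j :: nat assume j: "j \<in> {1..}"
    have "?x j = (norm (V j) / (?h * real j)) * norm (V j)" by (simp add: power2_eq_square)
    also have "\<dots> \<le> (D / ?h) * norm (V j)"
    proof (rule mult_right_mono)
      have "norm (V j) / (?h * real j) \<le> D / (?h * real j)" using h D1(2)[of j] j by (intro divide_right_mono) auto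
      also have "\<dots> \<le> D / ?h" using h j D1(1) by (intro divide_left_mono) (auto simp: mult_le_cancel_left1)
      finally show "norm (V j) / (?h * real j) \<le> D / ?h" .
    qed simp
    finally show "?x j \<le> (D / ?h) * (norm (V j) * 1 ^ j)" by simp
  qed (use h in auto)
  then have S: "(?x has_sum infsum ?x {1..}) {1..}" by (rule has_sum_infsum)
  also have "?this \<longleftrightarrow> ((\<lambda>k. ?x (Suc k)) has_sum infsum ?x {1..}) UNIV"
    by (rule has_sum_reindex_bij_witness[of _ Suc "\<lambda>j. j - 1"]) auto
  finally have "(\<lambda>k. ?x (Suc k)) sums infsum ?x {1..}" by (rule has_sum_imp_sums)
  moreover have "- e * (- (\<beta> / 2) * e) = ?h" by (simp add: power2_eq_square)
  ultimately have "jack_Pi (- (\<beta> / 2) * e) e V = exp (infsum ?x {1..})"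
    unfolding jack_Pi_def by (simp only: sums_iff)
  with cohw_has_sum[OF h S] show ?thesis by simp
qed

lemma pr_degree:
  assumes e: "e > 0"
  shows "of_real (\<Sum>lam\<in>parts n. pr e lam * (\<Prod>k\<leftarrow>ks. mt e lam k)) =
     (\<Sum>\<mu>\<in>deg_msets n. vprod V \<mu> * star (vop V (\<beta> / 2 * e\<^sup>2) (e - \<beta> / 2 * e) ks) (coh V (\<beta> / 2 * e\<^sup>2)) \<mu>) / of_real (jack_Pi (- (\<beta> / 2) * e) e V)"
proof -
  define b where "b = \<beta> / 2 * e"
  define \<alpha> where "\<alpha> = 2 / \<beta>"
  define h where "h = \<beta> / 2 * e\<^sup>2"
  have b: "b > 0" and \<alpha>: "\<alpha> > 0" and h: "h > 0" using e beta by (auto simp: b_def \<alpha>_def h_def)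
  have ab: "e / (- (- (\<beta> / 2) * e)) = \<alpha>" using e beta by (simp add: \<alpha>_def field_simps)
  have hb: "\<alpha> * b\<^sup>2 = h" "b * (\<alpha> - 1) = e - b" using e beta by (simp_all add: \<alpha>_def b_def h_def power2_eq_square field_simps)
  define v where "v \<mu> = vprod V \<mu> / of_real b ^ size \<mu>" for \<mu>
  define ev where "ev lam = (\<Sum>\<mu>\<in>deg_msets n. of_real (jackF \<alpha> n lam \<mu>) * v \<mu>)" for lam
  have pl: "(\<Prod>i<length mu. V (mu ! i) / of_real b) = v (mset mu)" for mu
  proof -
    have "(\<Prod>i<length mu. V (mu ! i) / of_real b) = (\<Prod>i<length mu. V (mu ! i)) / of_real b ^ length mu"
      by (simp add: prod_dividef)
    also have "(\<Prod>i<length mu. V (mu ! i)) = vprod V (mset mu)"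
      by (induction mu rule: rev_induct) (simp_all add: nth_append vprod_def mult.commute)
    finally show ?thesis by (simp add: v_def)
  qed
  have ev: "jack_eval (- (\<beta> / 2) * e) e V lam = ev lam" if lam: "lam \<in> parts n" for lam
  proof -
    have "sum_list lam = n" using lam by (simp add: parts_def)
    then have "jack_eval (- (\<beta> / 2) * e) e V lam = (\<Sum>mu\<in>parts n. of_real (jackP \<alpha> lam mu) * v (mset mu))"
      unfolding jack_eval_def ab by (simp add: pl[symmetric] b_def)
    also have "\<dots> = (\<Sum>mu\<in>parts n. of_real (jackF \<alpha> n lam (mset mu)) * v (mset mu))"
      by (intro sum.cong refl) (simp add: jackP_eq[OF \<alpha> lam])
    also have "\<dots> = ev lam" unfolding ev_def
      by (rule sum.reindex_bij_betw[OF bij_parts, of "\<lambda>\<mu>. of_real (jackF \<alpha> n lam \<mu>) * v \<mu>"])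
    finally show ?thesis .
  qed
  have nm: "jack_norm2 (- (\<beta> / 2) * e) e lam = fip \<alpha> n (jackF \<alpha> n lam) (jackF \<alpha> n lam)" if lam: "lam \<in> parts n" for lam
  proof -
    have "sum_list lam = n" using lam by (simp add: parts_def)
    then have "jack_norm2 (- (\<beta> / 2) * e) e lam = jack_ip \<alpha> n (jackP \<alpha> lam) (jackP \<alpha> lam)"
      unfolding jack_norm2_def ab by simp
    also have "\<dots> = jack_ip \<alpha> n (\<lambda>mu. jackF \<alpha> n lam (mset mu)) (\<lambda>mu. jackF \<alpha> n lam (mset mu))"
      by (rule jack_ip_cong) (auto simp: jackP_eq[OF \<alpha> lam])
    finally show ?thesis by (simp add: jack_ip_fip)
  qed
  let ?Pi = "jack_Pi (- (\<beta> / 2) * e) e V"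
  have mp: "(\<Prod>k\<leftarrow>ks. mt e lam k) = b ^ sum_list ks * (\<Prod>k\<leftarrow>ks. walk \<alpha> lam k 0)" for lam
    by (induction ks) (simp_all add: mt_def b_def \<alpha>_def power_add mult_ac)
  define \<Psi> where "\<Psi> \<mu> = cnj (v \<mu>) / of_real (zz \<mu> * \<alpha> ^ size \<mu>)" for \<mu>
  define w where "w lam = (norm (ev lam))\<^sup>2 / fip \<alpha> n (jackF \<alpha> n lam) (jackF \<alpha> n lam)" for lam
  have pw: "pr e lam = w lam / ?Pi" if "lam \<in> parts n" for lam
    unfolding pr_def jack_prob_def w_def by (simp only: ev[OF that] nm[OF that])
  have "of_real (\<Sum>lam\<in>parts n. pr e lam * (\<Prod>k\<leftarrow>ks. mt e lam k)) = of_real b ^ sum_list ks * of_real (\<Sum>lam\<in>parts n. w lam * (\<Prod>k\<leftarrow>ks. walk \<alpha> lam k 0)) / complex_of_real ?Pi"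
  proof -
    have "(\<Sum>lam\<in>parts n. pr e lam * (\<Prod>k\<leftarrow>ks. mt e lam k)) = (\<Sum>lam\<in>parts n. b ^ sum_list ks * (w lam * (\<Prod>k\<leftarrow>ks. walk \<alpha> lam k 0)) / ?Pi)"
      by (intro sum.cong refl) (simp add: pw mp)
    also have "\<dots> = b ^ sum_list ks * (\<Sum>lam\<in>parts n. w lam * (\<Prod>k\<leftarrow>ks. walk \<alpha> lam k 0)) / ?Pi"
      by (simp only: sum_distrib_left sum_divide_distrib)
    finally show ?thesis by (simp only: of_real_mult of_real_divide of_real_power)
  qed
  also have "of_real (\<Sum>lam\<in>parts n. w lam * (\<Prod>k\<leftarrow>ks. walk \<alpha> lam k 0)) =
     (\<Sum>\<mu>\<in>deg_msets n. v \<mu> * foldr (vac (of_real \<alpha>) (of_real (\<alpha> - 1)) (\<lambda>_. 0)) ks \<Psi> \<mu>)"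
    unfolding w_def ev_def \<Psi>_def[abs_def] by (rule jack_expect_degree[OF \<alpha>, symmetric])
  also have "of_real b ^ sum_list ks * \<dots> =
     (\<Sum>\<mu>\<in>deg_msets n. vprod V \<mu> * (of_real b ^ sum_list ks * foldr (vac (of_real \<alpha>) (of_real \<alpha> - 1) (\<lambda>_. 0)) ks \<Psi> \<mu> / of_real b ^ size \<mu>))"
    unfolding sum_distrib_left by (intro sum.cong refl) (simp add: v_def)
  also have "\<dots> = (\<Sum>\<mu>\<in>deg_msets n. vprod V \<mu> * foldr (vac (of_real h) (of_real (e - b)) (\<lambda>_. 0)) ks (coh V h) \<mu>)"
  proof -
    \<comment> \<open>One power of \<open>b\<close> per part sits in \<open>v\<close>, the other
      comes from the change of variables; with \<alpha> they combine to \<open>h\<close>.\<close>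
    have "(\<lambda>\<mu>. \<Psi> \<mu> / of_real b ^ size \<mu>) = coh V h"
      unfolding coh_def[abs_def] \<Psi>_def v_def hb(1)[symmetric]
      by (rule ext) (simp add: power_mult_distrib power2_eq_square mult_ac)
    moreover have "complex_of_real \<alpha> * (of_real b)\<^sup>2 = of_real h" "complex_of_real b * (of_real \<alpha> - 1) = of_real (e - b)"
      unfolding hb[symmetric] by simp_all
    moreover have "complex_of_real b \<noteq> 0" using b by simp
    ultimately show ?thesis using foldr_vac_rescale[of "of_real b" ks "of_real \<alpha>" \<Psi>] by simp
  qed
  also have "foldr (vac (of_real h) (of_real (e - b)) (\<lambda>_. 0)) ks (coh V h) = star (vop V h (e - b) ks) (coh V h)"
    unfolding vop_def by (rule foldr_vac_star) (rule coh_step[OF h])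
  finally show ?thesis unfolding h_def b_def .
qed

text \<open>Evaluation at \<open>V\<close> is multiplicative, so the coherent state contributes
  exactly the factor \<open>jack_Pi\<close>, which the normalisation cancels. The sum is still
  grouped by degree; absolute convergence over partitions is obtained in
  \<open>partition_sum\<close>.\<close>

lemma pr_moment_sum:
  assumes e: "e > 0"
  shows "((\<lambda>n. \<Sum>lam\<in>parts n. pr e lam * (\<Prod>k\<leftarrow>ks. mt e lam k)) has_sum
     Re (\<Sum>\<^sub>\<infinity>\<mu>\<in>pos_mset. vprod V \<mu> * vop V (\<beta> / 2 * e\<^sup>2) (e - \<beta> / 2 * e) ks \<mu>)) UNIV"
proof -
  let ?h = "\<beta> / 2 * e\<^sup>2" and ?Pi = "jack_Pi (- (\<beta> / 2) * e) e V"
  let ?f = "vop V ?h (e - \<beta> / 2 * e) ks"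
  have h: "?h > 0" using e beta by simp
  have Pi: "?Pi > 0" by (simp add: jack_Pi_def)
  have c: "((\<lambda>\<mu>. vprod V \<mu> * coh V ?h \<mu>) has_sum of_real ?Pi) pos_mset"
    unfolding vprod_coh using Pi_has_sum[OF e] by (simp only: has_sum_of_real_iff)
  have ca: "(\<lambda>\<mu>. norm (vprod V \<mu> * coh V ?h \<mu>)) summable_on pos_mset"
    unfolding vprod_coh using has_sum_imp_summable[OF Pi_has_sum[OF e]] cohw_nonneg[OF h] by simp
  have "((\<lambda>\<mu>. vprod V \<mu> * star ?f (coh V ?h) \<mu>) has_sum (infsum (\<lambda>\<mu>. vprod V \<mu> * ?f \<mu>) pos_mset * of_real ?Pi)) pos_mset"
    using ev_star[OF vop_summable[OF ad] ca] infsumI[OF c] by simp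
  also have "?this \<longleftrightarrow> ((\<lambda>(n, \<mu>). vprod V \<mu> * star ?f (coh V ?h) \<mu>) has_sum (infsum (\<lambda>\<mu>. vprod V \<mu> * ?f \<mu>) pos_mset * of_real ?Pi)) (Sigma UNIV deg_msets)"
    by (rule has_sum_reindex_bij_witness[of _ snd "\<lambda>\<mu>. (sum_mset \<mu>, \<mu>)"]) (auto simp: deg_msets_def)
  finally have "((\<lambda>n. \<Sum>\<mu>\<in>deg_msets n. vprod V \<mu> * star ?f (coh V ?h) \<mu>) has_sum (infsum (\<lambda>\<mu>. vprod V \<mu> * ?f \<mu>) pos_mset * of_real ?Pi)) UNIV"
    by (rule has_sum_SigmaD) (auto intro: has_sum_finite finite_deg_msets)
  from has_sum_cmult_left[OF this, of "1 / of_real ?Pi"]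
  have "((\<lambda>n. complex_of_real (\<Sum>lam\<in>parts n. pr e lam * (\<Prod>k\<leftarrow>ks. mt e lam k))) has_sum infsum (\<lambda>\<mu>. vprod V \<mu> * ?f \<mu>) pos_mset) UNIV"
    unfolding pr_degree[OF e] using Pi by simp
  from has_sum_Re[OF this] show ?thesis by simp
qed

lemma tau_real: "tau V k = of_real (Re (tau V k))"
  and tau_newton: "real k * Re (tau V k) = (\<Sum>j=1..k. Re (tau V (k - j)) * vmom V j)"
  and vmom_0: "vmom V 0 = 1"
proof -
  have V: "abs_coeffs V" by (rule analytic_abs_coeffs[OF an])
  show v0: "vmom V 0 = 1" by (simp add: vmom_def)
  have rec: "of_nat n * tau V n = (\<Sum>j=1..n. tau V (n - j) * of_real (vmom V j))" for n
  proof -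
    have "of_nat (Suc n) * tau V n = (\<Sum>k\<le>n. tau V k * of_real (vmom V (n - k)))"
      using szego_identity[OF V, of n] by (simp only: vmom_cmean[OF V])
    \<comment> \<open>The term \<open>k = n\<close> carries the zeroth moment 1; subtracting it
      lowers the factor \<open>Suc n\<close> to \<open>n\<close> and leaves Newton's form.\<close>
    also have "\<dots> = (\<Sum>k<n. tau V k * of_real (vmom V (n - k))) + tau V n"
      by (simp add: lessThan_Suc_atMost[symmetric] v0)
    also have "(\<Sum>k<n. tau V k * of_real (vmom V (n - k))) = (\<Sum>j=1..n. tau V (n - j) * of_real (vmom V j))"
      by (rule sum.reindex_bij_witness[of _ "\<lambda>j. n - j" "\<lambda>k. n - k"]) auto
    finally show ?thesis by (simp add: algebra_simps)
  qed
  have re: "tau V k = of_real (Re (tau V k))" for k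
  proof (induction k rule: less_induct)
    case (less k)
    show ?case
    proof (cases "k = 0")
      case True
      then show ?thesis by (simp add: tau_def)
    next
      case False
      have "of_nat k * tau V k = (\<Sum>j=1..k. of_real (Re (tau V (k - j)) * vmom V j))"
        unfolding rec by (intro sum.cong refl) (use less False in auto)
      also have "\<dots> = of_real (\<Sum>j=1..k. Re (tau V (k - j)) * vmom V j)" by simp
      finally have "tau V k = of_real ((\<Sum>j=1..k. Re (tau V (k - j)) * vmom V j) / real k)"
        using False by (simp add: field_simps)
      then show ?thesis by (metis Re_complex_of_real)
    qed
  qed
  then show "tau V k = of_real (Re (tau V k))" .
  have "Re (of_nat k * tau V k) = Re (\<Sum>j=1..k. tau V (k - j) * of_real (vmom V j))" by (simp only: rec)
  then show "real k * Re (tau V k) = (\<Sum>j=1..k. Re (tau V (k - j)) * vmom V j)" by simp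
qed

end

text \<open>Products of linear statistics are polynomials in the vacuum eigenvalues by the Newton relations, so
  convergence of the monomials in these eigenvalues suffices.\<close>
inductive_set moment_polys :: "((nat \<Rightarrow> real) \<Rightarrow> real) set" where
  mono: "(\<lambda>t. \<Prod>k\<leftarrow>ks. t k) \<in> moment_polys"
| lin: "f \<in> moment_polys \<Longrightarrow> g \<in> moment_polys \<Longrightarrow> (\<lambda>t. c * f t + g t) \<in> moment_polys"

lemma moment_polys_mult:
  assumes "f \<in> moment_polys" "g \<in> moment_polys"
  shows "(\<lambda>t. f t * g t) \<in> moment_polys"
  using assms(1)
proof induction
  case (mono ks)
  from assms(2) show ?case
  proof induction
    case (mono ls)
    show ?case using moment_polys.mono[of "ks @ ls"] by simp
  next
    case (lin f g c)
    from moment_polys.lin[OF lin.IH, of c] show ?case by (simp add: algebra_simps)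
  qed
next
  case (lin f1 f2 c)
  from moment_polys.lin[OF lin.IH, of c] show ?case by (simp add: algebra_simps)
qed

lemma moment_polys_sum:
  assumes "finite I" "\<And>i. i \<in> I \<Longrightarrow> f i \<in> moment_polys"
  shows "(\<lambda>t. \<Sum>i\<in>I. f i t) \<in> moment_polys"
  using assms
proof (induction I rule: finite_induct)
  case empty
  from moment_polys.lin[OF moment_polys.mono[of "[]"] moment_polys.mono[of "[]"], of "-1"] show ?case by simp
next
  case (insert i I)
  then have "f i \<in> moment_polys" "(\<lambda>t. \<Sum>i\<in>I. f i t) \<in> moment_polys" by auto
  from moment_polys.lin[OF this, of 1] insert show ?case by simp
qed

lemma moment_polys_prod_list:
  "(\<And>l. p l \<in> moment_polys) \<Longrightarrow> (\<lambda>t. \<Prod>l\<leftarrow>ls. p l t) \<in> moment_polys"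
proof (induction ls)
  case Nil
  show ?case using moment_polys.mono[of "[]"] by simp
next
  case (Cons l ls)
  then show ?case by (simp add: moment_polys_mult)
qed

definition newton_pair :: "(nat \<Rightarrow> real) \<Rightarrow> (nat \<Rightarrow> real) \<Rightarrow> bool" where
  "newton_pair t s \<longleftrightarrow> t 0 = 1 \<and> s 0 = 1 \<and> (\<forall>k. real k * t k = (\<Sum>j=1..k. t (k - j) * s j))"

text \<open>One polynomial serves all Newton pairs at once. This uniformity matters: it is applied
  to the eigenvalues of every partition and also to the limits \<open>Re (tau V k)\<close>.\<close>

lemma newton_moment_poly:
  "\<exists>p. p \<in> moment_polys \<and> (\<forall>t s. newton_pair t s \<longrightarrow> p t = s l)"
proof (induction l rule: less_induct)
  case (less l)
  show ?case
  proof (cases "l = 0")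
    case True
    then show ?thesis using moment_polys.mono[of "[]"] by (intro exI[of _ "\<lambda>t. 1"]) (auto simp: newton_pair_def)
  next
    case False
    from less have "\<forall>j\<in>{..<l}. \<exists>p. p \<in> moment_polys \<and> (\<forall>t s. newton_pair t s \<longrightarrow> p t = s j)" by blast
    from bchoice[OF this] obtain p where
      p: "\<forall>j\<in>{..<l}. p j \<in> moment_polys \<and> (\<forall>t s. newton_pair t s \<longrightarrow> p j t = s j)" by blast
    let ?q = "\<lambda>t. \<Sum>j=1..<l. t (l - j) * p j t"
    have tm: "(\<lambda>t. t k) \<in> moment_polys" for k using moment_polys.mono[of "[k]"] by simp
    have "?q \<in> moment_polys" by (rule moment_polys_sum) (use p in \<open>auto intro!: moment_polys_mult tm\<close>)
    moreover have "(\<lambda>t. real l * t l + 0) \<in> moment_polys"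
      using moment_polys_sum[of "{}"] by (intro moment_polys.lin tm) simp
    ultimately have "(\<lambda>t. (- 1) * ?q t + (real l * t l + 0)) \<in> moment_polys" by (rule moment_polys.lin)
    then have "(\<lambda>t. real l * t l - ?q t) \<in> moment_polys" by simp
    moreover have "real l * t l - ?q t = s l" if h: "newton_pair t s" for t s
    proof -
      have "real l * t l = (\<Sum>j=1..l. t (l - j) * s j)" using h by (simp add: newton_pair_def)
      also have "{1..l} = insert l {1..<l}" using False by auto
      also have "(\<Sum>j\<in>insert l {1..<l}. t (l - j) * s j) = s l + (\<Sum>j=1..<l. t (l - j) * s j)"
        using h by (simp add: newton_pair_def)
      also have "(\<Sum>j=1..<l. t (l - j) * s j) = ?q t" by (intro sum.cong refl) (use p h in auto)
      finally show ?thesis by simp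
    qed
    ultimately show ?thesis by (intro exI[of _ "\<lambda>t. real l * t l - ?q t"]) blast
  qed
qed

section \<open>From vacuum eigenvalues to linear statistics\<close>

context jack_asymptotics
begin

lemma pr_nonneg:
  assumes "e > 0"
  shows "pr e lam \<ge> 0"
proof -
  have "e / (- (- (\<beta> / 2) * e)) > 0" using assms beta by simp
  then have "jack_norm2 (- (\<beta> / 2) * e) e lam \<ge> 0"
    unfolding jack_norm2_def jack_ip_def zee_def
    by (intro sum_nonneg mult_nonneg_nonneg[OF mult_nonneg_nonneg[OF zero_le_square]] zero_le_power prod_nonneg) auto
  moreover have "jack_Pi (- (\<beta> / 2) * e) e V \<ge> 0" by (simp add: jack_Pi_def)
  ultimately show ?thesis unfolding pr_def jack_prob_def by simp
qed

lemma tau_prod_real: "Re (\<Prod>k\<leftarrow>ks. tau V k) = (\<Prod>k\<leftarrow>ks. Re (tau V k))"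
proof -
  have "(\<Prod>k\<leftarrow>ks. tau V k) = of_real (\<Prod>k\<leftarrow>ks. Re (tau V k))"
    by (induction ks) (simp_all add: tau_real[symmetric])
  then show ?thesis by simp
qed

lemma graded_limit:
  assumes "g \<in> moment_polys"
  shows "\<exists>M. (\<forall>e>0. ((\<lambda>n. \<Sum>lam\<in>parts n. pr e lam * g (mt e lam)) has_sum M e) UNIV) \<and>
     (M \<longlongrightarrow> g (\<lambda>k. Re (tau V k))) (at_right 0)"
  using assms
proof induction
  case (mono ks)
  let ?M = "\<lambda>e. Re (\<Sum>\<^sub>\<infinity>\<mu>\<in>pos_mset. vprod V \<mu> * vop V (\<beta> / 2 * e\<^sup>2) (e - \<beta> / 2 * e) ks \<mu>)"
  have h: "((\<lambda>e. \<beta> / 2 * e\<^sup>2) \<longlongrightarrow> 0) (at_right 0)" "((\<lambda>e. e - \<beta> / 2 * e) \<longlongrightarrow> 0) (at_right 0)"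
    by (auto intro!: tendsto_eq_intros)
  have "(?M \<longlongrightarrow> (\<Prod>k\<leftarrow>ks. Re (tau V k))) (at_right 0)"
    unfolding tau_prod_real[symmetric] by (rule tendsto_Re[OF vop_limit[OF ad h]])
  then show ?case by (intro exI[of _ ?M] conjI allI impI pr_moment_sum)
next
  case (lin f g c)
  then obtain M N where
    M: "\<And>e. e > 0 \<Longrightarrow> ((\<lambda>n. \<Sum>lam\<in>parts n. pr e lam * f (mt e lam)) has_sum M e) UNIV"
      "(M \<longlongrightarrow> f (\<lambda>k. Re (tau V k))) (at_right 0)" and
    N: "\<And>e. e > 0 \<Longrightarrow> ((\<lambda>n. \<Sum>lam\<in>parts n. pr e lam * g (mt e lam)) has_sum N e) UNIV"
      "(N \<longlongrightarrow> g (\<lambda>k. Re (tau V k))) (at_right 0)"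
    by blast
  have "((\<lambda>n. \<Sum>lam\<in>parts n. pr e lam * (c * f (mt e lam) + g (mt e lam))) has_sum (c * M e + N e)) UNIV" if "e > 0" for e
    using has_sum_add[OF has_sum_cmult_right[OF M(1)[OF that], of c] N(1)[OF that]]
    by (simp add: sum_distrib_left sum.distrib[symmetric] algebra_simps)
  moreover have "((\<lambda>e. c * M e + N e) \<longlongrightarrow> c * f (\<lambda>k. Re (tau V k)) + g (\<lambda>k. Re (tau V k))) (at_right 0)"
    by (intro tendsto_add tendsto_mult tendsto_const M(2) N(2))
  ultimately show ?case by (intro exI[of _ "\<lambda>e. c * M e + N e"] conjI allI impI)
qed

text \<open>Since \<open>\<bar>y\<bar> \<le> y\<^sup>2 + 1\<close>, it suffices to control the
  square of \<open>g\<close> plus 1. This is again a moment polynomial, and nonnegative, so its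
  convergence by degree is absolute over partitions; the graded sum for \<open>g\<close> may then be
  rearranged.\<close>

lemma partition_sum:
  assumes g: "g \<in> moment_polys" and e: "e > 0"
    and M: "((\<lambda>n. \<Sum>lam\<in>parts n. pr e lam * g (mt e lam)) has_sum M) UNIV"
  shows "(\<Sum>\<^sub>\<infinity>lam\<in>{lam. is_partition lam}. pr e lam * g (mt e lam)) = M"
proof -
  let ?h = "\<lambda>t. 1 * (g t * g t) + (\<Prod>k\<leftarrow>[]. t k)"
  have "?h \<in> moment_polys" by (intro moment_polys.lin moment_polys_mult g moment_polys.mono)
  from graded_limit[OF this] e have "(\<lambda>n. \<Sum>lam\<in>parts n. pr e lam * ?h (mt e lam)) summable_on UNIV"
    using has_sum_imp_summable by blast
  then have "(\<lambda>n. \<Sum>lam\<in>parts n. norm (case (n, lam) of (n, lam) \<Rightarrow> pr e lam * ?h (mt e lam))) summable_on UNIV"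
    using pr_nonneg[OF e] by (simp add: abs_mult)
  then have "(\<lambda>x. norm (case x of (n, lam) \<Rightarrow> pr e lam * ?h (mt e lam))) summable_on Sigma (UNIV :: nat set) parts"
    by (subst abs_summable_Sigma_finite) (auto simp: finite_parts)
  then have "(\<lambda>x. norm (case x of (n, lam) \<Rightarrow> pr e lam * g (mt e lam))) summable_on Sigma (UNIV :: nat set) parts"
  proof (rule Infinite_Sum.abs_summable_on_comparison_test)
    fix x :: "nat \<times> nat list"
    have "\<bar>y\<bar> \<le> \<bar>y * y + 1\<bar>" for y :: real
      using zero_le_square[of "\<bar>y\<bar> - 1"] by (simp add: algebra_simps abs_mult_self_eq)
    then show "norm (case x of (n, lam) \<Rightarrow> pr e lam * g (mt e lam)) \<le> norm (case x of (n, lam) \<Rightarrow> pr e lam * ?h (mt e lam))"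
      by (auto simp: abs_mult intro!: mult_left_mono split: prod.split)
  qed
  from infsum_Sigma_finite[OF _ this]
  have "(\<Sum>\<^sub>\<infinity>(n, lam)\<in>Sigma UNIV parts. pr e lam * g (mt e lam)) = M"
    using infsumI[OF M] by (simp add: finite_parts)
  moreover have "(\<Sum>\<^sub>\<infinity>(n, lam)\<in>Sigma UNIV parts. pr e lam * g (mt e lam)) = (\<Sum>\<^sub>\<infinity>lam\<in>{lam. is_partition lam}. pr e lam * g (mt e lam))"
    by (rule infsum_reindex_bij_witness[of _ "\<lambda>lam. (sum_list lam, lam)" snd]) (auto simp: parts_def)
  ultimately show ?thesis by simp
qed

lemma ch_limit:
  "((\<lambda>e. \<Sum>\<^sub>\<infinity>lam\<in>{lam. is_partition lam}. jack_prob (- (\<beta> / 2) * e) e V lam *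
      (\<Prod>l\<leftarrow>ls. ch l (profile (- (\<beta> / 2) * e) e lam))) \<longlongrightarrow> (\<Prod>l\<leftarrow>ls. ch l (cshape V))) (at_right 0)"
proof -
  have "\<forall>l. \<exists>p. p \<in> moment_polys \<and> (\<forall>t s. newton_pair t s \<longrightarrow> p t = s l)" using newton_moment_poly by blast
  from choice[OF this] obtain p where p: "\<And>l. p l \<in> moment_polys" "\<And>l t s. newton_pair t s \<Longrightarrow> p l t = s l" by blast
  let ?g = "\<lambda>t. \<Prod>l\<leftarrow>ls. p l t"
  have g: "?g \<in> moment_polys" by (rule moment_polys_prod_list) (rule p)
  obtain M where M: "\<And>e. e > 0 \<Longrightarrow> ((\<lambda>n. \<Sum>lam\<in>parts n. pr e lam * ?g (mt e lam)) has_sum M e) UNIV"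
    "(M \<longlongrightarrow> ?g (\<lambda>k. Re (tau V k))) (at_right 0)"
    using graded_limit[OF g] by blast
  have chp: "ch l (profile (- (\<beta> / 2) * e) e lam) = p l (mt e lam)" if e: "e > 0" and lam: "is_partition lam" for e lam l
  proof -
    define b where "b = \<beta> / 2 * e"
    define s where "s l = ch l (profile (- (\<beta> / 2) * e) e lam)" for l
    have b: "b > 0" "e / b = 2 / \<beta>" using e beta by (auto simp: b_def field_simps)
    have s: "s l = b ^ l * csum (2 / \<beta>) lam l" for l
      using ch_profile[OF b(1) e lam, of l] by (simp add: s_def b(2)) (simp add: b_def)
    have mt: "mt e lam k = b ^ k * walk (2 / \<beta>) lam k 0" for k by (simp only: mt_def b_def)
    have "p l (mt e lam) = s l"
    proof (rule p(2), unfold newton_pair_def, intro conjI)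
      show "s 0 = 1" by (simp add: s_def ch_def)
      show "mt e lam 0 = 1" by (simp add: mt)
      show "\<forall>k. real k * mt e lam k = (\<Sum>j=1..k. mt e lam (k - j) * s j)"
      proof
        fix k
        have "real k * mt e lam k = b ^ k * (\<Sum>j=1..k. walk (2 / \<beta>) lam (k - j) 0 * csum (2 / \<beta>) lam j)"
          using walk_newton[OF lam, of k "2 / \<beta>"] by (simp add: mt)
        also have "\<dots> = (\<Sum>j=1..k. mt e lam (k - j) * s j)"
          unfolding sum_distrib_left
        proof (rule sum.cong)
          fix j assume "j \<in> {1..k}"
          then have "b ^ k = b ^ (k - j) * b ^ j" by (simp add: power_add[symmetric])
          then show "b ^ k * (walk (2 / \<beta>) lam (k - j) 0 * csum (2 / \<beta>) lam j) = mt e lam (k - j) * s j"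
            by (simp add: mt s)
        qed simp
        finally show "real k * mt e lam k = (\<Sum>j=1..k. mt e lam (k - j) * s j)" .
      qed
    qed
    then show ?thesis by (simp add: s_def)
  qed
  have "eventually (\<lambda>e. (\<Sum>\<^sub>\<infinity>lam\<in>{lam. is_partition lam}. jack_prob (- (\<beta> / 2) * e) e V lam *
      (\<Prod>l\<leftarrow>ls. ch l (profile (- (\<beta> / 2) * e) e lam))) = M e) (at_right 0)"
    using eventually_at_right_less[of 0]
  proof eventually_elim
    case (elim e)
    have "(\<Sum>\<^sub>\<infinity>lam\<in>{lam. is_partition lam}. jack_prob (- (\<beta> / 2) * e) e V lam * (\<Prod>l\<leftarrow>ls. ch l (profile (- (\<beta> / 2) * e) e lam))) =
      (\<Sum>\<^sub>\<infinity>lam\<in>{lam. is_partition lam}. pr e lam * ?g (mt e lam))"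
      by (intro infsum_cong) (simp only: mem_Collect_eq chp[OF elim] pr_def)
    then show ?case using partition_sum[OF g elim M(1)[OF elim]] by simp
  qed
  \<comment> \<open>The Newton partners of \<open>Re (tau V k)\<close> are the moments of the
    symbol, hence the linear statistics of \<open>cshape V\<close>.\<close>
  moreover have "p l (\<lambda>k. Re (tau V k)) = ch l (cshape V)" for l
    unfolding ch_cshape[OF analytic_abs_coeffs[OF an]]
    by (rule p(2)) (use tau_newton vmom_0 in \<open>auto simp: newton_pair_def tau_def\<close>)
  ultimately show ?thesis using M(2) by (simp add: tendsto_cong)
qed

end

theorem theorem5p1:
  fixes V :: "nat \<Rightarrow> complex"
  assumes "analytic_symbol V"
  shows "\<exists>fs. limit_shape V fs \<and>
    (\<forall>\<beta>::real. \<beta> > 0 \<longrightarrow> (\<forall>ls :: nat list. ls \<noteq> [] \<longrightarrow>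
      ((\<lambda>e1. \<Sum>\<^sub>\<infinity>lam\<in>{lam. is_partition lam}.
           jack_prob (- (\<beta> / 2) * e1) e1 V lam *
           (\<Prod>l\<leftarrow>ls. ch l (profile (- (\<beta> / 2) * e1) e1 lam)))
        \<longlongrightarrow> (\<Prod>l\<leftarrow>ls. ch l fs)) (at_right 0)))"
proof (intro exI conjI allI impI)
  show "limit_shape V (cshape V)" by (rule limit_shape_cshape[OF analytic_abs_coeffs[OF assms]])
  obtain D \<rho> where d: "analytic_data V D \<rho>" using analytic_data_exists[OF assms] by blast
  fix \<beta> :: real and ls :: "nat list"
  assume "\<beta> > 0"
  then interpret jack_asymptotics V \<beta> D \<rho> using assms d by unfold_locales
  show "((\<lambda>e1. \<Sum>\<^sub>\<infinity>lam\<in>{lam. is_partition lam}. jack_prob (- (\<beta> / 2) * e1) e1 V lam *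
           (\<Prod>l\<leftarrow>ls. ch l (profile (- (\<beta> / 2) * e1) e1 lam)))
        \<longlongrightarrow> (\<Prod>l\<leftarrow>ls. ch l (cshape V))) (at_right 0)" by (rule ch_limit)
qed

end
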